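(* Let $d \in \mathbb{N}$, $n \in \mathbb{N}_0$, $0 < p,q,r \le \infty$, $\alpha \in \mathbb{R}$, and let $A \in \mathrm{GL}(d,\mathbb{R})$ be a matrix in expansive Jordan normal form with largest eigenvalue $\lambda_{\max}$. Put $n^* = \alpha + \frac1q - \frac1p$ (with $1/\infty = 0$). Assume that (a) $p \le q$, and that at least one of the following conditions holds: (b) $n < \frac{\ln(|\det A|)}{\ln(\lambda_{\max})}\cdot n^*$; (b') $n = n^* = 0$ and $r \le q^\nabla$; (b'') $A$ is asymptotically norm diagonal, $n = \frac{\ln(|\det A|)}{\ln(\lambda_{\max})}\cdot n^*$, and $r \le q^\nabla$. Then the embedding $B_{p,r}^\alpha(A) \hookrightarrow W^{n,q}(\mathbb{R}^d)$ holds.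
   Context: $\mathbb{N} = \{1,2,\dots\}$, $\mathbb{N}_0 = \mathbb{N}\cup\{0\}$. A matrix is in expansive normal form if all its eigenvalues are real and $>1$ and its determinant equals $2$; it is in expansive Jordan normal form if in addition it is in Jordan normal form. Such an $A$ is called asymptotically norm diagonal (AND) if the algebraic and geometric multiplicities of its largest eigenvalue $\lambda_{\max}$ coincide. For $0<q\le\infty$: $q^\nabla = q$ if $q \le 2$, and $q^\nabla = q'$ if $q > 2$, where $\frac1q + \frac1{q'} = 1$ (so $\infty^\nabla = 1$). Fourier transform: $\widehat f(\xi) = \int_{\mathbb{R}^d} f(x) e^{-2\pi i \langle \xi, x\rangle}\,dx$, extended to tempered distributions $\mathcal{S}'(\mathbb{R}^d)$. An $A$-wavelet is a Schwartz function $\psi \in \mathcal{S}(\mathbb{R}^d)$ such that $\widehat\psi$ has compact support contained in $\mathbb{R}^d\setminus\{0\}$ and $\sum_{j\in\mathbb{Z}} \widehat\psi((A^T)^{-j}\xi) = 1$ for all $\xi \in \mathbb{R}^d \setminus\{0\}$. A low-pass complement to $\psi$ is a Schwartz function $\psi^i_0 \in \mathcal{S}(\mathbb{R}^d)$ with compactly supported Fourier transform such that $\widehat{\psi^i_0}(\xi) + \sum_{j \in \mathbb{N}} \widehat\psi((A^T)^{-j}\xi) = 1$ for all $\xi\in\mathbb{R}^d$. For $j \ge 1$ put $\psi^i_j(x) = |\det A|^j \psi(A^j x)$. Fix an $A$-wavelet $\psi$ with low-pass complement $\psi_0^i$ (these exist, and different choices give the same spaces with equivalent quasi-norms). Inhomogeneous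 anisotropic Besov space: $B^\alpha_{p,r}(A)$ is the space of all $f \in \mathcal{S}'(\mathbb{R}^d)$ with $\|f\|_{B^\alpha_{p,r}(A)} = \big\| \big( |\det A|^{j\alpha} \|f * \psi^i_j\|_{L^p} \big)_{j\in\mathbb{N}_0} \big\|_{\ell^r(\mathbb{N}_0)} < \infty$. Embedding: by definition, $B^\alpha_{p,r}(A) \hookrightarrow W^{n,q}(\mathbb{R}^d)$ means that for every multiindex $\beta \in \mathbb{N}_0^d$ with $|\beta| \le n$ the operator $\partial_*^\beta : B^\alpha_{p,r}(A) \to L^q(\mathbb{R}^d)$, $\partial_*^\beta f = \sum_{j \in \mathbb{N}_0} \partial^\beta (f * \psi^i_j)$, is well-defined and bounded, the series converging unconditionally in the (quasi-)norm of $L^q(\mathbb{R}^d)$ for every $f$. *)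

theory Defs
  imports
    "HOL-Analysis.Analysis"
    "HOL-Probability.Essential_Supremum"
    "Jordan_Normal_Form.Jordan_Normal_Form"
begin

no_notation Matrix.vec_index (infixl \<open>$\<close> 100)
no_notation Matrix.scalar_prod (infix \<open>\<bullet>\<close> 70)

text \<open>The space of dimension d is \<open>real^'d\<close> with \<open>'d\<close> finite and linearly ordered. The order
  numbers the coordinates; it matters for Jordan normal form and fixes the order in which the
  partial derivatives of a multiindex are taken.\<close>

type_synonym 'd sqmat = "real^'d^'d"
type_synonym 'd cfun = "real^'d \<Rightarrow> complex"
type_synonym 'd functional = "'d cfun \<Rightarrow> complex"


section \<open>Matrices\<close>

definition coord :: "nat \<Rightarrow> 'd :: {finite, linorder}" where
  "coord i = sorted_list_of_set UNIV ! i"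

definition to_mat :: "('d :: {finite, linorder}) sqmat \<Rightarrow> real mat" where
  "to_mat A = Matrix.mat CARD('d) CARD('d) (\<lambda>(i, j). A $ coord i $ coord j)"

definition expansive_normal_form :: "('d :: {finite, linorder}) sqmat \<Rightarrow> bool" where
  "expansive_normal_form A \<longleftrightarrow>
     (\<forall>\<mu> :: complex. eigenvalue (map_mat complex_of_real (to_mat A)) \<mu> \<longrightarrow> \<mu> \<in> \<real> \<and> Re \<mu> > 1) \<and>
     Determinants.det A = 2"

text \<open>\<open>jordan_nf\<close> of the library means similarity to a Jordan matrix; here the matrix itself must
  be a Jordan matrix (with ones above the diagonal).\<close>

definition expansive_Jordan_normal_form :: "('d :: {finite, linorder}) sqmat \<Rightarrow> bool" where
  "expansive_Jordan_normal_form A \<longleftrightarrow>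
     expansive_normal_form A \<and> (\<exists>n_as. 0 \<notin> fst ` set n_as \<and> to_mat A = jordan_matrix n_as)"

definition max_eigenvalue :: "('d :: {finite, linorder}) sqmat \<Rightarrow> real" where
  "max_eigenvalue A = Max {\<mu>. eigenvalue (to_mat A) \<mu>}"

definition asymptotically_norm_diagonal :: "('d :: {finite, linorder}) sqmat \<Rightarrow> bool" where
  "asymptotically_norm_diagonal A \<longleftrightarrow>
     Polynomial.order (max_eigenvalue A) (char_poly (to_mat A)) =
     dim {v. A *v v = max_eigenvalue A *\<^sub>R v}"

definition mat_powi :: "('d :: finite) sqmat \<Rightarrow> int \<Rightarrow> 'd sqmat" where
  "mat_powi M j = (if j \<ge> 0 then (((**) M) ^^ nat j) (Finite_Cartesian_Product.mat 1)
                   else (((**) (matrix_inv M)) ^^ nat (- j)) (Finite_Cartesian_Product.mat 1))"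


section \<open>Lebesgue quasi-norms\<close>

text \<open>For a counting measure this is the sequence space quasi-norm. For finite \<open>p\<close> the case
  distinction is only there because \<open>powr\<close> is not available on \<^typ>\<open>ennreal\<close>.\<close>

definition Lnorm :: "'a measure \<Rightarrow> ennreal \<Rightarrow> ('a \<Rightarrow> ennreal) \<Rightarrow> ennreal" where
  "Lnorm M p g =
     (let pow = (\<lambda>(t :: ennreal) (s :: real). if t = \<infinity> then \<infinity> else ennreal (enn2real t powr s))
      in if p = \<infinity> then esssup M g
         else pow (\<integral>\<^sup>+ x. pow (g x) (enn2real p) \<partial>M) (1 / enn2real p))"

definition Lp_norm :: "ennreal \<Rightarrow> ('d :: finite) cfun \<Rightarrow> ennreal" where
  "Lp_norm p f = Lnorm lborel p (\<lambda>x. ennreal (norm (f x)))"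

definition Lp_space :: "ennreal \<Rightarrow> ('d :: finite) cfun set" where
  "Lp_space p = {f \<in> borel_measurable lborel. Lp_norm p f < \<infinity>}"

definition nabla_exponent :: "ennreal \<Rightarrow> ennreal" where
  "nabla_exponent q = (if q \<le> 2 then q else 1 / (1 - 1 / q))"


section \<open>Schwartz functions and tempered distributions\<close>

definition partial_deriv :: "('d :: finite) \<Rightarrow> 'd cfun \<Rightarrow> 'd cfun" where
  "partial_deriv i f x = vector_derivative (\<lambda>t. f (x + t *\<^sub>R axis i 1)) (at 0)"

definition multi_deriv ::
    "(('d :: {finite, linorder}) \<Rightarrow> nat) \<Rightarrow> 'd cfun \<Rightarrow> 'd cfun" where
  "multi_deriv \<beta> =
     foldr partial_deriv (concat (map (\<lambda>i. replicate (\<beta> i) i) (sorted_list_of_set UNIV)))"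

definition smooth :: "('d :: finite) cfun \<Rightarrow> bool" where
  "smooth f \<longleftrightarrow> (\<forall>is x. foldr partial_deriv is f differentiable (at x))"

definition multi_monom :: "('d \<Rightarrow> nat) \<Rightarrow> real^('d :: finite) \<Rightarrow> real" where
  "multi_monom \<gamma> x = (\<Prod>i\<in>UNIV. (x $ i) ^ \<gamma> i)"

definition schwartz :: "('d :: {finite, linorder}) cfun set" where
  "schwartz = {f. smooth f \<and>
     (\<forall>\<gamma> \<beta>. bounded (range (\<lambda>x. multi_monom \<gamma> x *\<^sub>R multi_deriv \<beta> f x)))}"

definition schwartz_seminorm ::
    "(('d :: {finite, linorder}) \<Rightarrow> nat) \<Rightarrow> ('d \<Rightarrow> nat) \<Rightarrow> 'd cfun \<Rightarrow> real" where
  "schwartz_seminorm \<gamma> \<beta> f = (SUP x. norm (multi_monom \<gamma> x *\<^sub>R multi_deriv \<beta> f x))"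

definition schwartz_topology :: "('d :: {finite, linorder}) cfun topology" where
  "schwartz_topology = topology_generated_by
     {{\<eta> \<in> schwartz. schwartz_seminorm \<gamma> \<beta> (\<lambda>x. \<eta> x - \<phi> x) < \<epsilon>} | \<gamma> \<beta> \<phi> \<epsilon>. \<phi> \<in> schwartz \<and> \<epsilon> > 0}"

text \<open>Functionals are total functions in HOL; they are normalised to 0 off the Schwartz space so
  that equal distributions are equal terms.\<close>

definition tempered :: "('d :: {finite, linorder}) functional set" where
  "tempered = {u.
     (\<forall>\<phi>\<in>schwartz. \<forall>\<eta>\<in>schwartz. u (\<lambda>x. \<phi> x + \<eta> x) = u \<phi> + u \<eta>) \<and>
     (\<forall>c. \<forall>\<phi>\<in>schwartz. u (\<lambda>x. c * \<phi> x) = c * u \<phi>) \<and>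
     continuous_map schwartz_topology euclidean u \<and>
     (\<forall>\<phi>. \<phi> \<notin> schwartz \<longrightarrow> u \<phi> = 0)}"

text \<open>Convolution of a tempered distribution with a Schwartz function, as a function.\<close>

definition convol :: "('d :: finite) functional \<Rightarrow> 'd cfun \<Rightarrow> 'd cfun" where
  "convol u \<phi> x = u (\<lambda>y. \<phi> (x - y))"

definition fourier :: "('d :: finite) cfun \<Rightarrow> 'd cfun" where
  "fourier f \<xi> =
     (LINT x|lborel. f x * exp (- (2 * complex_of_real pi * \<i> * complex_of_real (\<xi> \<bullet> x))))"


section \<open>Anisotropic Besov spaces\<close>

definition supp :: "('d :: finite) cfun \<Rightarrow> (real^'d) set" where
  "supp f = closure {x. f x \<noteq> 0}"

definition is_wavelet :: "('d :: {finite, linorder}) sqmat \<Rightarrow> 'd cfun \<Rightarrow> bool" where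
  "is_wavelet A \<psi> \<longleftrightarrow> \<psi> \<in> schwartz \<and>
     compact (supp (fourier \<psi>)) \<and> supp (fourier \<psi>) \<subseteq> UNIV - {0} \<and>
     (\<forall>\<xi>. \<xi> \<noteq> 0 \<longrightarrow>
        ((\<lambda>j :: int. fourier \<psi> (mat_powi (Finite_Cartesian_Product.transpose A) (- j) *v \<xi>))
          has_sum 1) UNIV)"

definition is_low_pass_complement ::
    "('d :: {finite, linorder}) sqmat \<Rightarrow> 'd cfun \<Rightarrow> 'd cfun \<Rightarrow> bool" where
  "is_low_pass_complement A \<psi> \<psi>0 \<longleftrightarrow> \<psi>0 \<in> schwartz \<and> compact (supp (fourier \<psi>0)) \<and>
     (\<forall>\<xi>. ((\<lambda>j :: nat. fourier \<psi> (mat_powi (Finite_Cartesian_Product.transpose A) (- int j) *v \<xi>))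
             has_sum (1 - fourier \<psi>0 \<xi>)) {1..})"

definition inhom_wavelet ::
    "('d :: finite) sqmat \<Rightarrow> 'd cfun \<Rightarrow> 'd cfun \<Rightarrow> nat \<Rightarrow> 'd cfun" where
  "inhom_wavelet A \<psi> \<psi>0 j =
     (if j = 0 then \<psi>0
      else (\<lambda>x. complex_of_real (\<bar>Determinants.det A\<bar> ^ j) * \<psi> (mat_powi A (int j) *v x)))"

definition besov_norm ::
    "('d :: finite) sqmat \<Rightarrow> 'd cfun \<Rightarrow> 'd cfun \<Rightarrow> real \<Rightarrow> ennreal \<Rightarrow> ennreal \<Rightarrow>
     'd functional \<Rightarrow> ennreal" where
  "besov_norm A \<psi> \<psi>0 \<alpha> p r f = Lnorm (count_space UNIV) r
     (\<lambda>j :: nat. ennreal (\<bar>Determinants.det A\<bar> powr (real j * \<alpha>)) *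
                 Lp_norm p (convol f (inhom_wavelet A \<psi> \<psi>0 j)))"

definition besov_space ::
    "('d :: {finite, linorder}) sqmat \<Rightarrow> 'd cfun \<Rightarrow> 'd cfun \<Rightarrow> real \<Rightarrow> ennreal \<Rightarrow> ennreal \<Rightarrow>
     'd functional set" where
  "besov_space A \<psi> \<psi>0 \<alpha> p r = {f \<in> tempered. besov_norm A \<psi> \<psi>0 \<alpha> p r f < \<infinity>}"

text \<open>\<open>g\<close> is the unconditional sum of the \<open>F j\<close> in \<open>L^q\<close>. As in \<^const>\<open>has_sum\<close>, unconditional
  convergence is convergence of the net of finite partial sums; the sum is unique up to null sets.\<close>

definition Lp_has_sum ::
    "ennreal \<Rightarrow> (nat \<Rightarrow> ('d :: finite) cfun) \<Rightarrow> 'd cfun \<Rightarrow> bool" where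
  "Lp_has_sum q F g \<longleftrightarrow> (\<forall>j. F j \<in> Lp_space q) \<and> g \<in> Lp_space q \<and>
     ((\<lambda>J. Lp_norm q (\<lambda>x. (\<Sum>j\<in>J. F j x) - g x)) \<longlongrightarrow> 0) (finite_subsets_at_top UNIV)"

definition besov_embeds_sobolev ::
    "('d :: {finite, linorder}) sqmat \<Rightarrow> 'd cfun \<Rightarrow> 'd cfun \<Rightarrow>
     real \<Rightarrow> ennreal \<Rightarrow> ennreal \<Rightarrow> nat \<Rightarrow> ennreal \<Rightarrow> bool" where
  "besov_embeds_sobolev A \<psi> \<psi>0 \<alpha> p r n q \<longleftrightarrow>
     (\<forall>\<beta> :: 'd \<Rightarrow> nat. (\<Sum>i\<in>UNIV. \<beta> i) \<le> n \<longrightarrow>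
       (\<exists>C :: real. \<forall>f \<in> besov_space A \<psi> \<psi>0 \<alpha> p r. \<exists>g.
          Lp_has_sum q (\<lambda>j. multi_deriv \<beta> (convol f (inhom_wavelet A \<psi> \<psi>0 j))) g \<and>
          Lp_norm q g \<le> ennreal C * besov_norm A \<psi> \<psi>0 \<alpha> p r f))"

end

theory Submission
  imports Defs "HOL-Probability.Characteristic_Functions" "HOL-Probability.Sinc_Integral"
    "HOL-Complex_Analysis.Conformal_Mappings"
begin

text \<open>
  The argument splits \<open>\<partial>f\<close> into the frequency pieces \<open>F j = \<partial>(f * \<phi> j)\<close>, estimates each piece, and then
  sums the pieces in \<open>L^q\<close>.

  The wavelets \<open>\<phi> j\<close> are, for \<open>j \<ge> 1\<close>, the \<open>L^1\<close>-normalised dilates of \<open>\<psi>\<close> by \<open>A^j\<close>.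
  Undoing this dilation turns \<open>f * \<phi> j\<close> into a function whose frequencies stay in a fixed compact set, so
  that it is reproduced by convolution with one fixed Schwartz kernel. For such functions the
  Bernstein-Nikolskii inequality (\<open>bernstein_nikolskii\<close>) bounds derivatives in \<open>L^q\<close> by the function itself
  in \<open>L^p\<close> whenever \<open>p \<le> q\<close>, for quasi-norms too. Redoing the dilation, a derivative of order \<open>k\<close> costs at
  most the \<open>k\<close>-th power of the entries of \<open>A^j\<close>, and the change of integrability costs
  \<open>2^(j (1/p - 1/q))\<close> because \<open>det A = 2\<close>; this is \<open>derivative_bound\<close>.

  The entries of \<open>A^j\<close> grow at most like \<open>(\<lambda> + \<delta>)^j\<close>, where \<open>\<lambda>\<close> is the largest eigenvalue
  and \<open>\<delta> > 0\<close> is arbitrary; if all Jordan blocks of \<open>\<lambda>\<close> are trivial, the bound holds with \<open>\<delta> = 0\<close>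
  (\<open>power_growth\<close>, \<open>power_growth_AND\<close>). Compared with the weight \<open>2^(j \<alpha>)\<close> of the Besov norm, the piece
  \<open>F j\<close> is multiplied by \<open>(\<lambda> + \<delta>)^(j n) 2^(- j n*)\<close>. Under the strict inequality between \<open>n\<close> and
  \<open>n* ln 2 / ln \<lambda>\<close> this factor decays geometrically, and the boundedness of the Besov sequence is enough.
  In the two limiting cases the factor stays bounded, and the sequence is in \<open>\<ell>^t\<close> with \<open>t = q^\<nabla>\<close>.

  It remains to control \<open>\<Sum>j\<in>J. F j\<close> in \<open>L^q\<close> by the \<open>\<ell>^t\<close> norm of the numbers
  \<open>\<parallel>F j\<parallel>_q\<close>, uniformly in the finite set \<open>J\<close>. For \<open>q \<le> 1\<close> this is the subadditivity of \<open>x \<mapsto> x^q\<close> and for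
  \<open>q = \<infinity>\<close> the triangle inequality. For \<open>1 < q < \<infinity>\<close> one has \<open>t = min q q'\<close>, and the bound comes from complex
  interpolation between \<open>L^1\<close> or \<open>L^\<infinity>\<close>, where the triangle inequality gives \<open>\<ell>^1\<close>, and \<open>L^2\<close>, where
  orthogonality of pieces with separated frequencies gives \<open>\<ell>^2\<close>
  (\<open>almost_orthogonal_sum\<close>, \<open>riesz_thorin_bilinear\<close>, \<open>synthesis_bound_all\<close>). A bound of this shape on
  all finite subsets makes the tails of the series small in the net sense, and a sufficiently sparse
  subsequence of the partial sums converges almost everywhere to the unconditional sum
  (\<open>Lp_unconditional_sum\<close>).

  The only facts on tempered distributions that enter are that \<open>u * \<phi>\<close> is a continuous
  function of polynomial growth and that \<open>\<phi> * \<kappa> = \<phi>\<close> implies \<open>(u * \<phi>) * \<kappa> = u * \<phi>\<close>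
  (\<open>convol_poly_growth\<close>, \<open>convol_reproduce\<close>). All later steps work with functions, and identities between
  kernels are read off from their Fourier transforms by \<open>cv_eqI\<close>.
\<close>

type_synonym 'd rvec = "real^'d"

abbreviation idm :: "('d::finite) sqmat" where "idm \<equiv> Finite_Cartesian_Product.mat 1"

section \<open>A polynomial weight\<close>

text \<open>A product of one-dimensional weights: a power of it dominates every monomial, its inverse is
  integrable by Fubini, and unlike a power of \<open>1 + norm x\<close> it needs no dimension-dependent exponent for that.\<close>

definition weight :: "real^('d::finite) => real" where
  "weight x = (\<Prod>i\<in>UNIV. 1 + (x $ i)\<^sup>2)"

lemma weight_ge_1: "weight x \<ge> 1"
  unfolding weight_def by (rule prod_ge_1) simp

lemma weight_pos [simp]: "weight x > 0"
  using weight_ge_1[of x] by linarith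

lemma weight_nonneg [simp]: "weight x \<ge> 0"
  using weight_pos[of x] by linarith

lemma weight_neq_0 [simp]: "weight x \<noteq> 0"
  using weight_pos[of x] by linarith

lemma weight_0 [simp]: "weight 0 = 1"
  by (simp add: weight_def)

lemma weight_minus [simp]: "weight (- x) = weight x"
  by (simp add: weight_def)

lemma weight_diff_commute: "weight (x - y) = weight (y - x)"
  using weight_minus[of "x - y"] by simp

lemma continuous_on_weight [continuous_intros]:
  "continuous_on S f ==> continuous_on S (\<lambda>x. weight (f x))"
  unfolding weight_def by (intro continuous_intros)

lemma borel_measurable_weight [measurable]: "weight \<in> borel_measurable borel"
  by (intro borel_measurable_continuous_onI continuous_intros)

text \<open>This is the submultiplicativity that lets a weight be moved through a convolution; coordinatewise
  it is \<open>1 + (a + b)^2 \<le> 2 (1 + a^2) (1 + b^2)\<close>.\<close>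

lemma weight_add: "weight (a + b :: real^'d::finite) \<le> 2 ^ CARD('d) * weight a * weight b"
proof -
  have "1 + (s + t)\<^sup>2 \<le> 2 * (1 + s\<^sup>2) * (1 + t\<^sup>2)" for s t :: real
  proof -
    have "2 * (1 + s\<^sup>2) * (1 + t\<^sup>2) - (1 + (s + t)\<^sup>2) = 1 + (s - t)\<^sup>2 + 2 * (s * t)\<^sup>2"
      by (simp add: power2_eq_square algebra_simps)
    also have "\<dots> \<ge> 0" by simp
    finally show ?thesis by simp
  qed
  then have "weight (a + b) \<le> (\<Prod>i\<in>UNIV. 2 * (1 + (a $ i)\<^sup>2) * (1 + (b $ i)\<^sup>2))"
    unfolding weight_def by (intro prod_mono) auto
  also have "\<dots> = 2 ^ CARD('d) * weight a * weight b"
    by (simp only: prod.distrib weight_def prod_constant)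
  finally show ?thesis .
qed

lemma weight_add_power:
  "weight (a + b :: real^'d::finite) ^ N \<le> 2 ^ (CARD('d) * N) * weight a ^ N * weight b ^ N"
proof -
  have "weight (a + b) ^ N \<le> (2 ^ CARD('d) * weight a * weight b) ^ N"
    by (intro power_mono weight_add) simp
  then show ?thesis by (simp add: power_mult_distrib power_mult)
qed

lemma weight_le_of_norm_le_1:
  assumes "norm b \<le> 1" shows "weight (b :: real^'d::finite) \<le> 2 ^ CARD('d)"
proof -
  have "(b $ i)\<^sup>2 \<le> 1" for i
    using component_le_norm_cart[of b i] assms by (simp add: abs_square_le_1)
  then have "weight b \<le> (\<Prod>i\<in>(UNIV::'d set). 2)"
    unfolding weight_def by (intro prod_mono) (auto simp: add.commute)
  then show ?thesis by simp
qed

lemma weight_linear: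
  assumes "linear (f :: real^'d::finite => real^'d)"
  obtains C where "C > 0" "\<And>x. weight (f x) \<le> C * weight x ^ CARD('d)"
proof -
  obtain B where B: "B > 0" "\<And>x. norm (f x) \<le> B * norm x"
    using linear_bounded_pos[OF assms] by auto
  have n2: "1 + (norm x)\<^sup>2 \<le> real CARD('d) * weight x" for x :: "real^'d"
  proof -
    have "(x $ i)\<^sup>2 + 1 \<le> weight x" for i
    proof -
      have "(\<Prod>i\<in>{i}. 1 + (x $ i)\<^sup>2) \<le> weight x"
        unfolding weight_def by (rule prod_mono2) auto
      then show ?thesis by simp
    qed
    then have "(\<Sum>i\<in>UNIV. (x $ i)\<^sup>2 + 1) \<le> (\<Sum>i\<in>(UNIV::'d set). weight x)"
      by (intro sum_mono) auto
    then have "(\<Sum>i\<in>UNIV. (x $ i)\<^sup>2) + real CARD('d) \<le> real CARD('d) * weight x"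
      by (simp add: sum.distrib)
    moreover have "(norm x)\<^sup>2 = (\<Sum>i\<in>UNIV. (x $ i)\<^sup>2)"
      by (simp add: norm_vec_def L2_set_def sum_nonneg)
    moreover have "real CARD('d) \<ge> 1" by (simp add: Suc_le_eq)
    ultimately show ?thesis by linarith
  qed
  let ?c = "(1 + B\<^sup>2) * real CARD('d)"
  have c0: "?c > 0" using B by (intro mult_pos_pos) (auto simp: add_pos_nonneg)
  have "weight (f x) \<le> ?c ^ CARD('d) * weight x ^ CARD('d)" for x
  proof -
    have "1 + (f x $ i)\<^sup>2 \<le> ?c * weight x" for i
    proof -
      have "\<bar>f x $ i\<bar> \<le> B * norm x" using component_le_norm_cart[of "f x" i] B(2)[of x] by linarith
      then have "(f x $ i)\<^sup>2 \<le> (B * norm x)\<^sup>2"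
        by (simp add: abs_le_square_iff[symmetric])
      also have "\<dots> = B\<^sup>2 * (norm x)\<^sup>2" by (simp add: power_mult_distrib)
      finally have "1 + (f x $ i)\<^sup>2 \<le> (1 + B\<^sup>2) * (1 + (norm x)\<^sup>2)"
        by (simp add: algebra_simps) (smt (verit) zero_le_power2)
      also have "\<dots> \<le> (1 + B\<^sup>2) * (real CARD('d) * weight x)"
        by (intro mult_left_mono n2) (simp add: add_nonneg_nonneg)
      finally show ?thesis by simp
    qed
    then have "weight (f x) \<le> (\<Prod>i\<in>(UNIV::'d set). ?c * weight x)"
      unfolding weight_def[of "f x"] by (intro prod_mono) auto
    then show ?thesis by (simp add: power_mult_distrib)
  qed
  then show ?thesis using that[of "?c ^ CARD('d)"] c0 by simp
qed

lemma nn_integral_inverse_weight_finite: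
  "(\<integral>\<^sup>+x. ennreal (1 / weight (x :: real^'d::finite)) \<partial>lborel) < \<infinity>"
proof -
  have "(\<integral>\<^sup>+x. ennreal (1 / weight (x :: real^'d)) \<partial>lborel)
      = (\<integral>\<^sup>+x. (\<Prod>b\<in>Basis. ennreal (1 / (1 + ((x :: real^'d) \<bullet> b)\<^sup>2))) \<partial>lborel)"
  proof (rule nn_integral_cong)
    fix x :: "real^'d"
    have "(\<Prod>b\<in>Basis. 1 / (1 + (x \<bullet> b)\<^sup>2)) = (\<Prod>i\<in>UNIV. 1 / (1 + (x $ i)\<^sup>2))"
    proof -
      have B: "Basis = (\<lambda>i. axis i (1::real)) ` (UNIV::'d set)" by (auto simp: Basis_vec_def)
      have "inj (\<lambda>i::'d. axis i (1::real))" by (auto simp: inj_on_def axis_eq_axis)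
      then show ?thesis unfolding B by (subst prod.reindex) (auto simp: inner_axis)
    qed
    then show "ennreal (1 / weight x) = (\<Prod>b\<in>Basis. ennreal (1 / (1 + (x \<bullet> b)\<^sup>2)))"
      by (subst prod_ennreal) (auto simp: weight_def prod_dividef intro!: divide_nonneg_pos add_pos_nonneg)
  qed
  also have "\<dots> = (\<Prod>b\<in>(Basis::(real^'d) set). (\<integral>\<^sup>+x. ennreal (1 / (1 + x\<^sup>2)) \<partial>lborel))"
    by (rule nn_integral_lborel_prod) auto
  also have "\<dots> < \<infinity>"
  proof -
    have "set_integrable lborel (einterval (-\<infinity>) \<infinity>) (\<lambda>x::real. inverse (1 + x\<^sup>2))"
      by (rule integrable_inverse_1_plus_square)
    then have "integrable lborel (\<lambda>x::real. 1 / (1 + x\<^sup>2))"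
      by (simp add: set_integrable_def einterval_def inverse_eq_divide)
    then have "(\<integral>\<^sup>+x. ennreal (1 / (1 + x\<^sup>2)) \<partial>lborel) < \<infinity>"
      by (subst (asm) integrable_iff_bounded) (simp add: add_nonneg_nonneg)
    then show ?thesis by (simp add: power_less_top_ennreal)
  qed
  finally show ?thesis .
qed

section \<open>Iterated partial derivatives\<close>

abbreviation pderivs :: "'d::finite list => 'd cfun => 'd cfun" where
  "pderivs is f \<equiv> foldr partial_deriv is f"

lemma smooth_pderivs: "smooth f ==> smooth (pderivs js f)"
  unfolding smooth_def by (metis foldr_append)

lemma smooth_differentiable: "smooth f ==> f differentiable (at x)"
  unfolding smooth_def by (metis foldr.simps(1) id_apply)

lemma smooth_pderivs_differentiable: "smooth f ==> pderivs is f differentiable (at x)"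
  by (simp add: smooth_def)

lemma smooth_continuous: "smooth f ==> continuous_on S f"
  by (meson continuous_at_imp_continuous_on differentiable_imp_continuous_within smooth_differentiable)

lemma vec_eq_sum_axis: "(v :: real^'d::finite) = (\<Sum>i\<in>UNIV. (v $ i) *\<^sub>R axis i 1)"
  by (simp add: Finite_Cartesian_Product.vec_eq_iff axis_def if_distrib cong: if_cong)

lemma has_vector_derivative_along:
  assumes "(f has_derivative f') (at (x + t *\<^sub>R b))"
  shows "((\<lambda>t. f (x + t *\<^sub>R b)) has_vector_derivative f' b) (at t)"
proof -
  have "((\<lambda>t. x + t *\<^sub>R b) has_derivative (\<lambda>h. h *\<^sub>R b)) (at t)"
    by (auto intro!: derivative_eq_intros)
  from diff_chain_at[OF this assms]
  have "((\<lambda>t. f (x + t *\<^sub>R b)) has_derivative (\<lambda>h. f' (h *\<^sub>R b))) (at t)" by (simp add: o_def)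
  then show ?thesis
    using has_derivative_linear[OF assms] by (simp add: has_vector_derivative_def linear_cmul)
qed

lemma partial_deriv_eq:
  assumes "(f has_derivative f') (at x)"
  shows "partial_deriv i f x = f' (axis i 1)"
  unfolding partial_deriv_def
  using has_vector_derivative_along[of f f' x 0 "axis i 1"] assms
  by (intro vector_derivative_at) simp

lemma has_derivative_partials:
  assumes "f differentiable (at x)"
  shows "(f has_derivative (\<lambda>v. \<Sum>i\<in>UNIV. (v $ i) *\<^sub>R partial_deriv i f x)) (at x)"
proof -
  obtain f' where f': "(f has_derivative f') (at x)" using assms by (auto simp: differentiable_def)
  have "f' v = (\<Sum>i\<in>UNIV. (v $ i) *\<^sub>R partial_deriv i f x)" for v
  proof -
    have "f' v = f' (\<Sum>i\<in>UNIV. (v $ i) *\<^sub>R axis i 1)" using vec_eq_sum_axis[of v] by simp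
    also have "\<dots> = (\<Sum>i\<in>UNIV. (v $ i) *\<^sub>R f' (axis i 1))"
      using has_derivative_linear[OF f'] by (simp add: linear_sum linear_cmul)
    finally show ?thesis by (simp add: partial_deriv_eq[OF f'])
  qed
  then have "f' = (\<lambda>v. \<Sum>i\<in>UNIV. (v $ i) *\<^sub>R partial_deriv i f x)" by (rule ext)
  with f' show ?thesis by simp
qed

lemma has_vector_derivative_axis:
  assumes "\<And>y. f differentiable (at y)"
  shows "((\<lambda>t. f (x + t *\<^sub>R axis i 1)) has_vector_derivative partial_deriv i f (x + t *\<^sub>R axis i 1)) (at t)"
proof -
  obtain f' where f': "(f has_derivative f') (at (x + t *\<^sub>R axis i 1))"
    using assms by (meson differentiable_def)
  show ?thesis using has_vector_derivative_along[OF f'] partial_deriv_eq[OF f'] by simp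
qed

text \<open>The mean value theorem, used once in each direction, expresses the second difference over a
  parallelogram by a mixed derivative at an intermediate point.\<close>

lemma second_difference_mvt:
  fixes g :: "'a::real_vector => real"
  assumes g1: "\<And>y t. ((\<lambda>t. g (y + t *\<^sub>R a)) has_real_derivative g1 (y + t *\<^sub>R a)) (at t)"
    and g2: "\<And>y t. ((\<lambda>t. g1 (y + t *\<^sub>R b)) has_real_derivative g2 (y + t *\<^sub>R b)) (at t)"
    and h: "h > 0"
  shows "\<exists>s t. 0 < s \<and> s < h \<and> 0 < t \<and> t < h \<and>
     g (x + h *\<^sub>R a + h *\<^sub>R b) - g (x + h *\<^sub>R a) - g (x + h *\<^sub>R b) + g x
       = h * h * g2 (x + s *\<^sub>R a + t *\<^sub>R b)"
proof -
  let ?\<phi> = "\<lambda>s. g (x + h *\<^sub>R b + s *\<^sub>R a) - g (x + s *\<^sub>R a)"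
  have "\<exists>s>0. s < h \<and> ?\<phi> h - ?\<phi> 0 = (h - 0) * (g1 (x + h *\<^sub>R b + s *\<^sub>R a) - g1 (x + s *\<^sub>R a))"
    by (rule MVT2[OF h]) (intro DERIV_diff g1)
  then obtain s where s: "0 < s" "s < h"
    "?\<phi> h - ?\<phi> 0 = h * (g1 (x + h *\<^sub>R b + s *\<^sub>R a) - g1 (x + s *\<^sub>R a))" by auto
  have "\<exists>t>0. t < h \<and> g1 (x + s *\<^sub>R a + h *\<^sub>R b) - g1 (x + s *\<^sub>R a + 0 *\<^sub>R b)
     = (h - 0) * g2 (x + s *\<^sub>R a + t *\<^sub>R b)"
    by (rule MVT2[OF h]) (intro g2)
  then obtain t where "0 < t" "t < h" "g1 (x + s *\<^sub>R a + h *\<^sub>R b) - g1 (x + s *\<^sub>R a)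
     = h * g2 (x + s *\<^sub>R a + t *\<^sub>R b)" by auto
  with s show ?thesis by (intro exI[of _ s] exI[of _ t]) (simp add: algebra_simps)
qed

text \<open>The second difference is symmetric in the two directions, so both mixed derivatives are limits of
  the same quotients.\<close>

lemma mixed_second_derivatives_real:
  fixes g :: "'a::real_normed_vector => real"
  assumes ga: "\<And>y t. ((\<lambda>t. g (y + t *\<^sub>R a)) has_real_derivative ga (y + t *\<^sub>R a)) (at t)"
    and gab: "\<And>y t. ((\<lambda>t. ga (y + t *\<^sub>R b)) has_real_derivative gab (y + t *\<^sub>R b)) (at t)"
    and gb: "\<And>y t. ((\<lambda>t. g (y + t *\<^sub>R b)) has_real_derivative gb (y + t *\<^sub>R b)) (at t)"
    and gba: "\<And>y t. ((\<lambda>t. gb (y + t *\<^sub>R a)) has_real_derivative gba (y + t *\<^sub>R a)) (at t)"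
    and cont: "isCont gab x" "isCont gba x"
  shows "gab x = gba x"
proof -
  let ?h = "\<lambda>n. 1 / real (Suc n)"
  have "\<forall>n. \<exists>s t s' t'. 0 < s \<and> s < ?h n \<and> 0 < t \<and> t < ?h n \<and> 0 < s' \<and> s' < ?h n \<and> 0 < t' \<and> t' < ?h n
      \<and> gab (x + s *\<^sub>R a + t *\<^sub>R b) = gba (x + s' *\<^sub>R b + t' *\<^sub>R a)"
  proof
    fix n
    have h: "?h n > 0" by simp
    obtain s t where 1: "0 < s" "s < ?h n" "0 < t" "t < ?h n"
      "g (x + ?h n *\<^sub>R a + ?h n *\<^sub>R b) - g (x + ?h n *\<^sub>R a) - g (x + ?h n *\<^sub>R b) + g x
       = ?h n * ?h n * gab (x + s *\<^sub>R a + t *\<^sub>R b)"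
      using second_difference_mvt[OF ga gab h, of x] by blast
    obtain s' t' where 2: "0 < s'" "s' < ?h n" "0 < t'" "t' < ?h n"
      "g (x + ?h n *\<^sub>R b + ?h n *\<^sub>R a) - g (x + ?h n *\<^sub>R b) - g (x + ?h n *\<^sub>R a) + g x
       = ?h n * ?h n * gba (x + s' *\<^sub>R b + t' *\<^sub>R a)"
      using second_difference_mvt[OF gb gba h, of x] by blast
    have "?h n * ?h n * gab (x + s *\<^sub>R a + t *\<^sub>R b) = ?h n * ?h n * gba (x + s' *\<^sub>R b + t' *\<^sub>R a)"
      using 1(5) 2(5) by (simp add: algebra_simps)
    then have "gab (x + s *\<^sub>R a + t *\<^sub>R b) = gba (x + s' *\<^sub>R b + t' *\<^sub>R a)" by simp
    with 1 2 show "\<exists>s t s' t'. 0 < s \<and> s < ?h n \<and> 0 < t \<and> t < ?h n \<and> 0 < s' \<and> s' < ?h n \<and> 0 < t' \<and> t' < ?h n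
      \<and> gab (x + s *\<^sub>R a + t *\<^sub>R b) = gba (x + s' *\<^sub>R b + t' *\<^sub>R a)" by blast
  qed
  then obtain s t s' t' where st: "\<And>n. 0 < s n" "\<And>n. s n < ?h n" "\<And>n. 0 < t n" "\<And>n. t n < ?h n"
     "\<And>n. 0 < s' n" "\<And>n. s' n < ?h n" "\<And>n. 0 < t' n" "\<And>n. t' n < ?h n"
     "\<And>n. gab (x + s n *\<^sub>R a + t n *\<^sub>R b) = gba (x + s' n *\<^sub>R b + t' n *\<^sub>R a)" by metis
  have h0: "?h \<longlonglongrightarrow> 0" by (rule LIMSEQ_Suc[OF lim_1_over_n])
  have lim0: "f \<longlonglongrightarrow> 0" if "\<And>n. 0 < f n" "\<And>n. f n < ?h n" for f
    by (rule tendsto_sandwich[OF _ _ tendsto_const h0]) (intro always_eventually allI less_imp_le that)+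
  have "(\<lambda>n. x + s n *\<^sub>R a + t n *\<^sub>R b) \<longlonglongrightarrow> x + 0 *\<^sub>R a + 0 *\<^sub>R b"
    by (intro tendsto_intros lim0 st)
  then have A: "(\<lambda>n. gab (x + s n *\<^sub>R a + t n *\<^sub>R b)) \<longlonglongrightarrow> gab x"
    using isCont_tendsto_compose[OF cont(1)] by simp
  have "(\<lambda>n. x + s' n *\<^sub>R b + t' n *\<^sub>R a) \<longlonglongrightarrow> x + 0 *\<^sub>R b + 0 *\<^sub>R a"
    by (intro tendsto_intros lim0 st)
  then have "(\<lambda>n. gba (x + s' n *\<^sub>R b + t' n *\<^sub>R a)) \<longlonglongrightarrow> gba x"
    using isCont_tendsto_compose[OF cont(2)] by simp
  with A st(9) show ?thesis using LIMSEQ_unique by (metis (no_types, lifting) LIMSEQ_unique ext)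
qed

lemma partial_deriv_commute:
  assumes "smooth f"
  shows "partial_deriv i (partial_deriv j f) = partial_deriv j (partial_deriv i f)"
proof
  fix x
  have d: "pderivs is f differentiable (at y)" for "is" y using assms by (simp add: smooth_def)
  have v: "((\<lambda>t. pderivs is f (y + t *\<^sub>R axis k 1)) has_vector_derivative
       pderivs (k # is) f (y + t *\<^sub>R axis k 1)) (at t)" for "is" k y t
    using has_vector_derivative_axis[of "pderivs is f" y k t] d by simp
  have c: "isCont (pderivs is f) y" for "is" y
    using d differentiable_imp_continuous_within by blast
  have re: "((\<lambda>t. Re (pderivs is f (y + t *\<^sub>R axis k 1))) has_real_derivative
       Re (pderivs (k # is) f (y + t *\<^sub>R axis k 1))) (at t)" for "is" k y t
    using bounded_linear.has_vector_derivative[OF bounded_linear_Re v]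
    by (simp add: has_real_derivative_iff_has_vector_derivative)
  have im: "((\<lambda>t. Im (pderivs is f (y + t *\<^sub>R axis k 1))) has_real_derivative
       Im (pderivs (k # is) f (y + t *\<^sub>R axis k 1))) (at t)" for "is" k y t
    using bounded_linear.has_vector_derivative[OF bounded_linear_Im v]
    by (simp add: has_real_derivative_iff_has_vector_derivative)
  have "Re (pderivs [j, i] f x) = Re (pderivs [i, j] f x)"
    by (rule mixed_second_derivatives_real[where g = "\<lambda>y. Re (pderivs [] f y)" and
      ga = "\<lambda>y. Re (pderivs [i] f y)" and gb = "\<lambda>y. Re (pderivs [j] f y)" and a = "axis i 1" and b = "axis j 1"])
      (rule re isCont_Re c)+
  moreover have "Im (pderivs [j, i] f x) = Im (pderivs [i, j] f x)"
    by (rule mixed_second_derivatives_real[where g = "\<lambda>y. Im (pderivs [] f y)" and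
      ga = "\<lambda>y. Im (pderivs [i] f y)" and gb = "\<lambda>y. Im (pderivs [j] f y)" and a = "axis i 1" and b = "axis j 1"])
      (rule im isCont_Im c)+
  ultimately show "partial_deriv i (partial_deriv j f) x = partial_deriv j (partial_deriv i f) x"
    by (simp add: complex_eq_iff)
qed

lemma pderivs_move_front:
  assumes "smooth f" shows "pderivs (ys @ a # zs) f = pderivs (a # ys @ zs) f"
proof (induction ys)
  case (Cons y ys)
  have "pderivs ((y # ys) @ a # zs) f = partial_deriv y (partial_deriv a (pderivs (ys @ zs) f))"
    using Cons by simp
  also have "\<dots> = partial_deriv a (partial_deriv y (pderivs (ys @ zs) f))"
    by (rule partial_deriv_commute) (rule smooth_pderivs[OF assms])
  finally show ?case by simp
qed simp

lemma pderivs_cong_mset: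
  assumes "smooth f" "mset is = mset js" shows "pderivs is f = pderivs js f"
  using assms(2)
proof (induction "is" arbitrary: js)
  case (Cons a "is")
  then have "a \<in> set js" by (metis list.set_intros(1) set_mset_mset)
  then obtain ys zs where js: "js = ys @ a # zs" by (meson split_list)
  with Cons have "mset is = mset (ys @ zs)" by simp
  then have "pderivs is f = pderivs (ys @ zs) f" by (rule Cons.IH)
  then show ?case unfolding js pderivs_move_front[OF assms(1)] by simp
qed simp

text \<open>By commutation of partial derivatives only the multiplicities in the list matter. Lists are easier
  to do induction on than multiindices, so all later estimates are made for lists.\<close>

lemma pderivs_eq_multi_deriv:
  fixes f :: "('d::{finite,linorder}) cfun"
  assumes "smooth f"
  shows "pderivs is f = multi_deriv (count_list is) f"
  unfolding multi_deriv_def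
proof (rule pderivs_cong_mset[OF assms])
  have *: "mset (concat (map (\<lambda>i. replicate (\<beta> i) i) xs)) = (\<Sum>i\<leftarrow>xs. replicate_mset (\<beta> i) i)"
    for \<beta> :: "'d => nat" and xs by (induction xs) auto
  show "mset is = mset (concat (map (\<lambda>i. replicate (count_list is i) i) (sorted_list_of_set UNIV)))"
  proof (rule multiset_eqI)
    fix a
    have "count (\<Sum>i\<leftarrow>xs. replicate_mset (\<beta> i) i) a = (if a \<in> set xs then \<beta> a else 0)"
      if "distinct xs" for \<beta> :: "'d => nat" and xs
      using that by (induction xs) auto
    then show "count (mset is) a = count (mset (concat (map (\<lambda>i. replicate (count_list is i) i) (sorted_list_of_set UNIV)))) a"
      unfolding * by (simp add: count_mset)
  qed
qed

definition deriv_list :: "('d::{finite,linorder} => nat) => 'd list" where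
  "deriv_list \<beta> = concat (map (\<lambda>i. replicate (\<beta> i) i) (sorted_list_of_set UNIV))"

lemma multi_deriv_eq_pderivs: "multi_deriv \<beta> = pderivs (deriv_list \<beta>)"
  by (simp add: multi_deriv_def deriv_list_def)

lemma length_deriv_list: "length (deriv_list \<beta>) = (\<Sum>i\<in>UNIV. \<beta> i)"
proof -
  have "length (deriv_list \<beta>) = sum_list (map \<beta> (sorted_list_of_set UNIV))"
    by (simp add: deriv_list_def length_concat o_def)
  also have "\<dots> = (\<Sum>i\<in>UNIV. \<beta> i)"
    by (subst sum_list_distinct_conv_sum_set) auto
  finally show ?thesis .
qed

lemma partial_deriv_sum:
  assumes "finite K" "\<And>k. k \<in> K ==> g k differentiable (at x)"
  shows "partial_deriv i (\<lambda>x. \<Sum>k\<in>K. c k * g k x) x = (\<Sum>k\<in>K. c k * partial_deriv i (g k) x)"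
proof -
  obtain g' where g': "\<And>k. k \<in> K ==> (g k has_derivative g' k) (at x)"
    using assms(2) unfolding differentiable_def by metis
  have "((\<lambda>x. \<Sum>k\<in>K. c k * g k x) has_derivative (\<lambda>v. \<Sum>k\<in>K. c k * g' k v)) (at x)"
    by (intro has_derivative_sum has_derivative_mult_right g')
  from partial_deriv_eq[OF this] show ?thesis
    using partial_deriv_eq[OF g'] by simp
qed

lemma pderivs_sum:
  assumes "finite K" "\<And>k js x. k \<in> K ==> length js < length is ==> pderivs js (g k) differentiable (at x)"
  shows "pderivs is (\<lambda>x. \<Sum>k\<in>K. c k * g k x) = (\<lambda>x. \<Sum>k\<in>K. c k * pderivs is (g k) x)"
  using assms(2)
proof (induction "is")
  case (Cons i "is")
  then have "pderivs is (\<lambda>x. \<Sum>k\<in>K. c k * g k x) = (\<lambda>x. \<Sum>k\<in>K. c k * pderivs is (g k) x)"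
    by simp
  then have "pderivs (i # is) (\<lambda>x. \<Sum>k\<in>K. c k * g k x) = partial_deriv i (\<lambda>x. \<Sum>k\<in>K. c k * pderivs is (g k) x)"
    by simp
  also have "\<dots> = (\<lambda>x. \<Sum>k\<in>K. c k * partial_deriv i (pderivs is (g k)) x)"
    by (rule ext, rule partial_deriv_sum[OF assms(1)]) (use Cons.prems in auto)
  finally show ?case by simp
qed simp

lemma differentiable_sum_mult:
  fixes g :: "'k => 'a::real_normed_vector => complex"
  assumes "\<And>k. k \<in> K ==> g k differentiable (at x)"
  shows "(\<lambda>x. \<Sum>k\<in>K. c k * g k x) differentiable (at x)"
  using assms by (induction K rule: infinite_finite_induct) auto

lemma smooth_sum:
  assumes "finite K" "\<And>k. k \<in> K ==> smooth (g k)"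
  shows "smooth (\<lambda>x. \<Sum>k\<in>K. c k * g k x)"
  unfolding smooth_def
proof (intro allI)
  fix "is" x
  show "pderivs is (\<lambda>x. \<Sum>k\<in>K. c k * g k x) differentiable (at x)"
    using assms by (subst pderivs_sum) (auto simp: smooth_def intro!: differentiable_sum_mult)
qed

lemma partial_deriv_affine:
  fixes M :: "real^'d^'d::finite"
  assumes "f differentiable (at (M *v x + b))"
  shows "partial_deriv i (\<lambda>x. f (M *v x + b)) x
      = (\<Sum>k\<in>UNIV. complex_of_real (M $ k $ i) * partial_deriv k f (M *v x + b))"
    and "(\<lambda>x. f (M *v x + b)) differentiable (at x)"
proof -
  have "((\<lambda>x. M *v x + b) has_derivative (\<lambda>v. M *v v)) (at x)"
    by (auto intro!: derivative_eq_intros linear_imp_has_derivative)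
  from diff_chain_at[OF this has_derivative_partials[OF assms]]
  have d: "((\<lambda>x. f (M *v x + b)) has_derivative
      (\<lambda>v. \<Sum>k\<in>UNIV. ((M *v v) $ k) *\<^sub>R partial_deriv k f (M *v x + b))) (at x)"
    by (simp add: o_def)
  then show "(\<lambda>x. f (M *v x + b)) differentiable (at x)" by (auto simp: differentiable_def)
  have "(M *v axis i 1) $ k = M $ k $ i" for k
    by (simp add: matrix_vector_mult_def axis_def if_distrib cong: if_cong)
  then show "partial_deriv i (\<lambda>x. f (M *v x + b)) x
      = (\<Sum>k\<in>UNIV. complex_of_real (M $ k $ i) * partial_deriv k f (M *v x + b))"
    unfolding partial_deriv_eq[OF d] by (simp add: scaleR_conv_of_real)
qed

lemma pderivs_affine_snoc:
  fixes M :: "real^'d^'d::finite"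
  assumes "smooth f" and "\<And>g js x. smooth g ==> length js < length is ==>
       pderivs js (\<lambda>x. g (M *v x + b)) differentiable (at x)"
  shows "pderivs (is @ [i]) (\<lambda>x. f (M *v x + b)) =
    (\<lambda>x. \<Sum>k\<in>UNIV. complex_of_real (M $ k $ i) * pderivs is (\<lambda>x. partial_deriv k f (M *v x + b)) x)"
proof -
  have "pderivs (is @ [i]) (\<lambda>x. f (M *v x + b))
     = pderivs is (\<lambda>x. \<Sum>k\<in>UNIV. complex_of_real (M $ k $ i) * partial_deriv k f (M *v x + b))"
  proof -
    have "partial_deriv i (\<lambda>x. f (M *v x + b))
      = (\<lambda>x. \<Sum>k\<in>UNIV. complex_of_real (M $ k $ i) * partial_deriv k f (M *v x + b))"
      by (rule ext) (rule partial_deriv_affine(1)[OF smooth_differentiable[OF assms(1)]])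
    then show ?thesis by simp
  qed
  also have "\<dots> = (\<lambda>x. \<Sum>k\<in>UNIV. complex_of_real (M $ k $ i) * pderivs is (\<lambda>x. partial_deriv k f (M *v x + b)) x)"
    using smooth_pderivs[OF assms(1), of "[_]"] assms(2) by (intro pderivs_sum) auto
  finally show ?thesis .
qed

lemma smooth_affine:
  fixes M :: "real^'d^'d::finite"
  assumes "smooth f" shows "smooth (\<lambda>x. f (M *v x + b))"
proof -
  have "smooth f ==> length is = n ==> pderivs is (\<lambda>x. f (M *v x + b)) differentiable (at x)" for f n "is" x
  proof (induction n arbitrary: f "is" x rule: less_induct)
    case (less n)
    show ?case
    proof (cases "is" rule: rev_cases)
      case Nil
      then show ?thesis using less.prems partial_deriv_affine(2)[OF smooth_differentiable] by simp
    next
      case (snoc js i)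
      have *: "\<And>k x. pderivs js (\<lambda>x. partial_deriv k f (M *v x + b)) differentiable (at x)"
        using less.IH[of "length js"] smooth_pderivs[OF less.prems(1), of "[_]"] snoc less.prems by auto
      have "pderivs is (\<lambda>x. f (M *v x + b)) =
        (\<lambda>x. \<Sum>k\<in>UNIV. complex_of_real (M $ k $ i) * pderivs js (\<lambda>x. partial_deriv k f (M *v x + b)) x)"
        unfolding snoc
      proof (rule pderivs_affine_snoc[OF less.prems(1)])
        fix g :: "'d cfun" and ls :: "'d list" and y
        assume "smooth g" "length ls < length js"
        then show "pderivs ls (\<lambda>x. g (M *v x + b)) differentiable (at y)"
          using less.IH[of "length ls" g ls y] less.prems(2) snoc by simp
      qed
      then show ?thesis using * by (auto intro!: differentiable_sum_mult)
    qed
  qed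
  then show ?thesis using assms unfolding smooth_def by blast
qed

text \<open>Each derivative of \<open>f (M x + b)\<close> is, by the chain rule, a sum of \<open>CARD('d)\<close> derivatives of \<open>f\<close> with
  entries of \<open>M\<close> as coefficients. This is where the size of the dilation matrix enters the embedding.\<close>

lemma norm_pderivs_affine_le:
  fixes M :: "real^'d^'d::finite"
  assumes "smooth f" and M: "\<And>k i. \<bar>M $ k $ i\<bar> \<le> m"
    and "\<And>ls. length ls = length is ==> norm (pderivs ls f (M *v x + b)) \<le> B"
  shows "norm (pderivs is (\<lambda>x. f (M *v x + b)) x) \<le> (real CARD('d) * m) ^ length is * B"
  using assms(1,3)
proof (induction "is" arbitrary: f rule: rev_induct)
  case (snoc i "is")
  have m0: "0 \<le> m" using M by (meson abs_ge_zero order_trans)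
  have eq: "pderivs (is @ [i]) (\<lambda>x. f (M *v x + b)) =
    (\<lambda>x. \<Sum>k\<in>UNIV. complex_of_real (M $ k $ i) * pderivs is (\<lambda>x. partial_deriv k f (M *v x + b)) x)"
    by (rule pderivs_affine_snoc[OF snoc.prems(1)]) (use smooth_affine smooth_def in blast)
  have IH: "norm (pderivs is (\<lambda>x. partial_deriv k f (M *v x + b)) x) \<le> (real CARD('d) * m) ^ length is * B" for k
  proof (rule snoc.IH)
    show "smooth (partial_deriv k f)" using smooth_pderivs[OF snoc.prems(1), of "[k]"] by simp
    fix ls :: "'d list" assume "length ls = length is"
    then show "norm (pderivs ls (partial_deriv k f) (M *v x + b)) \<le> B"
      using snoc.prems(2)[of "ls @ [k]"] by simp
  qed
  have "norm (pderivs (is @ [i]) (\<lambda>x. f (M *v x + b)) x)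
    \<le> (\<Sum>k\<in>(UNIV::'d set). m * ((real CARD('d) * m) ^ length is * B))"
    unfolding eq by (intro sum_norm_le) (auto simp: norm_mult intro!: mult_mono IH M m0)
  then show ?case by (simp add: mult_ac)
qed simp

section \<open>Schwartz functions\<close>

lemma abs_multi_monom_le: "\<bar>multi_monom \<gamma> x\<bar> \<le> weight x ^ (\<Sum>i\<in>UNIV. \<gamma> i)"
proof -
  let ?N = "\<Sum>i\<in>UNIV. \<gamma> i"
  have "\<bar>x $ i\<bar> ^ \<gamma> i \<le> (1 + (x $ i)\<^sup>2) ^ ?N" for i
  proof -
    have "\<bar>x $ i\<bar> \<le> 1 + (x $ i)\<^sup>2"
    proof -
      have "0 \<le> (\<bar>x $ i\<bar> - 1)\<^sup>2 + \<bar>x $ i\<bar>" by simp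
      then have "0 \<le> 1 + (x $ i)\<^sup>2 - \<bar>x $ i\<bar>" by (simp add: power2_eq_square algebra_simps)
      then show ?thesis by simp
    qed
    then have "\<bar>x $ i\<bar> ^ \<gamma> i \<le> (1 + (x $ i)\<^sup>2) ^ \<gamma> i" by (intro power_mono) auto
    also have "\<dots> \<le> (1 + (x $ i)\<^sup>2) ^ ?N" by (intro power_increasing member_le_sum) auto
    finally show ?thesis .
  qed
  then have "(\<Prod>i\<in>UNIV. \<bar>x $ i\<bar> ^ \<gamma> i) \<le> (\<Prod>i\<in>UNIV. (1 + (x $ i)\<^sup>2) ^ ?N)"
    by (intro prod_mono) auto
  then show ?thesis
    by (simp add: multi_monom_def weight_def abs_prod power_abs prod_power_distrib)
qed

lemma multi_monom_add_2:
  "multi_monom (\<gamma>(i := \<gamma> i + 2)) x = (x $ i)\<^sup>2 * multi_monom \<gamma> x"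
  unfolding multi_monom_def
  by (subst (1 2) prod.remove[of UNIV i]) (auto simp: power_add mult_ac power2_eq_square)

lemma schwartz_smooth: "f \<in> schwartz ==> smooth f"
  by (simp add: schwartz_def)

text \<open>Expanding the power of the weight gives finitely many monomials.\<close>

lemma weight_power_bound_of_monom_bounds:
  fixes g :: "real^('d::finite) => complex"
  assumes "\<And>\<gamma>. \<exists>C. \<forall>x. norm (multi_monom \<gamma> x *\<^sub>R g x) \<le> C"
  shows "\<exists>C. \<forall>x. norm (g x) * weight x ^ N \<le> C"
proof -
  define S where "S = (\<lambda>g :: real^'d => complex. \<forall>\<gamma>. \<exists>C. \<forall>x. norm (multi_monom \<gamma> x *\<^sub>R g x) \<le> C)"
  have step: "S (\<lambda>x. (1 + (x $ i)\<^sup>2) *\<^sub>R g x)" if Sg: "S g" for g i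
    unfolding S_def
  proof
    fix \<gamma>
    obtain C1 where C1: "\<forall>x. norm (multi_monom \<gamma> x *\<^sub>R g x) \<le> C1" using Sg unfolding S_def by blast
    obtain C2 where C2: "\<forall>x. norm (multi_monom (\<gamma>(i := \<gamma> i + 2)) x *\<^sub>R g x) \<le> C2"
      using Sg unfolding S_def by blast
    have "norm (multi_monom \<gamma> x *\<^sub>R ((1 + (x $ i)\<^sup>2) *\<^sub>R g x)) \<le> C1 + C2" for x
    proof -
      have "multi_monom \<gamma> x *\<^sub>R ((1 + (x $ i)\<^sup>2) *\<^sub>R g x)
         = multi_monom \<gamma> x *\<^sub>R g x + multi_monom (\<gamma>(i := \<gamma> i + 2)) x *\<^sub>R g x"
        by (simp only: multi_monom_add_2) (simp add: algebra_simps)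
      then show ?thesis using C1 C2 by (metis norm_triangle_mono)
    qed
    then show "\<exists>C. \<forall>x. norm (multi_monom \<gamma> x *\<^sub>R ((1 + (x $ i)\<^sup>2) *\<^sub>R g x)) \<le> C" by blast
  qed
  have "S (\<lambda>x. (\<Prod>i\<in>I. 1 + (x $ i)\<^sup>2) *\<^sub>R g x)" if "S g" "finite I" for g and I :: "'d set"
    using that(2) by (induction I) (use that(1) step in \<open>auto simp: scaleR_scaleR[symmetric] simp del: scaleR_scaleR\<close>)
  then have W: "S (\<lambda>x. weight x *\<^sub>R g x)" if "S g" for g
    unfolding weight_def using that by simp
  have "S g" using assms by (simp add: S_def)
  then have "S (\<lambda>x. weight x ^ N *\<^sub>R g x)"
  proof (induction N)
    case (Suc N)
    from W[OF Suc.IH[OF Suc.prems]] show ?case by simp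
  qed simp
  then obtain C where "\<And>x. norm (multi_monom (\<lambda>_. 0) x *\<^sub>R (weight x ^ N *\<^sub>R g x)) \<le> C"
    unfolding S_def by blast
  then show ?thesis by (intro exI[of _ C]) (simp add: multi_monom_def mult.commute)
qed

text \<open>The form in which the Schwartz property is used: a bound by an arbitrary inverse power of the weight,
  uniform over all derivatives of one order.\<close>

lemma schwartz_decay:
  fixes f :: "('d::{finite,linorder}) cfun"
  assumes "f \<in> schwartz"
  shows "\<exists>C>0. \<forall>ls x. length ls = k \<longrightarrow> norm (pderivs ls f x) \<le> C / weight x ^ N"
proof -
  have "\<exists>C. \<forall>x. norm (pderivs ls f x) * weight x ^ N \<le> C" for ls
  proof (rule weight_power_bound_of_monom_bounds)
    fix \<gamma>
    have "bounded (range (\<lambda>x. multi_monom \<gamma> x *\<^sub>R multi_deriv (count_list ls) f x))"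
      using assms by (simp add: schwartz_def)
    then show "\<exists>C. \<forall>x. norm (multi_monom \<gamma> x *\<^sub>R pderivs ls f x) \<le> C"
      unfolding pderivs_eq_multi_deriv[OF schwartz_smooth[OF assms]] bounded_iff by blast
  qed
  then obtain C where C: "\<And>ls x. norm (pderivs ls f x) * weight x ^ N \<le> C ls" by metis
  let ?L = "{ls :: 'd list. length ls = k}"
  have fin: "finite ?L" using finite_lists_length_eq[of "UNIV :: 'd set" k] by simp
  define K where "K = 1 + (\<Sum>ls\<in>?L. \<bar>C ls\<bar>)"
  have "K > 0" unfolding K_def by (simp add: add_pos_nonneg sum_nonneg)
  moreover have "norm (pderivs ls f x) \<le> K / weight x ^ N" if "length ls = k" for ls x
  proof -
    have "\<bar>C ls\<bar> \<le> (\<Sum>ls\<in>?L. \<bar>C ls\<bar>)" using that fin by (intro member_le_sum) auto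
    then have "norm (pderivs ls f x) * weight x ^ N \<le> K" using C[of ls x] by (simp add: K_def)
    then show ?thesis by (simp add: pos_le_divide_eq)
  qed
  ultimately show ?thesis by blast
qed

lemma schwartz_decay_list:
  assumes "f \<in> schwartz"
  obtains C where "C > 0" "\<And>x. norm (pderivs is f x) \<le> C / weight x ^ N"
  using schwartz_decay[OF assms, of "length is" N] that by blast

lemma schwartz_decay_fun:
  assumes "f \<in> schwartz"
  obtains C where "C > 0" "\<And>x. norm (f x) \<le> C / weight x ^ N"
  using schwartz_decay_list[OF assms, of "[]" N] that by auto

lemma schwartzI:
  assumes "smooth f" "\<And>is N. \<exists>C. \<forall>x. norm (pderivs is f x) \<le> C / weight x ^ N"
  shows "f \<in> schwartz"
proof -
  have "bounded (range (\<lambda>x. multi_monom \<gamma> x *\<^sub>R multi_deriv \<beta> f x))" for \<gamma> \<beta>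
  proof -
    obtain C where C: "\<And>x. norm (multi_deriv \<beta> f x) \<le> C / weight x ^ (\<Sum>i\<in>UNIV. \<gamma> i)"
      using assms(2) unfolding multi_deriv_eq_pderivs by metis
    have "norm (multi_monom \<gamma> x *\<^sub>R multi_deriv \<beta> f x) \<le> C" for x
    proof -
      have "norm (multi_monom \<gamma> x *\<^sub>R multi_deriv \<beta> f x)
          \<le> weight x ^ (\<Sum>i\<in>UNIV. \<gamma> i) * (C / weight x ^ (\<Sum>i\<in>UNIV. \<gamma> i))"
        unfolding norm_scaleR by (intro mult_mono abs_multi_monom_le C) auto
      then show ?thesis by simp
    qed
    then show ?thesis by (auto simp: bounded_iff)
  qed
  then show ?thesis using assms(1) by (simp add: schwartz_def)
qed

lemma schwartz_pderivs:
  assumes "f \<in> schwartz" shows "pderivs js f \<in> schwartz"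
proof (rule schwartzI)
  fix "is" N
  show "\<exists>C. \<forall>x. norm (pderivs is (pderivs js f) x) \<le> C / weight x ^ N"
    using schwartz_decay_list[OF assms, of "is @ js" N] by (metis foldr_append)
qed (rule smooth_pderivs[OF schwartz_smooth[OF assms]])

lemma schwartz_sum:
  assumes "finite K" "\<And>k. k \<in> K ==> g k \<in> schwartz"
  shows "(\<lambda>x. \<Sum>k\<in>K. c k * g k x) \<in> schwartz"
proof (rule schwartzI)
  show "smooth (\<lambda>x. \<Sum>k\<in>K. c k * g k x)" using assms by (intro smooth_sum schwartz_smooth)
  fix "is" :: "'b list" and N
  have "\<forall>k\<in>K. \<exists>C. \<forall>x. norm (pderivs is (g k) x) \<le> C / weight x ^ N"
    using schwartz_decay_list[OF assms(2)] by meson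
  then obtain C where C: "\<And>k x. k \<in> K ==> norm (pderivs is (g k) x) \<le> C k / weight x ^ N"
    by metis
  have "pderivs is (\<lambda>x. \<Sum>k\<in>K. c k * g k x) = (\<lambda>x. \<Sum>k\<in>K. c k * pderivs is (g k) x)"
    using assms schwartz_smooth by (intro pderivs_sum) (auto simp: smooth_def)
  moreover have "norm (\<Sum>k\<in>K. c k * pderivs is (g k) x) \<le> (\<Sum>k\<in>K. norm (c k) * C k) / weight x ^ N" for x
    unfolding sum_divide_distrib times_divide_eq_right[symmetric]
    by (intro sum_norm_le) (simp add: norm_mult mult_left_mono C del: times_divide_eq_right)
  ultimately show "\<exists>C. \<forall>x. norm (pderivs is (\<lambda>x. \<Sum>k\<in>K. c k * g k x) x) \<le> C / weight x ^ N"
    by metis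
qed

lemma schwartz_scale: "f \<in> schwartz ==> (\<lambda>x. c * f x) \<in> schwartz"
  using schwartz_sum[of "{()}" "\<lambda>_. f" "\<lambda>_. c"] by simp

lemma schwartz_add:
  assumes "f \<in> schwartz" "g \<in> schwartz" shows "(\<lambda>x. f x + g x) \<in> schwartz"
  using schwartz_sum[of "UNIV :: bool set" "\<lambda>b. if b then f else g" "\<lambda>_. 1"] assms
  by (simp add: UNIV_bool add.commute)

lemma schwartz_diff:
  assumes "f \<in> schwartz" "g \<in> schwartz" shows "(\<lambda>x. f x - g x) \<in> schwartz"
  using schwartz_add[OF assms(1) schwartz_scale[OF assms(2), of "-1"]] by simp

lemma pderivs_diff:
  assumes "smooth f" "smooth g"
  shows "pderivs is (\<lambda>x. f x - g x) = (\<lambda>x. pderivs is f x - pderivs is g x)"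
  using pderivs_sum[of "UNIV :: bool set" "is" "\<lambda>b. if b then f else g" "\<lambda>b. if b then 1 else -1"] assms
  by (simp add: UNIV_bool smooth_def algebra_simps)

lemma divide_le_divide_shift:
  fixes a b c k :: real
  assumes "a \<le> k * b" "a > 0" "b > 0" "c \<ge> 0"
  shows "c / b \<le> c * k / a"
proof -
  have "c / b = (c * a) / (a * b)" using assms by simp
  also have "\<dots> \<le> (c * (k * b)) / (a * b)"
    using assms by (intro divide_right_mono mult_left_mono) auto
  also have "\<dots> = c * k / a" using assms by simp
  finally show ?thesis .
qed

lemma matrix_inv_mult:
  assumes "invertible M"
  shows "M ** matrix_inv M = idm"
    and "matrix_inv M ** M = idm"
  using assms someI_ex[of "\<lambda>A'. M ** A' = idm \<and> A' ** M = idm"]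
  unfolding invertible_def matrix_inv_def by auto

lemma schwartz_affine:
  fixes M :: "('d::{finite,linorder}) sqmat"
  assumes "f \<in> schwartz" "invertible M"
  shows "(\<lambda>x. f (M *v x + b)) \<in> schwartz"
proof (rule schwartzI)
  show "smooth (\<lambda>x. f (M *v x + b))" by (intro smooth_affine schwartz_smooth assms)
  fix "is" :: "'d list" and N
  obtain C0 where C0: "C0 > 0" "\<And>x. weight (matrix_inv M *v x) \<le> C0 * weight x ^ CARD('d)"
    using weight_linear[OF matrix_vector_mul_linear, of "matrix_inv M"] by blast
  define n where "n = CARD('d) * N"
  obtain C where C: "C > 0" "\<And>ls x. length ls = length is ==> norm (pderivs ls f x) \<le> C / weight x ^ n"
    using schwartz_decay[OF assms(1), of "length is" n] by blast
  define m where "m = (\<Sum>k\<in>UNIV. \<Sum>i\<in>UNIV. \<bar>M $ k $ i\<bar>)"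
  have m: "\<bar>M $ k $ i\<bar> \<le> m" for k i
  proof -
    have "\<bar>M $ k $ i\<bar> \<le> (\<Sum>i\<in>UNIV. \<bar>M $ k $ i\<bar>)" by (intro member_le_sum) auto
    also have "\<dots> \<le> m" unfolding m_def by (intro member_le_sum) (auto intro: sum_nonneg)
    finally show ?thesis .
  qed
  define K where "K = (C0 * (2 ^ CARD('d) * weight b) ^ CARD('d)) ^ N"
  have w: "weight x ^ N \<le> K * weight (M *v x + b) ^ n" for x
  proof -
    have "x = matrix_inv M *v ((M *v x + b) + - b)"
      using assms(2) by (simp add: matrix_vector_mul_assoc matrix_inv_mult(2))
    then have "weight x \<le> C0 * weight ((M *v x + b) + - b) ^ CARD('d)" using C0(2) by metis
    also have "\<dots> \<le> C0 * (2 ^ CARD('d) * weight (M *v x + b) * weight (- b)) ^ CARD('d)"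
      using C0(1) by (intro mult_left_mono power_mono weight_add) auto
    finally have "weight x \<le> C0 * (2 ^ CARD('d) * weight b) ^ CARD('d) * weight (M *v x + b) ^ CARD('d)"
      by (simp add: power_mult_distrib mult_ac)
    then have "weight x ^ N \<le> (C0 * (2 ^ CARD('d) * weight b) ^ CARD('d) * weight (M *v x + b) ^ CARD('d)) ^ N"
      by (intro power_mono) auto
    then show ?thesis by (simp add: power_mult_distrib K_def n_def power_mult)
  qed
  have "norm (pderivs is (\<lambda>x. f (M *v x + b)) x) \<le> ((real CARD('d) * m) ^ length is * (C * K)) / weight x ^ N" for x
  proof -
    have "norm (pderivs is (\<lambda>x. f (M *v x + b)) x) \<le> (real CARD('d) * m) ^ length is * (C / weight (M *v x + b) ^ n)"
      by (rule norm_pderivs_affine_le[OF schwartz_smooth[OF assms(1)] m]) (use C in auto)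
    also have "C / weight (M *v x + b) ^ n \<le> C * K / weight x ^ N"
      using divide_le_divide_shift[OF w[of x] _ _ less_imp_le[OF C(1)]] by simp
    finally show ?thesis using m[of undefined undefined]
      by (simp add: mult_left_mono)
  qed
  then show "\<exists>C. \<forall>x. norm (pderivs is (\<lambda>x. f (M *v x + b)) x) \<le> C / weight x ^ N" by blast
qed

lemma matrix_minus_mat_1: "(- idm :: ('d::finite) sqmat) *v x = - x"
  using matrix_vector_mult_diff_rdistrib[of 0 "idm" x] by simp

lemma schwartz_reflect_translate:
  fixes f :: "('d::{finite,linorder}) cfun"
  assumes "f \<in> schwartz" shows "(\<lambda>y. f (x - y)) \<in> schwartz"
proof -
  let ?M = "- idm :: 'd sqmat"
  have "?M ** ?M = idm"
    by (subst matrix_eq) (simp add: matrix_vector_mul_assoc[symmetric] matrix_minus_mat_1)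
  then have "invertible ?M" unfolding invertible_def by blast
  from schwartz_affine[OF assms this, of x] show ?thesis
    by (simp add: matrix_minus_mat_1)
qed

text \<open>A mean value estimate along the segment from \<open>a\<close> to \<open>a + b\<close>, on which the weight is comparable to its
  value at \<open>a\<close>.\<close>

lemma schwartz_difference_bound:
  fixes f :: "('d::{finite,linorder}) cfun"
  assumes "f \<in> schwartz"
  shows "\<exists>C>0. \<forall>a b. norm b \<le> 1 \<longrightarrow> norm (f (a + b) - f a) \<le> C * norm b / weight a ^ N"
proof -
  obtain C where C: "C > 0" "\<And>ls x. length ls = 1 ==> norm (pderivs ls f x) \<le> C / weight x ^ N"
    using schwartz_decay[OF assms, of 1 N] by blast
  let ?K = "real CARD('d) * C * 2 ^ (CARD('d) * N) * 2 ^ (CARD('d) * N)"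
  have "norm (f (a + b) - f a) \<le> ?K * norm b / weight a ^ N" if b: "norm b \<le> 1" for a b
  proof -
    have "norm (f (a + b) - f a) \<le> (?K / weight a ^ N) * norm (a + b - a)"
    proof (rule differentiable_bound[of "cball a 1" f])
      fix z assume "z \<in> cball a 1"
      then have z: "norm (a - z) \<le> 1" by (simp add: dist_norm)
      show "(f has_derivative (\<lambda>v. \<Sum>i\<in>UNIV. (v $ i) *\<^sub>R partial_deriv i f z)) (at z within cball a 1)"
        by (rule has_derivative_at_withinI, rule has_derivative_partials)
          (intro smooth_differentiable schwartz_smooth assms)
      have "weight a ^ N \<le> 2 ^ (CARD('d) * N) * weight z ^ N * weight (a - z) ^ N"
        using weight_add_power[of z "a - z" N] by simp
      also have "\<dots> \<le> 2 ^ (CARD('d) * N) * weight z ^ N * (2 ^ CARD('d)) ^ N"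
        by (intro mult_left_mono power_mono weight_le_of_norm_le_1 z) auto
      finally have w: "weight a ^ N \<le> 2 ^ (CARD('d) * N) * 2 ^ (CARD('d) * N) * weight z ^ N"
        by (simp only: power_mult[of "2::real" "CARD('d)" N] mult.assoc mult.commute[of "weight z ^ N"])
      have p: "norm (partial_deriv i f z) \<le> C * 2 ^ (CARD('d) * N) * 2 ^ (CARD('d) * N) / weight a ^ N" for i
      proof -
        have "norm (partial_deriv i f z) \<le> C / weight z ^ N" using C(2)[of "[i]" z] by simp
        also have "\<dots> \<le> C * 2 ^ (CARD('d) * N) * 2 ^ (CARD('d) * N) / weight a ^ N"
          using divide_le_divide_shift[OF w _ _ less_imp_le[OF C(1)]] by (simp add: mult.assoc)
        finally show ?thesis .
      qed
      show "onorm (\<lambda>v. \<Sum>i\<in>UNIV. (v $ i) *\<^sub>R partial_deriv i f z) \<le> ?K / weight a ^ N"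
      proof (rule onorm_le)
        fix v :: "'d rvec"
        have "norm (\<Sum>i\<in>UNIV. (v $ i) *\<^sub>R partial_deriv i f z)
          \<le> (\<Sum>i\<in>(UNIV::'d set). norm v * (C * 2 ^ (CARD('d) * N) * 2 ^ (CARD('d) * N) / weight a ^ N))"
        proof (rule sum_norm_le)
          fix i :: 'd
          show "norm ((v $ i) *\<^sub>R partial_deriv i f z)
            \<le> norm v * (C * 2 ^ (CARD('d) * N) * 2 ^ (CARD('d) * N) / weight a ^ N)"
            unfolding norm_scaleR by (intro mult_mono p component_le_norm_cart) auto
        qed
        also have "\<dots> = ?K / weight a ^ N * norm v" by simp
        finally show "norm (\<Sum>i\<in>UNIV. (v $ i) *\<^sub>R partial_deriv i f z) \<le> ?K / weight a ^ N * norm v" .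
      qed
    next
      show "a + b \<in> cball a 1" using b by (simp add: dist_norm)
    qed auto
    also have "a + b - a = b" by simp
    finally show ?thesis by simp
  qed
  moreover have "?K > 0" using C(1) by (intro mult_pos_pos) auto
  ultimately show ?thesis by blast
qed

section \<open>Integration against the weight\<close>

lemma lborel_distr_reflect:
  "distr lborel borel (\<lambda>y. x - y) = (lborel :: 'a::euclidean_space measure)"
proof (rule lborel_eqI[symmetric])
  fix l u :: 'a assume lu: "\<And>b. b \<in> Basis ==> l \<bullet> b \<le> u \<bullet> b"
  have "(\<lambda>y. x - y) -` box l u \<inter> space lborel = box (x - u) (x - l)"
    by (auto simp: mem_box inner_diff_left less_diff_eq diff_less_eq add.commute)
  then have "emeasure (distr lborel borel (\<lambda>y. x - y)) (box l u) = emeasure lborel (box (x - u) (x - l))"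
    by (subst emeasure_distr) auto
  also have "\<dots> = (\<Prod>b\<in>Basis. (u - l) \<bullet> b)"
    using lu by (subst emeasure_lborel_box) (auto simp: inner_diff_left)
  finally show "emeasure (distr lborel borel (\<lambda>y. x - y)) (box l u) = (\<Prod>b\<in>Basis. (u - l) \<bullet> b)" .
qed simp

lemma nn_integral_reflect:
  fixes f :: "'a::euclidean_space => ennreal"
  assumes [measurable]: "f \<in> borel_measurable borel"
  shows "(\<integral>\<^sup>+y. f (x - y) \<partial>lborel) = (\<integral>\<^sup>+y. f y \<partial>lborel)"
  using nn_integral_distr[of "\<lambda>y. x - y" lborel borel f] by (simp add: lborel_distr_reflect)

lemma integral_reflect:
  fixes f :: "'a::euclidean_space => complex"
  assumes [measurable]: "f \<in> borel_measurable borel"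
  shows "(LINT y|lborel. f (x - y)) = (LINT y|lborel. f y)"
  using integral_distr[of "\<lambda>y. x - y" lborel borel f] by (simp add: lborel_distr_reflect)

lemma integrable_reflect:
  fixes f :: "'a::euclidean_space => 'b::{banach,second_countable_topology}"
  assumes "integrable lborel f"
  shows "integrable lborel (\<lambda>y. f (x - y))"
  using integrable_distr[of "\<lambda>y. x - y" lborel borel f] assms by (simp add: lborel_distr_reflect)

lemma integrable_inverse_weight: "integrable lborel (\<lambda>x :: ('d::finite) rvec. 1 / weight x)"
  using nn_integral_inverse_weight_finite by (intro integrableI_bounded) auto

definition poly_growth :: "('d::finite) cfun => bool" where
  "poly_growth g \<longleftrightarrow> g \<in> borel_measurable borel \<and> (\<exists>C N. \<forall>x. norm (g x) \<le> C * weight x ^ N)"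

lemma poly_growth_measurable: "poly_growth g ==> g \<in> borel_measurable borel"
  by (simp add: poly_growth_def)

lemma poly_growthE:
  assumes "poly_growth g"
  obtains C N where "C > 0" "\<And>x. norm (g x) \<le> C * weight x ^ N"
proof -
  obtain C N where C: "\<And>x. norm (g x) \<le> C * weight x ^ N" using assms unfolding poly_growth_def by blast
  have "norm (g x) \<le> (\<bar>C\<bar> + 1) * weight x ^ N" for x
    by (rule order_trans[OF C]) (intro mult_right_mono, auto)
  then show ?thesis using that[of "\<bar>C\<bar> + 1" N] by simp
qed

lemma schwartz_continuous: "f \<in> schwartz ==> continuous_on S f"
  by (intro smooth_continuous schwartz_smooth)

lemma schwartz_measurable: "f \<in> schwartz ==> f \<in> borel_measurable borel"
  by (intro borel_measurable_continuous_onI schwartz_continuous)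

lemma schwartz_poly_growth: "f \<in> schwartz ==> poly_growth f"
  unfolding poly_growth_def using schwartz_measurable
  by (metis (no_types) div_by_1 mult.right_neutral power_0 schwartz_decay_fun)

lemma weight_power_le_shift:
  fixes x y :: "('d::finite) rvec"
  shows "weight y ^ N \<le> 2 ^ (CARD('d) * N) * weight x ^ N * weight (x - y) ^ N"
  using weight_add_power[of x "y - x" N] by (simp add: weight_diff_commute)

lemma poly_growth_times_decay:
  fixes g :: "('d::finite) cfun"
  assumes "norm (g y) \<le> C * weight y ^ N" "norm c \<le> C' / weight (x - y) ^ (N + k)" "C > 0" "C' > 0"
  shows "norm (g y * c) \<le> C * C' * 2 ^ (CARD('d) * N) * weight x ^ N * (1 / weight (x - y) ^ k)"
proof -
  have "norm (g y * c) \<le> (C * weight y ^ N) * (C' / weight (x - y) ^ (N + k))"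
    unfolding norm_mult using assms by (intro mult_mono) auto
  also have "\<dots> \<le> (C * (2 ^ (CARD('d) * N) * weight x ^ N * weight (x - y) ^ N)) * (C' / weight (x - y) ^ (N + k))"
    using assms by (intro mult_mono mult_left_mono weight_power_le_shift) auto
  also have "\<dots> = C * C' * 2 ^ (CARD('d) * N) * weight x ^ N * (1 / weight (x - y) ^ k)"
    by (simp add: power_add divide_simps)
  finally show ?thesis .
qed

section \<open>Convolution with a Schwartz function\<close>

definition cv :: "('d::finite) cfun => 'd cfun => 'd cfun" where
  "cv g \<kappa> x = (LINT y|lborel. g y * \<kappa> (x - y))"

lemma integrable_cv_bound:
  fixes g h :: "('d::finite) cfun"
  assumes "poly_growth g" "h \<in> borel_measurable borel" "\<And>N. \<exists>C>0. \<forall>x. norm (h x) \<le> C / weight x ^ N"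
  shows "integrable lborel (\<lambda>y. g y * h (x - y))"
    and "\<exists>C N. \<forall>x. (LINT y|lborel. norm (g y * h (x - y))) \<le> C * weight x ^ N"
proof -
  obtain C N where C: "C > 0" "\<And>x. norm (g x) \<le> C * weight x ^ N" using poly_growthE[OF assms(1)] by blast
  obtain C' where C': "C' > 0" "\<And>x. norm (h x) \<le> C' / weight x ^ (N + 1)" using assms(3) by blast
  note [measurable] = poly_growth_measurable[OF assms(1)] assms(2)
  have b: "norm (g y * h (x - y)) \<le> C * C' * 2 ^ (CARD('d) * N) * weight x ^ N * (1 / weight (x - y))" for x y
    using poly_growth_times_decay[of g y C N "h (x - y)" C' x 1] C C' by simp
  have i: "integrable lborel (\<lambda>y. K * (1 / weight (x - y)))" for x :: "'d rvec" and K :: real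
    using integrable_mult_right[OF integrable_reflect[OF integrable_inverse_weight, of x], of K] by simp
  have int: "integrable lborel (\<lambda>y. g y * h (x - y))" for x
    by (rule Bochner_Integration.integrable_bound[OF i[where K = "C * C' * 2 ^ (CARD('d) * N) * weight x ^ N" and x = x]])
       (use b C C' in \<open>auto simp: abs_mult intro!: AE_I2\<close>)
  then show "integrable lborel (\<lambda>y. g y * h (x - y))" .
  have r: "(LINT y|lborel. 1 / weight (x - y)) = (LINT y|lborel. 1 / weight (y :: 'd rvec))"
    for x :: "'d rvec"
    using integral_distr[of "\<lambda>y. x - y" lborel borel "\<lambda>y :: 'd rvec. 1 / weight y"]
    by (simp add: lborel_distr_reflect)
  have "(LINT y|lborel. norm (g y * h (x - y))) \<le>
     C * C' * 2 ^ (CARD('d) * N) * (LINT y|lborel. 1 / weight (y :: 'd rvec)) * weight x ^ N" for x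
  proof -
    have "(LINT y|lborel. norm (g y * h (x - y))) \<le> (LINT y|lborel. C * C' * 2 ^ (CARD('d) * N) * weight x ^ N * (1 / weight (x - y)))"
      using b by (intro integral_mono integrable_norm int i) auto
    then show ?thesis unfolding integral_mult_right_zero r by (simp only: mult_ac)
  qed
  then show "\<exists>C N. \<forall>x. (LINT y|lborel. norm (g y * h (x - y))) \<le> C * weight x ^ N" by blast
qed

lemma schwartz_decay_ex: "f \<in> schwartz ==> \<exists>C>0. \<forall>x. norm (f x) \<le> C / weight x ^ N"
  using schwartz_decay_fun by metis

lemma cv_integrable:
  assumes "poly_growth g" "\<kappa> \<in> schwartz"
  shows "integrable lborel (\<lambda>y. g y * \<kappa> (x - y))"
  using assms by (intro integrable_cv_bound(1) schwartz_measurable schwartz_decay_ex)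

lemma cv_flip:
  assumes [measurable]: "g \<in> borel_measurable borel" "\<kappa> \<in> borel_measurable borel"
  shows "cv g \<kappa> x = (LINT y|lborel. g (x - y) * \<kappa> y)"
  unfolding cv_def using integral_reflect[of "\<lambda>y. g y * \<kappa> (x - y)" x] by simp

lemma cv_commute:
  assumes "g \<in> borel_measurable borel" "\<kappa> \<in> borel_measurable borel"
  shows "cv g \<kappa> = cv \<kappa> g"
  by (rule ext, subst cv_flip[OF assms]) (simp add: cv_def mult.commute)

lemma schwartz_second_order_bound:
  fixes f :: "('d::{finite,linorder}) cfun"
  assumes "f \<in> schwartz"
  shows "\<exists>C>0. \<forall>a h. \<bar>h\<bar> \<le> 1 \<longrightarrow>
     norm (f (a + h *\<^sub>R axis i 1) - f a - h *\<^sub>R partial_deriv i f a) \<le> h\<^sup>2 * (C / weight a ^ N)"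
proof -
  have "partial_deriv i f \<in> schwartz" using schwartz_pderivs[OF assms, of "[i]"] by simp
  then obtain C where C: "C > 0" "\<And>a b. norm b \<le> 1 ==>
      norm (partial_deriv i f (a + b) - partial_deriv i f a) \<le> C * norm b / weight a ^ N"
    using schwartz_difference_bound[of "partial_deriv i f" N] by blast
  have "norm (f (a + h *\<^sub>R axis i 1) - f a - h *\<^sub>R partial_deriv i f a) \<le> h\<^sup>2 * (C / weight a ^ N)" if h: "\<bar>h\<bar> \<le> 1" for a h
  proof -
    let ?\<phi> = "\<lambda>t. f (a + t *\<^sub>R axis i 1) - t *\<^sub>R partial_deriv i f a"
    have "norm (?\<phi> h - ?\<phi> 0) \<le> (C * \<bar>h\<bar> / weight a ^ N) * norm (h - 0)"
    proof (rule differentiable_bound[of "cball 0 \<bar>h\<bar>" ?\<phi>])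
      fix t assume "t \<in> cball (0::real) \<bar>h\<bar>"
      then have t: "\<bar>t\<bar> \<le> \<bar>h\<bar>" by (simp add: dist_norm)
      have "((\<lambda>t. f (a + t *\<^sub>R axis i 1)) has_derivative (\<lambda>s. s *\<^sub>R partial_deriv i f (a + t *\<^sub>R axis i 1))) (at t)"
        using has_vector_derivative_axis[of f a i t] smooth_differentiable[OF schwartz_smooth[OF assms]]
        by (simp add: has_vector_derivative_def)
      from has_derivative_diff[OF this has_derivative_scaleR_left[OF has_derivative_ident]]
      show "(?\<phi> has_derivative (\<lambda>s. s *\<^sub>R (partial_deriv i f (a + t *\<^sub>R axis i 1) - partial_deriv i f a))) (at t within cball 0 \<bar>h\<bar>)"
        unfolding scaleR_diff_right
        by (rule has_derivative_at_withinI)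
      have "norm (partial_deriv i f (a + t *\<^sub>R axis i 1) - partial_deriv i f a) \<le> C * norm (t *\<^sub>R axis i (1::real) :: 'd rvec) / weight a ^ N"
        using t h by (intro C(2)) simp
      also have "\<dots> \<le> C * \<bar>h\<bar> / weight a ^ N"
        using t C(1) by (intro divide_right_mono mult_left_mono) auto
      finally have n: "norm (partial_deriv i f (a + t *\<^sub>R axis i 1) - partial_deriv i f a) \<le> C * \<bar>h\<bar> / weight a ^ N" .
      show "onorm (\<lambda>s. s *\<^sub>R (partial_deriv i f (a + t *\<^sub>R axis i 1) - partial_deriv i f a)) \<le> C * \<bar>h\<bar> / weight a ^ N"
        by (rule onorm_le) (use mult_left_mono[OF n] in \<open>simp add: mult.commute\<close>)
    qed auto
    then show ?thesis by (simp add: power2_eq_square abs_mult[symmetric] algebra_simps)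
  qed
  with C(1) show ?thesis by blast
qed

text \<open>Differentiation under the integral, done by hand: the second order Taylor remainder of \<open>\<kappa>\<close> is bounded by
  the square of the increment times a rapidly decreasing function.\<close>

lemma partial_deriv_cv:
  fixes g :: "('d::{finite,linorder}) cfun"
  assumes g: "poly_growth g" and \<kappa>: "\<kappa> \<in> schwartz"
  shows "partial_deriv i (cv g \<kappa>) x = cv g (partial_deriv i \<kappa>) x"
proof -
  let ?e = "axis i 1 :: 'd rvec"
  have d\<kappa>: "partial_deriv i \<kappa> \<in> schwartz" using schwartz_pderivs[OF \<kappa>, of "[i]"] by simp
  obtain C N where C: "C > 0" "\<And>x. norm (g x) \<le> C * weight x ^ N" using poly_growthE[OF g] by blast
  obtain C' where C': "C' > 0" "\<And>a h. \<bar>h\<bar> \<le> 1 ==>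
     norm (\<kappa> (a + h *\<^sub>R ?e) - \<kappa> a - h *\<^sub>R partial_deriv i \<kappa> a) \<le> h\<^sup>2 * (C' / weight a ^ (N + 1))"
    using schwartz_second_order_bound[OF \<kappa>, of i "N + 1"] by blast
  define K where "K = C * C' * 2 ^ (CARD('d) * N) * weight x ^ N * (LINT y|lborel. 1 / weight (x - y))"
  have est: "norm (cv g \<kappa> (x + h *\<^sub>R ?e) - cv g \<kappa> x - h *\<^sub>R cv g (partial_deriv i \<kappa>) x) \<le> h\<^sup>2 * K"
    if h: "\<bar>h\<bar> \<le> 1" "h \<noteq> 0" for h
  proof -
    let ?R = "\<lambda>y. g y * (\<kappa> (x + h *\<^sub>R ?e - y) - \<kappa> (x - y) - h *\<^sub>R partial_deriv i \<kappa> (x - y))"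
    have "cv g \<kappa> (x + h *\<^sub>R ?e) - cv g \<kappa> x - h *\<^sub>R cv g (partial_deriv i \<kappa>) x = (LINT y|lborel. ?R y)"
      unfolding cv_def using cv_integrable[OF g \<kappa>] cv_integrable[OF g d\<kappa>]
      by (simp add: right_diff_distrib scaleR_conv_of_real mult.left_commute[of _ "complex_of_real h"])
    also have "norm \<dots> \<le> (LINT y|lborel. h\<^sup>2 * (C * C' * 2 ^ (CARD('d) * N) * weight x ^ N * (1 / weight (x - y))))"
    proof (rule Bochner_Integration.integral_norm_bound_integral)
      show "integrable lborel ?R"
        using cv_integrable[OF g \<kappa>] cv_integrable[OF g d\<kappa>]
        by (simp add: right_diff_distrib scaleR_conv_of_real mult.left_commute[of _ "complex_of_real h"])
      show "integrable lborel (\<lambda>y. h\<^sup>2 * (C * C' * 2 ^ (CARD('d) * N) * weight x ^ N * (1 / weight (x - y))))"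
        by (intro integrable_mult_right integrable_reflect[OF integrable_inverse_weight])
      fix y
      have "norm (g y * (\<kappa> (x + h *\<^sub>R ?e - y) - \<kappa> (x - y) - h *\<^sub>R partial_deriv i \<kappa> (x - y)))
        \<le> C * (h\<^sup>2 * C') * 2 ^ (CARD('d) * N) * weight x ^ N * (1 / weight (x - y) ^ 1)"
        using C C' C'(2)[OF h(1), of "x - y"] h(2)
        by (intro poly_growth_times_decay) (auto simp: algebra_simps)
      then show "norm (?R y) \<le> h\<^sup>2 * (C * C' * 2 ^ (CARD('d) * N) * weight x ^ N * (1 / weight (x - y)))"
        by (simp add: mult_ac)
    qed
    also have "\<dots> = h\<^sup>2 * K" by (simp only: K_def integral_mult_right_zero)
    finally show ?thesis .
  qed
  have "((\<lambda>t. cv g \<kappa> (x + t *\<^sub>R ?e)) has_vector_derivative cv g (partial_deriv i \<kappa>) x) (at 0)"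
    unfolding has_vector_derivative_def has_derivative_at
  proof (intro conjI)
    show "bounded_linear (\<lambda>h. h *\<^sub>R cv g (partial_deriv i \<kappa>) x)" by (rule bounded_linear_scaleR_left)
    have "((\<lambda>h. \<bar>h\<bar> * K) \<longlongrightarrow> \<bar>0\<bar> * K) (at 0)" by (intro tendsto_intros)
    then have lim: "((\<lambda>h. \<bar>h\<bar> * K) \<longlongrightarrow> 0) (at 0)" by simp
    show "(\<lambda>h. norm (cv g \<kappa> (x + (0 + h) *\<^sub>R ?e) - cv g \<kappa> (x + 0 *\<^sub>R ?e) - h *\<^sub>R cv g (partial_deriv i \<kappa>) x) / norm h) \<midarrow>0\<rightarrow> 0"
    proof (rule tendsto_sandwich[OF _ _ tendsto_const lim])
      have "\<forall>\<^sub>F h in at (0::real). h \<noteq> 0 \<and> \<bar>h\<bar> \<le> 1"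
        by (auto simp: eventually_at dist_real_def intro!: exI[of _ 1])
      then show "\<forall>\<^sub>F h in at 0. norm (cv g \<kappa> (x + (0 + h) *\<^sub>R ?e) - cv g \<kappa> (x + 0 *\<^sub>R ?e) - h *\<^sub>R cv g (partial_deriv i \<kappa>) x) / norm h \<le> \<bar>h\<bar> * K"
        by (rule eventually_mono)
          (use est in \<open>auto simp: divide_simps power2_eq_square abs_mult[symmetric] mult_ac\<close>)
    qed (auto intro: always_eventually)
  qed
  then show ?thesis unfolding partial_deriv_def by (rule vector_derivative_at)
qed

lemma pderivs_cv:
  assumes "poly_growth g" "\<kappa> \<in> schwartz"
  shows "pderivs is (cv g \<kappa>) = cv g (pderivs is \<kappa>)"
proof (induction "is")
  case (Cons i "is")
  then show ?case
    using partial_deriv_cv[OF assms(1) schwartz_pderivs[OF assms(2)]] by auto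
qed simp

lemma pderivs_reflect:
  assumes "smooth f"
  shows "pderivs is (\<lambda>y. f (x - y)) = (\<lambda>y. (-1) ^ length is * pderivs is f (x - y))"
proof (induction "is")
  case (Cons i "is")
  have "partial_deriv i (\<lambda>y. (-1) ^ length is * pderivs is f (x - y)) y = - ((-1) ^ length is * partial_deriv i (pderivs is f) (x - y))" for y
  proof -
    have "((\<lambda>y. x - y) has_derivative (\<lambda>v. - v)) (at y)" by (auto intro!: derivative_eq_intros)
    from diff_chain_at[OF this has_derivative_partials[OF smooth_pderivs_differentiable[OF assms]]]
    have "((\<lambda>y. pderivs is f (x - y)) has_derivative
      (\<lambda>v. \<Sum>i\<in>UNIV. ((- v) $ i) *\<^sub>R partial_deriv i (pderivs is f) (x - y))) (at y)"
      by (simp add: o_def)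
    then have "((\<lambda>y. (-1) ^ length is * pderivs is f (x - y)) has_derivative
      (\<lambda>v. (-1) ^ length is * (\<Sum>i\<in>UNIV. ((- v) $ i) *\<^sub>R partial_deriv i (pderivs is f) (x - y)))) (at y)"
      by (rule has_derivative_mult_right)
    from partial_deriv_eq[OF this, of i] show ?thesis
      by (simp add: axis_def if_distrib if_distribR sum_negf cong: if_cong)
  qed
  then have "partial_deriv i (\<lambda>y. (-1) ^ length is * pderivs is f (x - y))
      = (\<lambda>y. (-1) ^ length (i # is) * pderivs (i # is) f (x - y))" by (simp add: fun_eq_iff)
  with Cons show ?case by simp
qed simp

section \<open>Tempered distributions have finite order\<close>

lemma seminorm_upper:
  assumes "f \<in> schwartz"
  shows "norm (multi_monom \<gamma> x *\<^sub>R multi_deriv \<beta> f x) \<le> schwartz_seminorm \<gamma> \<beta> f"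
proof -
  have "bounded (range (\<lambda>x. multi_monom \<gamma> x *\<^sub>R multi_deriv \<beta> f x))"
    using assms by (simp add: schwartz_def)
  then have "bdd_above (range (\<lambda>x. norm (multi_monom \<gamma> x *\<^sub>R multi_deriv \<beta> f x)))"
    by (auto simp: bounded_iff bdd_above_def)
  then show ?thesis unfolding schwartz_seminorm_def by (intro cSUP_upper) auto
qed

lemma seminorm_triangle:
  assumes "f \<in> schwartz" "g \<in> schwartz" "h \<in> schwartz"
  shows "schwartz_seminorm \<gamma> \<beta> (\<lambda>x. f x - h x)
    \<le> schwartz_seminorm \<gamma> \<beta> (\<lambda>x. f x - g x) + schwartz_seminorm \<gamma> \<beta> (\<lambda>x. g x - h x)"
  unfolding schwartz_seminorm_def[of _ _ "\<lambda>x. f x - h x"]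
proof (rule cSUP_least)
  fix x
  note d = pderivs_diff[OF schwartz_smooth schwartz_smooth]
  have eq: "multi_monom \<gamma> x *\<^sub>R multi_deriv \<beta> (\<lambda>x. f x - h x) x
    = multi_monom \<gamma> x *\<^sub>R multi_deriv \<beta> (\<lambda>x. f x - g x) x + multi_monom \<gamma> x *\<^sub>R multi_deriv \<beta> (\<lambda>x. g x - h x) x"
    unfolding multi_deriv_eq_pderivs d[OF assms(1,3)] d[OF assms(1,2)] d[OF assms(2,3)]
    by (simp add: algebra_simps)
  show "norm (multi_monom \<gamma> x *\<^sub>R multi_deriv \<beta> (\<lambda>x. f x - h x) x)
    \<le> schwartz_seminorm \<gamma> \<beta> (\<lambda>x. f x - g x) + schwartz_seminorm \<gamma> \<beta> (\<lambda>x. g x - h x)"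
    unfolding eq
    by (rule order_trans[OF norm_triangle_ineq add_mono])
      (intro seminorm_upper schwartz_diff assms)+
qed simp

lemma schwartz_neighbourhood:
  fixes \<phi> :: "('d::{finite,linorder}) cfun"
  assumes "openin schwartz_topology U" "\<phi> \<in> U" "\<phi> \<in> schwartz"
  shows "\<exists>F \<epsilon>. finite F \<and> \<epsilon> > 0 \<and>
    (\<forall>\<eta>\<in>schwartz. (\<forall>(\<gamma>,\<beta>)\<in>F. schwartz_seminorm \<gamma> \<beta> (\<lambda>x. \<eta> x - \<phi> x) < \<epsilon>) \<longrightarrow> \<eta> \<in> U)"
proof -
  define near where "near = (\<lambda>F \<epsilon>. {\<eta> \<in> schwartz. \<forall>(\<gamma>,\<beta>)\<in>F. schwartz_seminorm \<gamma> \<beta> (\<lambda>x. \<eta> x - \<phi> x) < \<epsilon>})"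
  have "generate_topology_on {{\<eta> \<in> schwartz. schwartz_seminorm \<gamma> \<beta> (\<lambda>x. \<eta> x - \<phi> x) < \<epsilon>} | \<gamma> \<beta> (\<phi> :: 'd cfun) \<epsilon>.
       \<phi> \<in> schwartz \<and> \<epsilon> > 0} U"
    using assms(1) by (simp add: schwartz_topology_def openin_topology_generated_by_iff)
  then have "\<exists>F \<epsilon>. finite F \<and> \<epsilon> > 0 \<and> near F \<epsilon> \<subseteq> U" using assms(2)
  proof (induction U)
    case (Int a b)
    from Int.prems have "\<phi> \<in> a" "\<phi> \<in> b" by auto
    obtain F1 e1 where 1: "finite F1" "e1 > 0" "near F1 e1 \<subseteq> a" using Int.IH(1)[OF \<open>\<phi> \<in> a\<close>] by auto
    obtain F2 e2 where 2: "finite F2" "e2 > 0" "near F2 e2 \<subseteq> b" using Int.IH(2)[OF \<open>\<phi> \<in> b\<close>] by auto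
    have "near (F1 \<union> F2) (min e1 e2) \<subseteq> near F1 e1" "near (F1 \<union> F2) (min e1 e2) \<subseteq> near F2 e2"
      by (auto simp: near_def)
    with 1 2 show ?case by (intro exI[of _ "F1 \<union> F2"] exI[of _ "min e1 e2"]) auto
  next
    case (UN K)
    then obtain k where k: "k \<in> K" "\<phi> \<in> k" by blast
    from UN.IH[OF k] obtain F \<epsilon> where "finite F" "\<epsilon> > 0" "near F \<epsilon> \<subseteq> k" by auto
    then show ?case using k(1) by (intro exI[of _ F] exI[of _ \<epsilon>]) auto
  next
    case (Basis s)
    then obtain \<gamma> \<beta> \<phi>' \<epsilon> where s: "s = {\<eta> \<in> schwartz. schwartz_seminorm \<gamma> \<beta> (\<lambda>x. \<eta> x - \<phi>' x) < \<epsilon>}"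
      and \<phi>': "\<phi>' \<in> schwartz" by auto
    have lt: "schwartz_seminorm \<gamma> \<beta> (\<lambda>x. \<phi> x - \<phi>' x) < \<epsilon>" using Basis.prems s by auto
    let ?e = "\<epsilon> - schwartz_seminorm \<gamma> \<beta> (\<lambda>x. \<phi> x - \<phi>' x)"
    have "\<eta> \<in> s" if "\<eta> \<in> near {(\<gamma>,\<beta>)} ?e" for \<eta>
    proof -
      have \<eta>: "\<eta> \<in> schwartz" "schwartz_seminorm \<gamma> \<beta> (\<lambda>x. \<eta> x - \<phi> x) < ?e" using that by (auto simp: near_def)
      show ?thesis using seminorm_triangle[OF \<eta>(1) assms(3) \<phi>', of \<gamma> \<beta>] \<eta> by (simp add: s)
    qed
    then show ?case using lt by (intro exI[of _ "{(\<gamma>,\<beta>)}"] exI[of _ ?e]) auto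
  qed auto
  then obtain F \<epsilon> where F: "finite F" "\<epsilon> > 0" "near F \<epsilon> \<subseteq> U" by (elim exE conjE)
  show ?thesis
    by (intro exI[of _ F] exI[of _ \<epsilon>] conjI F(1,2) ballI impI subsetD[OF F(3)]) (simp add: near_def)
qed

text \<open>A neighbourhood of 0 in the Schwartz topology involves finitely many seminorms. Scaling a Schwartz
  function into such a neighbourhood bounds the functional by the largest of these seminorms.\<close>

lemma tempered_finite_order:
  fixes u :: "('d::{finite,linorder}) functional"
  assumes u: "u \<in> tempered"
  obtains C k N where "C > 0"
    "\<And>\<eta> B. \<eta> \<in> schwartz ==> (\<And>ls x. length ls \<le> k ==> norm (pderivs ls \<eta> x) \<le> B / weight x ^ N) ==> norm (u \<eta>) \<le> C * B"
proof -
  have hom: "u (\<lambda>x. c * \<eta> x) = c * u \<eta>" if "\<eta> \<in> schwartz" for c \<eta> using u that by (auto simp: tempered_def)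
  have cont: "continuous_map schwartz_topology euclidean u" using u by (simp add: tempered_def)
  have z: "(\<lambda>x. 0) \<in> (schwartz :: 'd cfun set)" using schwartz_sum[of "{} :: unit set" "\<lambda>_ _. 0" "\<lambda>_. 0"] by simp
  let ?U = "{\<eta> \<in> topspace schwartz_topology. u \<eta> \<in> ball 0 1}"
  have op: "openin schwartz_topology ?U"
    by (rule openin_continuous_map_preimage[OF cont]) (simp add: open_openin[symmetric])
  have sz: "schwartz_seminorm \<gamma> \<beta> (\<lambda>x::'d rvec. 0) < 1" for \<gamma> \<beta>
  proof -
    have "multi_deriv \<beta> (\<lambda>x::'d rvec. 0) = (\<lambda>x. 0)"
      using pderivs_sum[of "{}::unit set" "deriv_list \<beta>" "\<lambda>_ _. 0" "\<lambda>_. 0"] by (simp add: multi_deriv_eq_pderivs)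
    then show ?thesis by (simp add: schwartz_seminorm_def)
  qed
  have "(\<lambda>x. 0) \<in> topspace (schwartz_topology :: 'd cfun topology)"
  proof -
    have "openin schwartz_topology {\<eta> \<in> (schwartz :: 'd cfun set). schwartz_seminorm (\<lambda>_. 0) (\<lambda>_. 0) (\<lambda>x. \<eta> x - 0) < 1}"
      unfolding schwartz_topology_def openin_topology_generated_by_iff
      by (rule generate_topology_on.Basis, rule CollectI, rule exI[of _ "\<lambda>_. 0"], rule exI[of _ "\<lambda>_. 0"],
          rule exI[of _ "\<lambda>_. 0"], rule exI[of _ 1]) (simp add: z)
    moreover have "(\<lambda>x. 0) \<in> {\<eta> \<in> (schwartz :: 'd cfun set). schwartz_seminorm (\<lambda>_. 0) (\<lambda>_. 0) (\<lambda>x. \<eta> x - 0) < 1}"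
      using z sz by simp
    ultimately show ?thesis using openin_subset by blast
  qed
  then have U0: "(\<lambda>x. 0) \<in> ?U" using hom[OF z, of 0] by simp
  obtain F \<epsilon> where F: "finite F" "\<epsilon> > 0" and
    FU: "\<And>\<eta>. \<eta> \<in> schwartz ==> (\<forall>(\<gamma>,\<beta>)\<in>F. schwartz_seminorm \<gamma> \<beta> \<eta> < \<epsilon>) ==> \<eta> \<in> ?U"
    using schwartz_neighbourhood[OF op U0 z] by auto
  define k where "k = (\<Sum>(\<gamma>,\<beta>)\<in>F. \<Sum>i\<in>UNIV. \<beta> i)"
  define N where "N = (\<Sum>(\<gamma>,\<beta>)\<in>F. \<Sum>i\<in>UNIV. \<gamma> i)"
  have kN: "(\<Sum>i\<in>UNIV. \<beta> i) \<le> k" "(\<Sum>i\<in>UNIV. \<gamma> i) \<le> N" if "(\<gamma>,\<beta>) \<in> F" for \<gamma> \<beta>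
    using member_le_sum[OF that _ F(1), of "\<lambda>(\<gamma>,\<beta>). \<Sum>i\<in>UNIV. \<beta> i"]
      member_le_sum[OF that _ F(1), of "\<lambda>(\<gamma>,\<beta>). \<Sum>i\<in>UNIV. \<gamma> i"] by (auto simp: k_def N_def)
  have bound: "norm (u \<eta>) \<le> 2 / \<epsilon> * B'"
    if \<eta>: "\<eta> \<in> schwartz" and B: "\<And>ls x. length ls \<le> k ==> norm (pderivs ls \<eta> x) \<le> B / weight x ^ N" and "B < B'" "0 < B'"
    for \<eta> B B'
  proof -
    let ?c = "complex_of_real (\<epsilon> / (2 * B'))"
    have s: "(\<lambda>x. ?c * \<eta> x) \<in> schwartz" by (rule schwartz_scale[OF \<eta>])
    have "schwartz_seminorm \<gamma> \<beta> (\<lambda>x. ?c * \<eta> x) < \<epsilon>" if "(\<gamma>,\<beta>) \<in> F" for \<gamma> \<beta>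
    proof -
      have "schwartz_seminorm \<gamma> \<beta> (\<lambda>x. ?c * \<eta> x) \<le> \<epsilon> / 2"
        unfolding schwartz_seminorm_def
      proof (rule cSUP_least)
        fix x
        have "multi_deriv \<beta> (\<lambda>x. ?c * \<eta> x) = (\<lambda>x. ?c * multi_deriv \<beta> \<eta> x)"
          using pderivs_sum[of "{()}" "deriv_list \<beta>" "\<lambda>_. \<eta>" "\<lambda>_. ?c"] schwartz_smooth[OF \<eta>]
          by (simp add: multi_deriv_eq_pderivs smooth_def)
        then have "norm (multi_monom \<gamma> x *\<^sub>R multi_deriv \<beta> (\<lambda>x. ?c * \<eta> x) x)
          = (\<epsilon> / (2 * B')) * (\<bar>multi_monom \<gamma> x\<bar> * norm (multi_deriv \<beta> \<eta> x))"
          using F(2) \<open>0 < B'\<close> by (simp add: norm_mult norm_divide)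
        also have "\<dots> \<le> (\<epsilon> / (2 * B')) * (weight x ^ N * (B' / weight x ^ N))"
        proof (intro mult_left_mono mult_mono)
          have "\<bar>multi_monom \<gamma> x\<bar> \<le> weight x ^ (\<Sum>i\<in>UNIV. \<gamma> i)" by (rule abs_multi_monom_le)
          also have "\<dots> \<le> weight x ^ N" using kN[OF that] by (intro power_increasing weight_ge_1)
          finally show "\<bar>multi_monom \<gamma> x\<bar> \<le> weight x ^ N" .
          have "norm (multi_deriv \<beta> \<eta> x) \<le> B / weight x ^ N"
            unfolding multi_deriv_eq_pderivs using kN[OF that] by (intro B) (simp add: length_deriv_list)
          also have "\<dots> \<le> B' / weight x ^ N" using \<open>B < B'\<close> by (intro divide_right_mono) auto
          finally show "norm (multi_deriv \<beta> \<eta> x) \<le> B' / weight x ^ N" .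
        qed (use F(2) \<open>0 < B'\<close> in auto)
        also have "\<dots> = \<epsilon> / 2" using \<open>0 < B'\<close> by simp
        finally show "norm (multi_monom \<gamma> x *\<^sub>R multi_deriv \<beta> (\<lambda>x. ?c * \<eta> x) x) \<le> \<epsilon> / 2" .
      qed simp
      then show ?thesis using F(2) by simp
    qed
    then have "(\<lambda>x. ?c * \<eta> x) \<in> ?U" by (intro FU s) auto
    then have "norm (?c * u \<eta>) < 1" using hom[OF \<eta>, of ?c] by simp
    then have "(\<epsilon> / (2 * B')) * norm (u \<eta>) < 1" using F(2) \<open>0 < B'\<close> by (simp add: norm_mult norm_divide)
    then show ?thesis using F(2) \<open>0 < B'\<close> by (simp add: field_simps)
  qed
  have "norm (u \<eta>) \<le> 2 / \<epsilon> * B"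
    if \<eta>: "\<eta> \<in> schwartz" and B: "\<And>ls x. length ls \<le> k ==> norm (pderivs ls \<eta> x) \<le> B / weight x ^ N" for \<eta> B
  proof (rule field_le_epsilon)
    fix e :: real assume e: "e > 0"
    have "B \<ge> 0" using order_trans[OF norm_ge_zero B[of "[]" 0]] by simp
    have "norm (u \<eta>) \<le> 2 / \<epsilon> * (B + e * \<epsilon> / 2)"
      by (rule bound[OF \<eta> B]) (use e F(2) \<open>B \<ge> 0\<close> in \<open>auto intro: add_nonneg_pos\<close>)
    also have "\<dots> = 2 / \<epsilon> * B + e" using F(2) by (simp add: field_simps)
    finally show "norm (u \<eta>) \<le> 2 / \<epsilon> * B + e" .
  qed
  then show ?thesis using that[of "2 / \<epsilon>" k N] F(2) by simp
qed

section \<open>Convolution of a tempered distribution with a Schwartz function\<close>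

lemma tempered_add:
  "u \<in> tempered ==> f \<in> schwartz ==> g \<in> schwartz ==> u (\<lambda>x. f x + g x) = u f + u g"
  by (simp add: tempered_def)

lemma tempered_scale: "u \<in> tempered ==> f \<in> schwartz ==> u (\<lambda>x. c * f x) = c * u f"
  by (simp add: tempered_def)

text \<open>Translating the test function costs only powers of the weight in the finitely many seminorms that
  control \<open>u\<close>; the difference estimate comes from the same seminorms of a difference of translates.\<close>

lemma convol_poly_bound:
  fixes u :: "('d::{finite,linorder}) functional"
  assumes u: "u \<in> tempered" and \<phi>: "\<phi> \<in> schwartz"
  obtains C N where "C > 0"
    "\<And>x. norm (convol u \<phi> x) \<le> C * weight x ^ N"
    "\<And>x b. norm b \<le> 1 ==> norm (convol u \<phi> (x + b) - convol u \<phi> x) \<le> C * norm b * weight x ^ N"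
proof -
  obtain C k N where C: "C > 0" and
    bd: "\<And>\<eta> B. \<eta> \<in> schwartz ==> (\<And>ls x. length ls \<le> k ==> norm (pderivs ls \<eta> x) \<le> B / weight x ^ N) ==> norm (u \<eta>) \<le> C * B"
    using tempered_finite_order[OF u] by blast
  have sub: "u (\<lambda>y. f y - g y) = u f - u g" if "f \<in> schwartz" "g \<in> schwartz" for f g
  proof -
    have "u (\<lambda>y. f y + (-1) * g y) = u f + u (\<lambda>y. (-1) * g y)"
      by (rule tempered_add[OF u that(1) schwartz_scale[OF that(2)]])
    also have "u (\<lambda>y. (-1) * g y) = (-1) * u g" by (rule tempered_scale[OF u that(2)])
    finally show ?thesis by simp
  qed
  obtain C1 where C1: "C1 > 0" "\<And>ls x. length ls \<le> k ==> norm (pderivs ls \<phi> x) \<le> C1 / weight x ^ N"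
  proof -
    have "\<forall>j. \<exists>C>0. \<forall>ls x. length ls = j \<longrightarrow> norm (pderivs ls \<phi> x) \<le> C / weight x ^ N"
      using schwartz_decay[OF \<phi>] by blast
    then obtain c where c: "\<And>j. c j > 0" "\<And>j ls x. length ls = j ==> norm (pderivs ls \<phi> x) \<le> c j / weight x ^ N"
      by metis
    have "norm (pderivs ls \<phi> x) \<le> (\<Sum>j\<le>k. c j) / weight x ^ N" if "length ls \<le> k" for ls x
    proof -
      have "norm (pderivs ls \<phi> x) \<le> c (length ls) / weight x ^ N" using c by simp
      also have "\<dots> \<le> (\<Sum>j\<le>k. c j) / weight x ^ N"
        using that c(1) by (intro divide_right_mono member_le_sum) (auto intro: less_imp_le)
      finally show ?thesis .
    qed
    moreover have "(\<Sum>j\<le>k. c j) > 0" using c(1) by (intro sum_pos) auto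
    ultimately show ?thesis using that by blast
  qed
  obtain C2 where C2: "C2 > 0" "\<And>ls a b. length ls \<le> k ==> norm b \<le> 1 ==>
      norm (pderivs ls \<phi> (a + b) - pderivs ls \<phi> a) \<le> C2 * norm b / weight a ^ N"
  proof -
    have "\<forall>ls. \<exists>C>0. \<forall>a b. norm b \<le> 1 \<longrightarrow> norm (pderivs ls \<phi> (a + b) - pderivs ls \<phi> a) \<le> C * norm b / weight a ^ N"
      using schwartz_difference_bound[OF schwartz_pderivs[OF \<phi>]] by blast
    then obtain c where c: "\<And>ls. c ls > 0"
      "\<And>ls a b. norm b \<le> 1 ==> norm (pderivs ls \<phi> (a + b) - pderivs ls \<phi> a) \<le> c ls * norm b / weight a ^ N"
      by metis
    let ?L = "{ls :: 'd list. length ls \<le> k}"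
    have fin: "finite ?L" using finite_lists_length_le[of "UNIV :: 'd set" k] by simp
    have "norm (pderivs ls \<phi> (a + b) - pderivs ls \<phi> a) \<le> (\<Sum>ls\<in>?L. c ls) * norm b / weight a ^ N"
      if "length ls \<le> k" "norm b \<le> 1" for ls a b
    proof -
      have "norm (pderivs ls \<phi> (a + b) - pderivs ls \<phi> a) \<le> c ls * norm b / weight a ^ N" using c that by simp
      also have "\<dots> \<le> (\<Sum>ls\<in>?L. c ls) * norm b / weight a ^ N"
        using that c(1) fin by (intro divide_right_mono mult_right_mono member_le_sum) (auto intro: less_imp_le)
      finally show ?thesis .
    qed
    moreover have "(\<Sum>ls\<in>?L. c ls) > 0" using c(1) fin by (intro sum_pos) (auto intro: exI[of _ "[]"])
    ultimately show ?thesis using that by blast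
  qed
  have shift: "c / weight (x - y) ^ N \<le> (c * 2 ^ (CARD('d) * N) * weight x ^ N) / weight y ^ N" if "c \<ge> 0" for c and x y :: "'d rvec"
    using divide_le_divide_shift[of "weight y ^ N" "2 ^ (CARD('d) * N) * weight x ^ N" "weight (x - y) ^ N" c]
      weight_power_le_shift[of y N x] that by (simp add: mult.assoc)
  have A: "norm (convol u \<phi> x) \<le> C * (C1 * 2 ^ (CARD('d) * N) * weight x ^ N)" for x
    unfolding convol_def
  proof (rule bd[OF schwartz_reflect_translate[OF \<phi>]])
    fix ls :: "'d list" and y assume ls: "length ls \<le> k"
    have "norm (pderivs ls (\<lambda>y. \<phi> (x - y)) y) \<le> C1 / weight (x - y) ^ N"
      using C1(2)[OF ls, of "x - y"] by (simp add: pderivs_reflect[OF schwartz_smooth[OF \<phi>]] norm_mult norm_power)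
    also note shift[OF less_imp_le[OF C1(1)]]
    finally show "norm (pderivs ls (\<lambda>y. \<phi> (x - y)) y) \<le> C1 * 2 ^ (CARD('d) * N) * weight x ^ N / weight y ^ N" .
  qed
  have B: "norm (convol u \<phi> (x + b) - convol u \<phi> x) \<le> C * (C2 * norm b * 2 ^ (CARD('d) * N) * weight x ^ N)"
    if b: "norm b \<le> 1" for x b
  proof -
    note s = schwartz_reflect_translate[OF \<phi>]
    have eq: "convol u \<phi> (x + b) - convol u \<phi> x = u (\<lambda>y. \<phi> (x + b - y) - \<phi> (x - y))"
      unfolding convol_def by (rule sub[symmetric]) (rule s)+
    show ?thesis unfolding eq
    proof (rule bd[OF schwartz_diff[OF s s]])
      fix ls :: "'d list" and y assume ls: "length ls \<le> k"
      have "pderivs ls (\<lambda>y. \<phi> (x + b - y) - \<phi> (x - y)) y = (-1) ^ length ls * (pderivs ls \<phi> ((x - y) + b) - pderivs ls \<phi> (x - y))"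
        by (simp add: pderivs_diff[OF schwartz_smooth[OF s] schwartz_smooth[OF s]]
            pderivs_reflect[OF schwartz_smooth[OF \<phi>]] algebra_simps)
      then have "norm (pderivs ls (\<lambda>y. \<phi> (x + b - y) - \<phi> (x - y)) y) \<le> C2 * norm b / weight (x - y) ^ N"
        using C2(2)[OF ls b, of "x - y"] by (simp add: norm_mult norm_power)
      also have "\<dots> \<le> C2 * norm b * 2 ^ (CARD('d) * N) * weight x ^ N / weight y ^ N"
        by (rule shift) (use C2(1) in simp)
      finally show "norm (pderivs ls (\<lambda>y. \<phi> (x + b - y) - \<phi> (x - y)) y) \<le> C2 * norm b * 2 ^ (CARD('d) * N) * weight x ^ N / weight y ^ N" .
    qed
  qed
  let ?K = "C * (C1 + C2) * 2 ^ (CARD('d) * N)"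
  have "C * (C1 * 2 ^ (CARD('d) * N) * weight x ^ N) \<le> ?K * weight x ^ N" for x :: "'d rvec"
    using C C1(1) C2(1) by (simp add: algebra_simps)
  moreover have "C * (C2 * norm b * 2 ^ (CARD('d) * N) * weight x ^ N) \<le> ?K * norm b * weight x ^ N" for x b :: "'d rvec"
    using C C1(1) C2(1) by (simp add: algebra_simps)
  moreover have "?K > 0" using C C1(1) C2(1) by (intro mult_pos_pos) auto
  ultimately show ?thesis
    by (intro that[of ?K N] order_trans[OF A] order_trans[OF B])
qed

lemma convol_continuous:
  fixes u :: "('d::{finite,linorder}) functional"
  assumes u: "u \<in> tempered" and \<phi>: "\<phi> \<in> schwartz"
  shows "continuous_on UNIV (convol u \<phi>)"
proof -
  obtain C N where C: "C > 0"
    "\<And>x b. norm b \<le> 1 ==> norm (convol u \<phi> (x + b) - convol u \<phi> x) \<le> C * norm b * weight x ^ N"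
    using convol_poly_bound[OF u \<phi>] by metis
  have "isCont (convol u \<phi>) x" for x
  proof -
    have "((\<lambda>b. convol u \<phi> (x + b) - convol u \<phi> x) \<longlongrightarrow> 0) (at 0)"
    proof (rule Lim_null_comparison)
      have "\<forall>\<^sub>F b in at 0. norm b \<le> 1" by (auto simp: eventually_at intro!: exI[of _ 1])
      then show "\<forall>\<^sub>F b in at 0. norm (convol u \<phi> (x + b) - convol u \<phi> x) \<le> C * norm b * weight x ^ N"
        by (rule eventually_mono) (rule C(2))
      show "((\<lambda>b :: 'd rvec. C * norm b * weight x ^ N) \<longlongrightarrow> 0) (at 0)"
        by (intro tendsto_mult_left_zero tendsto_mult_right_zero tendsto_norm_zero tendsto_ident_at)
    qed
    then have "((\<lambda>b. convol u \<phi> (x + b)) \<longlongrightarrow> convol u \<phi> x) (at 0)" by (simp add: LIM_zero_iff)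
    then show ?thesis by (simp add: isCont_iff)
  qed
  then show ?thesis by (simp add: continuous_at_imp_continuous_on)
qed

lemma convol_poly_growth:
  assumes "u \<in> tempered" "\<phi> \<in> schwartz" shows "poly_growth (convol u \<phi>)"
  unfolding poly_growth_def using convol_poly_bound[OF assms]
    borel_measurable_continuous_onI[OF convol_continuous[OF assms]] by metis

section \<open>The reproducing formula\<close>

text \<open>Together with \<open>grid_step\<close> and \<open>grid_weight\<close> this describes Riemann sums: the box grows and the mesh shrinks
  with \<open>n\<close>, so that one parameter controls both errors.\<close>

definition grid_box :: "nat => ('d::finite) rvec set" where
  "grid_box n = {y. \<forall>i. - real (Suc n) \<le> y $ i \<and> y $ i < real (Suc n)}"

text \<open>The mesh has the extra factor \<open>CARD('d)\<close> so that the Euclidean distance to the grid point, not only each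
  coordinate, is at most \<open>1 / (n + 1)\<close>.\<close>

definition grid_step :: "nat => ('d::finite) rvec => 'd rvec" where
  "grid_step n y = vec_lambda (\<lambda>i. of_int \<lfloor>real (CARD('d) * Suc n) * y $ i\<rfloor> / real (CARD('d) * Suc n))"

lemma grid_step_component: "\<bar>(y - grid_step n y) $ i\<bar> \<le> 1 / real (CARD('d) * Suc n)"
  for y :: "('d::finite) rvec"
proof -
  let ?m = "real (CARD('d) * Suc n)"
  have m: "?m > 0" by (simp only: of_nat_0_less_iff) simp
  have "(y - grid_step n y) $ i = (?m * y $ i - of_int \<lfloor>?m * y $ i\<rfloor>) / ?m"
    using m by (simp add: grid_step_def diff_divide_distrib)
  moreover have "\<bar>?m * y $ i - of_int \<lfloor>?m * y $ i\<rfloor>\<bar> \<le> 1" by linarith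
  ultimately show ?thesis using m by (simp add: abs_divide divide_right_mono)
qed

lemma norm_grid_step: "norm (y - grid_step n y) \<le> 1 / real (Suc n)" for y :: "('d::finite) rvec"
proof -
  have "norm (y - grid_step n y) \<le> (\<Sum>i\<in>UNIV. \<bar>(y - grid_step n y) $ i\<bar>)" by (rule norm_le_l1_cart)
  also have "\<dots> \<le> (\<Sum>i\<in>(UNIV::'d set). 1 / real (CARD('d) * Suc n))"
    by (intro sum_mono grid_step_component)
  also have "\<dots> = 1 / real (Suc n)" unfolding of_nat_mult by (simp del: of_nat_Suc)
  finally show ?thesis .
qed

lemma norm_grid_step_le_1: "norm (y - grid_step n y) \<le> 1" for y :: "('d::finite) rvec"
  by (rule order_trans[OF norm_grid_step]) simp

lemma grid_step_measurable [measurable]: "grid_step n \<in> borel_measurable borel"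
  unfolding grid_step_def
  by (subst borel_measurable_euclidean_space) (auto simp: Basis_vec_def inner_axis)

lemma grid_box_measurable [measurable]: "grid_box n \<in> sets borel"
proof -
  have "grid_box n = (\<Inter>i\<in>UNIV. {y. - real (Suc n) \<le> y $ i \<and> y $ i < real (Suc n)})"
    by (auto simp: grid_box_def)
  also have "\<dots> \<in> sets borel" by (intro sets.finite_INT) auto
  finally show ?thesis .
qed

lemma grid_box_subset_cbox: "grid_box n \<subseteq> cbox (vec_lambda (\<lambda>_. - real (Suc n))) (vec_lambda (\<lambda>_. real (Suc n)))"
  by (auto simp: grid_box_def mem_box_cart less_imp_le)

lemma emeasure_grid_box: "emeasure lborel (grid_box n) < \<infinity>"
  by (rule emeasure_bounded_finite[OF bounded_subset[OF bounded_cbox grid_box_subset_cbox]])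

lemma finite_grid_step: "finite (grid_step n ` (grid_box n :: ('d::finite) rvec set))"
proof -
  let ?m = "real (CARD('d) * Suc n)"
  let ?K = "int (CARD('d) * Suc n * Suc n)"
  have "grid_step n ` (grid_box n :: 'd rvec set) \<subseteq> (\<lambda>f. vec_lambda (\<lambda>i. of_int (f i) / ?m)) ` (UNIV \<rightarrow>\<^sub>E {-?K..?K})"
  proof
    fix v assume "v \<in> grid_step n ` (grid_box n :: 'd rvec set)"
    then obtain y :: "'d rvec" where y: "y \<in> grid_box n" "v = grid_step n y" by auto
    have "\<lfloor>?m * y $ i\<rfloor> \<in> {-?K..?K}" for i
    proof -
      have b: "- real (Suc n) \<le> y $ i" "y $ i < real (Suc n)" using y(1) by (auto simp: grid_box_def)
      have "?m * - real (Suc n) \<le> ?m * y $ i" "?m * y $ i \<le> ?m * real (Suc n)"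
        using b by (intro mult_left_mono; simp)+
      moreover have "?m * real (Suc n) = of_int ?K" "?m * - real (Suc n) = of_int (-?K)"
        by (simp_all only: of_int_minus of_int_mult of_int_of_nat_eq of_nat_mult mult_minus_right)
      ultimately have lo: "of_int (-?K) \<le> ?m * y $ i" and hi: "?m * y $ i \<le> of_int ?K" by linarith+
      have "-?K \<le> \<lfloor>?m * y $ i\<rfloor>" using lo by (simp only: le_floor_iff)
      moreover have "\<lfloor>?m * y $ i\<rfloor> \<le> ?K" using floor_mono[OF hi] by (simp only: floor_of_int)
      ultimately show ?thesis by (simp only: atLeastAtMost_iff)
    qed
    then show "v \<in> (\<lambda>f. vec_lambda (\<lambda>i. of_int (f i) / ?m)) ` (UNIV \<rightarrow>\<^sub>E {-?K..?K})"
      unfolding y(2) grid_step_def by (intro image_eqI[of _ _ "\<lambda>i. \<lfloor>?m * y $ i\<rfloor>"]) auto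
  qed
  then show ?thesis by (rule finite_subset) (intro finite_imageI finite_PiE; simp)
qed

definition grid_weight :: "nat => ('d::finite) rvec => real" where
  "grid_weight n v = measure lborel (grid_box n \<inter> grid_step n -` {v})"

lemma grid_step_integral:
  fixes h :: "('d::finite) rvec => complex"
  shows "integrable lborel (\<lambda>y. indicator (grid_box n) y *\<^sub>R h (grid_step n y))"
    and "(LINT y|lborel. indicator (grid_box n) y *\<^sub>R h (grid_step n y))
      = (\<Sum>v\<in>grid_step n ` grid_box n. grid_weight n v *\<^sub>R h v)"
proof -
  let ?V = "grid_step n ` (grid_box n :: 'd rvec set)"
  let ?A = "\<lambda>v. grid_box n \<inter> grid_step n -` {v} :: 'd rvec set"
  have A: "?A v \<in> sets lborel" for v
    using measurable_sets[OF grid_step_measurable, of "{v}" n] by auto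
  have "emeasure lborel (?A v) \<le> emeasure lborel (grid_box n :: 'd rvec set)" for v
    by (intro emeasure_mono) auto
  then have fin: "emeasure lborel (?A v) < \<infinity>" for v
    using emeasure_grid_box le_less_trans by blast
  have eq: "(\<lambda>y. indicator (grid_box n) y *\<^sub>R h (grid_step n y)) = (\<lambda>y. \<Sum>v\<in>?V. indicator (?A v) y *\<^sub>R h v)"
  proof
    fix y
    have "(\<Sum>v\<in>?V. indicator (?A v) y *\<^sub>R h v) = (\<Sum>v\<in>?V. if v = grid_step n y then indicator (grid_box n) y *\<^sub>R h v else 0)"
      by (intro sum.cong) (auto simp: indicator_def)
    then show "indicator (grid_box n) y *\<^sub>R h (grid_step n y) = (\<Sum>v\<in>?V. indicator (?A v) y *\<^sub>R h v)"
      by (auto simp: finite_grid_step indicator_def)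
  qed
  have i: "integrable lborel (\<lambda>y. indicator (?A v) y *\<^sub>R h v)" for v
    using A fin by (intro integrable_scaleR_left integrable_real_indicator) auto
  show "integrable lborel (\<lambda>y. indicator (grid_box n) y *\<^sub>R h (grid_step n y))"
    unfolding eq by (intro Bochner_Integration.integrable_sum i)
  show "(LINT y|lborel. indicator (grid_box n) y *\<^sub>R h (grid_step n y)) = (\<Sum>v\<in>?V. grid_weight n v *\<^sub>R h v)"
  proof -
    have "(LINT y|lborel. indicator (?A v) y *\<^sub>R h v) = grid_weight n v *\<^sub>R h v" for v
      using A[of v] fin[of v] by (subst integral_scaleR_left) (auto simp: grid_weight_def)
    then show ?thesis unfolding eq by (subst Bochner_Integration.integral_sum[OF i]) simp
  qed
qed

lemma weight_ge_outside_grid_box: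
  assumes "y \<notin> grid_box n" shows "real (Suc n) \<le> weight y"
proof -
  obtain i where "\<not> (- real (Suc n) \<le> y $ i \<and> y $ i < real (Suc n))" using assms unfolding grid_box_def by blast
  then have i: "\<bar>y $ i\<bar> \<ge> real (Suc n)" by linarith
  then have "real (Suc n) ^ 2 \<le> \<bar>y $ i\<bar> ^ 2" by (intro power_mono) auto
  moreover have "real (Suc n) \<le> real (Suc n) ^ 2" by (simp add: power2_eq_square)
  ultimately have "real (Suc n) \<le> 1 + (y $ i)\<^sup>2" by simp
  also have "\<dots> = (\<Prod>i\<in>{i}. 1 + (y $ i)\<^sup>2)" by simp
  also have "\<dots> \<le> weight y" unfolding weight_def by (rule prod_mono2) auto
  finally show ?thesis .
qed

text \<open>The error is \<open>O(1 / n)\<close> with a constant that depends on \<open>g\<close> only through its weighted Lipschitz constant \<open>a\<close>.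
  This uniformity is needed in \<open>convol_reproduce\<close>, where the sum is compared with the integral for a whole
  family of functions \<open>g\<close> at once.\<close>

lemma grid_sum_error:
  fixes \<kappa> :: "('d::{finite,linorder}) cfun"
  assumes \<kappa>: "\<kappa> \<in> schwartz"
  shows "\<exists>C>0. \<forall>g a n. g \<in> borel_measurable borel \<longrightarrow> (\<forall>y. norm (g y) \<le> a * weight y ^ N) \<longrightarrow>
    (\<forall>y b. norm b \<le> 1 \<longrightarrow> norm (g (y + b) - g y) \<le> a * norm b * weight y ^ N) \<longrightarrow>
    norm ((LINT y|lborel. g y * \<kappa> (x - y)) - (\<Sum>v\<in>grid_step n ` grid_box n. grid_weight n v *\<^sub>R (g v * \<kappa> (x - v))))
      \<le> C * a / real (Suc n)"
proof -
  obtain C1 where C1: "C1 > 0" "\<And>x. norm (\<kappa> x) \<le> C1 / weight x ^ (N + 2)"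
    using schwartz_decay_fun[OF \<kappa>] by blast
  obtain C2 where C2: "C2 > 0" "\<And>a b. norm b \<le> 1 ==> norm (\<kappa> (a + b) - \<kappa> a) \<le> C2 * norm b / weight a ^ (N + 2)"
    using schwartz_difference_bound[OF \<kappa>, of "N + 2"] by blast
  define D where "D = 2 ^ (CARD('d) * (N + 2)) * weight x ^ (N + 2)"
  have D: "D > 0" by (simp add: D_def)
  have sh: "c / weight (x - y) ^ (N + 2) \<le> c * D / weight y ^ (N + 2)" if "c \<ge> 0" for c y
    using divide_le_divide_shift[of "weight y ^ (N + 2)" D "weight (x - y) ^ (N + 2)" c]
      weight_power_le_shift[of y "N + 2" x] that by (simp add: D_def)
  define K where "K = (2 * C1 + 2 * C2) * D"
  have K: "K > 0" using C1 C2 D by (simp add: K_def)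
  define I where "I = (LINT y|lborel. 1 / weight (y :: 'd rvec))"
  have I0: "I \<ge> 0" unfolding I_def by (intro Bochner_Integration.integral_nonneg) simp
  have main: "norm ((LINT y|lborel. g y * \<kappa> (x - y)) - (\<Sum>v\<in>grid_step n ` grid_box n. grid_weight n v *\<^sub>R (g v * \<kappa> (x - v))))
      \<le> (K * (I + 1)) * a / real (Suc n)"
    if [measurable]: "g \<in> borel_measurable borel" and g1: "\<And>y. norm (g y) \<le> a * weight y ^ N"
      and g2: "\<And>y b. norm b \<le> 1 ==> norm (g (y + b) - g y) \<le> a * norm b * weight y ^ N" for g a n
  proof -
    have a0: "a \<ge> 0" using order_trans[OF norm_ge_zero g1[of 0]] by simp
    let ?F = "\<lambda>y. g y * \<kappa> (x - y)"
    have pair: "s * t \<le> (c1 * c2) / (weight y)\<^sup>2" if "s \<le> c1 * weight y ^ N" "t \<le> c2 / weight y ^ (N + 2)" "0 \<le> s" "0 \<le> t"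
      for s t c1 c2 and y :: "'d rvec"
    proof -
      have c: "0 \<le> c1 * weight y ^ N" using that by linarith
      have "s * t \<le> (c1 * weight y ^ N) * (c2 / weight y ^ (N + 2))"
        using that c by (intro mult_mono) auto
      then show ?thesis by (simp add: power_add power2_eq_square)
    qed
    have k1: "norm (\<kappa> (x - y)) \<le> C1 * D / weight y ^ (N + 2)" for y
      using C1(2)[of "x - y"] sh[of C1 y] C1(1) by simp
    have k2: "norm (\<kappa> (x - (y + b)) - \<kappa> (x - y)) \<le> C2 * norm b * D / weight y ^ (N + 2)" if "norm b \<le> 1" for y b
      using C2(2)[of "- b" "x - y"] sh[of "C2 * norm b" y] C2(1) that by (simp add: diff_diff_eq)
    have F1: "norm (?F y) \<le> a * K / (weight y)\<^sup>2" for y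
    proof -
      have "norm (?F y) \<le> (a * (C1 * D)) / (weight y)\<^sup>2"
        unfolding norm_mult by (rule pair[OF g1 k1]) auto
      also have "\<dots> \<le> a * K / (weight y)\<^sup>2"
        using a0 C1 C2 D by (intro divide_right_mono mult_left_mono) (auto simp: K_def algebra_simps)
      finally show ?thesis .
    qed
    have F2: "norm (?F (y + b) - ?F y) \<le> a * K * norm b / (weight y)\<^sup>2" if b: "norm b \<le> 1" for y b
    proof -
      have "norm (\<kappa> (x - (y + b))) \<le> norm (\<kappa> (x - y)) + norm (\<kappa> (x - (y + b)) - \<kappa> (x - y))"
        by (metis add.commute diff_add_cancel norm_triangle_ineq)
      also have "\<dots> \<le> C1 * D / weight y ^ (N + 2) + C2 * 1 * D / weight y ^ (N + 2)"
      proof (intro add_mono k1 order_trans[OF k2[OF b]])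
        show "C2 * norm b * D / weight y ^ (N + 2) \<le> C2 * 1 * D / weight y ^ (N + 2)"
          using b C2(1) D by (intro divide_right_mono mult_right_mono mult_left_mono) auto
      qed
      finally have k3: "norm (\<kappa> (x - (y + b))) \<le> (C1 + C2) * D / weight y ^ (N + 2)"
        by (simp add: add_divide_distrib algebra_simps)
      have "?F (y + b) - ?F y = (g (y + b) - g y) * \<kappa> (x - (y + b)) + g y * (\<kappa> (x - (y + b)) - \<kappa> (x - y))"
        by (simp add: algebra_simps)
      then have "norm (?F (y + b) - ?F y) \<le> norm (g (y + b) - g y) * norm (\<kappa> (x - (y + b))) + norm (g y) * norm (\<kappa> (x - (y + b)) - \<kappa> (x - y))"
        by (metis norm_mult norm_triangle_ineq)
      also have "\<dots> \<le> ((a * norm b) * ((C1 + C2) * D)) / (weight y)\<^sup>2 + (a * (C2 * norm b * D)) / (weight y)\<^sup>2"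
        by (intro add_mono pair[OF g2[OF b] k3] pair[OF g1 k2[OF b]]) auto
      also have "\<dots> = a * norm b * ((C1 + 2 * C2) * D) / (weight y)\<^sup>2"
        by (simp add: add_divide_distrib[symmetric] algebra_simps)
      also have "\<dots> \<le> a * norm b * K / (weight y)\<^sup>2"
        unfolding K_def using a0 C1 C2 D by (intro divide_right_mono mult_left_mono mult_right_mono mult_nonneg_nonneg) auto
      finally show ?thesis by (simp add: mult_ac)
    qed
    have w2: "1 / (weight y)\<^sup>2 \<le> 1 / weight y" for y :: "'d rvec"
      using mult_left_mono[OF weight_ge_1[of y], of "weight y"] by (simp add: power2_eq_square divide_simps)
    let ?E = "\<lambda>y. ?F y - indicator (grid_box n) y *\<^sub>R ?F (grid_step n y)"
    have E: "norm (?E y) \<le> a * K / real (Suc n) * (1 / weight y)" for y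
    proof (cases "y \<in> grid_box n")
      case True
      have nb: "norm (grid_step n y - y) \<le> 1 / real (Suc n)" "norm (grid_step n y - y) \<le> 1"
        using norm_grid_step[of y n] norm_grid_step_le_1[of y n] by (simp_all add: norm_minus_commute)
      have "norm (?E y) = norm (?F (y + (grid_step n y - y)) - ?F y)"
        using True by (simp add: norm_minus_commute)
      also have "\<dots> \<le> a * K * norm (grid_step n y - y) / (weight y)\<^sup>2" by (rule F2[OF nb(2)])
      also have "\<dots> = a * K * norm (grid_step n y - y) * (1 / (weight y)\<^sup>2)" by simp
      also have "\<dots> \<le> a * K * (1 / real (Suc n)) * (1 / weight y)"
        using a0 K nb by (intro mult_mono mult_left_mono w2 nb mult_nonneg_nonneg) auto
      finally show ?thesis by simp
    next
      case False
      have "norm (?E y) \<le> a * K / (weight y)\<^sup>2" using False F1[of y] by simp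
      also have "\<dots> = a * K * (1 / weight y) * (1 / weight y)" by (simp add: power2_eq_square)
      also have "\<dots> \<le> a * K * (1 / real (Suc n)) * (1 / weight y)"
        using a0 K weight_ge_outside_grid_box[OF False]
        by (intro mult_right_mono mult_left_mono mult_nonneg_nonneg frac_le) auto
      finally show ?thesis by simp
    qed
    have pg: "poly_growth g" using g1 by (auto simp: poly_growth_def)
    have "(LINT y|lborel. g y * \<kappa> (x - y)) - (\<Sum>v\<in>grid_step n ` grid_box n. grid_weight n v *\<^sub>R (g v * \<kappa> (x - v)))
      = (LINT y|lborel. ?E y)"
      using grid_step_integral[of n ?F] cv_integrable[OF pg \<kappa>]
      by (subst Bochner_Integration.integral_diff) auto
    also have "norm \<dots> \<le> (LINT y|lborel. a * K / real (Suc n) * (1 / weight (y :: 'd rvec)))"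
      using grid_step_integral(1)[of n ?F] cv_integrable[OF pg \<kappa>] E
      by (intro Bochner_Integration.integral_norm_bound_integral integrable_mult_right integrable_inverse_weight) auto
    also have "\<dots> = a * K / real (Suc n) * I" by (simp only: integral_mult_right_zero I_def)
    also have "\<dots> \<le> a * K / real (Suc n) * (I + 1)" using a0 K by (intro mult_left_mono) auto
    finally show ?thesis by (simp add: mult_ac)
  qed
  show ?thesis
  proof (intro exI[of _ "K * (I + 1)"] conjI allI impI)
    show "K * (I + 1) > 0" using K I0 by (intro mult_pos_pos) auto
  qed (rule main, auto)
qed

lemma tempered_sum:
  assumes u: "u \<in> tempered" and "finite V" "\<And>v. v \<in> V ==> f v \<in> schwartz"
  shows "u (\<lambda>x. \<Sum>v\<in>V. c v * f v x) = (\<Sum>v\<in>V. c v * u (f v))"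
  using assms(2,3)
proof (induction V)
  case empty
  have "(\<lambda>x. 0) \<in> schwartz" using schwartz_sum[of "{} :: unit set" "\<lambda>_ _. 0" "\<lambda>_. 0"] by simp
  from tempered_scale[OF u this, of 0] show ?case by simp
next
  case (insert v V)
  have "u (\<lambda>x. c v * f v x + (\<Sum>v\<in>V. c v * f v x)) = u (\<lambda>x. c v * f v x) + u (\<lambda>x. \<Sum>v\<in>V. c v * f v x)"
    using insert by (intro tempered_add[OF u] schwartz_scale schwartz_sum) auto
  moreover have "u (\<lambda>x. c v * f v x) = c v * u (f v)" using insert.prems by (intro tempered_scale[OF u]) auto
  ultimately show ?case using insert by simp
qed

text \<open>Formally \<open>u\<close> is applied under an integral sign. To justify this, the integral \<open>\<phi> (x - z) = (\<kappa> * \<phi>) (x - z)\<close>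
  is replaced by Riemann sums, which are finite combinations of translates of \<open>\<phi>\<close>. They converge to it in all
  the seminorms that control \<open>u\<close>, and the values of \<open>u\<close> on them are Riemann sums for \<open>((u * \<phi>) * \<kappa>) x\<close>.\<close>

lemma convol_reproduce:
  fixes u :: "('d::{finite,linorder}) functional"
  assumes u: "u \<in> tempered" and \<phi>: "\<phi> \<in> schwartz" and \<kappa>: "\<kappa> \<in> schwartz" and eq: "cv \<phi> \<kappa> = \<phi>"
  shows "cv (convol u \<phi>) \<kappa> = convol u \<phi>"
proof
  fix x
  let ?V = "\<lambda>n. grid_step n ` (grid_box n :: 'd rvec set)"
  define S where "S = (\<lambda>n z. \<Sum>v\<in>?V n. (complex_of_real (grid_weight n v) * \<kappa> (x - v)) * \<phi> (v - z))"
  note rt = schwartz_reflect_translate[OF \<phi>]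
  have S: "S n \<in> schwartz" for n unfolding S_def by (intro schwartz_sum finite_grid_step rt)
  have uS: "u (S n) = (\<Sum>v\<in>?V n. grid_weight n v *\<^sub>R (convol u \<phi> v * \<kappa> (x - v)))" for n
    unfolding S_def
    by (subst tempered_sum[OF u finite_grid_step rt]) (simp add: convol_def scaleR_conv_of_real mult_ac)
  obtain C k N where C: "C > 0" and
    bd: "\<And>\<eta> B. \<eta> \<in> schwartz ==> (\<And>ls x. length ls \<le> k ==> norm (pderivs ls \<eta> x) \<le> B / weight x ^ N) ==> norm (u \<eta>) \<le> C * B"
    using tempered_finite_order[OF u] by blast
  obtain K where K: "K > 0" and Ke: "\<And>g a n. g \<in> borel_measurable borel ==> (\<And>y. norm (g y) \<le> a * weight y ^ N) ==>
    (\<And>y b. norm b \<le> 1 ==> norm (g (y + b) - g y) \<le> a * norm b * weight y ^ N) ==>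
    norm ((LINT y|lborel. g y * \<kappa> (x - y)) - (\<Sum>v\<in>?V n. grid_weight n v *\<^sub>R (g v * \<kappa> (x - v)))) \<le> K * a / real (Suc n)"
    using grid_sum_error[OF \<kappa>, of N x] by blast
  have "\<forall>ls. \<exists>C>0. (\<forall>x. norm (pderivs ls \<phi> x) \<le> C / weight x ^ N) \<and>
    (\<forall>a b. norm b \<le> 1 \<longrightarrow> norm (pderivs ls \<phi> (a + b) - pderivs ls \<phi> a) \<le> C * norm b / weight a ^ N)"
  proof
    fix ls
    obtain c1 where c1: "c1 > 0" "\<And>x. norm (pderivs ls \<phi> x) \<le> c1 / weight x ^ N" using schwartz_decay_list[OF \<phi>] by blast
    obtain c2 where c2: "c2 > 0" "\<And>a b. norm b \<le> 1 ==> norm (pderivs ls \<phi> (a + b) - pderivs ls \<phi> a) \<le> c2 * norm b / weight a ^ N"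
      using schwartz_difference_bound[OF schwartz_pderivs[OF \<phi>]] by blast
    have "c1 / weight x ^ N \<le> (c1 + c2) / weight x ^ N" for x :: "'d rvec" using c2(1) by (intro divide_right_mono) auto
    moreover have "c2 * norm b / weight a ^ N \<le> (c1 + c2) * norm b / weight a ^ N" for a b :: "'d rvec"
      using c1(1) by (intro divide_right_mono mult_right_mono) auto
    ultimately show "\<exists>C>0. (\<forall>x. norm (pderivs ls \<phi> x) \<le> C / weight x ^ N) \<and>
      (\<forall>a b. norm b \<le> 1 \<longrightarrow> norm (pderivs ls \<phi> (a + b) - pderivs ls \<phi> a) \<le> C * norm b / weight a ^ N)"
      using c1(1) c2(1) order_trans[OF c1(2)] order_trans[OF c2(2)]
      by (intro exI[of _ "c1 + c2"] conjI allI impI add_pos_pos) auto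
  qed
  then obtain c where c: "\<And>ls. c ls > 0" "\<And>ls x. norm (pderivs ls \<phi> x) \<le> c ls / weight x ^ N"
    "\<And>ls a b. norm b \<le> 1 ==> norm (pderivs ls \<phi> (a + b) - pderivs ls \<phi> a) \<le> c ls * norm b / weight a ^ N"
    by metis
  define c' where "c' = (\<Sum>ls\<in>{ls :: 'd list. length ls \<le> k}. c ls)"
  have cc': "c ls \<le> c'" if "length ls \<le> k" for ls
    unfolding c'_def using that c(1) finite_lists_length_le[of "UNIV :: 'd set" k]
    by (intro member_le_sum) (auto intro: less_imp_le)
  define D where "D = (2 :: real) ^ (CARD('d) * N)"
  have sh: "t / weight (y - z) ^ N \<le> t * D / weight z ^ N * weight y ^ N" if "t \<ge> 0" for t and y z :: "'d rvec"
    using divide_le_divide_shift[of "weight z ^ N" "D * weight y ^ N" "weight (y - z) ^ N" t]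
      weight_power_le_shift[of z N y] that by (simp add: D_def mult_ac)
  have eq': "cv \<kappa> \<phi> = \<phi>" using eq cv_commute[OF schwartz_measurable[OF \<phi>] schwartz_measurable[OF \<kappa>]] by simp
  have e1: "norm (u (\<lambda>z. \<phi> (x - z)) - u (S n)) \<le> C * (K * (c' * D)) / real (Suc n)" for n
  proof -
    have "u (\<lambda>z. \<phi> (x - z)) - u (S n) = u (\<lambda>z. \<phi> (x - z) - S n z)"
      using tempered_sum[OF u, of "UNIV :: bool set" "\<lambda>b. if b then (\<lambda>z. \<phi> (x - z)) else S n" "\<lambda>b. if b then 1 else - 1"] S rt
      by (simp add: UNIV_bool algebra_simps)
    also have "norm \<dots> \<le> C * (K * (c' * D) / real (Suc n))"
    proof (rule bd[OF schwartz_diff[OF rt S]])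
      fix ls :: "'d list" and z assume ls: "length ls \<le> k"
      let ?g = "\<lambda>y. pderivs ls \<phi> (y - z)"
      have pS: "pderivs ls (S n) = (\<lambda>z. \<Sum>v\<in>?V n. (complex_of_real (grid_weight n v) * \<kappa> (x - v)) * ((-1) ^ length ls * pderivs ls \<phi> (v - z)))"
        unfolding S_def
        by (subst pderivs_sum[OF finite_grid_step smooth_pderivs_differentiable[OF schwartz_smooth[OF rt]]])
          (simp add: pderivs_reflect[OF schwartz_smooth[OF \<phi>]])
      have "pderivs ls \<phi> (x - z) = cv \<kappa> (pderivs ls \<phi>) (x - z)"
        using pderivs_cv[OF schwartz_poly_growth[OF \<kappa>] \<phi>, of ls] eq' by simp
      also have "\<dots> = (LINT y|lborel. ?g y * \<kappa> (x - y))"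
        unfolding cv_def
        by (subst integral_reflect[of _ x, symmetric])
          (auto simp: mult.commute intro!: borel_measurable_times schwartz_measurable[OF \<kappa>]
            measurable_compose[OF _ schwartz_measurable[OF schwartz_pderivs[OF \<phi>]]])
      finally have "pderivs ls (\<lambda>z. \<phi> (x - z) - S n z) z = (-1) ^ length ls *
         ((LINT y|lborel. ?g y * \<kappa> (x - y)) - (\<Sum>v\<in>?V n. grid_weight n v *\<^sub>R (?g v * \<kappa> (x - v))))"
        unfolding pderivs_diff[OF schwartz_smooth[OF rt] schwartz_smooth[OF S]] pS
          pderivs_reflect[OF schwartz_smooth[OF \<phi>]]
        by (simp add: right_diff_distrib sum_distrib_left scaleR_conv_of_real mult_ac)
      then have "norm (pderivs ls (\<lambda>z. \<phi> (x - z) - S n z) z)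
        = norm ((LINT y|lborel. ?g y * \<kappa> (x - y)) - (\<Sum>v\<in>?V n. grid_weight n v *\<^sub>R (?g v * \<kappa> (x - v))))"
        by (simp add: norm_mult norm_power)
      also have "\<dots> \<le> K * (c ls * D / weight z ^ N) / real (Suc n)"
      proof (rule Ke)
        show "?g \<in> borel_measurable borel"
          by (intro measurable_compose[OF _ schwartz_measurable[OF schwartz_pderivs[OF \<phi>]]]) auto
        fix y
        show "norm (?g y) \<le> c ls * D / weight z ^ N * weight y ^ N"
          using c(1)[of ls] by (intro order_trans[OF c(2) sh]) auto
        fix b :: "'d rvec" assume b: "norm b \<le> 1"
        have "norm (?g (y + b) - ?g y) = norm (pderivs ls \<phi> ((y - z) + b) - pderivs ls \<phi> (y - z))"
          by (simp add: algebra_simps)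
        also have "\<dots> \<le> c ls * norm b / weight (y - z) ^ N" by (rule c(3)[OF b])
        also have "\<dots> \<le> c ls * norm b * D / weight z ^ N * weight y ^ N"
          using c(1)[of ls] by (intro sh) auto
        finally show "norm (?g (y + b) - ?g y) \<le> c ls * D / weight z ^ N * norm b * weight y ^ N"
          by (simp add: mult_ac)
      qed
      also have "\<dots> \<le> K * (c' * D / weight z ^ N) / real (Suc n)"
        using K cc'[OF ls] by (intro divide_right_mono mult_left_mono mult_right_mono) (auto simp: D_def)
      finally show "norm (pderivs ls (\<lambda>z. \<phi> (x - z) - S n z) z) \<le> K * (c' * D) / real (Suc n) / weight z ^ N"
        by (simp add: mult_ac divide_divide_eq_left)
    qed
    finally show ?thesis by simp
  qed
  obtain a N' where a: "a > 0" "\<And>y. norm (convol u \<phi> y) \<le> a * weight y ^ N'"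
    "\<And>y b. norm b \<le> 1 ==> norm (convol u \<phi> (y + b) - convol u \<phi> y) \<le> a * norm b * weight y ^ N'"
    using convol_poly_bound[OF u \<phi>] by metis
  obtain L where L: "L > 0" and Le: "\<And>g a n. g \<in> borel_measurable borel ==> (\<And>y. norm (g y) \<le> a * weight y ^ N') ==>
    (\<And>y b. norm b \<le> 1 ==> norm (g (y + b) - g y) \<le> a * norm b * weight y ^ N') ==>
    norm ((LINT y|lborel. g y * \<kappa> (x - y)) - (\<Sum>v\<in>?V n. grid_weight n v *\<^sub>R (g v * \<kappa> (x - v)))) \<le> L * a / real (Suc n)"
    using grid_sum_error[OF \<kappa>, of N' x] by blast
  have e2: "norm (cv (convol u \<phi>) \<kappa> x - u (S n)) \<le> L * a / real (Suc n)" for n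
    unfolding cv_def uS
    by (rule Le[OF poly_growth_measurable[OF convol_poly_growth[OF u \<phi>]] a(2,3)])
  define T where "T = L * a + C * (K * (c' * D))"
  have "norm (cv (convol u \<phi>) \<kappa> x - convol u \<phi> x) \<le> T / real (Suc n)" for n
  proof -
    have "norm (cv (convol u \<phi>) \<kappa> x - convol u \<phi> x)
      \<le> norm (cv (convol u \<phi>) \<kappa> x - u (S n)) + norm (u (\<lambda>z. \<phi> (x - z)) - u (S n))"
      unfolding convol_def[of u \<phi> x] by norm
    also have "\<dots> \<le> L * a / real (Suc n) + C * (K * (c' * D)) / real (Suc n)" by (intro add_mono e1 e2)
    also have "\<dots> = T / real (Suc n)" by (simp only: T_def add_divide_distrib)
    finally show ?thesis .
  qed
  moreover have "(\<lambda>n. T / real (Suc n)) \<longlonglongrightarrow> 0"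
    using tendsto_mult_right_zero[OF LIMSEQ_Suc[OF lim_1_over_n], of T] by simp
  ultimately have "norm (cv (convol u \<phi>) \<kappa> x - convol u \<phi> x) \<le> 0"
    by (intro LIMSEQ_le_const) auto
  then show "cv (convol u \<phi>) \<kappa> x = convol u \<phi> x" by simp
qed

section \<open>Linear change of variables\<close>

text \<open>The scaling of Lebesgue measure under a linear map is a statement about index types of class
  \<open>wellorder\<close>. A finite linear order is a well-order, so a copy of the index type can be put into that class
  and the scaling law transferred back along the copy.\<close>

typedef 'a wcopy = "UNIV :: 'a set" by auto

lemma bij_Abs_wcopy: "bij (Abs_wcopy :: 'a => 'a wcopy)"
  by (metis Abs_wcopy_cases Abs_wcopy_inject UNIV_I bijI' )

instance wcopy :: (finite) finite
proof
  have "(UNIV :: 'a wcopy set) = Abs_wcopy ` UNIV" by (metis bij_Abs_wcopy bij_is_surj)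
  then show "finite (UNIV :: 'a wcopy set)" by (metis finite finite_imageI)
qed

instantiation wcopy :: (linorder) linorder
begin
definition less_eq_wcopy :: "'a wcopy => 'a wcopy => bool" where
  "less_eq_wcopy a b \<longleftrightarrow> Rep_wcopy a \<le> Rep_wcopy b"
definition less_wcopy :: "'a wcopy => 'a wcopy => bool" where
  "less_wcopy a b \<longleftrightarrow> Rep_wcopy a < Rep_wcopy b"
instance
  by standard (auto simp: less_eq_wcopy_def less_wcopy_def less_le Rep_wcopy_inject)
end

instance wcopy :: ("{finite,linorder}") wellorder
proof
  fix P :: "'a wcopy => bool" and a :: "'a wcopy"
  assume step: "\<And>x. (\<And>y. y < x ==> P y) ==> P x"
  have "wf {(x, y :: 'a wcopy). x < y}"
  proof (rule finite_acyclic_wf)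
    have "trans {(x, y :: 'a wcopy). x < y}" by (auto simp: trans_def)
    then have "{(x, y :: 'a wcopy). x < y}\<^sup>+ = {(x, y). x < y}" by (rule trancl_id)
    then show "acyclic {(x, y :: 'a wcopy). x < y}" by (simp add: acyclic_def)
  qed simp
  then show "P a" by (induction a rule: wf_induct_rule) (use step in auto)
qed

definition to_wcopy :: "'d::{finite,linorder} rvec => 'd wcopy rvec" where
  "to_wcopy x = vec_lambda (\<lambda>i. x $ Rep_wcopy i)"

definition of_wcopy :: "'d::{finite,linorder} wcopy rvec => 'd rvec" where
  "of_wcopy x = vec_lambda (\<lambda>i. x $ Abs_wcopy i)"

lemma of_to_wcopy [simp]: "of_wcopy (to_wcopy x) = x"
  by (simp add: of_wcopy_def to_wcopy_def Abs_wcopy_inverse)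

lemma to_of_wcopy [simp]: "to_wcopy (of_wcopy x) = x"
  by (simp add: of_wcopy_def to_wcopy_def Rep_wcopy_inverse)

definition mat_wcopy :: "'d::{finite,linorder} sqmat => 'd wcopy sqmat" where
  "mat_wcopy A = vec_lambda (\<lambda>i. vec_lambda (\<lambda>j. A $ Rep_wcopy i $ Rep_wcopy j))"

lemma sum_wcopy: "(\<Sum>i\<in>(UNIV :: 'a::finite wcopy set). f (Rep_wcopy i)) = (\<Sum>i\<in>UNIV. f i)"
  using sum.reindex_bij_betw[OF bij_Abs_wcopy, of "\<lambda>i. f (Rep_wcopy i)"] by (simp add: Abs_wcopy_inverse)

lemma prod_wcopy: "(\<Prod>i\<in>(UNIV :: 'a::finite wcopy set). f (Rep_wcopy i)) = (\<Prod>i\<in>UNIV. f i)"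
  using prod.reindex_bij_betw[OF bij_Abs_wcopy, of "\<lambda>i. f (Rep_wcopy i)"] by (simp add: Abs_wcopy_inverse)

lemma to_wcopy_mult: "to_wcopy (A *v x) = mat_wcopy A *v to_wcopy x"
  by (simp add: to_wcopy_def mat_wcopy_def matrix_vector_mult_def Finite_Cartesian_Product.vec_eq_iff
      sum_wcopy[of "\<lambda>j. A $ _ $ j * x $ j"])

lemma det_mat_wcopy:
  fixes A :: "'d::{finite,linorder} sqmat"
  shows "Determinants.det (mat_wcopy A) = Determinants.det A"
proof -
  let ?m = "map_permutation UNIV (Abs_wcopy :: 'd => 'd wcopy)"
  let ?n = "map_permutation UNIV (Rep_wcopy :: 'd wcopy => 'd)"
  have inj: "inj (Abs_wcopy :: 'd => 'd wcopy)" "inj (Rep_wcopy :: 'd wcopy => 'd)"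
    by (rule bij_is_inj[OF bij_Abs_wcopy]) (simp add: inj_on_def Rep_wcopy_inject)
  have surj: "range (Abs_wcopy :: 'd => 'd wcopy) = UNIV" by (rule bij_is_surj[OF bij_Abs_wcopy])
  have surj': "range (Rep_wcopy :: 'd wcopy => 'd) = UNIV" by (metis Abs_wcopy_inverse UNIV_I surjI)
  have bb: "bij_betw (Abs_wcopy :: 'd => 'd wcopy) UNIV UNIV" "bij_betw (Rep_wcopy :: 'd wcopy => 'd) UNIV UNIV"
    using inj surj surj' by (auto simp: bij_betw_def)
  have perm: "p permutes UNIV ==> ?m p permutes UNIV" "p' permutes UNIV ==> ?n p' permutes UNIV" for p p'
    using map_permutation_permutes[OF bb(1)] map_permutation_permutes[OF bb(2)] by auto
  have app: "?m p i = Abs_wcopy (p (Rep_wcopy i))" "?n p' j = Rep_wcopy (p' (Abs_wcopy j))" for p i p' j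
    using map_permutation_apply[OF inj(1), of "Rep_wcopy i" p] map_permutation_apply[OF inj(2), of "Abs_wcopy j" p']
    by (simp_all add: Rep_wcopy_inverse Abs_wcopy_inverse)
  have bij: "bij_betw ?m {p. p permutes UNIV} {p. p permutes UNIV}"
    by (rule bij_betw_byWitness[where f' = ?n])
      (auto simp: perm app fun_eq_iff Rep_wcopy_inverse Abs_wcopy_inverse)
  have "Determinants.det (mat_wcopy A) = (\<Sum>p\<in>{p. p permutes UNIV}. of_int (sign (?m p)) * (\<Prod>i\<in>UNIV. mat_wcopy A $ i $ ?m p i))"
    unfolding Determinants.det_def by (rule sum.reindex_bij_betw[OF bij, symmetric])
  also have "\<dots> = (\<Sum>p\<in>{p. p permutes UNIV}. of_int (sign p) * (\<Prod>i\<in>UNIV. A $ i $ p i))"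
  proof (rule sum.cong[OF refl])
    fix p :: "'d => 'd" assume p: "p \<in> {p. p permutes UNIV}"
    have "(\<Prod>i\<in>UNIV. mat_wcopy A $ i $ ?m p i) = (\<Prod>i\<in>UNIV. A $ i $ p i)"
      using prod_wcopy[of "\<lambda>i. A $ i $ p i"] by (simp add: mat_wcopy_def app Abs_wcopy_inverse)
    then show "of_int (sign (?m p)) * (\<Prod>i\<in>UNIV. mat_wcopy A $ i $ ?m p i) = of_int (sign p) * (\<Prod>i\<in>UNIV. A $ i $ p i)"
      using sign_map_permutation[OF inj(1)] p by simp
  qed
  finally show ?thesis unfolding Determinants.det_def .
qed

lemma emeasure_box_cart:
  fixes l u :: "'d::finite rvec"
  assumes "\<And>i. l $ i \<le> u $ i"
  shows "emeasure lborel (box l u) = ennreal (\<Prod>i\<in>UNIV. u $ i - l $ i)"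
proof -
  have B: "Basis = (\<lambda>i. axis i (1::real)) ` (UNIV::'d set)" by (auto simp: Basis_vec_def)
  have inj: "inj (\<lambda>i::'d. axis i (1::real))" by (auto simp: inj_on_def axis_eq_axis)
  have "emeasure lborel (box l u) = ennreal (\<Prod>b\<in>Basis. (u - l) \<bullet> b)"
    using assms by (subst emeasure_lborel_box) (auto simp: Basis_vec_def inner_axis)
  also have "(\<Prod>b\<in>Basis. (u - l) \<bullet> b) = (\<Prod>i\<in>UNIV. u $ i - l $ i)"
    unfolding B using inj by (subst prod.reindex) (auto simp: inner_axis)
  finally show ?thesis .
qed

lemma to_wcopy_measurable [measurable]: "to_wcopy \<in> borel_measurable borel"
  unfolding to_wcopy_def by (subst borel_measurable_euclidean_space) (auto simp: Basis_vec_def inner_axis)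

lemma matrix_mult_measurable [measurable]: "(\<lambda>x. (A :: 'd::finite sqmat) *v x) \<in> borel_measurable borel"
  by (intro borel_measurable_continuous_onI linear_continuous_on linear_conv_bounded_linear[THEN iffD1] matrix_vector_mul_linear)

lemma to_wcopy_vimage_box: "to_wcopy -` box (to_wcopy l) (to_wcopy u) = box l u"
  by (auto simp: mem_box_cart to_wcopy_def) (metis Abs_wcopy_inverse UNIV_I)+

lemma lborel_distr_to_wcopy: "distr lborel borel (to_wcopy :: 'd::{finite,linorder} rvec => _) = lborel"
proof (rule lborel_eqI[symmetric])
  fix l u :: "'d wcopy rvec" assume lu: "\<And>b. b \<in> Basis ==> l \<bullet> b \<le> u \<bullet> b"
  have "axis i (1::real) \<in> Basis" for i :: "'d wcopy" by (auto simp: Basis_vec_def)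
  from lu[OF this] have lu': "l $ i \<le> u $ i" for i by (simp add: inner_axis)
  have "emeasure (distr lborel borel to_wcopy) (box l u) = emeasure lborel (to_wcopy -` box l u)"
    by (subst emeasure_distr) auto
  also have "to_wcopy -` box l u = box (of_wcopy l) (of_wcopy u)"
    using to_wcopy_vimage_box[of "of_wcopy l" "of_wcopy u"] by simp
  also have "emeasure lborel \<dots> = ennreal (\<Prod>i\<in>UNIV. u $ i - l $ i)"
    using lu' prod_wcopy[of "\<lambda>i. of_wcopy u $ i - of_wcopy l $ i"]
    by (subst emeasure_box_cart) (auto simp: of_wcopy_def Rep_wcopy_inverse)
  also have "\<dots> = emeasure lborel (box l u)" using lu' by (rule emeasure_box_cart[symmetric])
  also have "\<dots> = ennreal (\<Prod>b\<in>Basis. (u - l) \<bullet> b)" using lu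
    by (subst emeasure_lborel_box) (auto simp: inner_diff_left)
  finally show "emeasure (distr lborel borel to_wcopy) (box l u) = (\<Prod>b\<in>Basis. (u - l) \<bullet> b)" .
qed simp

lemma emeasure_matrix_vimage_box_wcopy:
  fixes A :: "'n::{finite,wellorder} sqmat"
  assumes "invertible A"
  shows "ennreal \<bar>Determinants.det A\<bar> * emeasure lborel ((*v) A -` box l u) = emeasure lborel (box l u)"
proof -
  have meas: "(*v) A -` box l u \<in> sets borel"
    using measurable_sets[OF matrix_mult_measurable, of "box l u" A] by simp
  have eq: "(*v) A -` box l u = (*v) (matrix_inv A) ` box l u"
  proof (intro equalityI subsetI)
    fix x assume "x \<in> (*v) A -` box l u"
    then show "x \<in> (*v) (matrix_inv A) ` box l u"
      by (intro image_eqI[of _ _ "A *v x"]) (simp_all add: matrix_vector_mul_assoc matrix_inv_mult[OF assms])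
  next
    fix x assume "x \<in> (*v) (matrix_inv A) ` box l u"
    then show "x \<in> (*v) A -` box l u" by (auto simp: matrix_vector_mul_assoc matrix_inv_mult[OF assms])
  qed
  have lm: "box l u \<in> lmeasurable" by (rule lmeasurable_box)
  have lin: "linear ((*v) (matrix_inv A))" by (rule matrix_vector_mul_linear)
  have lm': "(*v) A -` box l u \<in> lmeasurable" unfolding eq by (rule measurable_linear_image[OF lin lm])
  have "measure lebesgue ((*v) A -` box l u) = \<bar>Determinants.det (matrix_inv A)\<bar> * measure lebesgue (box l u)"
    unfolding eq by (subst measure_linear_image[OF lin lm]) simp
  moreover have "Determinants.det A * Determinants.det (matrix_inv A) = 1"
    using det_mul[of A "matrix_inv A"] matrix_inv_mult[OF assms] by simp
  then have "\<bar>Determinants.det A\<bar> * \<bar>Determinants.det (matrix_inv A)\<bar> = 1" by (simp add: abs_mult[symmetric])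
  ultimately have "\<bar>Determinants.det A\<bar> * measure lebesgue ((*v) A -` box l u) = measure lebesgue (box l u)"
    by (simp add: mult.assoc[symmetric])
  moreover have "emeasure lborel ((*v) A -` box l u) = ennreal (measure lebesgue ((*v) A -` box l u))"
    using emeasure_eq_measure2[OF lm'] meas by (simp add: sets_completionI_sets)
  moreover have "emeasure lborel (box l u) = ennreal (measure lebesgue (box l u))"
    using emeasure_eq_measure2[OF lm] by (simp add: sets_completionI_sets)
  ultimately show ?thesis by (simp add: ennreal_mult[symmetric])
qed

text \<open>Both sides are measures that agree on boxes.\<close>

lemma lborel_matrix:
  fixes A :: "'d::{finite,linorder} sqmat"
  assumes A: "invertible A"
  shows "lborel = density (distr lborel borel ((*v) A)) (\<lambda>_. ennreal \<bar>Determinants.det A\<bar>)"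
proof (rule lborel_eqI)
  fix l u :: "'d rvec" assume lu: "\<And>b. b \<in> Basis ==> l \<bullet> b \<le> u \<bullet> b"
  let ?A = "mat_wcopy A"
  have "mat_wcopy M ** mat_wcopy N = mat_wcopy (M ** N)" for M N :: "'d sqmat"
    by (simp add: mat_wcopy_def matrix_matrix_mult_def Finite_Cartesian_Product.vec_eq_iff
      sum_wcopy[of "\<lambda>j. M $ _ $ j * N $ j $ _"])
  moreover have "mat_wcopy (idm :: 'd sqmat) = idm"
    by (simp add: mat_wcopy_def Finite_Cartesian_Product.mat_def Finite_Cartesian_Product.vec_eq_iff Rep_wcopy_inject)
  ultimately have A': "invertible ?A" using A unfolding invertible_def by metis
  have "(*v) A -` box l u = to_wcopy -` ((*v) ?A -` box (to_wcopy l) (to_wcopy u))"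
    using to_wcopy_vimage_box[of l u] by (auto simp: to_wcopy_mult[symmetric])
  then have "emeasure lborel ((*v) A -` box l u) = emeasure (distr lborel borel to_wcopy) ((*v) ?A -` box (to_wcopy l) (to_wcopy u))"
    using measurable_sets[OF matrix_mult_measurable, of "box (to_wcopy l) (to_wcopy u)" ?A]
    by (subst emeasure_distr) auto
  then have "ennreal \<bar>Determinants.det A\<bar> * emeasure lborel ((*v) A -` box l u) = emeasure lborel (box (to_wcopy l) (to_wcopy u))"
    using emeasure_matrix_vimage_box_wcopy[OF A', of "to_wcopy l" "to_wcopy u"]
    by (simp add: lborel_distr_to_wcopy det_mat_wcopy)
  also have "\<dots> = emeasure lborel (to_wcopy -` box (to_wcopy l) (to_wcopy u) :: 'd rvec set)"
    unfolding lborel_distr_to_wcopy[symmetric, where 'd = 'd] by (subst emeasure_distr) auto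
  also have "\<dots> = (\<Prod>b\<in>Basis. (u - l) \<bullet> b)"
    unfolding to_wcopy_vimage_box using lu by (subst emeasure_lborel_box) (auto simp: inner_diff_left)
  finally show "emeasure (density (distr lborel borel ((*v) A)) (\<lambda>_. ennreal \<bar>Determinants.det A\<bar>)) (box l u)
      = (\<Prod>b\<in>Basis. (u - l) \<bullet> b)"
    using measurable_sets[OF matrix_mult_measurable, of "box l u" A]
    by (simp add: emeasure_density nn_integral_distr nn_integral_cmult_indicator emeasure_distr)
qed simp

lemma nn_integral_matrix:
  fixes A :: "'d::{finite,linorder} sqmat"
  assumes A: "invertible A" and [measurable]: "f \<in> borel_measurable borel"
  shows "ennreal \<bar>Determinants.det A\<bar> * (\<integral>\<^sup>+x. f (A *v x) \<partial>lborel) = (\<integral>\<^sup>+x. f x \<partial>lborel)"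
  by (subst (2) lborel_matrix[OF A]) (simp add: nn_integral_density nn_integral_distr nn_integral_cmult)

lemma integral_matrix:
  fixes A :: "'d::{finite,linorder} sqmat" and f :: "'d cfun"
  assumes A: "invertible A" and [measurable]: "f \<in> borel_measurable borel"
  shows "complex_of_real \<bar>Determinants.det A\<bar> * (LINT x|lborel. f (A *v x)) = (LINT x|lborel. f x)"
  by (subst (2) lborel_matrix[OF A])
    (simp add: integral_density integral_distr scaleR_conv_of_real)

section \<open>Uniqueness of the Fourier transform\<close>

lemma lborel_affine_integral:
  fixes F :: "'a::euclidean_space => complex"
  assumes F: "integrable lborel F" and c: "c \<noteq> 0"
  shows "integrable lborel (\<lambda>y. F (t + c *\<^sub>R y))"
    and "(LINT x|lborel. F x) = \<bar>c\<bar> ^ DIM('a) *\<^sub>R (LINT y|lborel. F (t + c *\<^sub>R y))"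
proof -
  have [measurable]: "F \<in> borel_measurable borel" using F by auto
  note L = lborel_affine[OF c, of t]
  have "integrable (density (distr lborel borel (\<lambda>x. t + c *\<^sub>R x)) (\<lambda>_. \<bar>c\<bar> ^ DIM('a))) F"
    using F by (subst (asm) L) simp
  then have "integrable lborel (\<lambda>y. \<bar>c\<bar> ^ DIM('a) *\<^sub>R F (t + c *\<^sub>R y))"
    by (simp add: integrable_density integrable_distr_eq)
  from integrable_scaleR_right[OF this, of "inverse (\<bar>c\<bar> ^ DIM('a))"] show "integrable lborel (\<lambda>y. F (t + c *\<^sub>R y))"
    using c by simp
  show "(LINT x|lborel. F x) = \<bar>c\<bar> ^ DIM('a) *\<^sub>R (LINT y|lborel. F (t + c *\<^sub>R y))"
    by (subst L) (simp add: integral_density integral_distr)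
qed

lemma lborel_prod_integral:
  fixes f :: "'a::euclidean_space => real => complex"
  assumes "\<And>b. b \<in> Basis ==> integrable lborel (f b)"
  shows "integrable lborel (\<lambda>x :: 'a. \<Prod>b\<in>Basis. f b (x \<bullet> b))"
    and "(LINT x|lborel. (\<Prod>b\<in>Basis. f b (x \<bullet> b))) = (\<Prod>b\<in>Basis. (LINT u|lborel. f b u))"
proof -
  interpret product_sigma_finite "\<lambda>_ :: 'a. lborel :: real measure" by standard
  have [measurable]: "b \<in> Basis ==> f b \<in> borel_measurable borel" for b using assms by auto
  have m: "(\<lambda>x :: 'a. \<Prod>b\<in>Basis. f b (x \<bullet> b)) \<in> borel_measurable borel" by measurable
  have eq: "(\<Prod>b\<in>Basis. f b ((\<Sum>b\<in>Basis. g b *\<^sub>R b) \<bullet> b)) = (\<Prod>b\<in>Basis. f b (g b))" for g :: "'a => real"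
    by (intro prod.cong) simp_all
  show "integrable lborel (\<lambda>x :: 'a. \<Prod>b\<in>Basis. f b (x \<bullet> b))"
    unfolding lborel_eq[where 'a = 'a] using m
    by (subst integrable_distr_eq) (auto simp: eq intro!: product_integrable_prod assms)
  show "(LINT x|lborel. (\<Prod>b\<in>Basis. f b (x \<bullet> b))) = (\<Prod>b\<in>Basis. (LINT u|lborel. f b u))"
    unfolding lborel_eq[where 'a = 'a] using m
    by (subst integral_distr) (auto simp: eq intro!: product_integral_prod assms)
qed

lemma integrable_pair_mult:
  fixes f :: "'a::euclidean_space => complex" and g :: "'b::euclidean_space => complex"
  assumes f: "integrable lborel f" and g: "integrable lborel g"
  shows "integrable (lborel \<Otimes>\<^sub>M lborel) (\<lambda>(x, y). f x * g y)"
proof (rule lborel_pair.Fubini_integrable)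
  have [measurable]: "f \<in> borel_measurable borel" "g \<in> borel_measurable borel" using f g by auto
  show "(\<lambda>(x, y). f x * g y) \<in> borel_measurable (lborel \<Otimes>\<^sub>M lborel)" by measurable
  show "integrable lborel (\<lambda>x. LINT y|lborel. norm (case (x, y) of (x, y) => f x * g y))"
    using f by (simp add: norm_mult)
  show "AE x in lborel. integrable lborel (\<lambda>y. case (x, y) of (x, y) => f x * g y)"
    using g by simp
qed

text \<open>The density of the standard normal distribution. Its Fourier transform is known from the theory of
  characteristic functions, which makes it the kernel of choice for Fourier inversion.\<close>

definition gauss :: "'a::euclidean_space => real" where
  "gauss x = (\<Prod>b\<in>Basis. std_normal_density (x \<bullet> b))"

lemma std_normal_char_lborel:
  "integrable lborel (\<lambda>u. std_normal_density u *\<^sub>R iexp (t * u))"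
  "(LINT u|lborel. std_normal_density u *\<^sub>R iexp (t * u)) = complex_of_real (exp (- t\<^sup>2 / 2))"
proof -
  have i: "integrable lborel std_normal_density" using integrable_std_normal_moment[of 0] by simp
  show "integrable lborel (\<lambda>u. std_normal_density u *\<^sub>R iexp (t * u))"
    by (rule Bochner_Integration.integrable_bound[OF i]) auto
  have "char std_normal_distribution t = (LINT u|lborel. std_normal_density u *\<^sub>R iexp (t * u))"
    unfolding char_def by (subst integral_density) auto
  then show "(LINT u|lborel. std_normal_density u *\<^sub>R iexp (t * u)) = complex_of_real (exp (- t\<^sup>2 / 2))"
    by (simp add: char_std_normal_distribution)
qed

lemma gauss_fourier:
  fixes t :: "'a::euclidean_space"
  shows "integrable lborel (\<lambda>x :: 'a. gauss x *\<^sub>R iexp (t \<bullet> x))"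
    and "(LINT x|lborel. gauss x *\<^sub>R iexp (t \<bullet> x)) = complex_of_real (sqrt (2 * pi) ^ DIM('a) * gauss t)"
proof -
  let ?f = "\<lambda>b u. std_normal_density u *\<^sub>R iexp ((t \<bullet> b) * u)"
  have eq: "(\<lambda>x. gauss x *\<^sub>R iexp (t \<bullet> x)) = (\<lambda>x. \<Prod>b\<in>Basis. ?f b (x \<bullet> b))"
  proof
    fix x :: 'a
    have "iexp (t \<bullet> x) = (\<Prod>b\<in>Basis. iexp ((t \<bullet> b) * (x \<bullet> b)))"
      by (subst euclidean_inner) (simp add: exp_sum[symmetric] sum_distrib_left)
    then show "gauss x *\<^sub>R iexp (t \<bullet> x) = (\<Prod>b\<in>Basis. ?f b (x \<bullet> b))"
      by (simp add: gauss_def scaleR_conv_of_real prod.distrib)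
  qed
  show "integrable lborel (\<lambda>x :: 'a. gauss x *\<^sub>R iexp (t \<bullet> x))"
    unfolding eq by (intro lborel_prod_integral std_normal_char_lborel)
  have "(LINT x|lborel. gauss x *\<^sub>R iexp (t \<bullet> x)) = (\<Prod>b\<in>Basis. complex_of_real (exp (- (t \<bullet> b)\<^sup>2 / 2)))"
    unfolding eq by (subst lborel_prod_integral(2)[OF std_normal_char_lborel(1)]) (simp only: std_normal_char_lborel)
  also have "\<dots> = (\<Prod>b\<in>Basis. complex_of_real (sqrt (2 * pi) * std_normal_density (t \<bullet> b)))"
    by (intro prod.cong refl) (simp add: std_normal_density_def)
  also have "\<dots> = complex_of_real (sqrt (2 * pi) ^ DIM('a) * gauss t)"
    by (simp add: gauss_def prod.distrib)
  finally show "(LINT x|lborel. gauss x *\<^sub>R iexp (t \<bullet> x)) = complex_of_real (sqrt (2 * pi) ^ DIM('a) * gauss t)" .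
qed

lemma gauss_props:
  shows "gauss x > 0" "integrable lborel (gauss :: 'a::euclidean_space => real)" "gauss (- x) = gauss (x :: 'a)"
    "(LINT x|lborel. gauss (x :: 'a)) > 0"
proof -
  show pos: "gauss x > 0" for x :: 'a unfolding gauss_def by (intro prod_pos) (simp add: normal_density_pos)
  have "integrable lborel (\<lambda>x :: 'a. complex_of_real (gauss x))"
    using gauss_fourier(1)[of 0] by (simp add: scaleR_conv_of_real)
  from integrable_Re[OF this] show i: "integrable lborel (gauss :: 'a => real)" by simp
  show "gauss (- x) = gauss x" unfolding gauss_def by (simp add: normal_density_def)
  have "complex_of_real (LINT x|lborel. gauss (x :: 'a)) = complex_of_real (sqrt (2 * pi) ^ DIM('a) * gauss (0::'a))"
    using gauss_fourier(2)[of "0 :: 'a"] by (simp add: scaleR_conv_of_real)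
  then have "(LINT x|lborel. gauss (x :: 'a)) = sqrt (2 * pi) ^ DIM('a) * gauss (0::'a)" by (simp only: of_real_eq_iff)
  then show "(LINT x|lborel. gauss (x :: 'a)) > 0" using pos[of 0] by simp
qed

text \<open>By Fubini, the average of \<open>f\<close> against a Gaussian centred at \<open>x0\<close> is an average of values of the Fourier
  transform of \<open>f\<close>, hence 0. Letting the Gaussian concentrate at \<open>x0\<close> gives the value of \<open>f\<close> there.\<close>

lemma fourier_zero_imp_zero:
  fixes f :: "'d::finite cfun"
  assumes f: "integrable lborel f" and cont: "continuous_on UNIV f" and bd: "\<And>x. norm (f x) \<le> B"
    and zero: "\<And>\<xi>. fourier f \<xi> = 0"
  shows "f x0 = 0"
proof -
  have [measurable]: "f \<in> borel_measurable borel" using f by auto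
  have [measurable]: "(gauss :: 'd rvec => real) \<in> borel_measurable borel" using gauss_props(2) by auto
  let ?K = "complex_of_real (sqrt (2 * pi) ^ DIM('d rvec))"
  have vanish: "(LINT y|lborel. gauss y *\<^sub>R f (x0 + c *\<^sub>R y)) = 0" if c: "c > 0" for c
  proof -
    have int: "integrable lborel (\<lambda>y. f (x0 + c *\<^sub>R y))" using c by (intro lborel_affine_integral f) auto
    have inner: "(LINT y|lborel. f (x0 + c *\<^sub>R y) * iexp (- (\<xi> \<bullet> y))) = 0" for \<xi>
    proof -
      let ?F = "\<lambda>x. f x * iexp (- ((\<xi> /\<^sub>R c) \<bullet> (x - x0)))"
      have "(LINT x|lborel. ?F x) = iexp ((\<xi> /\<^sub>R c) \<bullet> x0) * fourier f (\<xi> /\<^sub>R (2 * pi * c))"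
      proof -
        have F: "?F x = iexp ((\<xi> /\<^sub>R c) \<bullet> x0) * (f x * exp (- (2 * complex_of_real pi * \<i> * complex_of_real ((\<xi> /\<^sub>R (2 * pi * c)) \<bullet> x))))" for x
        proof -
          have "(\<xi> /\<^sub>R c) \<bullet> x = 2 * pi * ((\<xi> /\<^sub>R (2 * pi * c)) \<bullet> x)" by simp
          then have "iexp (- ((\<xi> /\<^sub>R c) \<bullet> (x - x0))) = iexp ((\<xi> /\<^sub>R c) \<bullet> x0) * exp (- (2 * complex_of_real pi * \<i> * complex_of_real ((\<xi> /\<^sub>R (2 * pi * c)) \<bullet> x)))"
            unfolding inner_diff_right by (simp only: exp_add[symmetric]) (simp add: algebra_simps)
          then show ?thesis by (simp add: mult_ac)
        qed
        show ?thesis unfolding fourier_def F by (rule integral_mult_right_zero)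
      qed
      also have "\<dots> = 0" by (simp add: zero)
      finally have z: "(LINT x|lborel. ?F x) = 0" .
      have "integrable lborel ?F" by (rule Bochner_Integration.integrable_bound[OF f]) (auto simp: norm_mult)
      from lborel_affine_integral(2)[OF this, of c x0] z c
      have "(LINT y|lborel. ?F (x0 + c *\<^sub>R y)) = 0" by simp
      moreover have "(\<xi> /\<^sub>R c) \<bullet> (x0 + c *\<^sub>R y - x0) = \<xi> \<bullet> y" for y using c by simp
      ultimately show ?thesis by (simp only:)
    qed
    have pair: "integrable (lborel \<Otimes>\<^sub>M lborel) (\<lambda>(y, \<xi>). (f (x0 + c *\<^sub>R y) * iexp (- (\<xi> \<bullet> y))) * gauss \<xi>)"
    proof -
      have "integrable (lborel \<Otimes>\<^sub>M lborel) (\<lambda>(y, \<xi> :: 'd rvec). f (x0 + c *\<^sub>R y) * complex_of_real (gauss \<xi>))"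
        using int gauss_props(2) by (intro integrable_pair_mult) auto
      then show ?thesis by (rule Bochner_Integration.integrable_bound) (auto simp: norm_mult)
    qed
    have "?K * (LINT y|lborel. gauss y *\<^sub>R f (x0 + c *\<^sub>R y))
      = (LINT y|lborel. f (x0 + c *\<^sub>R y) * (LINT \<xi>|lborel. gauss \<xi> *\<^sub>R iexp ((- y) \<bullet> \<xi>)))"
      unfolding gauss_fourier(2) gauss_props(3) integral_mult_right_zero[symmetric]
      by (intro Bochner_Integration.integral_cong refl) (simp add: scaleR_conv_of_real mult_ac)
    also have "\<dots> = (LINT y|lborel. LINT \<xi>|lborel. (f (x0 + c *\<^sub>R y) * iexp (- (\<xi> \<bullet> y))) * gauss \<xi>)"
      by (intro Bochner_Integration.integral_cong refl, subst integral_mult_right_zero[symmetric],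
          intro Bochner_Integration.integral_cong refl)
        (simp add: scaleR_conv_of_real mult_ac inner_commute)
    also have "\<dots> = (LINT \<xi>|lborel. LINT y|lborel. (f (x0 + c *\<^sub>R y) * iexp (- (\<xi> \<bullet> y))) * gauss \<xi>)"
      using lborel_pair.Fubini_integral[OF pair] by simp
    also have "\<dots> = 0" by (simp only: integral_mult_left_zero inner mult_zero_left) simp
    finally show ?thesis by simp
  qed
  have "(\<lambda>n. LINT y|lborel. gauss y *\<^sub>R f (x0 + (1 / real (Suc n)) *\<^sub>R y)) \<longlonglongrightarrow> (LINT y|lborel. gauss (y :: 'd rvec) *\<^sub>R f x0)"
  proof (rule Bochner_Integration.integral_dominated_convergence[where w = "\<lambda>y :: 'd rvec. gauss y * B"])
    show "integrable lborel (\<lambda>y :: 'd rvec. gauss y * B)" by (rule integrable_mult_left[OF gauss_props(2)])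
    show "AE y in lborel. (\<lambda>n. gauss y *\<^sub>R f (x0 + (1 / real (Suc n)) *\<^sub>R y)) \<longlonglongrightarrow> gauss y *\<^sub>R f x0"
    proof (intro AE_I2 tendsto_intros)
      fix y
      have "(\<lambda>n. x0 + (1 / real (Suc n)) *\<^sub>R y) \<longlonglongrightarrow> x0 + 0 *\<^sub>R y"
        by (intro tendsto_intros LIMSEQ_Suc[OF lim_1_over_n])
      moreover have "isCont f x0" using cont by (simp add: continuous_on_eq_continuous_at)
      ultimately show "(\<lambda>n. f (x0 + (1 / real (Suc n)) *\<^sub>R y)) \<longlonglongrightarrow> f x0"
        using isCont_tendsto_compose by fastforce
    qed
    show "AE y in lborel. norm (gauss y *\<^sub>R f (x0 + (1 / real (Suc n)) *\<^sub>R y)) \<le> gauss y * B" for n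
    proof (rule AE_I2)
      fix y :: "'d rvec"
      have "gauss y > 0" by (rule gauss_props(1))
      then show "norm (gauss y *\<^sub>R f (x0 + (1 / real (Suc n)) *\<^sub>R y)) \<le> gauss y * B"
        using bd[of "x0 + (1 / real (Suc n)) *\<^sub>R y"] by (simp add: mult_left_mono)
    qed
  qed measurable
  then have "(LINT y|lborel. gauss (y :: 'd rvec) *\<^sub>R f x0) = 0" using vanish by (simp add: LIMSEQ_const_iff)
  then have "complex_of_real (LINT y|lborel. gauss (y :: 'd rvec)) * f x0 = 0"
    by (simp add: scaleR_conv_of_real)
  then show ?thesis using gauss_props(4)[where 'a = "'d rvec"] by simp
qed

section \<open>Fourier transforms of convolutions\<close>

lemma integrable_shift:
  fixes F :: "'a::euclidean_space => complex"
  assumes "integrable lborel F"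
  shows "integrable lborel (\<lambda>x. F (x - y))" "(LINT x|lborel. F (x - y)) = (LINT x|lborel. F x)"
  using lborel_affine_integral[OF assms, of 1 "- y"] by (simp_all add: add.commute)

lemma schwartz_integrable: "f \<in> schwartz ==> integrable lborel f"
proof -
  assume f: "f \<in> schwartz"
  obtain C where C: "C > 0" "\<And>x. norm (f x) \<le> C / weight x ^ 1" using schwartz_decay_fun[OF f] by blast
  have "integrable lborel (\<lambda>x. C * (1 / weight x))" by (intro integrable_mult_right integrable_inverse_weight)
  then show ?thesis
    by (rule Bochner_Integration.integrable_bound) (use C schwartz_measurable[OF f] in auto)
qed

lemma convolution_pair_integrable:
  fixes f g :: "'a::euclidean_space => complex"
  assumes f: "integrable lborel f" and g: "integrable lborel g"
  shows "integrable (lborel \<Otimes>\<^sub>M lborel) (\<lambda>(y, x). f y * g (x - y))"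
proof (rule lborel_pair.Fubini_integrable)
  have [measurable]: "f \<in> borel_measurable borel" "g \<in> borel_measurable borel" using f g by auto
  show "(\<lambda>(y, x). f y * g (x - y)) \<in> borel_measurable (lborel \<Otimes>\<^sub>M lborel)" by measurable
  have "(LINT x|lborel. norm (g (x - y))) = (LINT x|lborel. norm (g x))" for y
  proof -
    have "integrable lborel (\<lambda>x. complex_of_real (norm (g x)))" using g by simp
    from integrable_shift(2)[OF this, of y] show ?thesis by (simp only: integral_complex_of_real of_real_eq_iff)
  qed
  then show "integrable lborel (\<lambda>y. LINT x|lborel. norm (case (y, x) of (y, x) => f y * g (x - y)))"
    using f by (simp add: norm_mult)
  show "AE y in lborel. integrable lborel (\<lambda>x. case (y, x) of (y, x) => f y * g (x - y))"
    using integrable_shift(1)[OF g] by simp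
qed

lemma cv_integrable_fourier:
  fixes f g :: "'d::finite cfun"
  assumes f: "integrable lborel f" and g: "integrable lborel g"
  shows "integrable lborel (cv f g)" "fourier (cv f g) \<xi> = fourier f \<xi> * fourier g \<xi>"
proof -
  have [measurable]: "f \<in> borel_measurable borel" "g \<in> borel_measurable borel" using f g by auto
  note pair = convolution_pair_integrable[OF f g]
  show "integrable lborel (cv f g)"
    unfolding cv_def using lborel_pair.integrable_snd[OF pair] by simp
  let ?e = "\<lambda>x :: 'd rvec. exp (- (2 * complex_of_real pi * \<i> * complex_of_real (\<xi> \<bullet> x)))"
  have ne: "norm (?e x) = 1" for x by simp
  have split: "?e x = ?e y * ?e (x - y)" for x y
    by (simp add: exp_add[symmetric] inner_diff_right algebra_simps)
  have pair': "integrable (lborel \<Otimes>\<^sub>M lborel) (\<lambda>(y, x). f y * g (x - y) * ?e x)"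
    by (rule Bochner_Integration.integrable_bound[OF pair]) (auto simp: norm_mult)
  have ge: "integrable lborel (\<lambda>x. g x * ?e x)"
    by (rule Bochner_Integration.integrable_bound[OF g]) (auto simp: norm_mult)
  have "fourier (cv f g) \<xi> = (LINT x|lborel. LINT y|lborel. f y * g (x - y) * ?e x)"
    unfolding fourier_def cv_def by simp
  also have "\<dots> = (LINT y|lborel. LINT x|lborel. f y * g (x - y) * ?e x)"
    using lborel_pair.Fubini_integral[OF pair'] by simp
  also have "\<dots> = (LINT y|lborel. (f y * ?e y) * fourier g \<xi>)"
  proof (rule Bochner_Integration.integral_cong[OF refl])
    fix y
    have "(LINT x|lborel. f y * g (x - y) * ?e x) = (LINT x|lborel. (f y * ?e y) * (g (x - y) * ?e (x - y)))"
      by (intro Bochner_Integration.integral_cong refl) (subst split[of _ y], simp only: mult_ac)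
    also have "\<dots> = (f y * ?e y) * (LINT x|lborel. g (x - y) * ?e (x - y))" by (rule integral_mult_right_zero)
    also have "(LINT x|lborel. g (x - y) * ?e (x - y)) = fourier g \<xi>"
      unfolding fourier_def by (rule integrable_shift(2)[OF ge])
    finally show "(LINT x|lborel. f y * g (x - y) * ?e x) = (f y * ?e y) * fourier g \<xi>" .
  qed
  also have "\<dots> = fourier f \<xi> * fourier g \<xi>" unfolding fourier_def[of f] by (rule integral_mult_left_zero)
  finally show "fourier (cv f g) \<xi> = fourier f \<xi> * fourier g \<xi>" .
qed

lemma cv_bounded_continuous:
  fixes f \<kappa> :: "('d::{finite,linorder}) cfun"
  assumes f: "integrable lborel f" and \<kappa>: "\<kappa> \<in> schwartz"
  shows "\<exists>B. \<forall>x. norm (cv f \<kappa> x) \<le> B" "continuous_on UNIV (cv f \<kappa>)"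
proof -
  have [measurable]: "f \<in> borel_measurable borel" "\<kappa> \<in> borel_measurable borel" using f schwartz_measurable[OF \<kappa>] by auto
  obtain C where C: "C > 0" "\<And>x. norm (\<kappa> x) \<le> C / weight x ^ 0" using schwartz_decay_fun[OF \<kappa>] by blast
  obtain K where K: "K > 0" "\<And>a b. norm b \<le> 1 ==> norm (\<kappa> (a + b) - \<kappa> a) \<le> K * norm b / weight a ^ 0"
    using schwartz_difference_bound[OF \<kappa>, of 0] by blast
  define I where "I = (LINT y|lborel. norm (f y))"
  have f\<kappa>: "norm (f y * \<kappa> (x - y)) \<le> C * norm (f y)" for x y
    using mult_left_mono[OF C(2)[of "x - y"], of "norm (f y)"] by (simp add: norm_mult mult.commute)
  have int: "integrable lborel (\<lambda>y. f y * \<kappa> (x - y))" for x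
    by (rule Bochner_Integration.integrable_bound[OF integrable_mult_right[OF f, of "complex_of_real C"]])
      (use C(1) f\<kappa> in \<open>auto simp: norm_mult\<close>)
  have "norm (cv f \<kappa> x) \<le> C * I" for x
  proof -
    have "norm (cv f \<kappa> x) \<le> (LINT y|lborel. C * norm (f y))"
      unfolding cv_def using f int f\<kappa>
      by (intro Bochner_Integration.integral_norm_bound_integral) auto
    then show ?thesis by (simp add: I_def)
  qed
  then show "\<exists>B. \<forall>x. norm (cv f \<kappa> x) \<le> B" by blast
  have diff: "norm (cv f \<kappa> (x + b) - cv f \<kappa> x) \<le> norm b * (K * I)" if b: "norm b \<le> 1" for x b
  proof -
    have "cv f \<kappa> (x + b) - cv f \<kappa> x = (LINT y|lborel. f y * (\<kappa> (x + b - y) - \<kappa> (x - y)))"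
      unfolding cv_def by (subst Bochner_Integration.integral_diff[symmetric, OF int int]) (simp add: algebra_simps)
    also have "norm \<dots> \<le> (LINT y|lborel. (norm b * K) * norm (f y))"
    proof (rule Bochner_Integration.integral_norm_bound_integral)
      show "integrable lborel (\<lambda>y. f y * (\<kappa> (x + b - y) - \<kappa> (x - y)))"
        using Bochner_Integration.integrable_diff[OF int int, of "x + b" x] by (simp add: algebra_simps)
      fix y
      have "norm (\<kappa> (x + b - y) - \<kappa> (x - y)) \<le> K * norm b"
        using K(2)[OF b, of "x - y"] by (simp add: algebra_simps)
      then have "norm (f y) * norm (\<kappa> (x + b - y) - \<kappa> (x - y)) \<le> norm (f y) * (K * norm b)"
        by (rule mult_left_mono) simp
      then show "norm (f y * (\<kappa> (x + b - y) - \<kappa> (x - y))) \<le> norm b * K * norm (f y)"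
        by (simp add: norm_mult mult_ac)
    qed (use f in simp)
    finally show ?thesis by (simp add: I_def mult.assoc)
  qed
  have "isCont (cv f \<kappa>) x" for x
  proof -
    have "((\<lambda>b. cv f \<kappa> (x + b) - cv f \<kappa> x) \<longlongrightarrow> 0) (at 0)"
    proof (rule Lim_null_comparison)
      have "\<forall>\<^sub>F b in at 0. norm b \<le> 1" by (auto simp: eventually_at intro!: exI[of _ 1])
      then show "\<forall>\<^sub>F b in at 0. norm (cv f \<kappa> (x + b) - cv f \<kappa> x) \<le> norm b * (K * I)"
        by (rule eventually_mono) (rule diff)
      show "((\<lambda>b :: 'd rvec. norm b * (K * I)) \<longlongrightarrow> 0) (at 0)"
        by (intro tendsto_mult_left_zero tendsto_norm_zero tendsto_ident_at)
    qed
    then have "((\<lambda>b. cv f \<kappa> (x + b)) \<longlongrightarrow> cv f \<kappa> x) (at 0)" by (simp add: LIM_zero_iff)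
    then show ?thesis by (simp add: isCont_iff)
  qed
  then show "continuous_on UNIV (cv f \<kappa>)" by (simp add: continuous_at_imp_continuous_on)
qed

lemma fourier_sum:
  assumes "\<And>k. k \<in> K ==> integrable lborel (g k)"
  shows "fourier (\<lambda>x. \<Sum>k\<in>K. c k * g k x) \<xi> = (\<Sum>k\<in>K. c k * fourier (g k) \<xi>)"
proof -
  let ?e = "\<lambda>x. exp (- (2 * complex_of_real pi * \<i> * complex_of_real (\<xi> \<bullet> x)))"
  have i: "integrable lborel (\<lambda>x. g k x * ?e x)" if "k \<in> K" for k
    by (rule Bochner_Integration.integrable_bound[OF assms[OF that]])
      (use assms[OF that] in \<open>auto simp: norm_mult\<close>)
  have "fourier (\<lambda>x. \<Sum>k\<in>K. c k * g k x) \<xi> = (LINT x|lborel. (\<Sum>k\<in>K. c k * (g k x * ?e x)))"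
    unfolding fourier_def by (simp only: sum_distrib_right mult.assoc)
  also have "\<dots> = (\<Sum>k\<in>K. (LINT x|lborel. c k * (g k x * ?e x)))"
    by (rule Bochner_Integration.integral_sum) (intro integrable_mult_right i)
  also have "\<dots> = (\<Sum>k\<in>K. c k * fourier (g k) \<xi>)" by (simp only: integral_mult_right_zero fourier_def)
  finally show ?thesis .
qed

text \<open>The Fourier transform turns convolution into multiplication and is injective on bounded continuous
  integrable functions.\<close>

lemma cv_eqI:
  fixes f \<kappa> h :: "('d::{finite,linorder}) cfun"
  assumes f: "f \<in> schwartz" and \<kappa>: "\<kappa> \<in> schwartz" and h: "h \<in> schwartz"
    and eq: "\<And>\<xi>. fourier f \<xi> * fourier \<kappa> \<xi> = fourier h \<xi>"
  shows "cv f \<kappa> = h"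
proof
  fix x
  note i = schwartz_integrable[OF f] schwartz_integrable[OF \<kappa>] schwartz_integrable[OF h]
  obtain B where B: "\<And>x. norm (cv f \<kappa> x) \<le> B" using cv_bounded_continuous(1)[OF i(1) \<kappa>] by blast
  obtain C where C: "C > 0" "\<And>x. norm (h x) \<le> C / weight x ^ 0" using schwartz_decay_fun[OF h] by blast
  have "cv f \<kappa> x - h x = 0"
  proof (rule fourier_zero_imp_zero)
    show "integrable lborel (\<lambda>x. cv f \<kappa> x - h x)" using cv_integrable_fourier(1)[OF i(1,2)] i(3) by simp
    show "continuous_on UNIV (\<lambda>x. cv f \<kappa> x - h x)"
      by (intro continuous_on_diff cv_bounded_continuous(2) i(1) \<kappa> schwartz_continuous h)
    show "norm (cv f \<kappa> x - h x) \<le> B + C" for x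
      using norm_triangle_ineq4[of "cv f \<kappa> x" "h x"] B[of x] C(2)[of x] by simp
    have "fourier (\<lambda>x. cv f \<kappa> x - h x) \<xi> = fourier (cv f \<kappa>) \<xi> - fourier h \<xi>" for \<xi>
      using fourier_sum[of "UNIV :: bool set" "\<lambda>b. if b then cv f \<kappa> else h" "\<lambda>b. if b then 1 else - 1" \<xi>]
        cv_integrable_fourier(1)[OF i(1,2)] i(3) by (simp add: UNIV_bool)
    then show "fourier (\<lambda>x. cv f \<kappa> x - h x) \<xi> = 0" for \<xi>
      using cv_integrable_fourier(2)[OF i(1,2)] eq by simp
  qed
  then show "cv f \<kappa> x = h x" by simp
qed

lemma fourier_dilate:
  fixes A :: "('d::{finite,linorder}) sqmat"
  assumes A: "invertible A" and f: "f \<in> borel_measurable borel"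
    and M: "\<And>x. (M *v \<xi>) \<bullet> (A *v x) = \<xi> \<bullet> x"
  shows "fourier (\<lambda>x. complex_of_real \<bar>Determinants.det A\<bar> * f (A *v x)) \<xi> = fourier f (M *v \<xi>)"
proof -
  let ?e = "\<lambda>x :: 'd rvec. exp (- (2 * complex_of_real pi * \<i> * complex_of_real ((M *v \<xi>) \<bullet> x)))"
  have "(\<lambda>x. f x * ?e x) \<in> borel_measurable borel" using f by measurable
  from integral_matrix[OF A this] show ?thesis unfolding fourier_def M by (simp add: mult.assoc)
qed

lemma fourier_reflect_cnj:
  assumes f: "f \<in> borel_measurable borel"
  shows "fourier (\<lambda>x. cnj (f (- x))) \<xi> = cnj (fourier f \<xi>)"
proof -
  have [measurable]: "f \<in> borel_measurable borel" by fact
  let ?h = "\<lambda>x. cnj (f x) * exp (2 * complex_of_real pi * \<i> * complex_of_real (\<xi> \<bullet> x))"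
  have [measurable]: "cnj \<in> borel_measurable borel" by (intro borel_measurable_continuous_onI continuous_intros)
  have [measurable]: "(\<lambda>x. exp (2 * complex_of_real pi * \<i> * complex_of_real (\<xi> \<bullet> x))) \<in> borel_measurable borel"
    by (intro borel_measurable_continuous_onI continuous_intros)
  have "?h \<in> borel_measurable borel" by measurable
  from integral_reflect[OF this, of 0]
  have "fourier (\<lambda>x. cnj (f (- x))) \<xi> = (LINT x|lborel. ?h x)" unfolding fourier_def by simp
  also have "\<dots> = (LINT x|lborel. cnj (f x * exp (- (2 * complex_of_real pi * \<i> * complex_of_real (\<xi> \<bullet> x)))))"
    by (simp add: exp_cnj)
  also have "\<dots> = cnj (fourier f \<xi>)" unfolding fourier_def by (rule Bochner_Integration.integral_cnj)
  finally show ?thesis .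
qed

section \<open>Commuting convolutions\<close>

lemma cv_measurable:
  assumes [measurable]: "g \<in> borel_measurable borel" "\<kappa> \<in> borel_measurable borel"
  shows "cv g \<kappa> \<in> borel_measurable borel"
proof -
  have "(\<lambda>x. LINT y|lborel. g y * \<kappa> (x - y)) \<in> borel_measurable lborel"
    by (rule lborel.borel_measurable_lebesgue_integral) measurable
  then show ?thesis by (simp add: cv_def[abs_def])
qed

lemma poly_growth_cv:
  assumes g: "poly_growth g" and \<kappa>: "\<kappa> \<in> schwartz"
  shows "poly_growth (cv g \<kappa>)"
proof -
  obtain C N where "\<And>x. (LINT y|lborel. norm (g y * \<kappa> (x - y))) \<le> C * weight x ^ N"
    using integrable_cv_bound(2)[OF g schwartz_measurable[OF \<kappa>] schwartz_decay_ex[OF \<kappa>]] by blast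
  then have "norm (cv g \<kappa> x) \<le> C * weight x ^ N" for x
    unfolding cv_def by (rule order_trans[OF integral_norm_bound])
  then show ?thesis
    using cv_measurable[OF poly_growth_measurable[OF g] schwartz_measurable[OF \<kappa>]] by (auto simp: poly_growth_def)
qed

text \<open>Fubini's theorem; the polynomial growth of \<open>g\<close> is absorbed by the decay of the two kernels.\<close>

lemma cv_cv:
  fixes g :: "('d::{finite,linorder}) cfun"
  assumes g: "poly_growth g" and \<kappa>: "\<kappa> \<in> schwartz" and \<theta>: "\<theta> \<in> schwartz"
  shows "cv (cv g \<kappa>) \<theta> x = (LINT z|lborel. g z * cv \<kappa> \<theta> (x - z))"
proof -
  have [measurable]: "g \<in> borel_measurable borel" "\<kappa> \<in> borel_measurable borel" "\<theta> \<in> borel_measurable borel"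
    using poly_growth_measurable[OF g] schwartz_measurable[OF \<kappa>] schwartz_measurable[OF \<theta>] by auto
  obtain C N where CN: "\<And>x. (LINT y|lborel. norm (g y * \<kappa> (x - y))) \<le> C * weight x ^ N"
    using integrable_cv_bound(2)[OF g schwartz_measurable[OF \<kappa>] schwartz_decay_ex[OF \<kappa>]] by blast
  let ?A = "\<lambda>y. LINT z|lborel. norm (g z * \<kappa> (y - z))"
  have Am: "?A \<in> borel_measurable lborel" by (rule lborel.borel_measurable_lebesgue_integral) measurable
  have A0: "?A y \<ge> 0" for y by (intro Bochner_Integration.integral_nonneg) simp
  have "poly_growth (\<lambda>y. complex_of_real (?A y))"
    unfolding poly_growth_def using Am CN A0 by (auto intro!: exI[of _ C] exI[of _ N])
  from cv_integrable[OF this \<theta>, of x] have i: "integrable lborel (\<lambda>y. complex_of_real (?A y) * \<theta> (x - y))" .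
  have pair: "integrable (lborel \<Otimes>\<^sub>M lborel) (\<lambda>(y, z). g z * \<kappa> (y - z) * \<theta> (x - y))"
  proof (rule lborel_pair.Fubini_integrable)
    show "(\<lambda>(y, z). g z * \<kappa> (y - z) * \<theta> (x - y)) \<in> borel_measurable (lborel \<Otimes>\<^sub>M lborel)" by measurable
    have eq: "(LINT z|lborel. norm (case (y, z) of (y, z) => g z * \<kappa> (y - z) * \<theta> (x - y)))
      = norm (complex_of_real (?A y) * \<theta> (x - y))" for y
      using A0[of y] by (simp add: norm_mult)
    show "integrable lborel (\<lambda>y. LINT z|lborel. norm (case (y, z) of (y, z) => g z * \<kappa> (y - z) * \<theta> (x - y)))"
      unfolding eq by (rule integrable_norm[OF i])
    show "AE y in lborel. integrable lborel (\<lambda>z. case (y, z) of (y, z) => g z * \<kappa> (y - z) * \<theta> (x - y))"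
      using cv_integrable[OF g \<kappa>] by simp
  qed
  have "cv (cv g \<kappa>) \<theta> x = (LINT y|lborel. LINT z|lborel. g z * \<kappa> (y - z) * \<theta> (x - y))"
    unfolding cv_def by simp
  also have "\<dots> = (LINT z|lborel. LINT y|lborel. g z * \<kappa> (y - z) * \<theta> (x - y))"
    using lborel_pair.Fubini_integral[OF pair] by simp
  also have "\<dots> = (LINT z|lborel. g z * cv \<kappa> \<theta> (x - z))"
  proof (rule Bochner_Integration.integral_cong[OF refl])
    fix z
    have "(LINT y|lborel. \<kappa> (y - z) * \<theta> (x - y)) = (LINT y|lborel. \<kappa> (x - y - z) * \<theta> (x - (x - y)))"
      by (rule integral_reflect[symmetric]) measurable
    also have "\<dots> = cv \<kappa> \<theta> (x - z)" by (subst cv_flip) (auto simp: algebra_simps)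
    finally show "(LINT y|lborel. g z * \<kappa> (y - z) * \<theta> (x - y)) = g z * cv \<kappa> \<theta> (x - z)"
      by (simp add: mult.assoc)
  qed
  finally show ?thesis .
qed

lemma cv_cv_commute:
  fixes g :: "('d::{finite,linorder}) cfun"
  assumes "poly_growth g" "\<kappa> \<in> schwartz" "\<theta> \<in> schwartz"
  shows "cv (cv g \<kappa>) \<theta> = cv (cv g \<theta>) \<kappa>"
  using cv_cv[OF assms] cv_cv[OF assms(1,3,2)]
    cv_commute[OF schwartz_measurable[OF assms(2)] schwartz_measurable[OF assms(3)]] by (simp add: fun_eq_iff)

section \<open>Lebesgue quasi-norms\<close>

text \<open>The power function inside \<open>Lnorm\<close>, with \<open>\<infinity>\<close> as a fixed point.\<close>

definition epow :: "ennreal => real => ennreal" where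
  "epow t s = (if t = \<infinity> then \<infinity> else ennreal (enn2real t powr s))"

lemma Lnorm_top: "Lnorm M \<infinity> g = esssup M g"
  by (simp add: Lnorm_def)

lemma Lnorm_real: "a > 0 ==> Lnorm M (ennreal a) g = epow (\<integral>\<^sup>+x. epow (g x) a \<partial>M) (1 / a)"
  by (simp add: Lnorm_def epow_def)

lemma epow_ennreal [simp]: "x \<ge> 0 ==> epow (ennreal x) s = ennreal (x powr s)"
  by (simp add: epow_def)

lemma epow_top [simp]: "epow \<infinity> s = \<infinity>" "epow Orderings.top s = \<infinity>"
  by (simp_all add: epow_def)

lemma epow_mono: assumes "t \<le> t'" "s \<ge> 0" shows "epow t s \<le> epow t' s"
proof (cases "t' = \<infinity>")
  case False
  then have "t \<noteq> \<infinity>" using assms(1) by (auto simp: top_unique)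
  moreover have "enn2real t powr s \<le> enn2real t' powr s"
    using assms False by (intro powr_mono2 enn2real_mono) (auto simp: less_top)
  ultimately show ?thesis using False by (simp add: epow_def ennreal_leI)
qed simp

lemma epow_epow: assumes "s > 0" "u > 0" shows "epow (epow t s) u = epow t (s * u)"
  by (cases t) (auto simp: powr_powr)

lemma epow_1 [simp]: "epow t 1 = t"
  by (cases t) auto

lemma epow_le_iff:
  assumes "s > 0" "c \<ge> 0" shows "epow t (1 / s) \<le> ennreal c \<longleftrightarrow> t \<le> ennreal (c powr s)"
proof
  assume "epow t (1 / s) \<le> ennreal c"
  then have "epow (epow t (1 / s)) s \<le> epow (ennreal c) s" using assms by (intro epow_mono) auto
  then show "t \<le> ennreal (c powr s)" using assms by (simp add: epow_epow)
next
  assume "t \<le> ennreal (c powr s)"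
  then have "epow t (1 / s) \<le> epow (ennreal (c powr s)) (1 / s)" using assms by (intro epow_mono) auto
  then show "epow t (1 / s) \<le> ennreal c" using assms by (simp add: powr_powr)
qed

lemma epow_mult: assumes "s > 0" shows "epow (t * u) s = epow t s * epow u s"
proof (cases "t = 0 \<or> u = 0")
  case False
  then show ?thesis
    by (cases t; cases u) (auto simp: ennreal_mult[symmetric] powr_mult ennreal_mult_top ennreal_top_mult)
qed (use assms in \<open>auto simp: epow_def\<close>)

lemma Lp_norm_real:
  "a > 0 ==> Lp_norm (ennreal a) f = epow (\<integral>\<^sup>+x. ennreal (norm (f x) powr a) \<partial>lborel) (1 / a)"
  by (simp add: Lp_norm_def Lnorm_real)

lemma Lp_norm_real_le_iff:
  assumes "a > 0" "c \<ge> 0"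
  shows "Lp_norm (ennreal a) f \<le> ennreal c \<longleftrightarrow> (\<integral>\<^sup>+x. ennreal (norm (f x) powr a) \<partial>lborel) \<le> ennreal (c powr a)"
  unfolding Lp_norm_real[OF assms(1)] by (rule epow_le_iff[OF assms])

lemma Lp_norm_top_leI:
  assumes "f \<in> borel_measurable borel" "\<And>x. norm (f x) \<le> c"
  shows "Lp_norm \<infinity> f \<le> ennreal c"
  unfolding Lp_norm_def Lnorm_top
  using assms by (intro esssup_I) (auto intro!: ennreal_leI)

lemma Lp_norm_top_AE:
  assumes "Lp_norm \<infinity> f \<le> ennreal c" "c \<ge> 0"
  shows "AE x in lborel. norm (f x) \<le> c"
proof -
  have "AE x in lborel. ennreal (norm (f x)) \<le> Lp_norm \<infinity> f"
    unfolding Lp_norm_def Lnorm_top by (rule esssup_AE)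
  then show ?thesis using assms by (auto elim!: eventually_mono dest: order_trans)
qed

lemma ennreal_exponent_cases:
  assumes "(0::ennreal) < q"
  obtains "q = \<infinity>" | a where "a > 0" "q = ennreal a"
proof (cases q)
  case (real r)
  then have "r > 0" using assms by (simp add: ennreal_less_zero_iff)
  then show ?thesis using that(2)[of r] real by simp
qed (use that in simp)

section \<open>A Bernstein-Nikolskii inequality\<close>

text \<open>Jensen's inequality for a measure of total mass at most \<open>W\<close>. It is derived from Young's inequality with
  a free parameter, so that no integrability has to be assumed.\<close>

lemma jensen_weighted:
  fixes H w :: "'a => real"
  assumes a: "a \<ge> 1" and E: "E \<ge> 0" "ennreal E \<le> (\<integral>\<^sup>+y. ennreal (H y * w y) \<partial>M)"
    and [measurable]: "H \<in> borel_measurable M" "w \<in> borel_measurable M"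
    and H: "\<And>y. H y \<ge> 0" and w: "\<And>y. w y \<ge> 0"
    and W: "(\<integral>\<^sup>+y. ennreal (w y) \<partial>M) \<le> ennreal W" "W > 0"
  shows "ennreal (E powr a) \<le> ennreal (W powr (a - 1)) * (\<integral>\<^sup>+y. ennreal (H y powr a * w y) \<partial>M)"
proof (cases "\<integral>\<^sup>+y. ennreal (H y powr a * w y) \<partial>M")
  case top
  then show ?thesis using W(2) by (simp add: ennreal_mult_top)
next
  case (real J)
  have young: "h \<le> \<tau> powr (1 - a) / a * h powr a + (1 - 1 / a) * \<tau>" if "h \<ge> 0" "\<tau> > 0" for h \<tau>
  proof (cases "h = 0")
    case True
    then show ?thesis using that a by simp
  next
    case False
    have "(h powr a * \<tau> powr (1 - a)) powr (1 / a) * \<tau> powr (1 - 1 / a) \<le> (1 / a) * (h powr a * \<tau> powr (1 - a)) + (1 - 1 / a) * \<tau>"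
      using that False a by (intro Youngs_inequality_0) auto
    moreover have "(h powr a * \<tau> powr (1 - a)) powr (1 / a) * \<tau> powr (1 - 1 / a) = h"
    proof -
      have "(h powr a * \<tau> powr (1 - a)) powr (1 / a) * \<tau> powr (1 - 1 / a) = h * (\<tau> powr ((1 - a) / a) * \<tau> powr (1 - 1 / a))"
        using that False a by (simp add: powr_mult powr_powr)
      also have "\<tau> powr ((1 - a) / a) * \<tau> powr (1 - 1 / a) = 1"
        using that a by (simp add: powr_add[symmetric] diff_divide_distrib)
      finally show ?thesis by simp
    qed
    ultimately show ?thesis by (simp add: mult_ac)
  qed
  have main: "E \<le> W powr (1 - 1 / a) * J' powr (1 / a)" if J': "J' > 0" "J \<le> J'" for J'
  proof -
    define \<tau> where "\<tau> = (J' / W) powr (1 / a)"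
    have \<tau>: "\<tau> > 0" using J' W by (simp add: \<tau>_def)
    have "ennreal E \<le> (\<integral>\<^sup>+y. ennreal (\<tau> powr (1 - a) / a) * ennreal (H y powr a * w y) + ennreal ((1 - 1 / a) * \<tau>) * ennreal (w y) \<partial>M)"
    proof (rule order_trans[OF E(2)], rule nn_integral_mono)
      fix y
      have "H y * w y \<le> (\<tau> powr (1 - a) / a * H y powr a + (1 - 1 / a) * \<tau>) * w y"
        by (intro mult_right_mono young H \<tau> w)
      also have "\<dots> = (\<tau> powr (1 - a) / a) * (H y powr a * w y) + ((1 - 1 / a) * \<tau>) * w y"
        by (simp add: algebra_simps)
      finally show "ennreal (H y * w y) \<le> ennreal (\<tau> powr (1 - a) / a) * ennreal (H y powr a * w y) + ennreal ((1 - 1 / a) * \<tau>) * ennreal (w y)"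
        using a \<tau> H w by (simp add: ennreal_mult[symmetric] ennreal_plus[symmetric] ennreal_leI del: ennreal_plus)
    qed
    also have "\<dots> = ennreal (\<tau> powr (1 - a) / a) * ennreal J + ennreal ((1 - 1 / a) * \<tau>) * (\<integral>\<^sup>+y. ennreal (w y) \<partial>M)"
      by (subst nn_integral_add) (auto simp: nn_integral_cmult real)
    also have "\<dots> \<le> ennreal (\<tau> powr (1 - a) / a) * ennreal J' + ennreal ((1 - 1 / a) * \<tau>) * ennreal W"
      using J' W by (intro add_mono mult_left_mono ennreal_leI) auto
    also have "\<dots> = ennreal (\<tau> powr (1 - a) / a * J' + (1 - 1 / a) * \<tau> * W)"
      using a \<tau> J' W by (simp add: ennreal_mult[symmetric] ennreal_plus[symmetric] del: ennreal_plus)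
    finally have "E \<le> \<tau> powr (1 - a) / a * J' + (1 - 1 / a) * \<tau> * W"
      using a \<tau> J' W by (subst (asm) ennreal_le_iff) auto
    also have "\<tau> powr (1 - a) * J' = \<tau> * W"
    proof -
      have "\<tau> powr (1 - a) = \<tau> * \<tau> powr (- a)" using \<tau> by (simp add: powr_diff powr_minus divide_inverse)
      moreover have "\<tau> powr (- a) = W / J'" using a J' W by (simp add: \<tau>_def powr_powr powr_minus)
      ultimately show ?thesis using J' by simp
    qed
    then have "\<tau> powr (1 - a) / a * J' + (1 - 1 / a) * \<tau> * W = \<tau> * W"
      using a by (simp add: field_simps)
    also have "\<tau> * W = W powr (1 - 1 / a) * J' powr (1 / a)"
      using J' W by (simp add: \<tau>_def powr_divide powr_diff)
    finally show ?thesis .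
  qed
  have "E powr a \<le> W powr (a - 1) * J + e" if e: "e > 0" for e
  proof -
    let ?J = "J + e / W powr (a - 1)"
    have J': "?J > 0" "J \<le> ?J" using e W real by (auto intro: add_nonneg_pos)
    have "E powr a \<le> (W powr (1 - 1 / a) * ?J powr (1 / a)) powr a"
      using E a by (intro powr_mono2 main J') auto
    also have "\<dots> = W powr (a - 1) * ?J"
      using a W J'(1) by (simp add: powr_mult powr_powr left_diff_distrib)
    also have "\<dots> = W powr (a - 1) * J + e" using W by (simp add: field_simps)
    finally show ?thesis .
  qed
  then have "E powr a \<le> W powr (a - 1) * J" by (rule field_le_epsilon)
  then have "ennreal (E powr a) \<le> ennreal (W powr (a - 1) * J)" by (rule ennreal_leI)
  also have "\<dots> = ennreal (W powr (a - 1)) * ennreal J" using real by (intro ennreal_mult) auto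
  finally show ?thesis using real by simp
qed

definition weight_mass :: "'d::finite itself => real" where
  "weight_mass _ = (LINT x|lborel. 1 / weight (x :: 'd rvec))"

lemma nn_integral_weight_shift:
  "(\<integral>\<^sup>+y. ennreal (1 / weight (x - y :: 'd::finite rvec)) \<partial>lborel) = ennreal (weight_mass TYPE('d))"
proof -
  have "(\<integral>\<^sup>+y. ennreal (1 / weight (x - y :: 'd rvec)) \<partial>lborel) = (\<integral>\<^sup>+y. ennreal (1 / weight (y :: 'd rvec)) \<partial>lborel)"
    by (rule nn_integral_reflect) measurable
  also have "\<dots> = ennreal (weight_mass TYPE('d))"
    unfolding weight_mass_def by (rule nn_integral_eq_integral[OF integrable_inverse_weight]) simp
  finally show ?thesis .
qed

lemma nn_integral_weight_shift':
  "(\<integral>\<^sup>+x. ennreal (1 / weight (x - y :: 'd::finite rvec)) \<partial>lborel) = ennreal (weight_mass TYPE('d))"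
  using nn_integral_weight_shift[of y] by (simp add: weight_diff_commute)

lemma weight_mass_nonneg: "weight_mass TYPE('d::finite) \<ge> 0"
  unfolding weight_mass_def by (intro Bochner_Integration.integral_nonneg) simp

lemma weight_powr_le:
  assumes "real N * s \<ge> 1" shows "weight x powr (- (real N * s)) \<le> 1 / weight x"
proof -
  have "weight x powr (- (real N * s)) \<le> weight x powr (-1)"
    using assms weight_ge_1[of x] by (intro powr_mono) auto
  then show ?thesis by (simp add: powr_minus_divide)
qed

text \<open>The idea for exponents below 1: writing \<open>H = H^s H^(1 - s)\<close> inside the reproducing inequality and
  estimating the second factor by the weighted supremum \<open>m\<close> (Peetre's maximal function at \<open>x\<close>) gives
  \<open>m \<le> const m^(1 - s) I\<close>. Since \<open>m\<close> is finite by polynomial growth, it can be divided out.\<close>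

lemma peetre_maximal_bound:
  fixes H :: "'d::finite rvec => real"
  assumes H: "\<And>y. H y \<ge> 0" "\<And>y. H y \<le> K * weight y ^ N" and [measurable]: "H \<in> borel_measurable borel"
    and s: "0 < s" "s \<le> 1" and c: "c > 0"
    and rep: "\<And>x. ennreal (H x) \<le> (\<integral>\<^sup>+y. ennreal (H y * (c / weight (x - y) ^ N)) \<partial>lborel)"
    and I: "(\<integral>\<^sup>+y. ennreal (H y powr s * weight (x - y) powr (- (real N * s))) \<partial>lborel) = ennreal I" "I \<ge> 0"
  obtains m where "m \<ge> 0" "\<And>y. H y \<le> m * weight (x - y) ^ N" "m powr s \<le> c * 2 ^ (CARD('d) * N) * I"
proof -
  let ?h = "\<lambda>y. H y / weight (x - y) ^ N"
  define m where "m = (SUP y. ?h y)"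
  have bdd: "bdd_above (range ?h)"
  proof (rule bdd_aboveI2)
    fix y
    have K: "K \<ge> 0" using order_trans[OF H(1) H(2)[of 0]] by simp
    have "H y \<le> K * (2 ^ (CARD('d) * N) * weight x ^ N * weight (x - y) ^ N)"
      using H(2)[of y] weight_power_le_shift[of y N x] K by (meson mult_left_mono order_trans)
    then show "?h y \<le> K * (2 ^ (CARD('d) * N) * weight x ^ N)"
      by (simp add: pos_divide_le_eq mult_ac)
  qed
  have up: "?h y \<le> m" for y unfolding m_def by (rule cSUP_upper[OF _ bdd]) simp
  have m0: "m \<ge> 0" using up[of x] H(1)[of x] by (simp add: order_trans)
  have Hm: "H y \<le> m * weight (x - y) ^ N" for y
    using up[of y] by (simp add: pos_divide_le_eq)
  let ?B = "c * 2 ^ (CARD('d) * N)"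
  have step: "?h z \<le> ?B * m powr (1 - s) * I" if m: "m > 0" for z
  proof -
    have "ennreal (H z) \<le> (\<integral>\<^sup>+y. ennreal (?B * m powr (1 - s) * weight (x - z) ^ N)
        * ennreal (H y powr s * weight (x - y) powr (- (real N * s))) \<partial>lborel)"
    proof (rule order_trans[OF rep], rule nn_integral_mono)
      fix y
      have "H y = H y powr s * H y powr (1 - s)" using H(1)[of y] by (simp add: powr_add[symmetric])
      also have "\<dots> \<le> H y powr s * (m * weight (x - y) ^ N) powr (1 - s)"
        using H(1) Hm s by (intro mult_left_mono powr_mono2) auto
      also have "(m * weight (x - y) ^ N) powr (1 - s) = m powr (1 - s) * (weight (x - y) ^ N * weight (x - y) powr (- (real N * s)))"
        using m by (simp add: powr_mult powr_realpow[symmetric] powr_powr powr_add[symmetric] right_diff_distrib)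
      finally have 1: "H y \<le> H y powr s * m powr (1 - s) * weight (x - y) powr (- (real N * s)) * weight (x - y) ^ N"
        by (simp add: mult_ac)
      have "weight (x - y) ^ N \<le> 2 ^ (CARD('d) * N) * weight (x - z) ^ N * weight (z - y) ^ N"
        using weight_add_power[of "x - z" "z - y" N] by simp
      then have "H y powr s * m powr (1 - s) * weight (x - y) powr (- (real N * s)) * weight (x - y) ^ N
        \<le> H y powr s * m powr (1 - s) * weight (x - y) powr (- (real N * s)) * (2 ^ (CARD('d) * N) * weight (x - z) ^ N * weight (z - y) ^ N)"
        by (intro mult_left_mono) auto
      with 1 have "H y * (c / weight (z - y) ^ N) \<le> H y powr s * m powr (1 - s) * weight (x - y) powr (- (real N * s))
        * (2 ^ (CARD('d) * N) * weight (x - z) ^ N * weight (z - y) ^ N) * (c / weight (z - y) ^ N)"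
        using c by (intro mult_right_mono) auto
      also have "\<dots> = ?B * m powr (1 - s) * weight (x - z) ^ N * (H y powr s * weight (x - y) powr (- (real N * s)))"
        by simp
      finally show "ennreal (H y * (c / weight (z - y) ^ N)) \<le> ennreal (?B * m powr (1 - s) * weight (x - z) ^ N)
        * ennreal (H y powr s * weight (x - y) powr (- (real N * s)))"
        using c by (simp add: ennreal_mult[symmetric] ennreal_leI)
    qed
    also have "\<dots> = ennreal (?B * m powr (1 - s) * weight (x - z) ^ N * I)"
      using c I by (subst nn_integral_cmult) (simp_all add: ennreal_mult[symmetric])
    finally have "H z \<le> ?B * m powr (1 - s) * weight (x - z) ^ N * I"
      using c I by (subst (asm) ennreal_le_iff) auto
    then show ?thesis by (simp add: pos_divide_le_eq mult_ac)
  qed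
  have "m powr s \<le> ?B * I"
  proof (cases "m = 0")
    case False
    then have m: "m > 0" using m0 by simp
    have "m \<le> ?B * m powr (1 - s) * I" unfolding m_def by (rule cSUP_least) (use step[OF m] in \<open>auto simp: m_def\<close>)
    then have "m powr s * m powr (1 - s) \<le> (?B * I) * m powr (1 - s)"
      using m by (simp add: powr_add[symmetric] mult_ac)
    then show ?thesis using m by simp
  qed (use c I in simp)
  then show ?thesis using that[OF m0 Hm] by blast
qed

text \<open>The maximal function bounds \<open>E\<close> by the weighted mean of \<open>H^s\<close>, and Jensen's inequality raises the exponent
  from \<open>s\<close> to \<open>a\<close>.\<close>

lemma bernstein_pointwise:
  fixes H :: "'d::finite rvec => real"
  assumes H: "\<And>y. H y \<ge> 0" "\<And>y. H y \<le> K * weight y ^ N" and [measurable]: "H \<in> borel_measurable borel"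
    and s: "0 < s" "s \<le> 1" "real N * s \<ge> 1" and c: "c > 0"
    and rep: "\<And>x. ennreal (H x) \<le> (\<integral>\<^sup>+y. ennreal (H y * (c / weight (x - y) ^ N)) \<partial>lborel)"
    and a: "s \<le> a" and D: "D > 0"
    and E: "E \<ge> 0" "ennreal E \<le> (\<integral>\<^sup>+y. ennreal (H y * (D / weight (x - y) ^ Suc N)) \<partial>lborel)"
  defines "W \<equiv> weight_mass TYPE('d) + 1"
  defines "\<kappa> \<equiv> (D * W) powr s * (c * 2 ^ (CARD('d) * N))"
  shows "ennreal (E powr a) \<le> ennreal (\<kappa> powr (a / s) * W powr (a / s - 1))
    * (\<integral>\<^sup>+y. ennreal (H y powr a * weight (x - y) powr (- (real N * s))) \<partial>lborel)"
proof -
  let ?w = "\<lambda>y. weight (x - y) powr (- (real N * s))"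
  have W: "W > 0" using weight_mass_nonneg[where 'd = 'd] by (simp add: W_def)
  have \<kappa>: "\<kappa> > 0" unfolding \<kappa>_def using D W c by (intro mult_pos_pos) auto
  have "ennreal (E powr s / \<kappa>) \<le> (\<integral>\<^sup>+y. ennreal (H y powr s * ?w y) \<partial>lborel)"
  proof (cases "\<integral>\<^sup>+y. ennreal (H y powr s * ?w y) \<partial>lborel")
    case (real J)
    obtain m where m: "m \<ge> 0" "\<And>y. H y \<le> m * weight (x - y) ^ N" "m powr s \<le> c * 2 ^ (CARD('d) * N) * J"
      using peetre_maximal_bound[OF H _ s(1,2) c rep real(2,1)] by auto
    have "ennreal E \<le> (\<integral>\<^sup>+y. ennreal (m * D) * ennreal (1 / weight (x - y)) \<partial>lborel)"
    proof (rule order_trans[OF E(2)], rule nn_integral_mono)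
      fix y
      have "H y * (D / weight (x - y) ^ Suc N) \<le> (m * weight (x - y) ^ N) * (D / weight (x - y) ^ Suc N)"
        using m D by (intro mult_right_mono) auto
      also have "\<dots> = m * D * (1 / weight (x - y))" by simp
      finally show "ennreal (H y * (D / weight (x - y) ^ Suc N)) \<le> ennreal (m * D) * ennreal (1 / weight (x - y))"
        using m D by (subst ennreal_mult[symmetric]) (auto intro!: ennreal_leI)
    qed
    also have "\<dots> = ennreal (m * D * weight_mass TYPE('d))"
      using m D weight_mass_nonneg[where 'd = 'd]
      by (subst nn_integral_cmult) (simp_all add: nn_integral_weight_shift ennreal_mult[symmetric])
    also have "\<dots> \<le> ennreal (m * D * W)" using m D by (intro ennreal_leI mult_left_mono) (auto simp: W_def)
    finally have "E \<le> m * (D * W)" using m D W by (subst (asm) ennreal_le_iff) (auto simp: mult.assoc)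
    then have "E powr s \<le> (m * (D * W)) powr s" using E s by (intro powr_mono2) auto
    also have "\<dots> = (D * W) powr s * m powr s" using m D W by (simp add: powr_mult mult_ac)
    also have "\<dots> \<le> (D * W) powr s * (c * 2 ^ (CARD('d) * N) * J)" using m(3) by (intro mult_left_mono) auto
    also have "\<dots> = J * \<kappa>" by (simp add: \<kappa>_def)
    finally have "E powr s / \<kappa> \<le> J" using \<kappa> by (simp add: pos_divide_le_eq)
    then show ?thesis using real by (simp add: ennreal_leI)
  qed simp
  from jensen_weighted[of "a / s", OF _ _ this _ _ _ _ _ W] s a \<kappa>
  have "ennreal ((E powr s / \<kappa>) powr (a / s)) \<le> ennreal (W powr (a / s - 1)) * (\<integral>\<^sup>+y. ennreal ((H y powr s) powr (a / s) * ?w y) \<partial>lborel)"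
  proof -
    have "(\<integral>\<^sup>+y. ennreal (?w y) \<partial>lborel) \<le> (\<integral>\<^sup>+y. ennreal (1 / weight (x - y)) \<partial>lborel)"
      by (intro nn_integral_mono ennreal_leI weight_powr_le s)
    also have "\<dots> \<le> ennreal W" unfolding nn_integral_weight_shift by (intro ennreal_leI) (simp add: W_def)
    finally have Ww: "(\<integral>\<^sup>+y. ennreal (?w y) \<partial>lborel) \<le> ennreal W" .
    show ?thesis
      by (rule jensen_weighted[OF _ _ \<open>ennreal (E powr s / \<kappa>) \<le> _\<close> _ _ _ _ Ww W]) (use s a \<kappa> in auto)
  qed
  then have j: "ennreal (E powr a / \<kappa> powr (a / s)) \<le> ennreal (W powr (a / s - 1)) * (\<integral>\<^sup>+y. ennreal (H y powr a * ?w y) \<partial>lborel)"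
    using s E \<kappa> H by (simp add: powr_divide powr_powr)
  have "ennreal (E powr a) = ennreal (\<kappa> powr (a / s)) * ennreal (E powr a / \<kappa> powr (a / s))"
    using \<kappa> by (subst ennreal_mult[symmetric]) auto
  also have "\<dots> \<le> ennreal (\<kappa> powr (a / s)) * (ennreal (W powr (a / s - 1)) * (\<integral>\<^sup>+y. ennreal (H y powr a * ?w y) \<partial>lborel))"
    by (intro mult_left_mono j) simp
  finally show ?thesis by (simp add: ennreal_mult mult.assoc)
qed

text \<open>The pointwise bound with \<open>a = p\<close>, where the weight is at most 1, controls the supremum of \<open>E\<close>. With \<open>a = q\<close>
  and integrated over \<open>x\<close> it controls the \<open>L^q\<close> norm of \<open>E\<close> by that of \<open>H\<close>, and the supremum bound applied to \<open>H\<close>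
  itself turns the \<open>L^q\<close> norm of \<open>H\<close> into its \<open>L^p\<close> norm.\<close>

lemma bernstein_nikolskii_real:
  fixes c :: "nat => real"
  assumes p: "0 < p" "p \<le> q" and c: "\<And>N. c N > 0"
  shows "\<exists>N C. C > 0 \<and> (\<forall>(H :: 'd::finite rvec => real) E S. H \<in> borel_measurable borel \<longrightarrow> (\<forall>y. H y \<ge> 0) \<longrightarrow>
     (\<exists>K M. \<forall>y. H y \<le> K * weight y ^ M) \<longrightarrow>
     (\<forall>N x. ennreal (H x) \<le> (\<integral>\<^sup>+y. ennreal (H y * (c N / weight (x - y) ^ N)) \<partial>lborel)) \<longrightarrow>
     (\<forall>x. E x \<ge> 0) \<longrightarrow>
     (\<forall>x. ennreal (E x) \<le> (\<integral>\<^sup>+y. ennreal (H y * (1 / weight (x - y) ^ N)) \<partial>lborel)) \<longrightarrow>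
     S \<ge> 0 \<longrightarrow> (\<integral>\<^sup>+y. ennreal (H y powr p) \<partial>lborel) \<le> ennreal (S powr p) \<longrightarrow>
     (\<forall>x. E x \<le> C * S) \<and> (\<integral>\<^sup>+x. ennreal (E x powr q) \<partial>lborel) \<le> ennreal ((C * S) powr q))"
proof -
  define s where "s = min 1 p"
  have s: "0 < s" "s \<le> 1" "s \<le> p" "s \<le> q" using p by (auto simp: s_def)
  define W where "W = weight_mass TYPE('d) + 1"
  have W: "W > 0" using weight_mass_nonneg[where 'd = 'd] by (simp add: W_def)
  define cst where "cst = (\<lambda>a D N. ((D * W) powr s * (c N * 2 ^ (CARD('d) * N))) powr (a / s) * W powr (a / s - 1))"
  define N0 where "N0 = nat \<lceil>1 / s\<rceil>"
  have N0: "real N0 * s \<ge> 1"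
  proof -
    have "real N0 \<ge> 1 / s" unfolding N0_def by (rule real_nat_ceiling_ge)
    then show ?thesis using s by (simp add: pos_divide_le_eq)
  qed
  define C0 where "C0 = cst p (c (Suc N0)) N0 powr (1 / p)"
  define C1 where "C1 = cst p 1 N0 powr (1 / p)"
  define C2 where "C2 = (cst q 1 N0 * W * C0 powr (q - p)) powr (1 / q)"
  have cst0: "cst a D N \<ge> 0" for a D N by (simp add: cst_def)
  define C where "C = 1 + C1 + C2"
  have C: "C > 0" "C1 \<le> C" "C2 \<le> C" by (auto simp: C_def C1_def C2_def add_pos_nonneg)
  have main: "(\<forall>x. E x \<le> C * S) \<and> (\<integral>\<^sup>+x. ennreal (E x powr q) \<partial>lborel) \<le> ennreal ((C * S) powr q)"
    if [measurable]: "H \<in> borel_measurable borel" and H0: "\<And>y. H y \<ge> 0" and gr: "\<exists>K M. \<forall>y. H y \<le> K * weight y ^ M"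
      and rep: "\<And>N x. ennreal (H x) \<le> (\<integral>\<^sup>+y. ennreal (H y * (c N / weight (x - y) ^ N)) \<partial>lborel)"
      and E0: "\<And>x. E x \<ge> 0" and E: "\<And>x. ennreal (E x) \<le> (\<integral>\<^sup>+y. ennreal (H y * (1 / weight (x - y) ^ Suc N0)) \<partial>lborel)"
      and S: "S \<ge> 0" "(\<integral>\<^sup>+y. ennreal (H y powr p) \<partial>lborel) \<le> ennreal (S powr p)"
    for H :: "'d rvec => real" and E S
  proof -
    have wle: "weight z powr (- (real N * s)) \<le> 1" for z :: "'d rvec" and N
      using powr_mono[of "- (real N * s)" 0 "weight z"] weight_ge_1[of z] s by simp
    have Iw: "(\<integral>\<^sup>+y. ennreal (H y powr p * weight (x - y) powr (- (real N * s))) \<partial>lborel) \<le> ennreal (S powr p)" for x N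
    proof (rule order_trans[OF nn_integral_mono S(2)])
      fix y show "ennreal (H y powr p * weight (x - y) powr (- (real N * s))) \<le> ennreal (H y powr p)"
        using mult_left_mono[OF wle[where N = N and z = "x - y"], of "H y powr p"] by (intro ennreal_leI) simp
    qed
    have sup: "e \<le> cst p D N powr (1 / p) * S"
      if "\<And>y. H y \<le> K * weight y ^ N" "real N * s \<ge> 1" "D > 0" "e \<ge> 0"
        "ennreal e \<le> (\<integral>\<^sup>+y. ennreal (H y * (D / weight (x - y) ^ Suc N)) \<partial>lborel)" for K N D x e
    proof -
      have "ennreal (e powr p) \<le> ennreal (cst p D N) * (\<integral>\<^sup>+y. ennreal (H y powr p * weight (x - y) powr (- (real N * s))) \<partial>lborel)"
        unfolding cst_def W_def
        by (rule bernstein_pointwise[OF H0 that(1) _ s(1,2) that(2) c rep s(3) that(3,4,5)]) simp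
      also have "\<dots> \<le> ennreal (cst p D N) * ennreal (S powr p)" by (intro mult_left_mono Iw) simp
      also have "\<dots> = ennreal (cst p D N * S powr p)" using cst0 by (intro ennreal_mult[symmetric]) auto
      finally have "e powr p \<le> cst p D N * S powr p" using cst0 by (subst (asm) ennreal_le_iff) auto
      then have "(e powr p) powr (1 / p) \<le> (cst p D N * S powr p) powr (1 / p)" using p by (intro powr_mono2) auto
      then show ?thesis using p that(4) S(1) cst0 by (simp add: powr_powr powr_mult)
    qed
    obtain K M where KM: "\<And>y. H y \<le> K * weight y ^ M" using gr by blast
    have K0: "K \<ge> 0" using order_trans[OF H0 KM[of 0]] by simp
    define N1 where "N1 = max M N0"
    have N1: "real N1 * s \<ge> 1"
    proof -
      have "real N0 * s \<le> real N1 * s" unfolding N1_def using s by (intro mult_right_mono) auto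
      with N0 show ?thesis by linarith
    qed
    have KM1: "H y \<le> K * weight y ^ N1" for y
      using KM[of y] mult_left_mono[OF power_increasing[of M N1 "weight y"] K0] weight_ge_1[of y] by (simp add: N1_def)
    have Hb1: "H x \<le> cst p (c (Suc N1)) N1 powr (1 / p) * S" for x
      by (rule sup[OF KM1 N1 c H0 rep])
    let ?K = "cst p (c (Suc N1)) N1 powr (1 / p) * S"
    have K': "?K \<ge> 0" using S by simp
    have Hb2: "H y \<le> ?K * weight y ^ N0" for y
      using Hb1[of y] mult_left_mono[OF one_le_power[OF weight_ge_1], of ?K y N0] K' by simp
    have Hb: "H x \<le> C0 * S" for x unfolding C0_def by (rule sup[OF Hb2 N0 c H0 rep])
    have Eb: "E x \<le> C1 * S" for x unfolding C1_def
      by (rule sup[OF Hb2 N0 _ E0 E]) simp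
    have "E x \<le> C * S" for x using Eb[of x] mult_right_mono[OF C(2) S(1)] by linarith
    moreover have "(\<integral>\<^sup>+x. ennreal (E x powr q) \<partial>lborel) \<le> ennreal ((C * S) powr q)"
    proof -
      let ?w = "\<lambda>z. weight z powr (- (real N0 * s))"
      have "(\<integral>\<^sup>+x. ennreal (E x powr q) \<partial>lborel)
        \<le> (\<integral>\<^sup>+x. ennreal (cst q 1 N0) * (\<integral>\<^sup>+y. ennreal (H y powr q * ?w (x - y)) \<partial>lborel) \<partial>lborel)"
        unfolding cst_def W_def
        by (intro nn_integral_mono bernstein_pointwise[OF H0 Hb2 _ s(1,2) N0 c rep s(4) _ E0 E]) auto
      also have "\<dots> = ennreal (cst q 1 N0) * (\<integral>\<^sup>+x. (\<integral>\<^sup>+y. ennreal (H y powr q * ?w (x - y)) \<partial>lborel) \<partial>lborel)"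
        by (rule nn_integral_cmult) measurable
      also have "(\<integral>\<^sup>+x. (\<integral>\<^sup>+y. ennreal (H y powr q * ?w (x - y)) \<partial>lborel) \<partial>lborel)
        = (\<integral>\<^sup>+y. (\<integral>\<^sup>+x. ennreal (H y powr q * ?w (x - y)) \<partial>lborel) \<partial>lborel)"
        by (rule lborel_pair.Fubini') measurable
      also have "\<dots> \<le> (\<integral>\<^sup>+y. ennreal ((C0 * S) powr (q - p)) * ennreal (H y powr p) * ennreal W \<partial>lborel)"
      proof (rule nn_integral_mono)
        fix y
        have "(\<integral>\<^sup>+x. ennreal (H y powr q * ?w (x - y)) \<partial>lborel) = ennreal (H y powr q) * (\<integral>\<^sup>+x. ennreal (?w (x - y)) \<partial>lborel)"
          by (subst nn_integral_cmult[symmetric]) (auto simp: ennreal_mult)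
        also have "\<dots> \<le> ennreal ((C0 * S) powr (q - p) * H y powr p) * ennreal W"
        proof (intro mult_mono ennreal_leI)
          have "H y powr q = H y powr (q - p) * H y powr p" using H0[of y] by (simp add: powr_add[symmetric])
          also have "\<dots> \<le> (C0 * S) powr (q - p) * H y powr p"
            using p H0 Hb by (intro mult_right_mono powr_mono2) auto
          finally show "H y powr q \<le> (C0 * S) powr (q - p) * H y powr p" .
          have "(\<integral>\<^sup>+x. ennreal (?w (x - y)) \<partial>lborel) \<le> (\<integral>\<^sup>+x. ennreal (1 / weight (x - y)) \<partial>lborel)"
            by (intro nn_integral_mono ennreal_leI weight_powr_le N0)
          also have "\<dots> \<le> ennreal W" unfolding nn_integral_weight_shift' by (intro ennreal_leI) (simp add: W_def)
          finally show "(\<integral>\<^sup>+x. ennreal (?w (x - y)) \<partial>lborel) \<le> ennreal W" .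
        qed auto
        finally show "(\<integral>\<^sup>+x. ennreal (H y powr q * ?w (x - y)) \<partial>lborel)
          \<le> ennreal ((C0 * S) powr (q - p)) * ennreal (H y powr p) * ennreal W" by (simp add: ennreal_mult)
      qed
      also have "\<dots> = ennreal ((C0 * S) powr (q - p)) * (\<integral>\<^sup>+y. ennreal (H y powr p) \<partial>lborel) * ennreal W"
        by (subst nn_integral_multc, measurable, subst nn_integral_cmult, measurable)
      also have "\<dots> \<le> ennreal ((C0 * S) powr (q - p)) * ennreal (S powr p) * ennreal W"
        by (intro mult_right_mono mult_left_mono S) auto
      finally have "(\<integral>\<^sup>+x. ennreal (E x powr q) \<partial>lborel) \<le> ennreal (cst q 1 N0) * (ennreal ((C0 * S) powr (q - p)) * ennreal (S powr p) * ennreal W)"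
        by (simp add: mult_left_mono)
      also have "\<dots> = ennreal (cst q 1 N0 * ((C0 * S) powr (q - p) * S powr p * W))"
        using cst0 W by (simp add: ennreal_mult[symmetric])
      also have "\<dots> = ennreal ((C2 * S) powr q)"
      proof -
        have "(C0 * S) powr (q - p) * S powr p = C0 powr (q - p) * S powr q"
          using S(1) by (simp add: C0_def powr_mult powr_add[symmetric])
        then have "cst q 1 N0 * ((C0 * S) powr (q - p) * S powr p * W) = (cst q 1 N0 * W * C0 powr (q - p)) * S powr q"
          by (simp add: mult_ac)
        also have "\<dots> = (C2 * S) powr q"
          using p S(1) cst0[of q 1 N0] W by (simp add: C2_def powr_mult powr_powr)
        finally show ?thesis by simp
      qed
      also have "\<dots> \<le> ennreal ((C * S) powr q)"
        using p S(1) C by (intro ennreal_leI powr_mono2 mult_right_mono) (auto simp: C2_def)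
      finally show ?thesis .
    qed
    ultimately show ?thesis by blast
  qed
  show ?thesis
    by (rule exI[of _ "Suc N0"], rule exI[of _ C], rule conjI[OF C(1)], intro allI impI, rule main) auto
qed

text \<open>The hypothesis on \<open>G\<close> holds for every function reproduced by a fixed Schwartz kernel, that is, for
  functions of bounded frequency, and the hypothesis on \<open>F\<close> for their derivatives. The order \<open>N\<close> of decay and the
  constant depend only on the constants \<open>c\<close> of the kernel; this is what makes the bound uniform over
  all dyadic pieces after rescaling.\<close>

lemma bernstein_nikolskii:
  fixes c :: "nat => real"
  assumes p: "(0::ennreal) < p" "p \<le> q" and c: "\<And>N. c N > 0"
  obtains N C where "C > 0"
    "\<And>(G :: 'd::finite cfun) F D. poly_growth G ==>
     (\<And>N x. ennreal (norm (G x)) \<le> (\<integral>\<^sup>+y. ennreal (norm (G y) * (c N / weight (x - y) ^ N)) \<partial>lborel)) ==>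
     F \<in> borel_measurable borel ==> D > 0 ==>
     (\<And>x. ennreal (norm (F x)) \<le> (\<integral>\<^sup>+y. ennreal (norm (G y) * (D / weight (x - y) ^ N)) \<partial>lborel)) ==>
     Lp_norm q F \<le> ennreal (C * D) * Lp_norm p G"
proof (cases rule: ennreal_exponent_cases[OF p(1)])
  case 1
  then have q: "q = \<infinity>" using p(2) by (simp add: top_unique)
  let ?W = "weight_mass TYPE('d) + 1"
  have W: "?W > 0" using weight_mass_nonneg[where 'd = 'd] by simp
  show ?thesis
  proof (rule that[of ?W 1])
    fix G F :: "'d cfun" and D :: real
    assume G: "poly_growth G" and F: "F \<in> borel_measurable borel" and D: "D > 0"
      and b: "\<And>x. ennreal (norm (F x)) \<le> (\<integral>\<^sup>+y. ennreal (norm (G y) * (D / weight (x - y) ^ 1)) \<partial>lborel)"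
    show "Lp_norm q F \<le> ennreal (?W * D) * Lp_norm p G"
    proof (cases "Lp_norm p G")
      case (real S)
      have AE: "AE y in lborel. norm (G y) \<le> S" using real 1 by (intro Lp_norm_top_AE) auto
      have "norm (F x) \<le> ?W * D * S" for x
      proof -
        have "ennreal (norm (F x)) \<le> (\<integral>\<^sup>+y. ennreal (S * D) * ennreal (1 / weight (x - y)) \<partial>lborel)"
        proof (rule order_trans[OF b], rule nn_integral_mono_AE)
          show "AE y in lborel. ennreal (norm (G y) * (D / weight (x - y) ^ 1)) \<le> ennreal (S * D) * ennreal (1 / weight (x - y))"
            using AE
          proof eventually_elim
            case (elim y)
            have "norm (G y) * (D / weight (x - y)) \<le> S * (D / weight (x - y))" using elim D by (intro mult_right_mono) auto
            then show ?case using real D by (subst ennreal_mult[symmetric]) (auto intro!: ennreal_leI)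
          qed
        qed
        also have "\<dots> = ennreal (S * D * weight_mass TYPE('d))"
          using real D weight_mass_nonneg[where 'd = 'd]
          by (subst nn_integral_cmult) (simp_all add: nn_integral_weight_shift ennreal_mult[symmetric])
        finally have "norm (F x) \<le> S * D * weight_mass TYPE('d)"
          using real D weight_mass_nonneg[where 'd = 'd] by (subst (asm) ennreal_le_iff) auto
        also have "\<dots> \<le> S * D * ?W" using real D by (intro mult_left_mono) auto
        finally show ?thesis by (simp add: mult_ac)
      qed
      then have "Lp_norm q F \<le> ennreal (?W * D * S)" unfolding q by (rule Lp_norm_top_leI[OF F])
      then show ?thesis using real D W by (simp add: ennreal_mult)
    next
      case top
      then show ?thesis using D W by (simp add: ennreal_mult_top)
    qed
  qed (rule W)
next
  case (2 a)
  define b where "b = (if q = \<infinity> then a else enn2real q)"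
  have ab: "a \<le> b"
  proof (cases q)
    case (real r) then show ?thesis using 2 p(2) by (simp add: b_def)
  qed (simp add: b_def)
  obtain N C where C: "C > 0" and BN: "\<And>(H :: 'd rvec => real) E S. H \<in> borel_measurable borel ==> (\<And>y. H y \<ge> 0) ==>
     (\<exists>K M. \<forall>y. H y \<le> K * weight y ^ M) ==>
     (\<And>N x. ennreal (H x) \<le> (\<integral>\<^sup>+y. ennreal (H y * (c N / weight (x - y) ^ N)) \<partial>lborel)) ==>
     (\<And>x. E x \<ge> 0) ==>
     (\<And>x. ennreal (E x) \<le> (\<integral>\<^sup>+y. ennreal (H y * (1 / weight (x - y) ^ N)) \<partial>lborel)) ==>
     S \<ge> 0 ==> (\<integral>\<^sup>+y. ennreal (H y powr a) \<partial>lborel) \<le> ennreal (S powr a) ==>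
     (\<forall>x. E x \<le> C * S) \<and> (\<integral>\<^sup>+x. ennreal (E x powr b) \<partial>lborel) \<le> ennreal ((C * S) powr b)"
    using bernstein_nikolskii_real[OF 2(1) ab, of c, where 'd = 'd] c by blast
  show ?thesis
  proof (rule that[OF C])
    fix G F :: "'d cfun" and D :: real
    assume G: "poly_growth G" and F: "F \<in> borel_measurable borel" and D: "D > 0"
      and rep: "\<And>N x. ennreal (norm (G x)) \<le> (\<integral>\<^sup>+y. ennreal (norm (G y) * (c N / weight (x - y) ^ N)) \<partial>lborel)"
      and b: "\<And>x. ennreal (norm (F x)) \<le> (\<integral>\<^sup>+y. ennreal (norm (G y) * (D / weight (x - y) ^ N)) \<partial>lborel)"
    have [measurable]: "G \<in> borel_measurable borel" by (rule poly_growth_measurable[OF G])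
    show "Lp_norm q F \<le> ennreal (C * D) * Lp_norm p G"
    proof (cases "Lp_norm p G")
      case (real S)
      have S: "(\<integral>\<^sup>+y. ennreal (norm (G y) powr a) \<partial>lborel) \<le> ennreal (S powr a)"
        using real 2 Lp_norm_real_le_iff[OF 2(1) real(1), of G] by simp
      have E: "ennreal (norm (F x) / D) \<le> (\<integral>\<^sup>+y. ennreal (norm (G y) * (1 / weight (x - y) ^ N)) \<partial>lborel)" for x
      proof -
        have "ennreal (norm (F x) / D) = ennreal (1 / D) * ennreal (norm (F x))"
          using D by (subst ennreal_mult[symmetric]) auto
        also have "\<dots> \<le> ennreal (1 / D) * (\<integral>\<^sup>+y. ennreal (norm (G y) * (D / weight (x - y) ^ N)) \<partial>lborel)"
          by (intro mult_left_mono b) simp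
        also have "\<dots> = (\<integral>\<^sup>+y. ennreal (1 / D) * ennreal (norm (G y) * (D / weight (x - y) ^ N)) \<partial>lborel)"
          by (rule nn_integral_cmult[symmetric]) measurable
        also have "\<dots> = (\<integral>\<^sup>+y. ennreal (norm (G y) * (1 / weight (x - y) ^ N)) \<partial>lborel)"
          using D by (intro nn_integral_cong) (subst ennreal_mult[symmetric], auto)
        finally show ?thesis .
      qed
      have gr: "\<exists>K M. \<forall>y. norm (G y) \<le> K * weight y ^ M" using G by (simp add: poly_growth_def)
      have "(\<forall>x. norm (F x) / D \<le> C * S) \<and> (\<integral>\<^sup>+x. ennreal ((norm (F x) / D) powr b) \<partial>lborel) \<le> ennreal ((C * S) powr b)"
        by (rule BN[OF _ _ gr rep _ E real(1) S]) (use D in auto)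
      then have sup: "norm (F x) \<le> C * D * S" and int: "(\<integral>\<^sup>+x. ennreal ((norm (F x) / D) powr b) \<partial>lborel) \<le> ennreal ((C * S) powr b)" for x
        using D by (auto simp: pos_divide_le_eq mult_ac)
      have CDS: "C * D * S \<ge> 0" using C D real by simp
      have "Lp_norm q F \<le> ennreal (C * D * S)"
      proof (cases "q = \<infinity>")
        case True
        then show ?thesis using Lp_norm_top_leI[OF F sup] by simp
      next
        case False
        then have qb: "q = ennreal b" using p by (simp add: b_def less_top)
        have "(\<integral>\<^sup>+x. ennreal (norm (F x) powr b) \<partial>lborel) = (\<integral>\<^sup>+x. ennreal (D powr b) * ennreal ((norm (F x) / D) powr b) \<partial>lborel)"
          using D by (intro nn_integral_cong) (subst ennreal_mult[symmetric], auto simp: powr_divide)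
        also have "\<dots> = ennreal (D powr b) * (\<integral>\<^sup>+x. ennreal ((norm (F x) / D) powr b) \<partial>lborel)"
          using F by (intro nn_integral_cmult) measurable
        also have "\<dots> \<le> ennreal (D powr b) * ennreal ((C * S) powr b)" by (intro mult_left_mono int) simp
        also have "\<dots> = ennreal ((C * D * S) powr b)"
          using C D real by (simp add: ennreal_mult[symmetric] powr_mult mult_ac)
        finally show ?thesis unfolding qb using 2(1) ab CDS by (subst Lp_norm_real_le_iff) auto
      qed
      then show ?thesis using real C D by (simp add: ennreal_mult)
    next
      case top
      then show ?thesis using C D by (simp add: ennreal_mult_top)
    qed
  qed
qed

section \<open>Almost orthogonality\<close>

lemma pderivs_cnj:
  assumes "smooth f" shows "pderivs is (\<lambda>x. cnj (f x)) = (\<lambda>x. cnj (pderivs is f x))"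
proof (induction "is")
  case (Cons i "is")
  have "partial_deriv i (\<lambda>x. cnj (pderivs is f x)) x = cnj (partial_deriv i (pderivs is f) x)" for x
  proof -
    obtain f' where f': "(pderivs is f has_derivative f') (at x)"
      using smooth_pderivs_differentiable[OF assms] by (auto simp: differentiable_def)
    show ?thesis
      using partial_deriv_eq[OF f'] partial_deriv_eq[OF bounded_linear.has_derivative[OF bounded_linear_cnj f']] by simp
  qed
  then have "partial_deriv i (\<lambda>x. cnj (pderivs is f x)) = (\<lambda>x. cnj (partial_deriv i (pderivs is f) x))" by (rule ext)
  with Cons show ?case by simp
qed simp

lemma schwartz_cnj: assumes "f \<in> schwartz" shows "(\<lambda>x. cnj (f x)) \<in> schwartz"
proof (rule schwartzI)
  note sm = schwartz_smooth[OF assms]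
  show "smooth (\<lambda>x. cnj (f x))"
    unfolding smooth_def pderivs_cnj[OF sm]
    using bounded_linear.has_derivative[OF bounded_linear_cnj] smooth_pderivs_differentiable[OF sm]
    unfolding differentiable_def by blast
  fix "is" N
  obtain C where "C > 0" "\<And>x. norm (pderivs is f x) \<le> C / weight x ^ N" using schwartz_decay_list[OF assms] by blast
  then show "\<exists>C. \<forall>x. norm (pderivs is (\<lambda>x. cnj (f x)) x) \<le> C / weight x ^ N"
    unfolding pderivs_cnj[OF sm] by (intro exI[of _ C]) simp
qed

lemma schwartz_zero: "(\<lambda>x. 0) \<in> schwartz"
  using schwartz_sum[of "{} :: unit set" "\<lambda>_ _. 0" "\<lambda>_. 0"] by simp

text \<open>Bounded measurable functions of bounded support: convolution, Fubini and integration of products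
  raise no integrability questions for them.\<close>

definition test_fun :: "('d::finite) cfun => bool" where
  "test_fun f \<longleftrightarrow> f \<in> borel_measurable borel \<and> (\<exists>R. \<forall>x. norm (f x) \<le> R \<and> (norm x > R \<longrightarrow> f x = 0))"

lemma test_fun_measurable: "test_fun f ==> f \<in> borel_measurable borel"
  by (simp add: test_fun_def)

lemma test_fun_bounded: "test_fun f ==> \<exists>R. \<forall>x. norm (f x) \<le> R"
  by (auto simp: test_fun_def)

lemma test_fun_poly_growth: "test_fun f ==> poly_growth f"
  unfolding poly_growth_def test_fun_def by (metis mult.right_neutral power_0)

lemma test_fun_integrable:
  assumes f: "test_fun f" shows "integrable lborel f"
proof -
  obtain R where R: "\<And>x. norm (f x) \<le> R" "\<And>x. norm x > R ==> f x = 0" using f by (auto simp: test_fun_def)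
  have "integrable lborel (\<lambda>x. R * indicator (cball 0 R) x)"
    using emeasure_bounded_finite[OF bounded_cball, of 0 R] by (intro integrable_mult_right integrable_real_indicator) auto
  then show ?thesis
  proof (rule Bochner_Integration.integrable_bound)
    show "AE x in lborel. norm (f x) \<le> norm (R * indicator (cball 0 R) x)"
    proof (rule AE_I2)
      fix x show "norm (f x) \<le> norm (R * indicator (cball 0 R) x)"
        using R(1)[of x] R(2)[of x] by (cases "norm x > R") (auto simp: indicator_def abs_of_nonneg order_trans[OF norm_ge_zero])
    qed
  qed (use test_fun_measurable[OF f] in simp)
qed

lemma nn_integral_cv_le:
  fixes p \<theta> :: "'d::finite cfun"
  assumes [measurable]: "p \<in> borel_measurable borel" "\<theta> \<in> borel_measurable borel"
    and C: "(\<integral>\<^sup>+x. ennreal (norm (\<theta> x)) \<partial>lborel) \<le> ennreal C" "C > 0" and a: "a \<ge> 1"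
  shows "(\<integral>\<^sup>+x. ennreal (norm (cv p \<theta> x) powr a) \<partial>lborel) \<le> ennreal (C powr a) * (\<integral>\<^sup>+x. ennreal (norm (p x) powr a) \<partial>lborel)"
proof -
  have C': "(\<integral>\<^sup>+y. ennreal (norm (\<theta> (x - y))) \<partial>lborel) \<le> ennreal C" for x
    using C(1) nn_integral_reflect[of "\<lambda>y. ennreal (norm (\<theta> y))" x] by simp
  have C'': "(\<integral>\<^sup>+x. ennreal (norm (\<theta> (x - y))) \<partial>lborel) \<le> ennreal C" for y
  proof -
    have "(\<integral>\<^sup>+x. ennreal (norm (\<theta> (x - y))) \<partial>lborel) = (\<integral>\<^sup>+x. ennreal (norm (\<theta> ((y - x) - y))) \<partial>lborel)"
      by (rule nn_integral_reflect[symmetric]) measurable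
    also have "\<dots> = (\<integral>\<^sup>+x. ennreal (norm (\<theta> x)) \<partial>lborel)"
      using nn_integral_reflect[of "\<lambda>y. ennreal (norm (\<theta> y))" 0] by simp
    finally show ?thesis using C(1) by simp
  qed
  have "ennreal (norm (cv p \<theta> x) powr a) \<le> ennreal (C powr (a - 1)) * (\<integral>\<^sup>+y. ennreal (norm (p y) powr a * norm (\<theta> (x - y))) \<partial>lborel)" for x
  proof (rule jensen_weighted[OF a])
    show "ennreal (norm (cv p \<theta> x)) \<le> (\<integral>\<^sup>+y. ennreal (norm (p y) * norm (\<theta> (x - y))) \<partial>lborel)"
    proof (cases "integrable lborel (\<lambda>y. p y * \<theta> (x - y))")
      case True
      then show ?thesis unfolding cv_def norm_mult[symmetric] by (rule integral_norm_bound_ennreal)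
    next
      case False
      then show ?thesis by (simp add: cv_def not_integrable_integral_eq)
    qed
  qed (use C C' in auto)
  then have "(\<integral>\<^sup>+x. ennreal (norm (cv p \<theta> x) powr a) \<partial>lborel)
     \<le> (\<integral>\<^sup>+x. ennreal (C powr (a - 1)) * (\<integral>\<^sup>+y. ennreal (norm (p y) powr a * norm (\<theta> (x - y))) \<partial>lborel) \<partial>lborel)"
    by (intro nn_integral_mono)
  also have "\<dots> = ennreal (C powr (a - 1)) * (\<integral>\<^sup>+x. (\<integral>\<^sup>+y. ennreal (norm (p y) powr a * norm (\<theta> (x - y))) \<partial>lborel) \<partial>lborel)"
    by (rule nn_integral_cmult) measurable
  also have "(\<integral>\<^sup>+x. (\<integral>\<^sup>+y. ennreal (norm (p y) powr a * norm (\<theta> (x - y))) \<partial>lborel) \<partial>lborel)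
     = (\<integral>\<^sup>+y. (\<integral>\<^sup>+x. ennreal (norm (p y) powr a * norm (\<theta> (x - y))) \<partial>lborel) \<partial>lborel)"
    by (rule lborel_pair.Fubini') measurable
  also have "\<dots> = (\<integral>\<^sup>+y. ennreal (norm (p y) powr a) * (\<integral>\<^sup>+x. ennreal (norm (\<theta> (x - y))) \<partial>lborel) \<partial>lborel)"
    by (intro nn_integral_cong, subst nn_integral_cmult[symmetric]) (auto simp: ennreal_mult)
  also have "\<dots> \<le> (\<integral>\<^sup>+y. ennreal (norm (p y) powr a) * ennreal C \<partial>lborel)"
    by (intro nn_integral_mono mult_left_mono C'') simp
  also have "\<dots> = (\<integral>\<^sup>+y. ennreal (norm (p y) powr a) \<partial>lborel) * ennreal C"
    by (rule nn_integral_multc) measurable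
  finally have "(\<integral>\<^sup>+x. ennreal (norm (cv p \<theta> x) powr a) \<partial>lborel)
     \<le> ennreal (C powr (a - 1)) * ((\<integral>\<^sup>+y. ennreal (norm (p y) powr a) \<partial>lborel) * ennreal C)"
    by (simp add: mult_left_mono)
  also have "\<dots> = ennreal (C powr (a - 1) * C) * (\<integral>\<^sup>+y. ennreal (norm (p y) powr a) \<partial>lborel)"
    using C(2) by (subst ennreal_mult) (auto simp: mult_ac)
  also have "C powr (a - 1) * C = C powr a" using C(2) by (simp add: powr_diff)
  finally show ?thesis .
qed

lemma cv_test_fun:
  fixes p \<theta> :: "('d::{finite,linorder}) cfun"
  assumes p: "test_fun p" and \<theta>: "\<theta> \<in> schwartz"
  shows "cv p \<theta> \<in> borel_measurable borel" "integrable lborel (cv p \<theta>)" "\<exists>B. \<forall>x. norm (cv p \<theta> x) \<le> B"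
  using cv_measurable[OF test_fun_measurable[OF p] schwartz_measurable[OF \<theta>]]
    cv_integrable_fourier(1)[OF test_fun_integrable[OF p] schwartz_integrable[OF \<theta>]]
    cv_bounded_continuous(1)[OF test_fun_integrable[OF p] \<theta>] by auto

lemma integrable_mult_bounded:
  fixes f g :: "'a => complex"
  assumes f: "integrable M f" and [measurable]: "g \<in> borel_measurable M" and B: "\<And>x. norm (g x) \<le> B"
  shows "integrable M (\<lambda>x. f x * g x)"
proof (rule Bochner_Integration.integrable_bound[OF integrable_mult_right[OF f, of "complex_of_real B"]])
  show "(\<lambda>x. f x * g x) \<in> borel_measurable M" using f by measurable
  show "AE x in M. norm (f x * g x) \<le> norm (complex_of_real B * f x)"
  proof (rule AE_I2)
    fix x
    have "norm (f x) * norm (g x) \<le> norm (f x) * \<bar>B\<bar>" by (intro mult_left_mono order_trans[OF B abs_ge_self]) simp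
    then show "norm (f x * g x) \<le> norm (complex_of_real B * f x)" by (simp add: norm_mult mult.commute)
  qed
qed

lemma cnj_measurable [measurable]: "cnj \<in> borel_measurable borel"
  by (intro borel_measurable_continuous_onI continuous_intros)

text \<open>Moving \<open>\<theta>'\<close> to the other side replaces it by its reflected conjugate, whose Fourier transform is the
  conjugate of that of \<open>\<theta>'\<close>. The two kernels then convolve to 0.\<close>

lemma convolutions_orthogonal:
  fixes p p' \<theta> \<theta>' :: "('d::{finite,linorder}) cfun"
  assumes p: "test_fun p" "test_fun p'" and \<theta>: "\<theta> \<in> schwartz" "\<theta>' \<in> schwartz"
    and disj: "\<And>\<xi>. fourier \<theta> \<xi> * cnj (fourier \<theta>' \<xi>) = 0"
  shows "(LINT x|lborel. cv p \<theta> x * cnj (cv p' \<theta>' x)) = 0"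
proof -
  define \<kappa> where "\<kappa> = (\<lambda>x. cnj (\<theta>' (- x)))"
  have \<kappa>: "\<kappa> \<in> schwartz"
    using schwartz_cnj[OF schwartz_reflect_translate[OF \<theta>(2), of 0]] by (simp add: \<kappa>_def)
  have "cv \<theta> \<kappa> = (\<lambda>x. 0)"
  proof (rule cv_eqI[OF \<theta>(1) \<kappa> schwartz_zero])
    fix \<xi> show "fourier \<theta> \<xi> * fourier \<kappa> \<xi> = fourier (\<lambda>x. 0) \<xi>"
      using disj[of \<xi>] unfolding \<kappa>_def fourier_reflect_cnj[OF schwartz_measurable[OF \<theta>(2)]] by (simp add: fourier_def)
  qed
  then have z: "cv (cv p \<theta>) \<kappa> y = 0" for y
    using cv_cv[OF test_fun_poly_growth[OF p(1)] \<theta>(1) \<kappa>, of y] by simp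
  note [measurable] = test_fun_measurable[OF p(1)] test_fun_measurable[OF p(2)] schwartz_measurable[OF \<theta>(1)]
    schwartz_measurable[OF \<theta>(2)] cv_test_fun(1)[OF p(1) \<theta>(1)]
  obtain B where B: "\<And>x. norm (cv p \<theta> x) \<le> B" using cv_test_fun(3)[OF p(1) \<theta>(1)] by blast
  have "integrable (lborel \<Otimes>\<^sub>M lborel) (\<lambda>w. (case w of (y, x) => cnj (p' y * \<theta>' (x - y))) * cv p \<theta> (snd w))"
  proof (rule integrable_mult_bounded)
    show "integrable (lborel \<Otimes>\<^sub>M lborel) (\<lambda>(y, x). cnj (p' y * \<theta>' (x - y)))"
      using integrable_cnj[OF convolution_pair_integrable[OF test_fun_integrable[OF p(2)] schwartz_integrable[OF \<theta>(2)]]]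
      by (simp add: case_prod_unfold)
    show "(\<lambda>w. cv p \<theta> (snd w)) \<in> borel_measurable (lborel \<Otimes>\<^sub>M lborel)" by measurable
  qed (rule B)
  then have pair: "integrable (lborel \<Otimes>\<^sub>M lborel) (\<lambda>(y, x). cv p \<theta> x * cnj (p' y * \<theta>' (x - y)))"
    by (simp add: case_prod_unfold mult.commute)
  have "(LINT x|lborel. cv p \<theta> x * cnj (cv p' \<theta>' x)) = (LINT x|lborel. LINT y|lborel. cv p \<theta> x * cnj (p' y * \<theta>' (x - y)))"
    unfolding cv_def[of p' \<theta>'] Bochner_Integration.integral_cnj[symmetric] integral_mult_right_zero[symmetric] ..
  also have "\<dots> = (LINT y|lborel. LINT x|lborel. cv p \<theta> x * cnj (p' y * \<theta>' (x - y)))"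
    using lborel_pair.Fubini_integral[OF pair] by simp
  also have "\<dots> = (LINT y|lborel. cnj (p' y) * cv (cv p \<theta>) \<kappa> y)"
    unfolding cv_def[of "cv p \<theta>" \<kappa>] integral_mult_right_zero[symmetric]
    by (simp add: \<kappa>_def mult_ac)
  also have "\<dots> = 0" by (simp add: z)
  finally show ?thesis .
qed

text \<open>In the expansion of the square only the pairs with \<open>\<bar>j - k\<bar> \<le> L\<close> survive, and each index occurs in at most
  \<open>2 L + 1\<close> of them.\<close>

lemma almost_orthogonal_sum:
  fixes p :: "nat => ('d::{finite,linorder}) cfun"
  assumes J: "finite J" and p: "\<And>j. j \<in> J ==> test_fun (p j)" and \<theta>: "\<And>j. \<theta> j \<in> schwartz"
    and disj: "\<And>j k \<xi>. j + L < k \<or> k + L < j ==> fourier (\<theta> j) \<xi> * cnj (fourier (\<theta> k) \<xi>) = 0"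
    and C: "\<And>j. (\<integral>\<^sup>+x. ennreal (norm (\<theta> j x)) \<partial>lborel) \<le> ennreal C" "C > 0"
    and a: "\<And>j. j \<in> J ==> (\<integral>\<^sup>+x. ennreal (norm (p j x) powr 2) \<partial>lborel) \<le> ennreal (a j)" "\<And>j. a j \<ge> 0"
  shows "integrable lborel (\<lambda>x. (norm (\<Sum>j\<in>J. cv (p j) (\<theta> j) x))\<^sup>2)"
    and "(LINT x|lborel. (norm (\<Sum>j\<in>J. cv (p j) (\<theta> j) x))\<^sup>2) \<le> real (2 * L + 1) * C\<^sup>2 * (\<Sum>j\<in>J. a j)"
proof -
  let ?c = "\<lambda>j. cv (p j) (\<theta> j)"
  have c: "j \<in> J ==> ?c j \<in> borel_measurable borel" "j \<in> J ==> integrable lborel (?c j)"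
     "j \<in> J ==> \<exists>B. \<forall>x. norm (?c j x) \<le> B" for j
    using cv_test_fun[OF p \<theta>] by auto
  have int: "integrable lborel (\<lambda>x. ?c j x * cnj (?c k x))" if jk: "j \<in> J" "k \<in> J" for j k
  proof -
    obtain B where "\<And>x. norm (?c k x) \<le> B" using c(3)[OF jk(2)] by blast
    then show ?thesis using c jk by (intro integrable_mult_bounded[where B = B]) (auto intro: measurable_compose[OF _ cnj_measurable])
  qed
  have sq: "complex_of_real ((norm (\<Sum>j\<in>J. ?c j x))\<^sup>2) = (\<Sum>j\<in>J. \<Sum>k\<in>J. ?c j x * cnj (?c k x))" for x
    by (simp only: complex_norm_square cnj_sum sum_product)
  have i2: "integrable lborel (\<lambda>x. complex_of_real ((norm (\<Sum>j\<in>J. ?c j x))\<^sup>2))"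
    unfolding sq by (intro Bochner_Integration.integrable_sum int)
  from integrable_Re[OF this] show i: "integrable lborel (\<lambda>x. (norm (\<Sum>j\<in>J. ?c j x))\<^sup>2)" by simp
  define A where "A = (\<lambda>j. LINT x|lborel. (norm (?c j x))\<^sup>2)"
  have iA: "integrable lborel (\<lambda>x. (norm (?c j x))\<^sup>2)" if "j \<in> J" for j
    using integrable_Re[OF int[OF that that]] by (simp only: complex_norm_square[symmetric] Re_complex_of_real)
  have A: "A j \<le> C\<^sup>2 * a j" if j: "j \<in> J" for j
  proof -
    have "ennreal (A j) = (\<integral>\<^sup>+x. ennreal ((norm (?c j x))\<^sup>2) \<partial>lborel)"
      unfolding A_def by (rule nn_integral_eq_integral[OF iA[OF j], symmetric]) simp
    also have "\<dots> = (\<integral>\<^sup>+x. ennreal (norm (?c j x) powr 2) \<partial>lborel)" by (simp add: powr_numeral)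
    also have "\<dots> \<le> ennreal (C powr 2) * (\<integral>\<^sup>+x. ennreal (norm (p j x) powr 2) \<partial>lborel)"
      by (rule nn_integral_cv_le[OF test_fun_measurable[OF p[OF j]] schwartz_measurable[OF \<theta>] C]) simp
    also have "\<dots> \<le> ennreal (C powr 2) * ennreal (a j)" by (intro mult_left_mono a j) simp
    also have "\<dots> = ennreal (C\<^sup>2 * a j)" using C a by (simp add: ennreal_mult powr_numeral)
    finally show ?thesis using C a by (subst (asm) ennreal_le_iff) auto
  qed
  have A0: "A j \<ge> 0" for j unfolding A_def by (intro Bochner_Integration.integral_nonneg) simp
  have cross: "norm (LINT x|lborel. ?c j x * cnj (?c k x)) \<le> (if j \<le> k + L \<and> k \<le> j + L then (A j + A k) / 2 else 0)"
    if jk: "j \<in> J" "k \<in> J" for j k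
  proof (cases "j \<le> k + L \<and> k \<le> j + L")
    case True
    have "norm (LINT x|lborel. ?c j x * cnj (?c k x)) \<le> (LINT x|lborel. ((norm (?c j x))\<^sup>2 + (norm (?c k x))\<^sup>2) / 2)"
    proof (rule Bochner_Integration.integral_norm_bound_integral[OF int[OF jk]])
      show "integrable lborel (\<lambda>x. ((norm (?c j x))\<^sup>2 + (norm (?c k x))\<^sup>2) / 2)" using iA jk by simp
      fix x show "norm (?c j x * cnj (?c k x)) \<le> ((norm (?c j x))\<^sup>2 + (norm (?c k x))\<^sup>2) / 2"
        using sum_squares_bound[of "norm (?c j x)" "norm (?c k x)"] by (simp add: norm_mult)
    qed
    also have "\<dots> = (A j + A k) / 2" using iA jk by (simp add: A_def)
    finally show ?thesis using True by simp
  next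
    case False
    have "(LINT x|lborel. ?c j x * cnj (?c k x)) = 0"
      by (rule convolutions_orthogonal[OF p[OF jk(1)] p[OF jk(2)] \<theta> \<theta> disj]) (use False in auto)
    then show ?thesis by (subst if_not_P[OF False]) simp
  qed
  have eq: "complex_of_real (LINT x|lborel. (norm (\<Sum>j\<in>J. ?c j x))\<^sup>2) = (\<Sum>j\<in>J. \<Sum>k\<in>J. (LINT x|lborel. ?c j x * cnj (?c k x)))"
  proof -
    have "complex_of_real (LINT x|lborel. (norm (\<Sum>j\<in>J. ?c j x))\<^sup>2) = (LINT x|lborel. (\<Sum>j\<in>J. \<Sum>k\<in>J. ?c j x * cnj (?c k x)))"
      unfolding sq[symmetric] by (rule integral_complex_of_real[symmetric])
    also have "\<dots> = (\<Sum>j\<in>J. \<Sum>k\<in>J. (LINT x|lborel. ?c j x * cnj (?c k x)))"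
      by (subst Bochner_Integration.integral_sum, intro Bochner_Integration.integrable_sum int, assumption+,
          intro sum.cong refl Bochner_Integration.integral_sum int)
    finally show ?thesis .
  qed
  have "(LINT x|lborel. (norm (\<Sum>j\<in>J. ?c j x))\<^sup>2) \<le> norm (complex_of_real (LINT x|lborel. (norm (\<Sum>j\<in>J. ?c j x))\<^sup>2))"
    unfolding norm_of_real by (rule abs_ge_self)
  also have "\<dots> = norm (\<Sum>j\<in>J. \<Sum>k\<in>J. (LINT x|lborel. ?c j x * cnj (?c k x)))" unfolding eq ..
  also have "\<dots> \<le> (\<Sum>j\<in>J. \<Sum>k\<in>J. if j \<le> k + L \<and> k \<le> j + L then (A j + A k) / 2 else 0)"
    by (intro order_trans[OF norm_sum] sum_mono cross)
  also have "\<dots> = (\<Sum>j\<in>J. \<Sum>k\<in>J. if j \<le> k + L \<and> k \<le> j + L then A j else 0)"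
  proof -
    let ?b = "\<lambda>j k. j \<le> k + L \<and> k \<le> j + L"
    have "(\<Sum>j\<in>J. \<Sum>k\<in>J. if ?b j k then (A j + A k) / 2 else 0)
      = (\<Sum>j\<in>J. \<Sum>k\<in>J. (if ?b j k then A j else 0) / 2) + (\<Sum>j\<in>J. \<Sum>k\<in>J. (if ?b j k then A k else 0) / 2)"
      by (simp only: sum.distrib[symmetric]) (intro sum.cong refl, auto simp: add_divide_distrib)
    also have "(\<Sum>j\<in>J. \<Sum>k\<in>J. (if ?b j k then A k else 0) / 2) = (\<Sum>j\<in>J. \<Sum>k\<in>J. (if ?b j k then A j else 0) / 2)"
      by (subst sum.swap) (intro sum.cong refl, auto)
    finally show ?thesis by (simp add: sum_divide_distrib[symmetric])
  qed
  also have "\<dots> \<le> (\<Sum>j\<in>J. real (2 * L + 1) * A j)"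
  proof (rule sum_mono)
    fix j assume "j \<in> J"
    have "(\<Sum>k\<in>J. if j \<le> k + L \<and> k \<le> j + L then A j else 0) = (\<Sum>k\<in>{k\<in>J. j \<le> k + L \<and> k \<le> j + L}. A j)"
      using J by (intro sum.inter_filter[symmetric])
    also have "\<dots> = real (card {k\<in>J. j \<le> k + L \<and> k \<le> j + L}) * A j" by simp
    also have "\<dots> \<le> real (2 * L + 1) * A j"
    proof (intro mult_right_mono A0)
      have "{k\<in>J. j \<le> k + L \<and> k \<le> j + L} \<subseteq> {j - L..j + L}" by auto
      then have "card {k\<in>J. j \<le> k + L \<and> k \<le> j + L} \<le> card {j - L..j + L}" by (intro card_mono) auto
      then show "real (card {k\<in>J. j \<le> k + L \<and> k \<le> j + L}) \<le> real (2 * L + 1)" by simp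
    qed
    finally show "(\<Sum>k\<in>J. if j \<le> k + L \<and> k \<le> j + L then A j else 0) \<le> real (2 * L + 1) * A j" .
  qed
  also have "\<dots> \<le> (\<Sum>j\<in>J. real (2 * L + 1) * (C\<^sup>2 * a j))" by (intro sum_mono mult_left_mono A) auto
  also have "\<dots> = real (2 * L + 1) * C\<^sup>2 * (\<Sum>j\<in>J. a j)" by (simp add: sum_distrib_left mult.assoc)
  finally show "(LINT x|lborel. (norm (\<Sum>j\<in>J. ?c j x))\<^sup>2) \<le> real (2 * L + 1) * C\<^sup>2 * (\<Sum>j\<in>J. a j)" .
qed

section \<open>The three lines theorem\<close>

text \<open>Multiplication by a factor \<open>exp (\<epsilon> (z^2 - 1))\<close> makes the function decay at infinity inside the
  strip, where the maximum principle on a large rectangle applies; then \<open>\<epsilon>\<close> tends to 0.\<close>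

lemma three_lines:
  assumes hol: "\<Phi> holomorphic_on UNIV" and B: "\<And>z. 0 \<le> Re z ==> Re z \<le> 1 ==> norm (\<Phi> z) \<le> B"
    and M: "M > 0" "\<And>z. Re z = 0 \<or> Re z = 1 ==> norm (\<Phi> z) \<le> M"
    and z: "0 \<le> Re z" "Re z \<le> 1"
  shows "norm (\<Phi> z) \<le> M"
proof -
  have B0: "B \<ge> 0" using order_trans[OF norm_ge_zero B[of 0]] by simp
  have eps: "norm (\<Phi> z) * exp (\<epsilon> * (- (Im z)\<^sup>2 - 1)) \<le> M" if e: "\<epsilon> > 0" for \<epsilon>
  proof -
    let ?\<Psi> = "\<lambda>w. \<Phi> w * exp (of_real \<epsilon> * (w * w - 1))"
    have n: "norm (?\<Psi> w) = norm (\<Phi> w) * exp (\<epsilon> * ((Re w)\<^sup>2 - (Im w)\<^sup>2 - 1))" for w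
      by (simp add: norm_mult power2_eq_square)
    define Y where "Y = \<bar>Im z\<bar> + 1 + (B / M) / \<epsilon>"
    have Y: "Y \<ge> 1" "\<bar>Im z\<bar> \<le> Y" "B / M \<le> \<epsilon> * Y"
    proof -
      have "(B / M) / \<epsilon> \<ge> 0" using B0 M e by simp
      then show "Y \<ge> 1" "\<bar>Im z\<bar> \<le> Y" by (auto simp: Y_def)
      have "\<epsilon> * Y = \<epsilon> * (\<bar>Im z\<bar> + 1) + B / M" using e by (simp add: Y_def distrib_left)
      then show "B / M \<le> \<epsilon> * Y" using e by simp
    qed
    let ?S = "cbox (Complex 0 (- Y)) (Complex 1 Y)"
    have "norm (?\<Psi> z) \<le> M"
    proof (rule maximum_modulus_frontier[of ?\<Psi> ?S])
      have h: "?\<Psi> holomorphic_on UNIV" by (intro holomorphic_intros hol)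
      then show "?\<Psi> holomorphic_on interior ?S" by (rule holomorphic_on_subset) simp
      show "continuous_on (closure ?S) ?\<Psi>"
        by (rule holomorphic_on_imp_continuous_on[OF holomorphic_on_subset[OF h]]) simp
      show "z \<in> ?S" using z Y by (auto simp: in_cbox_complex_iff abs_le_iff)
      fix w assume "w \<in> frontier ?S"
      then have w: "w \<in> ?S" "w \<notin> box (Complex 0 (- Y)) (Complex 1 Y)"
        by (auto simp: frontier_def interior_cbox)
      then have re: "0 \<le> Re w" "Re w \<le> 1" by (auto simp: in_cbox_complex_iff)
      have re2: "(Re w)\<^sup>2 \<le> 1" using re by (simp add: abs_square_le_1)
      have cases: "(Re w = 0 \<or> Re w = 1) \<or> \<bar>Im w\<bar> = Y"
        using w by (auto simp: in_cbox_complex_iff in_box_complex_iff)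
      show "norm (?\<Psi> w) \<le> M"
      proof (cases "Re w = 0 \<or> Re w = 1")
        case True
        have "(Re w)\<^sup>2 - (Im w)\<^sup>2 - 1 \<le> 0" using re2 zero_le_power2[of "Im w"] by linarith
        then have "\<epsilon> * ((Re w)\<^sup>2 - (Im w)\<^sup>2 - 1) \<le> 0" using e by (intro mult_nonneg_nonpos) auto
        then have "norm (?\<Psi> w) \<le> norm (\<Phi> w) * 1" unfolding n by (intro mult_left_mono) auto
        then show ?thesis using M(2)[OF True] by simp
      next
        case False
        then have Im: "(Im w)\<^sup>2 = Y\<^sup>2" using cases by (metis power2_abs)
        have "Y \<le> Y\<^sup>2" using Y(1) by (simp add: power2_eq_square)
        then have "B / M \<le> \<epsilon> * Y\<^sup>2" using Y(3) mult_left_mono[of Y "Y\<^sup>2" \<epsilon>] e by linarith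
        also have "\<dots> \<le> exp (\<epsilon> * Y\<^sup>2)" using exp_ge_add_one_self[of "\<epsilon> * Y\<^sup>2"] by linarith
        finally have "B * exp (- (\<epsilon> * Y\<^sup>2)) \<le> M" using M(1) by (simp add: exp_minus field_simps)
        moreover have "norm (?\<Psi> w) \<le> B * exp (- (\<epsilon> * Y\<^sup>2))"
          unfolding n Im
        proof (intro mult_mono B re)
          have "\<epsilon> * ((Re w)\<^sup>2 - Y\<^sup>2 - 1) \<le> \<epsilon> * (- Y\<^sup>2)" using e re2 by (intro mult_left_mono) auto
          then show "exp (\<epsilon> * ((Re w)\<^sup>2 - Y\<^sup>2 - 1)) \<le> exp (- (\<epsilon> * Y\<^sup>2))" by simp
        qed (use B0 in auto)
        ultimately show ?thesis by linarith
      qed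
    qed (rule bounded_cbox)
    then have "norm (\<Phi> z) * exp (\<epsilon> * ((Re z)\<^sup>2 - (Im z)\<^sup>2 - 1)) \<le> M" unfolding n .
    moreover have "\<epsilon> * (- (Im z)\<^sup>2 - 1) \<le> \<epsilon> * ((Re z)\<^sup>2 - (Im z)\<^sup>2 - 1)" using e by (intro mult_left_mono) auto
    then have "norm (\<Phi> z) * exp (\<epsilon> * (- (Im z)\<^sup>2 - 1)) \<le> norm (\<Phi> z) * exp (\<epsilon> * ((Re z)\<^sup>2 - (Im z)\<^sup>2 - 1))"
      by (intro mult_left_mono) auto
    ultimately show ?thesis by linarith
  qed
  have "((\<lambda>\<epsilon>. norm (\<Phi> z) * exp (\<epsilon> * (- (Im z)\<^sup>2 - 1))) \<longlongrightarrow> norm (\<Phi> z) * exp (0 * (- (Im z)\<^sup>2 - 1))) (at_right 0)"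
    by (intro tendsto_intros)
  then have "norm (\<Phi> z) * exp (0 * (- (Im z)\<^sup>2 - 1)) \<le> M"
    by (rule tendsto_upperbound) (auto simp: eventually_at_right_field intro!: exI[of _ 1] eps)
  then show ?thesis by simp
qed

section \<open>Complex powers and analytic families\<close>

text \<open>The complex power that keeps the phase of \<open>f\<close>, so that exponent 1 gives back \<open>f\<close> (\<open>cpow_one\<close>).\<close>

definition cpow :: "('d::finite) cfun => complex => 'd cfun" where
  "cpow f w x = sgn (f x) * exp (w * of_real (ln (norm (f x))))"

text \<open>Functions that are bounded, of bounded support, and bounded away from 0 where they do not vanish. The
  last condition bounds the logarithm in \<open>cpow\<close>, so that \<open>cpow f z\<close> is entire in \<open>z\<close> with locally uniform bounds.\<close>

definition cut_fun :: "('d::finite) cfun => bool" where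
  "cut_fun f \<longleftrightarrow> f \<in> borel_measurable borel \<and>
     (\<exists>R>0. \<forall>x. f x \<noteq> 0 \<longrightarrow> 1 / R \<le> norm (f x) \<and> norm (f x) \<le> R \<and> norm x \<le> R)"

lemma norm_cpow: "norm (cpow f w x) = norm (f x) powr Re w"
  by (simp add: cpow_def norm_mult norm_sgn powr_def)

lemma cpow_one: "cpow f 1 = f"
proof
  fix x
  show "cpow f 1 x = f x"
    by (cases "f x = 0") (simp_all add: cpow_def sgn_div_norm exp_of_real scaleR_conv_of_real)
qed

lemma cpow_measurable: "f \<in> borel_measurable borel ==> cpow f w \<in> borel_measurable borel"
proof -
  assume [measurable]: "f \<in> borel_measurable borel"
  have [measurable]: "(exp :: complex => complex) \<in> borel_measurable borel"
    by (intro borel_measurable_continuous_onI continuous_intros)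
  show ?thesis unfolding cpow_def[abs_def] sgn_div_norm by measurable
qed

lemma cut_fun_ln_bound:
  assumes "cut_fun f" obtains K where "K \<ge> 0" "\<And>x. f x \<noteq> 0 ==> \<bar>ln (norm (f x))\<bar> \<le> K" "\<And>x. f x \<noteq> 0 ==> norm x \<le> K"
proof -
  obtain R where R: "R > 0" "\<And>x. f x \<noteq> 0 ==> 1 / R \<le> norm (f x) \<and> norm (f x) \<le> R \<and> norm x \<le> R"
    using assms unfolding cut_fun_def by blast
  have "\<bar>ln (norm (f x))\<bar> \<le> \<bar>ln R\<bar>" if "f x \<noteq> 0" for x
  proof -
    have "ln (norm (f x)) \<le> ln R" using R that by simp
    moreover have "ln (1 / R) \<le> ln (norm (f x))" using R(1) R(2)[OF that] that by (subst ln_le_cancel_iff) auto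
    ultimately show ?thesis using R(1) by (simp add: ln_div)
  qed
  then show ?thesis using that[of "\<bar>ln R\<bar> + R"] R by fastforce
qed

lemma cut_fun_cpow_test_fun:
  assumes f: "cut_fun f" shows "test_fun (cpow f w)"
proof -
  obtain K where K: "K \<ge> 0" "\<And>x. f x \<noteq> 0 ==> \<bar>ln (norm (f x))\<bar> \<le> K" "\<And>x. f x \<noteq> 0 ==> norm x \<le> K"
    using cut_fun_ln_bound[OF f] by blast
  let ?R = "exp (\<bar>Re w\<bar> * K) + K"
  have "norm (cpow f w x) \<le> ?R \<and> (norm x > ?R \<longrightarrow> cpow f w x = 0)" for x
  proof (cases "f x = 0")
    case False
    have "Re w * ln (norm (f x)) \<le> \<bar>Re w\<bar> * K"
      using mult_mono[OF order_refl K(2)[OF False], of "\<bar>Re w\<bar>"] by (simp add: abs_mult[symmetric] abs_le_iff)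
    then have "norm (cpow f w x) \<le> exp (\<bar>Re w\<bar> * K)" using False by (simp add: norm_cpow powr_def)
    moreover have "norm x \<le> ?R" using K(3)[OF False] by (simp add: add_increasing)
    ultimately show ?thesis using K(1) by auto
  qed (use K(1) in \<open>simp add: cpow_def add_nonneg_nonneg\<close>)
  then show ?thesis unfolding test_fun_def using f cpow_measurable[of f w] by (auto simp: cut_fun_def)
qed

lemma norm_LINT_le:
  fixes f :: "'a => 'b::{banach,second_countable_topology}"
  assumes "integrable M f" "integrable M g" "\<And>x. norm (f x) \<le> g x"
  shows "norm (LINT x|M. f x) \<le> (LINT x|M. g x)"
  by (rule order_trans[OF integral_norm_bound integral_mono[OF integrable_norm[OF assms(1)] assms(2)]]) (rule assms(3))

text \<open>Differentiation under the integral: as \<open>l\<close> is bounded, the remainder of the exponential is quadratic in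
  the increment of \<open>z\<close>, uniformly in \<open>w\<close>.\<close>

lemma exp_integral_holomorphic:
  fixes K :: "'a => complex" and l :: "'a => real"
  assumes K: "integrable M K" and [measurable]: "l \<in> borel_measurable M" and l: "\<And>w. \<bar>l w\<bar> \<le> \<Lambda>"
  shows "(\<lambda>z. LINT w|M. K w * exp (z * of_real (l w))) holomorphic_on UNIV"
    and "0 \<le> Re z ==> Re z \<le> 1 ==> norm (LINT w|M. K w * exp (z * of_real (l w))) \<le> exp \<Lambda> * (LINT w|M. norm (K w))"
proof -
  have \<Lambda>: "\<Lambda> \<ge> 0" using order_trans[OF abs_ge_zero l] .
  have [measurable]: "K \<in> borel_measurable M" using K by auto
  have ne: "norm (exp (z * of_real (l w))) \<le> exp (\<bar>Re z\<bar> * \<Lambda>)" for z :: complex and w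
  proof -
    have "Re z * l w \<le> \<bar>Re z\<bar> * \<Lambda>" using mult_mono[OF order_refl l[of w], of "\<bar>Re z\<bar>"] by (simp add: abs_mult[symmetric] abs_le_iff)
    then show ?thesis by simp
  qed
  have int: "integrable M (\<lambda>w. K w * exp (z * of_real (l w)))" for z
    by (rule integrable_mult_bounded[OF K _ ne]) measurable
  have int': "integrable M (\<lambda>w. K w * (of_real (l w) * exp (z * of_real (l w))))" for z
  proof (rule integrable_mult_bounded[OF K])
    show "norm (of_real (l w) * exp (z * of_real (l w))) \<le> \<Lambda> * exp (\<bar>Re z\<bar> * \<Lambda>)" for w
      unfolding norm_mult using l ne \<Lambda> by (intro mult_mono) auto
  qed measurable
  define \<Phi> where "\<Phi> = (\<lambda>z. LINT w|M. K w * exp (z * of_real (l w)))"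
  define D where "D = (\<lambda>z. LINT w|M. K w * (of_real (l w) * exp (z * of_real (l w))))"
  define B where "B = (\<lambda>z :: complex. exp \<Lambda> * \<Lambda>\<^sup>2 * exp (\<bar>Re z\<bar> * \<Lambda>) * (LINT w|M. norm (K w)))"
  have est: "norm (\<Phi> (z + h) - \<Phi> z - h * D z) \<le> (norm h)\<^sup>2 * B z" if h: "norm h \<le> 1" for z h
  proof -
    let ?e = "\<lambda>w. exp (z * of_real (l w))"
    have "\<Phi> (z + h) - \<Phi> z - h * D z = (LINT w|M. K w * (?e w * (exp (h * of_real (l w)) - 1 - h * of_real (l w))))"
    proof -
      have "h * D z = (LINT w|M. h * (K w * (of_real (l w) * ?e w)))" unfolding D_def by (rule integral_mult_right_zero[symmetric])
      then have "\<Phi> (z + h) - \<Phi> z - h * D z = (LINT w|M. K w * exp ((z + h) * of_real (l w)) - K w * ?e w - h * (K w * (of_real (l w) * ?e w)))"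
        unfolding \<Phi>_def using int int' by simp
      also have "\<dots> = (LINT w|M. K w * (?e w * (exp (h * of_real (l w)) - 1 - h * of_real (l w))))"
        by (intro Bochner_Integration.integral_cong refl) (simp add: distrib_right exp_add algebra_simps)
      finally show ?thesis .
    qed
    also have "norm \<dots> \<le> (LINT w|M. ((norm h)\<^sup>2 * (exp \<Lambda> * \<Lambda>\<^sup>2 * exp (\<bar>Re z\<bar> * \<Lambda>))) * norm (K w))"
    proof (rule norm_LINT_le)
      have bd: "norm (?e w * (exp (h * of_real (l w)) - 1 - h * of_real (l w))) \<le> (norm h)\<^sup>2 * (exp \<Lambda> * \<Lambda>\<^sup>2 * exp (\<bar>Re z\<bar> * \<Lambda>))" for w
      proof -
        let ?u = "h * complex_of_real (l w)"
        have nu: "norm ?u \<le> norm h * \<Lambda>" unfolding norm_mult using l[of w] by (intro mult_left_mono) auto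
        also have "\<dots> \<le> \<Lambda>" using mult_right_mono[OF h \<Lambda>] by simp
        finally have nu': "norm ?u \<le> \<Lambda>" .
        have "norm (exp ?u - (\<Sum>i\<le>1. ?u ^ i / fact i)) \<le> exp \<bar>Re ?u\<bar> * norm ?u ^ Suc 1 / fact 1"
          by (rule Taylor_exp)
        then have "norm (exp ?u - 1 - ?u) \<le> exp \<bar>Re ?u\<bar> * (norm ?u)\<^sup>2"
          by (simp add: power2_eq_square algebra_simps)
        also have "\<dots> \<le> exp \<Lambda> * (norm h * \<Lambda>)\<^sup>2"
          using nu nu' abs_Re_le_cmod[of ?u] by (intro mult_mono power_mono) auto
        finally have "norm (?e w) * norm (exp ?u - 1 - ?u) \<le> exp (\<bar>Re z\<bar> * \<Lambda>) * (exp \<Lambda> * (norm h * \<Lambda>)\<^sup>2)"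
          by (intro mult_mono ne) auto
        then show ?thesis by (simp add: norm_mult power_mult_distrib mult_ac)
      qed
      show "integrable M (\<lambda>w. K w * (?e w * (exp (h * of_real (l w)) - 1 - h * of_real (l w))))"
        by (rule integrable_mult_bounded[OF K _ bd]) measurable
      show "integrable M (\<lambda>w. ((norm h)\<^sup>2 * (exp \<Lambda> * \<Lambda>\<^sup>2 * exp (\<bar>Re z\<bar> * \<Lambda>))) * norm (K w))" using K by simp
      fix w
      show "norm (K w * (?e w * (exp (h * of_real (l w)) - 1 - h * of_real (l w)))) \<le> ((norm h)\<^sup>2 * (exp \<Lambda> * \<Lambda>\<^sup>2 * exp (\<bar>Re z\<bar> * \<Lambda>))) * norm (K w)"
        unfolding norm_mult[of "K w"] using mult_right_mono[OF bd[of w], of "norm (K w)"] by (simp add: mult.commute)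
    qed
    also have "\<dots> = (norm h)\<^sup>2 * B z" by (simp add: B_def)
    finally show ?thesis .
  qed
  have "(\<Phi> has_field_derivative D z) (at z)" for z
    unfolding DERIV_def
  proof (rule LIM_zero_cancel, rule Lim_null_comparison)
    have "((\<lambda>h :: complex. norm h * B z) \<longlongrightarrow> norm (0::complex) * B z) (at 0)" by (intro tendsto_intros)
    then show "((\<lambda>h :: complex. norm h * B z) \<longlongrightarrow> 0) (at 0)" by simp
    have "\<forall>\<^sub>F h in at (0::complex). h \<noteq> 0 \<and> norm h \<le> 1"
      by (auto simp: eventually_at intro!: exI[of _ 1])
    then show "\<forall>\<^sub>F h in at 0. norm ((\<Phi> (z + h) - \<Phi> z) / h - D z) \<le> norm h * B z"
    proof eventually_elim
      case (elim h)
      then have "(\<Phi> (z + h) - \<Phi> z) / h - D z = (\<Phi> (z + h) - \<Phi> z - h * D z) / h" by (simp add: diff_divide_distrib)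
      then have "norm ((\<Phi> (z + h) - \<Phi> z) / h - D z) = norm (\<Phi> (z + h) - \<Phi> z - h * D z) / norm h" by (simp add: norm_divide)
      also have "\<dots> \<le> ((norm h)\<^sup>2 * B z) / norm h" using elim by (intro divide_right_mono est) auto
      also have "\<dots> = norm h * B z" using elim by (simp add: power2_eq_square)
      finally show ?case .
    qed
  qed
  then have "\<Phi> holomorphic_on UNIV" by (auto simp: holomorphic_on_def field_differentiable_def)
  then show "(\<lambda>z. LINT w|M. K w * exp (z * of_real (l w))) holomorphic_on UNIV" unfolding \<Phi>_def .
  assume z: "0 \<le> Re z" "Re z \<le> 1"
  have "norm (LINT w|M. K w * exp (z * of_real (l w))) \<le> (LINT w|M. exp \<Lambda> * norm (K w))"
  proof (rule norm_LINT_le[OF int])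
    fix w
    have "norm (exp (z * of_real (l w))) \<le> exp \<Lambda>"
      using ne[where z = z and w = w] mult_right_mono[OF z(2) \<Lambda>] z by (auto elim: order_trans)
    then show "norm (K w * exp (z * of_real (l w))) \<le> exp \<Lambda> * norm (K w)"
      unfolding norm_mult by (subst mult.commute) (intro mult_right_mono, auto)
  qed (use K in simp)
  then show "norm (LINT w|M. K w * exp (z * of_real (l w))) \<le> exp \<Lambda> * (LINT w|M. norm (K w))" by simp
qed

text \<open>As a double integral over \<open>x\<close> and \<open>y\<close> the pairing has the form \<open>K exp (z l)\<close>, where \<open>l\<close> collects the
  logarithms of \<open>\<bar>f\<bar>\<close> and \<open>\<bar>g\<bar>\<close>.\<close>

lemma bilinear_family_holomorphic:
  fixes f g \<theta> :: "('d::{finite,linorder}) cfun" and \<alpha> \<beta> \<gamma> \<delta> :: real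
  assumes f: "cut_fun f" and g: "cut_fun g" and \<theta>: "\<theta> \<in> schwartz"
  defines "I \<equiv> \<lambda>z. LINT x|lborel. cv (cpow f (of_real \<alpha> + of_real \<beta> * z)) \<theta> x * cpow g (of_real \<gamma> + of_real \<delta> * z) x"
  shows "I holomorphic_on UNIV" "\<exists>B. \<forall>z. 0 \<le> Re z \<longrightarrow> Re z \<le> 1 \<longrightarrow> norm (I z) \<le> B"
proof -
  note tf = cut_fun_cpow_test_fun[OF f] and tg = cut_fun_cpow_test_fun[OF g]
  note [measurable] = schwartz_measurable[OF \<theta>] test_fun_measurable[OF tf] test_fun_measurable[OF tg]
  have [measurable]: "f \<in> borel_measurable borel" "g \<in> borel_measurable borel" using f g by (auto simp: cut_fun_def)
  have pair: "integrable (lborel \<Otimes>\<^sub>M lborel) (\<lambda>(y, x). cpow f a y * \<theta> (x - y) * cpow g b x)" for a b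
  proof -
    obtain B where B: "\<And>x. norm (cpow g b x) \<le> B" using test_fun_bounded[OF tg] by blast
    have "integrable (lborel \<Otimes>\<^sub>M lborel) (\<lambda>w. (case w of (y, x) => cpow f a y * \<theta> (x - y)) * cpow g b (snd w))"
      by (rule integrable_mult_bounded[OF convolution_pair_integrable[OF test_fun_integrable[OF tf] schwartz_integrable[OF \<theta>]] _ B]) measurable
    then show ?thesis by (simp add: case_prod_unfold)
  qed
  have eq: "(LINT x|lborel. cv (cpow f a) \<theta> x * cpow g b x) = (LINT w|(lborel \<Otimes>\<^sub>M lborel). (case w of (y, x) => cpow f a y * \<theta> (x - y) * cpow g b x))" for a b
  proof -
    have "(LINT x|lborel. cv (cpow f a) \<theta> x * cpow g b x) = (LINT x|lborel. LINT y|lborel. cpow f a y * \<theta> (x - y) * cpow g b x)"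
      unfolding cv_def by simp
    also have "\<dots> = (LINT w|(lborel \<Otimes>\<^sub>M lborel). (case w of (y, x) => cpow f a y * \<theta> (x - y) * cpow g b x))"
      using lborel_pair.integral_snd[OF pair] by simp
    finally show ?thesis .
  qed
  obtain Kf where Kf: "Kf \<ge> 0" "\<And>x. f x \<noteq> 0 ==> \<bar>ln (norm (f x))\<bar> \<le> Kf" "\<And>x. f x \<noteq> 0 ==> norm x \<le> Kf"
    using cut_fun_ln_bound[OF f] by blast
  obtain Kg where Kg: "Kg \<ge> 0" "\<And>x. g x \<noteq> 0 ==> \<bar>ln (norm (g x))\<bar> \<le> Kg" "\<And>x. g x \<noteq> 0 ==> norm x \<le> Kg"
    using cut_fun_ln_bound[OF g] by blast
  have Kf': "\<bar>ln (norm (f x))\<bar> \<le> Kf" for x using Kf(1) Kf(2)[of x] by (cases "f x = 0") auto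
  have Kg': "\<bar>ln (norm (g x))\<bar> \<le> Kg" for x using Kg(1) Kg(2)[of x] by (cases "g x = 0") auto
  define K where "K = (\<lambda>w. case w of (y, x) => cpow f (of_real \<alpha>) y * \<theta> (x - y) * cpow g (of_real \<gamma>) x)"
  define l where "l = (\<lambda>w. \<beta> * ln (norm (f (fst w))) + \<delta> * ln (norm (g (snd w))))"
  have lm: "l \<in> borel_measurable (lborel \<Otimes>\<^sub>M lborel)" unfolding l_def by measurable
  have lb: "\<bar>l w\<bar> \<le> \<bar>\<beta>\<bar> * Kf + \<bar>\<delta>\<bar> * Kg" for w
  proof -
    have "\<bar>l w\<bar> \<le> \<bar>\<beta>\<bar> * \<bar>ln (norm (f (fst w)))\<bar> + \<bar>\<delta>\<bar> * \<bar>ln (norm (g (snd w)))\<bar>"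
      unfolding l_def abs_mult[symmetric] by (rule abs_triangle_ineq)
    also have "\<dots> \<le> \<bar>\<beta>\<bar> * Kf + \<bar>\<delta>\<bar> * Kg" by (intro add_mono mult_left_mono Kf' Kg') auto
    finally show ?thesis .
  qed
  have Ki: "integrable (lborel \<Otimes>\<^sub>M lborel) K" unfolding K_def by (rule pair)
  have I: "I = (\<lambda>z. LINT w|(lborel \<Otimes>\<^sub>M lborel). K w * exp (z * of_real (l w)))"
  proof
    fix z
    show "I z = (LINT w|(lborel \<Otimes>\<^sub>M lborel). K w * exp (z * of_real (l w)))"
      unfolding I_def eq
    proof (intro Bochner_Integration.integral_cong refl)
      fix w :: "'d rvec \<times> 'd rvec"
      obtain y x where w: "w = (y, x)" by (cases w)
      show "(case w of (y, x) => cpow f (of_real \<alpha> + of_real \<beta> * z) y * \<theta> (x - y) * cpow g (of_real \<gamma> + of_real \<delta> * z) x)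
         = K w * exp (z * of_real (l w))"
        unfolding w by (simp add: K_def l_def cpow_def distrib_right distrib_left exp_add mult_ac)
    qed
  qed
  show "I holomorphic_on UNIV" unfolding I by (rule exp_integral_holomorphic(1)[OF Ki lm lb])
  show "\<exists>B. \<forall>z. 0 \<le> Re z \<longrightarrow> Re z \<le> 1 \<longrightarrow> norm (I z) \<le> B"
    unfolding I using exp_integral_holomorphic(2)[OF Ki lm lb] by blast
qed

lemma LINT_le_of_nn_integral_le:
  fixes f :: "'a => real"
  assumes [measurable]: "f \<in> borel_measurable M" and f: "\<And>x. f x \<ge> 0"
    and le: "(\<integral>\<^sup>+x. ennreal (f x) \<partial>M) \<le> ennreal a" and a: "a \<ge> 0"
  shows "integrable M f" "(LINT x|M. f x) \<le> a"
proof -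
  have "(\<integral>\<^sup>+x. ennreal (norm (f x)) \<partial>M) < \<infinity>" using le f by (simp add: le_less_trans)
  then show i: "integrable M f" by (intro integrableI_bounded) auto
  have "ennreal (LINT x|M. f x) = (\<integral>\<^sup>+x. ennreal (f x) \<partial>M)"
    by (rule nn_integral_eq_integral[OF i, symmetric]) (use f in auto)
  then have "ennreal (LINT x|M. f x) \<le> ennreal a" using le by (simp only:)
  then show "(LINT x|M. f x) \<le> a" using ennreal_le_iff[OF a] by blast
qed

section \<open>Riesz-Thorin interpolation for the synthesis operator\<close>

lemma cv_scale: "cv (\<lambda>y. c * p y) \<theta> x = c * cv p \<theta> x"
  unfolding cv_def by (simp add: mult.assoc)

lemma test_fun_scale: assumes "test_fun p" shows "test_fun (\<lambda>x. c * p x)"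
proof -
  obtain R where R: "\<And>x. norm (p x) \<le> R \<and> (norm x > R \<longrightarrow> p x = 0)" and [measurable]: "p \<in> borel_measurable borel"
    using assms by (auto simp: test_fun_def)
  have R0: "R \<ge> 0" using R[of 0] norm_ge_zero order_trans by blast
  have "norm (c * p x) \<le> norm c * R + R \<and> (norm x > norm c * R + R \<longrightarrow> c * p x = 0)" for x
  proof
    have "norm (c * p x) \<le> norm c * R" unfolding norm_mult using R[of x] by (intro mult_left_mono) auto
    then show "norm (c * p x) \<le> norm c * R + R" using R0 by simp
    have "norm c * R \<ge> 0" using R0 by simp
    then show "norm x > norm c * R + R \<longrightarrow> c * p x = 0" using R[of x] by auto
  qed
  then show ?thesis unfolding test_fun_def by auto
qed

text \<open>At the edge \<open>Re z = 0\<close> of the strip, Young's inequality for convolutions in \<open>L^1\<close> or \<open>L^\<infinity>\<close> and the triangle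
  inequality over \<open>j\<close> suffice.\<close>

lemma bilinear_edge_zero:
  fixes p :: "nat => ('d::{finite,linorder}) cfun"
  assumes J: "finite J" and p: "\<And>j. j \<in> J ==> test_fun (p j)" and \<theta>: "\<And>j. \<theta> j \<in> schwartz" and w: "test_fun w"
    and C: "\<And>j. (\<integral>\<^sup>+x. ennreal (norm (\<theta> j x)) \<partial>lborel) \<le> ennreal C" "C > 0"
    and a: "\<And>j. a j \<ge> 0" "(\<Sum>j\<in>J. a j) \<le> 1"
    and edge: "((\<forall>j\<in>J. (\<integral>\<^sup>+x. ennreal (norm (p j x)) \<partial>lborel) \<le> ennreal (a j)) \<and> (\<forall>x. norm (w x) \<le> 1)) \<or>
      ((\<forall>j\<in>J. \<forall>x. norm (p j x) \<le> a j) \<and> (\<integral>\<^sup>+x. ennreal (norm (w x)) \<partial>lborel) \<le> 1)"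
  shows "norm (\<Sum>j\<in>J. (LINT x|lborel. cv (p j) (\<theta> j) x * w x)) \<le> C"
proof -
  note [measurable] = test_fun_measurable[OF w]
  have each: "norm (LINT x|lborel. cv (p j) (\<theta> j) x * w x) \<le> C * a j" if j: "j \<in> J" for j
    using edge
  proof (elim disjE conjE)
    assume e: "\<forall>j\<in>J. (\<integral>\<^sup>+x. ennreal (norm (p j x)) \<partial>lborel) \<le> ennreal (a j)" "\<forall>x. norm (w x) \<le> 1"
    note c = cv_test_fun[OF p[OF j] \<theta>]
    have "(\<integral>\<^sup>+x. ennreal (norm (cv (p j) (\<theta> j) x) powr 1) \<partial>lborel) \<le> ennreal (C powr 1) * (\<integral>\<^sup>+x. ennreal (norm (p j x) powr 1) \<partial>lborel)"
      by (rule nn_integral_cv_le[OF test_fun_measurable[OF p[OF j]] schwartz_measurable[OF \<theta>] C]) simp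
    also have "\<dots> \<le> ennreal (C powr 1) * ennreal (a j)" using e(1) j by (intro mult_left_mono) auto
    finally have "(\<integral>\<^sup>+x. ennreal (norm (cv (p j) (\<theta> j) x)) \<partial>lborel) \<le> ennreal (C * a j)"
      using C(2) a(1) by (simp add: ennreal_mult)
    then have "(LINT x|lborel. norm (cv (p j) (\<theta> j) x)) \<le> C * a j"
      using c(1) C(2) a(1) by (intro LINT_le_of_nn_integral_le) auto
    moreover have "norm (LINT x|lborel. cv (p j) (\<theta> j) x * w x) \<le> (LINT x|lborel. norm (cv (p j) (\<theta> j) x))"
      using c(2) e(2) by (intro norm_LINT_le integrable_mult_bounded[where B = 1]) (auto simp: norm_mult mult_left_le)
    ultimately show ?thesis by linarith
  next
    assume e: "\<forall>j\<in>J. \<forall>x. norm (p j x) \<le> a j" "(\<integral>\<^sup>+x. ennreal (norm (w x)) \<partial>lborel) \<le> 1"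
    note c = cv_test_fun[OF p[OF j] \<theta>]
    have b: "norm (cv (p j) (\<theta> j) x) \<le> C * a j" for x
    proof -
      have i\<theta>: "integrable lborel (\<lambda>y. \<theta> j (x - y))" by (rule integrable_reflect[OF schwartz_integrable[OF \<theta>]])
      have "(\<integral>\<^sup>+y. ennreal (norm (\<theta> j (x - y))) \<partial>lborel) \<le> ennreal C"
        using C(1)[of j] nn_integral_reflect[of "\<lambda>y. ennreal (norm (\<theta> j y))" x] schwartz_measurable[OF \<theta>[of j]] by simp
      then have "(LINT y|lborel. norm (\<theta> j (x - y))) \<le> C"
        using i\<theta> C(2) by (intro LINT_le_of_nn_integral_le) auto
      moreover have "norm (cv (p j) (\<theta> j) x) \<le> (LINT y|lborel. a j * norm (\<theta> j (x - y)))"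
        unfolding cv_def
        using i\<theta> e(1) j cv_integrable[OF test_fun_poly_growth[OF p[OF j]] \<theta>[of j], of x]
        by (intro norm_LINT_le) (auto simp: norm_mult intro!: mult_right_mono)
      ultimately show ?thesis
        using mult_left_mono[of "LINT y|lborel. norm (\<theta> j (x - y))" C "a j"] a(1)[of j] by (simp add: mult.commute)
    qed
    have iw: "integrable lborel w" by (rule test_fun_integrable[OF w])
    have "(LINT x|lborel. norm (w x)) \<le> 1" using e(2) by (intro LINT_le_of_nn_integral_le) auto
    then have "(C * a j) * (LINT x|lborel. norm (w x)) \<le> (C * a j) * 1" using C(2) a(1) by (intro mult_left_mono) auto
    moreover have "norm (LINT x|lborel. cv (p j) (\<theta> j) x * w x) \<le> (LINT x|lborel. (C * a j) * norm (w x))"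
    proof (rule norm_LINT_le)
      show "integrable lborel (\<lambda>x. cv (p j) (\<theta> j) x * w x)"
        by (subst mult.commute) (rule integrable_mult_bounded[OF iw _ b], use c(1) in simp)
      show "norm (cv (p j) (\<theta> j) x * w x) \<le> (C * a j) * norm (w x)" for x
        unfolding norm_mult by (intro mult_right_mono b) simp
    qed (use iw in simp)
    ultimately show ?thesis by simp
  qed
  have "norm (\<Sum>j\<in>J. (LINT x|lborel. cv (p j) (\<theta> j) x * w x)) \<le> (\<Sum>j\<in>J. C * a j)"
    by (intro sum_norm_le each)
  also have "\<dots> \<le> C * 1" unfolding sum_distrib_left[symmetric] using C(2) a(2) by (intro mult_left_mono) auto
  finally show ?thesis by simp
qed

text \<open>At the edge \<open>Re z = 1\<close> both sides of the pairing are in \<open>L^2\<close>, and \<open>almost_orthogonal_sum\<close> bounds the sum.\<close>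

lemma bilinear_edge_one:
  fixes p :: "nat => ('d::{finite,linorder}) cfun"
  assumes J: "finite J" and p: "\<And>j. j \<in> J ==> test_fun (p j)" and \<theta>: "\<And>j. \<theta> j \<in> schwartz" and w: "test_fun w"
    and disj: "\<And>j k \<xi>. j + L < k \<or> k + L < j ==> fourier (\<theta> j) \<xi> * cnj (fourier (\<theta> k) \<xi>) = 0"
    and C: "\<And>j. (\<integral>\<^sup>+x. ennreal (norm (\<theta> j x)) \<partial>lborel) \<le> ennreal C" "C > 0"
    and a: "\<And>j. a j \<ge> 0" "(\<Sum>j\<in>J. a j) \<le> 1"
    and pa: "\<And>j. j \<in> J ==> (\<integral>\<^sup>+x. ennreal (norm (p j x) powr 2) \<partial>lborel) \<le> ennreal (a j)"
    and w2: "(\<integral>\<^sup>+x. ennreal (norm (w x) powr 2) \<partial>lborel) \<le> 1"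
  shows "norm (\<Sum>j\<in>J. (LINT x|lborel. cv (p j) (\<theta> j) x * w x)) \<le> real (2 * L + 1) * C"
proof -
  note [measurable] = test_fun_measurable[OF w]
  let ?h = "\<lambda>x. \<Sum>j\<in>J. cv (p j) (\<theta> j) x"
  let ?M = "real (2 * L + 1) * C"
  have M: "?M > 0" using C(2) by simp
  have ii: "integrable lborel (\<lambda>x. cv (p j) (\<theta> j) x * w x)" if j: "j \<in> J" for j
  proof -
    obtain B where B: "\<And>x. norm (w x) \<le> B" using test_fun_bounded[OF w] by blast
    show ?thesis by (rule integrable_mult_bounded[OF cv_test_fun(2)[OF p[OF j] \<theta>] _ B]) measurable
  qed
  have h: "integrable lborel (\<lambda>x. (norm (?h x))\<^sup>2)" "(LINT x|lborel. (norm (?h x))\<^sup>2) \<le> real (2 * L + 1) * C\<^sup>2 * (\<Sum>j\<in>J. a j)"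
    by (rule almost_orthogonal_sum[where p = p and \<theta> = \<theta> and L = L and a = a, OF J p \<theta> disj C pa a(1)]; assumption)+
  have "real (2 * L + 1) * C\<^sup>2 * (\<Sum>j\<in>J. a j) \<le> real (2 * L + 1) * C\<^sup>2 * 1"
    using a(2) by (intro mult_left_mono) auto
  also have "\<dots> \<le> ?M\<^sup>2" using C(2) by (simp add: power2_eq_square mult_le_cancel_right1 mult_mono)
  finally have h2: "(LINT x|lborel. (norm (?h x))\<^sup>2) \<le> ?M\<^sup>2" using h(2) by linarith
  have w2': "integrable lborel (\<lambda>x. (norm (w x))\<^sup>2)" "(LINT x|lborel. (norm (w x))\<^sup>2) \<le> 1"
  proof -
    have w2e: "(\<integral>\<^sup>+x. ennreal ((norm (w x))\<^sup>2) \<partial>lborel) \<le> ennreal 1" using w2 by (simp add: powr_numeral)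
    show "integrable lborel (\<lambda>x. (norm (w x))\<^sup>2)" "(LINT x|lborel. (norm (w x))\<^sup>2) \<le> 1"
      by (rule LINT_le_of_nn_integral_le[OF _ _ w2e]; simp)+
  qed
  have "(\<Sum>j\<in>J. (LINT x|lborel. cv (p j) (\<theta> j) x * w x)) = (LINT x|lborel. ?h x * w x)"
    by (simp add: sum_distrib_right Bochner_Integration.integral_sum[OF ii])
  also have "norm \<dots> \<le> (LINT x|lborel. (norm (?h x))\<^sup>2 / (2 * ?M) + ?M / 2 * (norm (w x))\<^sup>2)"
  proof (rule norm_LINT_le)
    show "integrable lborel (\<lambda>x. ?h x * w x)" by (simp add: sum_distrib_right ii)
    show "integrable lborel (\<lambda>x. (norm (?h x))\<^sup>2 / (2 * ?M) + ?M / 2 * (norm (w x))\<^sup>2)" using h(1) w2'(1) by simp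
    fix x
    have amgm: "s * t \<le> s\<^sup>2 / (2 * m) + m / 2 * t\<^sup>2" if "m > 0" for s t m :: real
    proof -
      have "0 \<le> (s - m * t)\<^sup>2 / (2 * m)" using that by simp
      also have "(s - m * t)\<^sup>2 / (2 * m) = s\<^sup>2 / (2 * m) + m / 2 * t\<^sup>2 - s * t"
        using that by (simp add: power2_eq_square field_simps)
      finally show ?thesis by simp
    qed
    show "norm (?h x * w x) \<le> (norm (?h x))\<^sup>2 / (2 * ?M) + ?M / 2 * (norm (w x))\<^sup>2"
      unfolding norm_mult by (rule amgm[OF M])
  qed
  also have "\<dots> = (LINT x|lborel. (norm (?h x))\<^sup>2) / (2 * ?M) + ?M / 2 * (LINT x|lborel. (norm (w x))\<^sup>2)"
    using h(1) w2'(1) by simp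
  also have "\<dots> \<le> ?M\<^sup>2 / (2 * ?M) + ?M / 2 * 1"
    using M h2 w2'(2) by (intro add_mono divide_right_mono mult_left_mono) auto
  also have "\<dots> = ?M" using M by (simp add: power2_eq_square)
  finally show ?thesis .
qed

text \<open>Stein-Thorin interpolation by duality. The pieces and the dual function are embedded in analytic
  families that pass through them at the real point \<open>\<tau>\<close>. The endpoint \<open>e0 = 1\<close> stands for \<open>L^1\<close> and \<open>e0 = 0\<close> for \<open>L^\<infinity>\<close>,
  and \<open>1/q\<close> lies at distance \<open>\<tau>\<close> on the way from \<open>e0\<close> to \<open>1/2\<close>.\<close>

lemma riesz_thorin_bilinear:
  fixes F :: "nat => ('d::{finite,linorder}) cfun" and e0 \<tau> q q' t :: real
  assumes J: "finite J" and F: "\<And>j. j \<in> J ==> cut_fun (F j)" and \<theta>: "\<And>j. \<theta> j \<in> schwartz" and g: "cut_fun g"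
    and disj: "\<And>j k \<xi>. j + L < k \<or> k + L < j ==> fourier (\<theta> j) \<xi> * cnj (fourier (\<theta> k) \<xi>) = 0"
    and C: "\<And>j. (\<integral>\<^sup>+x. ennreal (norm (\<theta> j x)) \<partial>lborel) \<le> ennreal C" "C > 0"
    and c: "\<And>j. c j > 0" "(\<Sum>j\<in>J. c j powr t) \<le> 1"
    and Fc: "\<And>j. j \<in> J ==> (\<integral>\<^sup>+x. ennreal (norm (F j x) powr q) \<partial>lborel) \<le> ennreal (c j powr q)"
    and gc: "(\<integral>\<^sup>+x. ennreal (norm (g x) powr q') \<partial>lborel) \<le> 1"
    and q: "q > 0" "1 / q + 1 / q' = 1" "q' > 0"
    and e0: "e0 = 0 \<or> e0 = 1" and \<tau>: "0 \<le> \<tau>" "\<tau> \<le> 1"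
    and eq: "1 / q = e0 + (1 / 2 - e0) * \<tau>" and et: "t * (1 - \<tau> / 2) = 1"
  shows "norm (\<Sum>j\<in>J. (LINT x|lborel. cv (F j) (\<theta> j) x * g x)) \<le> real (2 * L + 1) * C"
proof -
  \<comment> \<open>The exponents are the affine functions of \<open>z\<close> for which at \<open>Re z = 0\<close> the \<open>L^1\<close> norm (if \<open>e0 = 1\<close>) or the
    supremum (if \<open>e0 = 0\<close>) of \<open>p z j\<close> is at most \<open>c j^t\<close>, and
    at \<open>Re z = 1\<close> the integral of \<open>\<bar>p z j\<bar>^2\<close> is, while at \<open>z = \<tau>\<close> both families give back the data.\<close>
  define \<alpha> where "\<alpha> = q * e0"
  define \<beta> where "\<beta> = q * (1 / 2 - e0)"
  define \<gamma> where "\<gamma> = q' * (1 - e0)"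
  define \<delta> where "\<delta> = - (q' * (1 / 2 - e0))"
  define r0 where "r0 = t - q * e0"
  define r1 where "r1 = - (t / 2) - q * (1 / 2 - e0)"
  define d where "d = (\<lambda>j (z :: complex). exp ((of_real r0 + of_real r1 * z) * of_real (ln (c j))))"
  have nd: "norm (d j z) = c j powr (r0 + r1 * Re z)" for j and z :: complex
    using c(1)[of j] by (simp add: d_def powr_def)
  define p where "p = (\<lambda>(z :: complex) j y. d j z * cpow (F j) (of_real \<alpha> + of_real \<beta> * z) y)"
  define w where "w = (\<lambda>z. cpow g (of_real \<gamma> + of_real \<delta> * z))"
  define I where "I = (\<lambda>j z. LINT x|lborel. cv (cpow (F j) (of_real \<alpha> + of_real \<beta> * z)) (\<theta> j) x * w z x)"
  define \<Phi> where "\<Phi> = (\<lambda>z. \<Sum>j\<in>J. d j z * I j z)"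
  have \<Phi>: "\<Phi> z = (\<Sum>j\<in>J. (LINT x|lborel. cv (p z j) (\<theta> j) x * w z x))" for z
    unfolding \<Phi>_def I_def p_def cv_scale integral_mult_right_zero[symmetric] by (simp add: mult.assoc)
  have tp: "test_fun (p z j)" if "j \<in> J" for z j
    unfolding p_def by (intro test_fun_scale cut_fun_cpow_test_fun F that)
  have tw: "test_fun (w z)" for z unfolding w_def by (rule cut_fun_cpow_test_fun[OF g])
  have np: "norm (p z j y) = c j powr (r0 + r1 * Re z) * norm (F j y) powr (\<alpha> + \<beta> * Re z)" for z :: complex and j y
    by (simp add: p_def norm_mult nd norm_cpow)
  have nw: "norm (w z x) = norm (g x) powr (\<gamma> + \<delta> * Re z)" for z :: complex and x by (simp add: w_def norm_cpow)
  have hol: "\<Phi> holomorphic_on UNIV"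
    unfolding \<Phi>_def
  proof (intro holomorphic_on_sum holomorphic_on_mult)
    fix j assume j: "j \<in> J"
    show "d j holomorphic_on UNIV" unfolding d_def by (intro holomorphic_intros)
    show "I j holomorphic_on UNIV" using bilinear_family_holomorphic(1)[OF F[OF j] g \<theta>[of j], of \<alpha> \<beta> \<gamma> \<delta>]
      unfolding I_def w_def .
  qed
  have "\<forall>j\<in>J. \<exists>B. \<forall>z. 0 \<le> Re z \<longrightarrow> Re z \<le> 1 \<longrightarrow> norm (I j z) \<le> B"
    using bilinear_family_holomorphic(2)[OF F g \<theta>, of _ \<alpha> \<beta> _ \<gamma> \<delta>] unfolding I_def w_def by blast
  then obtain BI where BI: "\<And>j z. j \<in> J ==> 0 \<le> Re z ==> Re z \<le> 1 ==> norm (I j z) \<le> BI j" by metis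
  have bd: "norm (\<Phi> z) \<le> (\<Sum>j\<in>J. exp ((\<bar>r0\<bar> + \<bar>r1\<bar>) * \<bar>ln (c j)\<bar>) * BI j)" if z: "0 \<le> Re z" "Re z \<le> 1" for z
    unfolding \<Phi>_def
  proof (rule sum_norm_le)
    fix j assume j: "j \<in> J"
    have "norm (d j z) \<le> exp ((\<bar>r0\<bar> + \<bar>r1\<bar>) * \<bar>ln (c j)\<bar>)"
    proof -
      have "\<bar>r1 * Re z\<bar> \<le> \<bar>r1\<bar> * 1" unfolding abs_mult using z by (intro mult_left_mono) auto
      then have "\<bar>r0 + r1 * Re z\<bar> \<le> \<bar>r0\<bar> + \<bar>r1\<bar>" by linarith
      then have "\<bar>(r0 + r1 * Re z) * ln (c j)\<bar> \<le> (\<bar>r0\<bar> + \<bar>r1\<bar>) * \<bar>ln (c j)\<bar>"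
        unfolding abs_mult by (intro mult_right_mono) auto
      then show ?thesis using c(1)[of j] by (simp add: nd powr_def)
    qed
    then show "norm (d j z * I j z) \<le> exp ((\<bar>r0\<bar> + \<bar>r1\<bar>) * \<bar>ln (c j)\<bar>) * BI j"
      unfolding norm_mult by (intro mult_mono BI[OF j z]) auto
  qed
  have M0: "C \<le> real (2 * L + 1) * C" using C(2) mult_right_mono[of 1 "real (2 * L + 1)" C] by simp
  have cp: "(\<integral>\<^sup>+x. ennreal (c j powr (t - q) * norm (F j x) powr q) \<partial>lborel) \<le> ennreal (c j powr t)" if j: "j \<in> J" for j
  proof -
    have [measurable]: "F j \<in> borel_measurable borel" using F[OF j] by (simp add: cut_fun_def)
    have "(\<integral>\<^sup>+x. ennreal (c j powr (t - q) * norm (F j x) powr q) \<partial>lborel)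
      = ennreal (c j powr (t - q)) * (\<integral>\<^sup>+x. ennreal (norm (F j x) powr q) \<partial>lborel)"
      by (subst nn_integral_cmult[symmetric]) (auto simp: ennreal_mult)
    also have "\<dots> \<le> ennreal (c j powr (t - q)) * ennreal (c j powr q)" by (intro mult_left_mono Fc j) simp
    also have "\<dots> = ennreal (c j powr t)" using c(1)[of j] by (simp add: ennreal_mult[symmetric] powr_add[symmetric])
    finally show ?thesis .
  qed
  have edge: "norm (\<Phi> z) \<le> real (2 * L + 1) * C" if z: "Re z = 0 \<or> Re z = 1" for z
  proof (cases "Re z = 0")
    case True
    have "norm (\<Phi> z) \<le> C"
      unfolding \<Phi>
    proof (rule bilinear_edge_zero[OF J tp \<theta> tw C _ c(2)])
      show "((\<forall>j\<in>J. (\<integral>\<^sup>+x. ennreal (norm (p z j x)) \<partial>lborel) \<le> ennreal (c j powr t)) \<and> (\<forall>x. norm (w z x) \<le> 1)) \<or>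
        ((\<forall>j\<in>J. \<forall>x. norm (p z j x) \<le> c j powr t) \<and> (\<integral>\<^sup>+x. ennreal (norm (w z x)) \<partial>lborel) \<le> 1)"
        using e0
      proof
        assume e: "e0 = 1"
        have "(\<integral>\<^sup>+x. ennreal (norm (p z j x)) \<partial>lborel) \<le> ennreal (c j powr t)" if "j \<in> J" for j
          using cp[OF that] True e by (simp add: np r0_def \<alpha>_def)
        moreover have "norm (w z x) \<le> 1" for x using True e by (simp add: nw \<gamma>_def powr_zero_eq_one)
        ultimately show ?thesis by blast
      next
        assume e: "e0 = 0"
        have "norm (p z j x) \<le> c j powr t" for j x
          using True e by (cases "F j x = 0") (simp_all add: np r0_def \<alpha>_def)
        moreover have "(\<integral>\<^sup>+x. ennreal (norm (w z x)) \<partial>lborel) \<le> 1"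
          using gc True e by (simp add: nw \<gamma>_def)
        ultimately show ?thesis by blast
      qed
    qed auto
    then show ?thesis using M0 by linarith
  next
    case False
    then have z1: "Re z = 1" using z by blast
    have r: "r0 + r1 = (t - q) / 2" "\<alpha> + \<beta> = q / 2" "\<gamma> + \<delta> = q' / 2"
      by (simp_all add: r0_def r1_def \<alpha>_def \<beta>_def \<gamma>_def \<delta>_def algebra_simps add_divide_distrib diff_divide_distrib)
    show ?thesis unfolding \<Phi>
    proof (rule bilinear_edge_one[OF J tp \<theta> tw disj C _ c(2)])
      fix j assume j: "j \<in> J"
      have "norm (p z j x) powr 2 = c j powr (t - q) * norm (F j x) powr q" for x
      proof -
        have h1: "(t - q) / 2 * 2 = t - q" by (rule nonzero_eq_divide_eq[THEN iffD1, OF _ refl]) simp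
        have h2: "q / 2 * 2 = q" by (rule nonzero_eq_divide_eq[THEN iffD1, OF _ refl]) simp
        have "norm (p z j x) = c j powr ((t - q) / 2) * norm (F j x) powr (q / 2)"
          by (simp only: np z1 mult_1_right r)
        then have "norm (p z j x) powr 2 = c j powr ((t - q) / 2 * 2) * norm (F j x) powr (q / 2 * 2)"
          by (simp only: powr_mult powr_powr)
        then show ?thesis by (simp only: h1 h2)
      qed
      then show "(\<integral>\<^sup>+x. ennreal (norm (p z j x) powr 2) \<partial>lborel) \<le> ennreal (c j powr t)"
        using cp[OF j] by simp
    next
      show "(\<integral>\<^sup>+x. ennreal (norm (w z x) powr 2) \<partial>lborel) \<le> 1"
        using gc by (simp add: nw z1 r powr_powr)
    qed auto
  qed
  have M: "real (2 * L + 1) * C > 0" using C(2) by simp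
  have "norm (\<Phi> (of_real \<tau>)) \<le> real (2 * L + 1) * C"
    by (rule three_lines[OF hol bd M edge]) (use \<tau> in auto)
  moreover have "\<Phi> (of_real \<tau>) = (\<Sum>j\<in>J. (LINT x|lborel. cv (F j) (\<theta> j) x * g x))"
  proof -
    have "\<alpha> + \<beta> * \<tau> = q * (1 / q)" unfolding eq by (simp add: \<alpha>_def \<beta>_def algebra_simps)
    then have 1: "\<alpha> + \<beta> * \<tau> = 1" using q by simp
    have "\<gamma> + \<delta> * \<tau> = q' * (1 - 1 / q)" unfolding eq by (simp add: \<gamma>_def \<delta>_def algebra_simps)
    also have "1 - 1 / q = 1 / q'" using q(2) by linarith
    finally have 2: "\<gamma> + \<delta> * \<tau> = 1" using q by simp
    have 3: "r0 + r1 * \<tau> = t * (1 - \<tau> / 2) - (\<alpha> + \<beta> * \<tau>)"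
      by (simp add: r0_def r1_def \<alpha>_def \<beta>_def algebra_simps)
    have 1: "complex_of_real \<alpha> + complex_of_real \<beta> * complex_of_real \<tau> = 1"
      using arg_cong[OF 1, of complex_of_real] by simp
    have 2: "complex_of_real \<gamma> + complex_of_real \<delta> * complex_of_real \<tau> = 1"
      using arg_cong[OF 2, of complex_of_real] by simp
    have "r0 + r1 * \<tau> = 0" using 3 et \<open>\<alpha> + \<beta> * \<tau> = 1\<close> by simp
    then have "complex_of_real (r0 + r1 * \<tau>) = 0" by (simp only: of_real_0)
    then have 3: "complex_of_real r0 + complex_of_real r1 * complex_of_real \<tau> = 0"
      by (simp only: of_real_add of_real_mult)
    show ?thesis by (simp add: \<Phi>_def d_def I_def w_def 1 2 3 cpow_one)
  qed
  ultimately show ?thesis by simp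
qed

text \<open>Values that are too large or too small are set to 0 and not clipped, so that the truncation agrees with \<open>f\<close>
  wherever it does not vanish.\<close>

definition cutoff :: "nat => ('d::finite) cfun => 'd cfun" where
  "cutoff n f x = (if 1 / real (Suc n) \<le> norm (f x) \<and> norm (f x) \<le> real (Suc n) \<and> norm x \<le> real (Suc n) then f x else 0)"

lemma cutoff_measurable:
  assumes [measurable]: "f \<in> borel_measurable borel" shows "cutoff n f \<in> borel_measurable borel"
  unfolding cutoff_def[abs_def] by measurable

lemma cutoff_cut_fun: assumes "f \<in> borel_measurable borel" shows "cut_fun (cutoff n f)"
  unfolding cut_fun_def using cutoff_measurable[OF assms]
  by (intro conjI exI[of _ "real (Suc n)"]) (auto simp: cutoff_def)

lemma norm_cutoff_le: "norm (cutoff n f x) \<le> norm (f x)"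
  by (simp add: cutoff_def)

lemma cutoff_tendsto: "(\<lambda>n. cutoff n f x) \<longlonglongrightarrow> f x"
proof (cases "f x = 0")
  case True
  then have "cutoff n f x = f x" for n by (simp add: cutoff_def)
  then show ?thesis by simp
next
  case False
  define r where "r = norm (f x) + 1 / norm (f x) + norm x"
  have "\<forall>\<^sub>F n in sequentially. r \<le> real (Suc n)"
    using eventually_ge_at_top[of "nat \<lceil>r\<rceil>"] by eventually_elim linarith
  then have "\<forall>\<^sub>F n in sequentially. cutoff n f x = f x"
  proof eventually_elim
    case (elim n)
    have p: "norm (f x) > 0" "1 / norm (f x) > 0" using False by auto
    then have 1: "1 / norm (f x) \<le> real (Suc n)" "norm (f x) \<le> real (Suc n)" "norm x \<le> real (Suc n)"
      using elim norm_ge_zero[of x] unfolding r_def by linarith+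
    have "1 / real (Suc n) \<le> norm (f x)" using 1(1) p by (simp add: field_simps)
    with 1 show ?case by (simp add: cutoff_def)
  qed
  then show ?thesis by (rule tendsto_eventually)
qed

lemma nn_integral_le_of_tendsto:
  fixes u :: "nat => 'a => ennreal"
  assumes [measurable]: "\<And>n. u n \<in> borel_measurable M" and le: "\<And>n. (\<integral>\<^sup>+x. u n x \<partial>M) \<le> c"
    and lim: "\<And>x. (\<lambda>n. u n x) \<longlonglongrightarrow> f x"
  shows "(\<integral>\<^sup>+x. f x \<partial>M) \<le> c"
proof -
  have "(\<integral>\<^sup>+x. f x \<partial>M) = (\<integral>\<^sup>+x. liminf (\<lambda>n. u n x) \<partial>M)"
    by (intro nn_integral_cong lim_imp_Liminf[symmetric] lim) simp
  also have "\<dots> \<le> liminf (\<lambda>n. \<integral>\<^sup>+x. u n x \<partial>M)" by (rule nn_integral_liminf) measurable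
  also have "\<dots> \<le> c"
    by (rule order_trans[OF Liminf_mono[of _ "\<lambda>n. c"]]) (auto simp: le Liminf_const)
  finally show ?thesis .
qed

definition real_nabla :: "real => real" where
  "real_nabla q = (if q \<le> 2 then q else q / (q - 1))"

text \<open>For \<open>q \<le> 2\<close> the exponent is reached from \<open>L^1\<close>, for \<open>q > 2\<close> from \<open>L^\<infinity>\<close>; correspondingly \<open>1/t\<close> runs from 1 to
  \<open>1/2\<close>. This is where \<open>q^\<nabla>\<close> comes from.\<close>

lemma interpolation_exponents:
  assumes "1 < q"
  obtains e0 \<tau> where "e0 = 0 \<or> e0 = 1" "0 \<le> \<tau>" "\<tau> \<le> 1" "1 / q = e0 + (1 / 2 - e0) * \<tau>"
    "real_nabla q * (1 - \<tau> / 2) = 1"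
proof (cases "q \<le> 2")
  case True
  show ?thesis
    by (rule that[of 1 "2 - 2 / q"]) (use assms True in \<open>auto simp: real_nabla_def field_simps\<close>)
next
  case False
  show ?thesis
    by (rule that[of 0 "2 / q"]) (use assms False in \<open>auto simp: real_nabla_def field_simps\<close>)
qed

text \<open>The bilinear estimate is dualised with the extremal function \<open>cnj h \<bar>h\<bar>^(q - 2)\<close>, normalised in \<open>L^(q')\<close>. Here \<open>h\<close> is
  replaced by its truncation so that the dual function is admissible and its norm is finite a priori.\<close>

lemma synthesis_bound_cut:
  fixes F :: "nat => ('d::{finite,linorder}) cfun"
  assumes J: "finite J" and F: "\<And>j. j \<in> J ==> cut_fun (F j)" and \<theta>: "\<And>j. \<theta> j \<in> schwartz"
    and disj: "\<And>j k \<xi>. j + L < k \<or> k + L < j ==> fourier (\<theta> j) \<xi> * cnj (fourier (\<theta> k) \<xi>) = 0"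
    and C: "\<And>j. (\<integral>\<^sup>+x. ennreal (norm (\<theta> j x)) \<partial>lborel) \<le> ennreal C" "C > 0"
    and q: "1 < q"
    and c: "\<And>j. c j > 0" "(\<Sum>j\<in>J. c j powr real_nabla q) \<le> 1"
    and Fc: "\<And>j. j \<in> J ==> (\<integral>\<^sup>+x. ennreal (norm (F j x) powr q) \<partial>lborel) \<le> ennreal (c j powr q)"
  shows "(\<integral>\<^sup>+x. ennreal (norm (\<Sum>j\<in>J. cv (F j) (\<theta> j) x) powr q) \<partial>lborel) \<le> ennreal ((real (2 * L + 1) * C) powr q)"
proof -
  let ?h = "\<lambda>x. \<Sum>j\<in>J. cv (F j) (\<theta> j) x"
  let ?M = "real (2 * L + 1) * C"
  have tF: "test_fun (F j)" if "j \<in> J" for j using cut_fun_cpow_test_fun[OF F[OF that], of 1] by (simp add: cpow_one)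
  have cm: "cv (F j) (\<theta> j) \<in> borel_measurable borel" if "j \<in> J" for j by (rule cv_test_fun(1)[OF tF[OF that] \<theta>])
  have hm [measurable]: "?h \<in> borel_measurable borel" using cm by (intro borel_measurable_sum)
  obtain e0 \<tau> where e: "e0 = 0 \<or> e0 = 1" "0 \<le> \<tau>" "\<tau> \<le> 1" "1 / q = e0 + (1 / 2 - e0) * \<tau>" "real_nabla q * (1 - \<tau> / 2) = 1"
    using interpolation_exponents[OF q] by metis
  define q' where "q' = q / (q - 1)"
  have q': "q' > 0" "1 / q + 1 / q' = 1" "(q - 1) * q' = q" using q by (auto simp: q'_def field_simps)
  have bound: "(\<integral>\<^sup>+x. ennreal (norm (cutoff n ?h x) powr q) \<partial>lborel) \<le> ennreal (?M powr q)" for n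
  proof -
    let ?k = "cutoff n ?h"
    have km [measurable]: "?k \<in> borel_measurable borel" by (rule cutoff_measurable[OF hm])
    have tk: "test_fun ?k" using cut_fun_cpow_test_fun[OF cutoff_cut_fun[OF hm], of n 1] by (simp add: cpow_one)
    have tkq: "test_fun (\<lambda>x. complex_of_real (norm (?k x) powr q))"
    proof -
      obtain R where R: "\<And>x. norm (?k x) \<le> R \<and> (norm x > R \<longrightarrow> ?k x = 0)" using tk by (auto simp: test_fun_def)
      have "norm (complex_of_real (norm (?k x) powr q)) \<le> R powr q + \<bar>R\<bar> \<and> (norm x > R powr q + \<bar>R\<bar> \<longrightarrow> complex_of_real (norm (?k x) powr q) = 0)" for x
      proof
        have "norm (?k x) powr q \<le> R powr q" using R[of x] q by (intro powr_mono2) auto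
        then show "norm (complex_of_real (norm (?k x) powr q)) \<le> R powr q + \<bar>R\<bar>" by simp
        show "norm x > R powr q + \<bar>R\<bar> \<longrightarrow> complex_of_real (norm (?k x) powr q) = 0"
        proof
          assume "norm x > R powr q + \<bar>R\<bar>"
          then have "norm x > R" using powr_ge_zero[of R q] abs_ge_self[of R] by linarith
          then show "complex_of_real (norm (?k x) powr q) = 0" using R[of x] by simp
        qed
      qed
      then show ?thesis unfolding test_fun_def by auto
    qed
    have ik: "integrable lborel (\<lambda>x. norm (?k x) powr q)"
      using integrable_Re[OF test_fun_integrable[OF tkq]] by simp
    define s where "s = (LINT x|lborel. norm (?k x) powr q)"
    have s: "(\<integral>\<^sup>+x. ennreal (norm (?k x) powr q) \<partial>lborel) = ennreal s"
      unfolding s_def by (rule nn_integral_eq_integral[OF ik]) simp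
    have s0: "s \<ge> 0" unfolding s_def by (intro Bochner_Integration.integral_nonneg) simp
    show ?thesis
    proof (cases "s = 0")
      case True
      then show ?thesis using s by simp
    next
      case False
      then have sp: "s > 0" using s0 by simp
      define K where "K = s powr (- (1 / q'))"
      have K: "K > 0" using sp by (simp add: K_def)
      define g where "g = (\<lambda>x. cnj (?k x) * complex_of_real (norm (?k x) powr (q - 2) * K))"
      have ng: "norm (g x) = norm (?k x) powr (q - 1) * K" for x
      proof (cases "?k x = 0")
        case False
        have "norm (g x) = norm (?k x) powr 1 * norm (?k x) powr (q - 2) * K" using K by (simp add: g_def norm_mult)
        also have "\<dots> = norm (?k x) powr (q - 1) * K" by (simp only: powr_add[symmetric]) simp
        finally show ?thesis .
      qed (simp add: g_def)
      have gm [measurable]: "g \<in> borel_measurable borel" unfolding g_def by measurable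
      have gcut: "cut_fun g"
      proof -
        let ?N = "real (Suc n)"
        let ?R = "?N + ?N powr (q - 1) * K + ?N powr (q - 1) / K"
        have pos: "?N powr (q - 1) * K > 0" "?N powr (q - 1) / K > 0" using K by auto
        have "1 / ?R \<le> norm (g x) \<and> norm (g x) \<le> ?R \<and> norm x \<le> ?R" if gx: "g x \<noteq> 0" for x
        proof -
          have "?k x \<noteq> 0" using gx by (auto simp: g_def)
          then have kx: "1 / ?N \<le> norm (?k x)" "norm (?k x) \<le> ?N" "norm x \<le> ?N" by (auto simp: cutoff_def split: if_splits)
          have "norm (?k x) powr (q - 1) \<le> ?N powr (q - 1)" using kx q by (intro powr_mono2) auto
          then have up: "norm (g x) \<le> ?N powr (q - 1) * K" unfolding ng using K by (intro mult_right_mono) auto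
          have "(1 / ?N) powr (q - 1) \<le> norm (?k x) powr (q - 1)" using kx q by (intro powr_mono2) auto
          then have "(1 / ?N) powr (q - 1) * K \<le> norm (g x)" unfolding ng using K by (intro mult_right_mono) auto
          moreover have "(1 / ?N) powr (q - 1) * K = 1 / (?N powr (q - 1) / K)" by (simp add: powr_divide)
          moreover have "?N powr (q - 1) / K \<le> ?R" using pos by (intro add_increasing add_nonneg_nonneg order_refl) simp_all
          then have "1 / ?R \<le> 1 / (?N powr (q - 1) / K)" by (intro frac_le[OF _ _ pos(2)]) simp_all
          ultimately have "1 / ?R \<le> norm (g x)" by linarith
          moreover have "norm (g x) \<le> ?R" "norm x \<le> ?R" using up kx(3) pos by linarith+
          ultimately show ?thesis by blast
        qed
        moreover have "?R > 0" using pos by (intro add_pos_pos) auto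
        ultimately show ?thesis unfolding cut_fun_def using gm by blast
      qed
      have "(\<integral>\<^sup>+x. ennreal (norm (g x) powr q') \<partial>lborel) = (\<integral>\<^sup>+x. ennreal (1 / s) * ennreal (norm (?k x) powr q) \<partial>lborel)"
      proof (rule nn_integral_cong)
        fix x
        have "norm (g x) powr q' = norm (?k x) powr ((q - 1) * q') * K powr q'" unfolding ng using K by (simp add: powr_mult powr_powr)
        also have "K powr q' = 1 / s"
        proof -
          have "- (1 / q') * q' = -1" using q'(1) by simp
          then have "K powr q' = s powr (-1)" unfolding K_def powr_powr by (simp only:)
          then show ?thesis using sp by (simp add: powr_minus_divide)
        qed
        finally show "ennreal (norm (g x) powr q') = ennreal (1 / s) * ennreal (norm (?k x) powr q)"
          unfolding q'(3) using sp by (simp add: ennreal_mult[symmetric] mult.commute)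
      qed
      also have "\<dots> = ennreal (1 / s) * ennreal s" unfolding s[symmetric] by (rule nn_integral_cmult) measurable
      also have "\<dots> = 1" using sp by (simp add: ennreal_mult[symmetric])
      finally have g1: "(\<integral>\<^sup>+x. ennreal (norm (g x) powr q') \<partial>lborel) \<le> 1" by simp
      have "norm (\<Sum>j\<in>J. (LINT x|lborel. cv (F j) (\<theta> j) x * g x)) \<le> ?M"
        by (rule riesz_thorin_bilinear[OF J F \<theta> gcut disj C c Fc g1 _ q'(2,1) e]) (use q in auto)
      also have "(\<Sum>j\<in>J. (LINT x|lborel. cv (F j) (\<theta> j) x * g x)) = complex_of_real (K * s)"
      proof -
        have tg: "test_fun g" using cut_fun_cpow_test_fun[OF gcut, of 1] by (simp add: cpow_one)
        obtain B where B: "\<And>x. norm (g x) \<le> B" using test_fun_bounded[OF tg] by blast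
        have ii: "integrable lborel (\<lambda>x. cv (F j) (\<theta> j) x * g x)" if j: "j \<in> J" for j
          by (rule integrable_mult_bounded[OF cv_test_fun(2)[OF tF[OF j] \<theta>] _ B]) measurable
        have "(\<Sum>j\<in>J. (LINT x|lborel. cv (F j) (\<theta> j) x * g x)) = (LINT x|lborel. ?h x * g x)"
          by (simp add: sum_distrib_right Bochner_Integration.integral_sum[OF ii])
        also have "\<dots> = (LINT x|lborel. complex_of_real (K * norm (?k x) powr q))"
        proof (rule Bochner_Integration.integral_cong[OF refl])
          fix x
          show "?h x * g x = complex_of_real (K * norm (?k x) powr q)"
          proof (cases "?k x = 0")
            case True
            then show ?thesis by (simp add: g_def)
          next
            case False
            then have hk: "?h x = ?k x" by (auto simp: cutoff_def split: if_splits)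
            have "?h x * g x = complex_of_real ((norm (?k x))\<^sup>2 * norm (?k x) powr (q - 2) * K)"
              unfolding hk g_def of_real_mult complex_norm_square by (simp only: mult_ac)
            also have "(norm (?k x))\<^sup>2 * norm (?k x) powr (q - 2) = norm (?k x) powr q"
              using False by (simp add: powr_diff powr_numeral)
            finally show ?thesis by (simp add: mult.commute)
          qed
        qed
        also have "\<dots> = complex_of_real (K * s)" by (simp add: s_def)
        finally show ?thesis .
      qed
      finally have "K * s \<le> ?M" using K sp unfolding norm_of_real by simp
      moreover have "K * s = s powr (1 / q)"
      proof -
        have "K * s = s powr (- (1 / q')) * s powr 1" using sp by (simp add: K_def)
        also have "\<dots> = s powr (1 - 1 / q')" by (simp only: powr_add[symmetric]) (simp add: algebra_simps)
        also have "1 - 1 / q' = 1 / q" using q'(2) by linarith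
        finally show ?thesis .
      qed
      ultimately have "s powr (1 / q) \<le> ?M" by simp
      then have "(s powr (1 / q)) powr q \<le> ?M powr q" using q by (intro powr_mono2) auto
      then have "s \<le> ?M powr q" using q sp by (simp add: powr_powr)
      then show ?thesis unfolding s by (rule ennreal_leI)
    qed
  qed
  show ?thesis
  proof (rule nn_integral_le_of_tendsto[OF _ bound])
    fix n
    show "(\<lambda>x. ennreal (norm (cutoff n ?h x) powr q)) \<in> borel_measurable lborel"
      using cutoff_measurable[OF hm, of n] by measurable
  next
    fix x
    show "(\<lambda>n. ennreal (norm (cutoff n ?h x) powr q)) \<longlonglongrightarrow> ennreal (norm (?h x) powr q)"
      using q by (intro tendsto_ennrealI tendsto_powr' tendsto_norm cutoff_tendsto tendsto_const) auto
  qed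
qed

text \<open>Truncated pieces are no longer reproduced by their kernels, but their convolutions with the kernels
  converge pointwise to the pieces, and Fatou's lemma carries the bound over.\<close>

lemma synthesis_bound_normalized:
  fixes F :: "nat => ('d::{finite,linorder}) cfun"
  assumes J: "finite J" and F: "\<And>j. j \<in> J ==> poly_growth (F j)" and \<theta>: "\<And>j. \<theta> j \<in> schwartz"
    and rep: "\<And>j. j \<in> J ==> cv (F j) (\<theta> j) = F j"
    and disj: "\<And>j k \<xi>. j + L < k \<or> k + L < j ==> fourier (\<theta> j) \<xi> * cnj (fourier (\<theta> k) \<xi>) = 0"
    and C: "\<And>j. (\<integral>\<^sup>+x. ennreal (norm (\<theta> j x)) \<partial>lborel) \<le> ennreal C" "C > 0"
    and q: "1 < q"
    and c: "\<And>j. c j > 0" "(\<Sum>j\<in>J. c j powr real_nabla q) \<le> 1"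
    and Fc: "\<And>j. j \<in> J ==> (\<integral>\<^sup>+x. ennreal (norm (F j x) powr q) \<partial>lborel) \<le> ennreal (c j powr q)"
  shows "(\<integral>\<^sup>+x. ennreal (norm (\<Sum>j\<in>J. F j x) powr q) \<partial>lborel) \<le> ennreal ((real (2 * L + 1) * C) powr q)"
proof -
  have Fm: "F j \<in> borel_measurable borel" if "j \<in> J" for j by (rule poly_growth_measurable[OF F[OF that]])
  have cut: "cut_fun (cutoff n (F j))" if "j \<in> J" for n j by (rule cutoff_cut_fun[OF Fm[OF that]])
  let ?h = "\<lambda>n x. \<Sum>j\<in>J. cv (cutoff n (F j)) (\<theta> j) x"
  show ?thesis
  proof (rule nn_integral_le_of_tendsto[where u = "\<lambda>n x. ennreal (norm (?h n x) powr q)"])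
    fix n
    have "cv (cutoff n (F j)) (\<theta> j) \<in> borel_measurable borel" if "j \<in> J" for j
      by (intro cv_measurable cutoff_measurable Fm that schwartz_measurable \<theta>)
    then have [measurable]: "?h n \<in> borel_measurable borel" by (intro borel_measurable_sum)
    show "(\<lambda>x. ennreal (norm (?h n x) powr q)) \<in> borel_measurable lborel" by measurable
    show "(\<integral>\<^sup>+x. ennreal (norm (?h n x) powr q) \<partial>lborel) \<le> ennreal ((real (2 * L + 1) * C) powr q)"
    proof (rule synthesis_bound_cut[OF J cut \<theta> disj C q c])
      fix j assume j: "j \<in> J"
      have "(\<integral>\<^sup>+x. ennreal (norm (cutoff n (F j) x) powr q) \<partial>lborel) \<le> (\<integral>\<^sup>+x. ennreal (norm (F j x) powr q) \<partial>lborel)"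
        using q by (intro nn_integral_mono ennreal_leI powr_mono2 norm_cutoff_le) auto
      then show "(\<integral>\<^sup>+x. ennreal (norm (cutoff n (F j) x) powr q) \<partial>lborel) \<le> ennreal (c j powr q)"
        using Fc[OF j] by (rule order_trans)
    qed
  next
    fix x
    have "(\<lambda>n. cv (cutoff n (F j)) (\<theta> j) x) \<longlonglongrightarrow> F j x" if j: "j \<in> J" for j
    proof -
      note [measurable] = Fm[OF j] cutoff_measurable[OF Fm[OF j]] schwartz_measurable[OF \<theta>[of j]]
      have "(\<lambda>n. cv (cutoff n (F j)) (\<theta> j) x) \<longlonglongrightarrow> cv (F j) (\<theta> j) x"
        unfolding cv_def
      proof (rule integral_dominated_convergence[where w = "\<lambda>y. norm (F j y * \<theta> j (x - y))"])
        show "integrable lborel (\<lambda>y. norm (F j y * \<theta> j (x - y)))"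
          by (intro integrable_norm cv_integrable F[OF j] \<theta>)
        show "AE y in lborel. (\<lambda>n. cutoff n (F j) y * \<theta> j (x - y)) \<longlonglongrightarrow> F j y * \<theta> j (x - y)"
          by (intro AE_I2 tendsto_mult cutoff_tendsto tendsto_const)
        show "AE y in lborel. norm (cutoff n (F j) y * \<theta> j (x - y)) \<le> norm (F j y * \<theta> j (x - y))" for n
          unfolding norm_mult by (intro AE_I2 mult_right_mono norm_cutoff_le) auto
      qed measurable
      then show ?thesis using rep[OF j] by simp
    qed
    then have "(\<lambda>n. ?h n x) \<longlonglongrightarrow> (\<Sum>j\<in>J. F j x)" by (rule tendsto_sum)
    then show "(\<lambda>n. ennreal (norm (?h n x) powr q)) \<longlonglongrightarrow> ennreal (norm (\<Sum>j\<in>J. F j x) powr q)"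
      using q by (intro tendsto_ennrealI tendsto_powr' tendsto_norm tendsto_const) auto
  qed
qed

text \<open>Homogeneity reduces to the normalised case. The perturbation \<open>\<delta>\<close> makes all the numbers \<open>c j\<close> positive, and it
  tends to 0 at the end.\<close>

lemma synthesis_bound:
  fixes F :: "nat => ('d::{finite,linorder}) cfun"
  assumes J: "finite J" and F: "\<And>j. j \<in> J ==> poly_growth (F j)" and \<theta>: "\<And>j. \<theta> j \<in> schwartz"
    and rep: "\<And>j. j \<in> J ==> cv (F j) (\<theta> j) = F j"
    and disj: "\<And>j k \<xi>. j + L < k \<or> k + L < j ==> fourier (\<theta> j) \<xi> * cnj (fourier (\<theta> k) \<xi>) = 0"
    and C: "\<And>j. (\<integral>\<^sup>+x. ennreal (norm (\<theta> j x)) \<partial>lborel) \<le> ennreal C" "C > 0"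
    and q: "1 < q"
    and c: "\<And>j. c j \<ge> 0"
    and Fc: "\<And>j. j \<in> J ==> Lp_norm (ennreal q) (F j) \<le> ennreal (c j)"
  shows "Lp_norm (ennreal q) (\<lambda>x. \<Sum>j\<in>J. F j x)
    \<le> ennreal (real (2 * L + 1) * C * (\<Sum>j\<in>J. c j powr real_nabla q) powr (1 / real_nabla q))"
proof -
  define t where "t = real_nabla q"
  have t: "t > 0" using q by (simp add: t_def real_nabla_def)
  let ?M = "real (2 * L + 1) * C"
  have M: "?M > 0" using C(2) by simp
  let ?T = "\<Sum>j\<in>J. c j powr t"
  have T0: "?T \<ge> 0" by (intro sum_nonneg) simp
  have [measurable]: "(\<lambda>x. \<Sum>j\<in>J. F j x) \<in> borel_measurable borel"
    using poly_growth_measurable[OF F] by (intro borel_measurable_sum)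
  have step: "Lp_norm (ennreal q) (\<lambda>x. \<Sum>j\<in>J. F j x) \<le> ennreal (?M * (?T + real (card J) * \<delta> + \<delta>) powr (1 / t))" if \<delta>: "\<delta> > 0" for \<delta>
  proof -
    define S where "S = (?T + real (card J) * \<delta> + \<delta>) powr (1 / t)"
    have base: "?T + real (card J) * \<delta> + \<delta> > 0" using T0 \<delta> by (intro add_nonneg_pos add_nonneg_nonneg) auto
    have S: "S > 0" "S powr t = ?T + real (card J) * \<delta> + \<delta>" using base t by (auto simp: S_def powr_powr)
    define c' where "c' = (\<lambda>j. (c j powr t + \<delta>) powr (1 / t) / S)"
    have cp: "c j powr t + \<delta> > 0" for j using \<delta> by (intro add_nonneg_pos) auto
    have c'0: "c' j > 0" for j using cp[of j] S(1) by (simp add: c'_def)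
    have c't: "c' j powr t = (c j powr t + \<delta>) / S powr t" for j
      using cp[of j] S(1) t by (simp add: c'_def powr_divide powr_powr)
    have "(\<Sum>j\<in>J. c' j powr t) = (?T + real (card J) * \<delta>) / S powr t"
      unfolding c't by (simp add: sum_divide_distrib[symmetric] sum.distrib)
    also have "\<dots> \<le> 1" using base \<delta> by (simp add: S(2))
    finally have c'1: "(\<Sum>j\<in>J. c' j powr t) \<le> 1" .
    have cS: "c j / S \<le> c' j" for j
    proof -
      have "c j = (c j powr t) powr (1 / t)" using c[of j] t by (simp add: powr_powr)
      also have "\<dots> \<le> (c j powr t + \<delta>) powr (1 / t)" using t \<delta> by (intro powr_mono2) auto
      finally show ?thesis unfolding c'_def using S(1) by (intro divide_right_mono) auto
    qed
    let ?F = "\<lambda>j x. complex_of_real (1 / S) * F j x"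
    have "(\<integral>\<^sup>+x. ennreal (norm (\<Sum>j\<in>J. ?F j x) powr q) \<partial>lborel) \<le> ennreal (?M powr q)"
    proof (rule synthesis_bound_normalized[OF J _ \<theta> _ disj C q c'0 c'1[unfolded t_def]])
      fix j assume j: "j \<in> J"
      have [measurable]: "F j \<in> borel_measurable borel" by (rule poly_growth_measurable[OF F[OF j]])
      obtain K N where KN: "K > 0" "\<And>x. norm (F j x) \<le> K * weight x ^ N" using poly_growthE[OF F[OF j]] by blast
      have "norm (?F j x) \<le> (K / S) * weight x ^ N" for x
        using divide_right_mono[OF KN(2)[of x], of S] S(1) by (simp add: norm_mult norm_divide)
      moreover have "?F j \<in> borel_measurable borel" by measurable
      ultimately show "poly_growth (?F j)" unfolding poly_growth_def by blast
      show "cv (?F j) (\<theta> j) = ?F j" unfolding cv_scale[abs_def] rep[OF j] ..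
      have Fq: "(\<integral>\<^sup>+x. ennreal (norm (F j x) powr q) \<partial>lborel) \<le> ennreal (c j powr q)"
        using Fc[OF j] q c[of j] by (subst (asm) Lp_norm_real_le_iff) auto
      have "(\<integral>\<^sup>+x. ennreal (norm (?F j x) powr q) \<partial>lborel) = (\<integral>\<^sup>+x. ennreal ((1 / S) powr q) * ennreal (norm (F j x) powr q) \<partial>lborel)"
        using S(1) by (intro nn_integral_cong) (simp add: norm_mult norm_divide powr_divide ennreal_mult[symmetric])
      also have "\<dots> = ennreal ((1 / S) powr q) * (\<integral>\<^sup>+x. ennreal (norm (F j x) powr q) \<partial>lborel)"
        by (rule nn_integral_cmult) measurable
      also have "\<dots> \<le> ennreal ((1 / S) powr q) * ennreal (c j powr q)" by (intro mult_left_mono Fq) simp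
      also have "\<dots> = ennreal ((c j / S) powr q)" using S(1) c[of j] by (simp add: ennreal_mult[symmetric] powr_divide)
      also have "\<dots> \<le> ennreal (c' j powr q)" using cS c[of j] S(1) q by (intro ennreal_leI powr_mono2) auto
      finally show "(\<integral>\<^sup>+x. ennreal (norm (?F j x) powr q) \<partial>lborel) \<le> ennreal (c' j powr q)" .
    qed
    then have b: "(\<integral>\<^sup>+x. ennreal (norm (\<Sum>j\<in>J. ?F j x) powr q) \<partial>lborel) \<le> ennreal (?M powr q)" .
    have "(\<integral>\<^sup>+x. ennreal (norm (\<Sum>j\<in>J. F j x) powr q) \<partial>lborel)
       = (\<integral>\<^sup>+x. ennreal (S powr q) * ennreal (norm (\<Sum>j\<in>J. ?F j x) powr q) \<partial>lborel)"
    proof (rule nn_integral_cong)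
      fix x
      have "norm (\<Sum>j\<in>J. ?F j x) = norm (\<Sum>j\<in>J. F j x) / S"
        using S(1) by (simp add: sum_divide_distrib[symmetric] norm_divide)
      then show "ennreal (norm (\<Sum>j\<in>J. F j x) powr q) = ennreal (S powr q) * ennreal (norm (\<Sum>j\<in>J. ?F j x) powr q)"
        using S(1) by (simp add: ennreal_mult[symmetric] powr_divide)
    qed
    also have "\<dots> = ennreal (S powr q) * (\<integral>\<^sup>+x. ennreal (norm (\<Sum>j\<in>J. ?F j x) powr q) \<partial>lborel)"
    proof (rule nn_integral_cmult)
      have "(\<lambda>x. \<Sum>j\<in>J. ?F j x) \<in> borel_measurable borel"
        using poly_growth_measurable[OF F] by (intro borel_measurable_sum borel_measurable_times) auto
      then show "(\<lambda>x. ennreal (norm (\<Sum>j\<in>J. ?F j x) powr q)) \<in> borel_measurable lborel" by measurable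
    qed
    also have "\<dots> \<le> ennreal (S powr q) * ennreal (?M powr q)" by (intro mult_left_mono b) simp
    also have "\<dots> = ennreal ((?M * S) powr q)" using M S(1) by (simp add: ennreal_mult[symmetric] powr_mult mult.commute)
    finally have "Lp_norm (ennreal q) (\<lambda>x. \<Sum>j\<in>J. F j x) \<le> ennreal (?M * S)"
      using q M S(1) by (subst Lp_norm_real_le_iff) auto
    then show ?thesis by (simp add: S_def)
  qed
  have "((\<lambda>\<delta>. ennreal (?M * (?T + real (card J) * \<delta> + \<delta>) powr (1 / t))) \<longlongrightarrow> ennreal (?M * (?T + real (card J) * 0 + 0) powr (1 / t))) (at_right 0)"
  proof (intro tendsto_ennrealI tendsto_mult tendsto_const tendsto_powr' tendsto_add tendsto_ident_at)
    show "?T + real (card J) * 0 + 0 \<noteq> 0 \<or> 0 < 1 / t \<and> (\<forall>\<^sub>F \<delta> in at_right 0. 0 \<le> ?T + real (card J) * \<delta> + \<delta>)"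
      using t T0 by (auto simp: eventually_at_right_field intro!: exI[of _ 1] add_nonneg_nonneg)
  qed
  moreover have "\<forall>\<^sub>F \<delta> in at_right 0. Lp_norm (ennreal q) (\<lambda>x. \<Sum>j\<in>J. F j x) \<le> ennreal (?M * (?T + real (card J) * \<delta> + \<delta>) powr (1 / t))"
    using eventually_at_right_less[of "0::real"] by eventually_elim (rule step)
  ultimately have "Lp_norm (ennreal q) (\<lambda>x. \<Sum>j\<in>J. F j x) \<le> ennreal (?M * (?T + real (card J) * 0 + 0) powr (1 / t))"
    by (rule tendsto_lowerbound) simp
  then show ?thesis by (simp add: t_def)
qed

section \<open>Unconditional convergence in Lebesgue spaces\<close>

lemma Lp_norm_fatou:
  fixes h :: "nat => ('d::finite) cfun"
  assumes q: "0 < q" and [measurable]: "\<And>k. h k \<in> borel_measurable borel" "g \<in> borel_measurable borel"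
    and lim: "AE x in lborel. (\<lambda>k. h k x) \<longlonglongrightarrow> g x"
    and b: "\<And>k. Lp_norm q (h k) \<le> ennreal b" "b \<ge> 0"
  shows "Lp_norm q g \<le> ennreal b"
proof (cases rule: ennreal_exponent_cases[OF q])
  case 1
  have "AE x in lborel. \<forall>k. norm (h k x) \<le> b"
    unfolding AE_all_countable using b 1 by (auto intro: Lp_norm_top_AE)
  then have "AE x in lborel. ennreal (norm (g x)) \<le> ennreal b"
    using lim
  proof eventually_elim
    case (elim x)
    have "norm (g x) \<le> b" by (rule LIMSEQ_le_const2[OF tendsto_norm[OF elim(2)]]) (use elim(1) in auto)
    then show ?case by (rule ennreal_leI)
  qed
  then show ?thesis unfolding 1 Lp_norm_def Lnorm_top by (intro esssup_I) auto
next
  case (2 a)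
  have "(\<integral>\<^sup>+x. ennreal (norm (g x) powr a) \<partial>lborel) = (\<integral>\<^sup>+x. liminf (\<lambda>k. ennreal (norm (h k x) powr a)) \<partial>lborel)"
  proof (rule nn_integral_cong_AE)
    show "AE x in lborel. ennreal (norm (g x) powr a) = liminf (\<lambda>k. ennreal (norm (h k x) powr a))"
      using lim
    proof eventually_elim
      case (elim x)
      have "(\<lambda>k. ennreal (norm (h k x) powr a)) \<longlonglongrightarrow> ennreal (norm (g x) powr a)"
        using 2 by (intro tendsto_ennrealI tendsto_powr' tendsto_norm elim tendsto_const) auto
      then show ?case by (intro lim_imp_Liminf[symmetric]) auto
    qed
  qed
  also have "\<dots> \<le> liminf (\<lambda>k. \<integral>\<^sup>+x. ennreal (norm (h k x) powr a) \<partial>lborel)" by (rule nn_integral_liminf) measurable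
  also have "\<dots> \<le> liminf (\<lambda>k :: nat. ennreal (b powr a))"
  proof (intro Liminf_mono always_eventually allI)
    show "(\<integral>\<^sup>+x. ennreal (norm (h k x) powr a) \<partial>lborel) \<le> ennreal (b powr a)" for k
      by (rule Lp_norm_real_le_iff[OF 2(1) b(2), THEN iffD1]) (use b(1)[of k] 2(2) in simp)
  qed
  also have "\<dots> = ennreal (b powr a)" by (simp add: Liminf_const)
  finally show ?thesis unfolding 2(2) by (rule Lp_norm_real_le_iff[OF 2(1) b(2), THEN iffD2])
qed

text \<open>For finite \<open>q\<close> the sum of \<open>((4/3)^k \<bar>h k\<bar>)^q\<close> is integrable, hence finite almost everywhere. So \<open>\<bar>h k\<bar>\<close> decays
  geometrically almost everywhere. This avoids the triangle inequality, which fails for \<open>q < 1\<close>.\<close>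

lemma Lp_fast_summable_AE:
  fixes h :: "nat => ('d::finite) cfun"
  assumes q: "0 < q" and [measurable]: "\<And>k. h k \<in> borel_measurable borel"
    and b: "\<And>k. Lp_norm q (h k) \<le> ennreal ((1 / 2) ^ k)"
  shows "AE x in lborel. summable (\<lambda>k. norm (h k x))"
proof (cases rule: ennreal_exponent_cases[OF q])
  case 1
  have "AE x in lborel. \<forall>k. norm (h k x) \<le> (1 / 2) ^ k"
    unfolding AE_all_countable using b 1 by (auto intro: Lp_norm_top_AE)
  then show ?thesis
  proof eventually_elim
    case (elim x)
    show ?case by (rule summable_comparison_test'[of "\<lambda>k. (1 / 2 :: real) ^ k" 0]) (use elim in auto)
  qed
next
  case (2 a)
  let ?u = "\<lambda>k x. ennreal (((4 / 3) ^ k * norm (h k x)) powr a)"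
  define \<rho> where "\<rho> = (2 / 3 :: real) powr a"
  have \<rho>: "0 < \<rho>" "\<rho> < 1" using 2 powr_less_mono2[of a "2 / 3" 1] by (auto simp: \<rho>_def)
  have u: "(\<integral>\<^sup>+x. ?u k x \<partial>lborel) \<le> ennreal (\<rho> ^ k)" for k
  proof -
    have "(\<integral>\<^sup>+x. ?u k x \<partial>lborel) = (\<integral>\<^sup>+x. ennreal (((4 / 3) ^ k) powr a) * ennreal (norm (h k x) powr a) \<partial>lborel)"
      by (intro nn_integral_cong) (simp add: powr_mult ennreal_mult)
    also have "\<dots> = ennreal (((4 / 3) ^ k) powr a) * (\<integral>\<^sup>+x. ennreal (norm (h k x) powr a) \<partial>lborel)"
      by (rule nn_integral_cmult) measurable
    also have "\<dots> \<le> ennreal (((4 / 3) ^ k) powr a) * ennreal (((1 / 2) ^ k) powr a)"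
    proof (intro mult_left_mono)
      show "(\<integral>\<^sup>+x. ennreal (norm (h k x) powr a) \<partial>lborel) \<le> ennreal (((1 / 2) ^ k) powr a)"
        by (rule Lp_norm_real_le_iff[OF 2(1), THEN iffD1]) (use b[of k] 2(2) in simp_all)
    qed simp
    also have "\<dots> = ennreal (((4 / 3) ^ k * (1 / 2) ^ k) powr a)"
      by (simp only: powr_mult ennreal_mult powr_ge_zero)
    also have "(4 / 3) ^ k * (1 / 2) ^ k = (2 / 3 :: real) ^ k"
      by (simp only: power_mult_distrib[symmetric]) simp
    also have "((2 / 3 :: real) ^ k) powr a = \<rho> ^ k"
      unfolding \<rho>_def by (simp add: powr_realpow[symmetric] powr_powr mult.commute)
    finally show ?thesis .
  qed
  have "(\<integral>\<^sup>+x. (\<Sum>k. ?u k x) \<partial>lborel) = (\<Sum>k. \<integral>\<^sup>+x. ?u k x \<partial>lborel)" by (rule nn_integral_suminf) measurable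
  also have "\<dots> \<le> (\<Sum>k. ennreal (\<rho> ^ k))" by (intro suminf_le u) auto
  also have "\<dots> = ennreal (\<Sum>k. \<rho> ^ k)" using \<rho> by (intro suminf_ennreal_eq) (auto intro: summable_sums)
  finally have "(\<integral>\<^sup>+x. (\<Sum>k. ?u k x) \<partial>lborel) \<noteq> \<infinity>" by (auto simp: top_unique)
  moreover have "(\<lambda>x. \<Sum>k. ?u k x) \<in> borel_measurable lborel" by measurable
  ultimately have "AE x in lborel. (\<Sum>k. ?u k x) \<noteq> \<infinity>" by (rule nn_integral_PInf_AE[rotated])
  have fin: "\<exists>M\<ge>0. t = ennreal M" if "t \<noteq> \<infinity>" for t :: ennreal using that by (cases t) auto
  have pointwise: "summable (\<lambda>k. norm (h k x))" if ux: "(\<Sum>k. ?u k x) \<noteq> \<infinity>" for x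
  proof -
    obtain M where M: "M \<ge> 0" "(\<Sum>k. ?u k x) = ennreal M" using fin[OF ux] by blast
    have le: "norm (h k x) \<le> M powr (1 / a) * (3 / 4) ^ k" for k
    proof -
      have "(\<Sum>k\<in>{k}. ?u k x) \<le> (\<Sum>k. ?u k x)" by (rule sum_le_suminf) auto
      then have "?u k x \<le> ennreal M" unfolding M(2) by simp
      then have "((4 / 3) ^ k * norm (h k x)) powr a \<le> M" by (rule ennreal_le_iff[OF M(1), THEN iffD1])
      then have "(((4 / 3) ^ k * norm (h k x)) powr a) powr (1 / a) \<le> M powr (1 / a)"
        using 2(1) by (intro powr_mono2) auto
      then have "(4 / 3) ^ k * norm (h k x) \<le> M powr (1 / a)" using 2(1) by (simp add: powr_powr)
      then have "(3 / 4) ^ k * ((4 / 3) ^ k * norm (h k x)) \<le> (3 / 4) ^ k * M powr (1 / a)" by (intro mult_left_mono) auto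
      moreover have "(3 / 4) ^ k * (4 / 3) ^ k = (1 :: real)" by (simp only: power_mult_distrib[symmetric]) simp
      ultimately show ?thesis by (simp only: mult.assoc[symmetric] mult_1) (simp only: mult.commute)
    qed
    show ?thesis
    proof (rule summable_comparison_test'[of "\<lambda>k. M powr (1 / a) * (3 / 4 :: real) ^ k" 0])
      show "summable (\<lambda>k. M powr (1 / a) * (3 / 4 :: real) ^ k)" by (intro summable_mult summable_geometric) simp
      show "norm (norm (h k x)) \<le> M powr (1 / a) * (3 / 4) ^ k" for k
        unfolding real_norm_def abs_norm_cancel by (rule le)
    qed
  qed
  show ?thesis
    by (rule eventually_mono[OF \<open>AE x in lborel. (\<Sum>k. ?u k x) \<noteq> \<infinity>\<close> pointwise])
qed

text \<open>The bound on finite partial sums controls the sum over any finite set beyond \<open>N\<close> by a tail of the series of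
  the \<open>u j\<close>. Along a sparse sequence of initial segments the partial sums therefore converge almost
  everywhere, and Fatou's lemma transfers the tail bounds to the limit.\<close>

lemma Lp_unconditional_sum:
  fixes F :: "nat => ('d::finite) cfun"
  assumes q: "0 < q" and F: "\<And>j. F j \<in> borel_measurable borel"
    and u: "\<And>j. u j \<ge> 0" "summable u" and K: "K \<ge> 0" and \<tau>: "\<tau> > 0"
    and b: "\<And>J. finite J ==> Lp_norm q (\<lambda>x. \<Sum>j\<in>J. F j x) \<le> ennreal (K * (\<Sum>j\<in>J. u j) powr \<tau>)"
  shows "\<exists>g. Lp_has_sum q F g \<and> Lp_norm q g \<le> ennreal (K * (\<Sum>j. u j) powr \<tau>)"
proof -
  note [measurable] = F
  define T where "T = (\<lambda>N. (\<Sum>j. u j) - (\<Sum>j<N. u j))"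
  have T_ge: "(\<Sum>j\<in>J. u j) \<le> T N" if "finite J" "J \<inter> {..<N} = {}" for J N
  proof -
    have "(\<Sum>j\<in>J. u j) + (\<Sum>j<N. u j) = (\<Sum>j\<in>J \<union> {..<N}. u j)" using that by (intro sum.union_disjoint[symmetric]) auto
    also have "\<dots> \<le> (\<Sum>j. u j)" using that u by (intro sum_le_suminf) auto
    finally show ?thesis by (simp add: T_def)
  qed
  have T0: "T N \<ge> 0" for N using T_ge[of "{}" N] by simp
  define B where "B = (\<lambda>N. K * T N powr \<tau>)"
  have B0: "B N \<ge> 0" for N using K by (simp add: B_def)
  have B_anti: "B M \<le> B N" if "N \<le> M" for M N
  proof -
    have "(\<Sum>j<N. u j) \<le> (\<Sum>j<M. u j)" using that u by (intro sum_mono2) auto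
    then have "T M \<le> T N" by (simp add: T_def)
    then show ?thesis unfolding B_def using T0 \<tau> K by (intro mult_left_mono powr_mono2) auto
  qed
  have bB: "Lp_norm q (\<lambda>x. \<Sum>j\<in>J. F j x) \<le> ennreal (B N)" if "finite J" "J \<inter> {..<N} = {}" for J N
  proof -
    have "K * (\<Sum>j\<in>J. u j) powr \<tau> \<le> B N"
      unfolding B_def using T_ge[OF that] \<tau> K u by (intro mult_left_mono powr_mono2 sum_nonneg) auto
    then show ?thesis using b[OF that(1)] by (meson ennreal_leI order_trans)
  qed
  have Tlim: "T \<longlonglongrightarrow> 0"
    unfolding T_def using tendsto_diff[OF tendsto_const summable_LIMSEQ[OF u(2)], of "\<Sum>j. u j"] by simp
  have Blim: "B \<longlonglongrightarrow> 0"
  proof -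
    have "B \<longlonglongrightarrow> K * 0 powr \<tau>"
      unfolding B_def using \<tau> T0 by (intro tendsto_mult tendsto_const tendsto_powr' Tlim) auto
    then show ?thesis by simp
  qed
  have "\<exists>m. B m \<le> (1 / 2) ^ k" for k
  proof -
    have "\<forall>\<^sub>F m in sequentially. B m < (1 / 2) ^ k" by (rule order_tendstoD(2)[OF Blim]) simp
    then obtain m where "B m < (1 / 2) ^ k" by (auto simp: eventually_sequentially)
    then show ?thesis by (auto intro: less_imp_le)
  qed
  then obtain m where m: "\<And>k. B (m k) \<le> (1 / 2) ^ k" by metis
  \<comment> \<open>Partial sums of \<open>Suc (m i)\<close> dominate \<open>m k\<close> and are strictly increasing, so they also dominate \<open>k\<close>.\<close>
  define N where "N = (\<lambda>k. \<Sum>i<Suc k. Suc (m i))"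
  have N_mono: "N k \<le> N (Suc k)" for k by (simp add: N_def)
  have "m k \<le> N k" for k by (simp add: N_def)
  then have BN: "B (N k) \<le> (1 / 2) ^ k" for k using B_anti m order_trans by blast
  have N_ge: "k \<le> N k" for k
    by (induction k) (auto simp: N_def)
  define s where "s = (\<lambda>k x. \<Sum>j<N k. F j x)"
  have [measurable]: "s k \<in> borel_measurable borel" for k unfolding s_def by measurable
  have diff: "s (Suc k) x - s k x = (\<Sum>j\<in>{N k..<N (Suc k)}. F j x)" for k x
  proof -
    have "s (Suc k) x = s k x + (\<Sum>j\<in>{N k..<N (Suc k)}. F j x)"
      unfolding s_def lessThan_atLeast0
      by (rule sum.atLeastLessThan_concat[symmetric, OF _ N_mono]) (rule le0)
    then show ?thesis by (simp only: add_diff_cancel_left')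
  qed
  have "AE x in lborel. summable (\<lambda>k. norm (s (Suc k) x - s k x))"
  proof (rule Lp_fast_summable_AE[OF q])
    show "Lp_norm q (\<lambda>x. s (Suc k) x - s k x) \<le> ennreal ((1 / 2) ^ k)" for k
      unfolding diff using bB[of "{N k..<N (Suc k)}" "N k"] BN[of k] by (fastforce intro: order_trans ennreal_leI)
  qed measurable
  then have conv: "AE x in lborel. (\<lambda>k. s k x) \<longlonglongrightarrow> lim (\<lambda>k. s k x)"
  proof eventually_elim
    case (elim x)
    have "summable (\<lambda>k. s (Suc k) x - s k x)" by (rule summable_norm_cancel[OF elim])
    then have "(\<lambda>n. \<Sum>k<n. s (Suc k) x - s k x) \<longlonglongrightarrow> (\<Sum>k. s (Suc k) x - s k x)" by (rule summable_LIMSEQ)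
    then have "(\<lambda>n. s n x - s 0 x) \<longlonglongrightarrow> (\<Sum>k. s (Suc k) x - s k x)" by (simp only: sum_lessThan_telescope[of "\<lambda>k. s k x"])
    then have "(\<lambda>n. (s n x - s 0 x) + s 0 x) \<longlonglongrightarrow> (\<Sum>k. s (Suc k) x - s k x) + s 0 x" by (intro tendsto_add tendsto_const)
    then have "convergent (\<lambda>n. s n x)" by (auto simp: convergent_def)
    then show ?case by (simp add: convergent_LIMSEQ_iff)
  qed
  \<comment> \<open>On the null set of divergence \<open>lim\<close> is an arbitrary value; \<open>g\<close> is measurable all the same.\<close>
  define g where "g = (\<lambda>x. lim (\<lambda>k. s k x))"
  have g [measurable]: "g \<in> borel_measurable borel"
    unfolding g_def by (rule borel_measurable_lim_metric) measurable
  have tail: "Lp_norm q (\<lambda>x. (\<Sum>j\<in>J. F j x) - g x) \<le> ennreal (B M)" if J: "finite J" "{..<M} \<subseteq> J" for J M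
  proof -
    obtain m where m: "J \<subseteq> {..<m}" using J(1) finite_nat_iff_bounded by blast
    show ?thesis
    proof (rule Lp_norm_fatou[OF q, where h = "\<lambda>k x. (\<Sum>j\<in>J. F j x) - s (k + m) x"])
      show "AE x in lborel. (\<lambda>k. (\<Sum>j\<in>J. F j x) - s (k + m) x) \<longlonglongrightarrow> (\<Sum>j\<in>J. F j x) - g x"
        using conv unfolding g_def
      proof eventually_elim
        case (elim x)
        show ?case by (intro tendsto_diff tendsto_const LIMSEQ_ignore_initial_segment elim)
      qed
      show "Lp_norm q (\<lambda>x. (\<Sum>j\<in>J. F j x) - s (k + m) x) \<le> ennreal (B M)" for k
      proof -
        have sub: "J \<subseteq> {..<N (k + m)}" using m N_ge[of "k + m"] by fastforce
        have "s (k + m) x = (\<Sum>j\<in>J. F j x) + (\<Sum>j\<in>{..<N (k + m)} - J. F j x)" for x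
          unfolding s_def using sum.subset_diff[OF sub, of "\<lambda>j. F j x"] by (simp add: add.commute)
        then have "norm ((\<Sum>j\<in>J. F j x) - s (k + m) x) = norm (\<Sum>j\<in>{..<N (k + m)} - J. F j x)" for x by simp
        then have "Lp_norm q (\<lambda>x. (\<Sum>j\<in>J. F j x) - s (k + m) x) = Lp_norm q (\<lambda>x. \<Sum>j\<in>{..<N (k + m)} - J. F j x)"
          by (simp only: Lp_norm_def)
        also have "\<dots> \<le> ennreal (B M)" using J by (intro bB) auto
        finally show ?thesis .
      qed
    qed (use B0 in measurable)
  qed
  have g_le: "Lp_norm q g \<le> ennreal (K * (\<Sum>j. u j) powr \<tau>)"
    using tail[of "{}" 0] by (simp add: B_def T_def Lp_norm_def)
  have "F j \<in> Lp_space q" for j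
    using b[of "{j}"] F[of j] by (auto simp: Lp_space_def less_top[symmetric] top_unique)
  moreover have "g \<in> Lp_space q" using g_le g by (auto simp: Lp_space_def less_top[symmetric] top_unique)
  moreover have "((\<lambda>J. Lp_norm q (\<lambda>x. (\<Sum>j\<in>J. F j x) - g x)) \<longlongrightarrow> 0) (finite_subsets_at_top UNIV)"
  proof (rule order_tendstoI)
    fix e :: ennreal assume e: "0 < e"
    have "(\<lambda>M. ennreal (B M)) \<longlonglongrightarrow> ennreal 0" by (intro tendsto_ennrealI Blim)
    then have "\<forall>\<^sub>F M in sequentially. ennreal (B M) < e" using e by (intro order_tendstoD(2)) auto
    then obtain M where M: "ennreal (B M) < e" by (auto simp: eventually_sequentially)
    show "\<forall>\<^sub>F J in finite_subsets_at_top UNIV. Lp_norm q (\<lambda>x. (\<Sum>j\<in>J. F j x) - g x) < e"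
      unfolding eventually_finite_subsets_at_top
    proof (intro exI[of _ "{..<M}"] conjI allI impI)
      fix J :: "nat set" assume "finite J \<and> {..<M} \<subseteq> J \<and> J \<subseteq> UNIV"
      then have "Lp_norm q (\<lambda>x. (\<Sum>j\<in>J. F j x) - g x) \<le> ennreal (B M)" by (intro tail) simp_all
      then show "Lp_norm q (\<lambda>x. (\<Sum>j\<in>J. F j x) - g x) < e" using M by (rule order_le_less_trans)
    qed simp_all
  qed simp
  ultimately show ?thesis using g_le by (auto simp: Lp_has_sum_def)
qed

section \<open>Sums of band-limited functions for all exponents\<close>

lemma powr_sum_le:
  fixes f :: "'a => real"
  assumes "0 < a" "a \<le> 1" "finite J" "\<And>j. j \<in> J ==> f j \<ge> 0"
  shows "(\<Sum>j\<in>J. f j) powr a \<le> (\<Sum>j\<in>J. f j powr a)"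
proof (cases "(\<Sum>j\<in>J. f j) = 0")
  case True
  then show ?thesis by (auto intro: sum_nonneg)
next
  case False
  define s where "s = (\<Sum>j\<in>J. f j)"
  have s: "s > 0" using False assms(4) sum_nonneg[of J f] by (auto simp: s_def)
  have "f j / s \<le> f j powr a / s powr a" if j: "j \<in> J" for j
  proof -
    have "0 \<le> f j / s" "f j / s \<le> 1"
      using s assms(4)[OF j] member_le_sum[of j J f] j assms by (auto simp: s_def)
    then have "(f j / s) powr 1 \<le> (f j / s) powr a" using assms by (intro powr_mono') auto
    then show ?thesis using \<open>0 \<le> f j / s\<close> s assms(4)[OF j] by (simp add: powr_divide)
  qed
  then have "(\<Sum>j\<in>J. f j / s) \<le> (\<Sum>j\<in>J. f j powr a / s powr a)" by (rule sum_mono)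
  moreover have "(\<Sum>j\<in>J. f j / s) = 1" using s by (simp add: sum_divide_distrib[symmetric] s_def)
  ultimately have "1 \<le> (\<Sum>j\<in>J. f j powr a) / s powr a" by (simp add: sum_divide_distrib)
  then show ?thesis using s by (simp add: pos_le_divide_eq s_def)
qed

lemma nabla_exponent_real:
  assumes "1 < a" shows "nabla_exponent (ennreal a) = ennreal (real_nabla a)"
proof (cases "a \<le> 2")
  case True
  then have "ennreal a \<le> 2" by (metis ennreal_leI ennreal_numeral zero_le_numeral)
  then show ?thesis using True by (simp add: nabla_exponent_def real_nabla_def)
next
  case False
  have "\<not> ennreal a \<le> ennreal 2" using False by (subst ennreal_le_iff) auto
  then have n: "\<not> ennreal a \<le> 2" by simp
  have "1 / ennreal a = ennreal (1 / a)" using divide_ennreal[of 1 a] False by simp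
  moreover have "1 - ennreal (1 / a) = ennreal (1 - 1 / a)" using ennreal_minus[of "1 / a" 1] False by simp
  moreover have "1 / ennreal (1 - 1 / a) = ennreal (1 / (1 - 1 / a))" using divide_ennreal[of 1 "1 - 1 / a"] False by simp
  moreover have "1 / (1 - 1 / a) = real_nabla a" using False by (simp add: real_nabla_def field_simps)
  ultimately show ?thesis using n by (simp add: nabla_exponent_def)
qed

text \<open>The exponent \<open>t\<close> is the one of the triangle inequality for \<open>q \<le> 1\<close> and \<open>q = \<infinity>\<close>, where the frequency supports do
  not matter, and the interpolated one for \<open>1 < q < \<infinity>\<close>.\<close>

lemma synthesis_bound_all:
  fixes \<theta> :: "nat => ('d::{finite,linorder}) cfun"
  assumes q: "(0::ennreal) < q" and \<theta>: "\<And>j. \<theta> j \<in> schwartz"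
    and disj: "\<And>j k \<xi>. j + L < k \<or> k + L < j ==> fourier (\<theta> j) \<xi> * cnj (fourier (\<theta> k) \<xi>) = 0"
    and C: "\<And>j. (\<integral>\<^sup>+x. ennreal (norm (\<theta> j x)) \<partial>lborel) \<le> ennreal C" "C > 0"
  obtains t K where "t > 0" "K > 0" "nabla_exponent q = ennreal t"
    "\<And>J F c. finite J ==> (\<And>j. j \<in> J ==> poly_growth (F j)) ==> (\<And>j. j \<in> J ==> cv (F j) (\<theta> j) = F j) ==>
      (\<And>j. c j \<ge> 0) ==> (\<And>j. j \<in> J ==> Lp_norm q (F j) \<le> ennreal (c j)) ==>
      Lp_norm q (\<lambda>x. \<Sum>j\<in>J. F j x) \<le> ennreal (K * (\<Sum>j\<in>J. c j powr t) powr (1 / t))"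
proof (cases rule: ennreal_exponent_cases[OF q])
  case 1
  show ?thesis
  proof (rule that[of 1 1])
    show "nabla_exponent q = ennreal 1" using 1 by (simp add: nabla_exponent_def top_unique)
    fix J :: "nat set" and F :: "nat => 'd cfun" and c :: "nat => real"
    assume J: "finite J" and F: "\<And>j. j \<in> J ==> poly_growth (F j)" and c: "\<And>j. c j \<ge> 0"
      and b: "\<And>j. j \<in> J ==> Lp_norm q (F j) \<le> ennreal (c j)"
    have "AE x in lborel. \<forall>j\<in>J. norm (F j x) \<le> c j"
      using J b c 1 by (intro AE_finite_allI) (auto intro: Lp_norm_top_AE)
    then have "AE x in lborel. ennreal (norm (\<Sum>j\<in>J. F j x)) \<le> ennreal (\<Sum>j\<in>J. c j)"
    proof eventually_elim
      case (elim x)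
      have "norm (\<Sum>j\<in>J. F j x) \<le> (\<Sum>j\<in>J. c j)" using elim by (intro sum_norm_le) auto
      then show ?case by (rule ennreal_leI)
    qed
    moreover have "(\<lambda>x. \<Sum>j\<in>J. F j x) \<in> borel_measurable borel"
      using poly_growth_measurable[OF F] by (intro borel_measurable_sum)
    ultimately have "Lp_norm q (\<lambda>x. \<Sum>j\<in>J. F j x) \<le> ennreal (\<Sum>j\<in>J. c j)"
      unfolding 1 Lp_norm_def Lnorm_top by (intro esssup_I) auto
    then show "Lp_norm q (\<lambda>x. \<Sum>j\<in>J. F j x) \<le> ennreal (1 * (\<Sum>j\<in>J. c j powr 1) powr (1 / 1))"
      using c by (simp add: sum_nonneg)
  qed auto
next
  case (2 a)
  show ?thesis
  proof (cases "a \<le> 1")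
    case True
    show ?thesis
    proof (rule that[of a 1])
      have "ennreal a \<le> 1" using True by simp
      then have "ennreal a \<le> 2" by (rule order_trans) simp
      then show "nabla_exponent q = ennreal a" using 2 by (simp add: nabla_exponent_def)
      fix J :: "nat set" and F :: "nat => 'd cfun" and c :: "nat => real"
      assume J: "finite J" and F: "\<And>j. j \<in> J ==> poly_growth (F j)" and c: "\<And>j. c j \<ge> 0"
        and b: "\<And>j. j \<in> J ==> Lp_norm q (F j) \<le> ennreal (c j)"
      have Fm: "(\<lambda>x. ennreal (norm (F j x) powr a)) \<in> borel_measurable lborel" if "j \<in> J" for j
        using poly_growth_measurable[OF F[OF that]] by measurable
      have "(\<integral>\<^sup>+x. ennreal (norm (\<Sum>j\<in>J. F j x) powr a) \<partial>lborel) \<le> (\<integral>\<^sup>+x. (\<Sum>j\<in>J. ennreal (norm (F j x) powr a)) \<partial>lborel)"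
      proof (rule nn_integral_mono)
        fix x
        have "norm (\<Sum>j\<in>J. F j x) powr a \<le> (\<Sum>j\<in>J. norm (F j x)) powr a" using 2 by (intro powr_mono2 norm_sum) auto
        also have "\<dots> \<le> (\<Sum>j\<in>J. norm (F j x) powr a)" using 2 True J by (intro powr_sum_le) auto
        finally show "ennreal (norm (\<Sum>j\<in>J. F j x) powr a) \<le> (\<Sum>j\<in>J. ennreal (norm (F j x) powr a))"
          by (simp add: sum_ennreal ennreal_leI)
      qed
      also have "\<dots> = (\<Sum>j\<in>J. \<integral>\<^sup>+x. ennreal (norm (F j x) powr a) \<partial>lborel)" by (rule nn_integral_sum[OF Fm])
      also have "\<dots> \<le> (\<Sum>j\<in>J. ennreal (c j powr a))"
        by (intro sum_mono Lp_norm_real_le_iff[OF 2(1) c, THEN iffD1]) (use b 2(2) in simp)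
      also have "\<dots> = ennreal ((\<Sum>j\<in>J. c j powr a))" by (simp add: sum_ennreal)
      also have "(\<Sum>j\<in>J. c j powr a) = ((\<Sum>j\<in>J. c j powr a) powr (1 / a)) powr a"
        using 2 by (simp add: powr_powr sum_nonneg)
      finally show "Lp_norm q (\<lambda>x. \<Sum>j\<in>J. F j x) \<le> ennreal (1 * (\<Sum>j\<in>J. c j powr a) powr (1 / a))"
        unfolding 2(2) mult_1 by (rule Lp_norm_real_le_iff[OF 2(1) powr_ge_zero, THEN iffD2])
    qed (use 2 in auto)
  next
    case False
    show ?thesis
    proof (rule that[of "real_nabla a" "real (2 * L + 1) * C"])
      show "nabla_exponent q = ennreal (real_nabla a)" using 2 False by (simp add: nabla_exponent_real)
      show "real_nabla a > 0" using False by (simp add: real_nabla_def)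
      show "real (2 * L + 1) * C > 0" using C(2) by simp
      fix J :: "nat set" and F :: "nat => 'd cfun" and c :: "nat => real"
      assume J: "finite J" and F: "\<And>j. j \<in> J ==> poly_growth (F j)" and rep: "\<And>j. j \<in> J ==> cv (F j) (\<theta> j) = F j"
        and c: "\<And>j. c j \<ge> 0" and b: "\<And>j. j \<in> J ==> Lp_norm q (F j) \<le> ennreal (c j)"
      have b': "\<And>j. j \<in> J ==> Lp_norm (ennreal a) (F j) \<le> ennreal (c j)" using b 2 by simp
      show "Lp_norm q (\<lambda>x. \<Sum>j\<in>J. F j x) \<le> ennreal (real (2 * L + 1) * C * (\<Sum>j\<in>J. c j powr real_nabla a) powr (1 / real_nabla a))"
        unfolding 2(2) by (rule synthesis_bound[OF J F \<theta> rep disj C _ c b']) (use False in auto)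
    qed
  qed
qed

section \<open>Sequence spaces\<close>

lemma Lnorm_count_ge:
  fixes g :: "nat => ennreal"
  assumes r: "0 < r" shows "g j \<le> Lnorm (count_space UNIV) r g"
proof (cases rule: ennreal_exponent_cases[OF r])
  case 1
  have "AE j in count_space UNIV. g j \<le> esssup (count_space UNIV) g" by (rule esssup_AE)
  then show ?thesis unfolding 1 Lnorm_top by (simp add: AE_count_space)
next
  case (2 a)
  have "epow (g j) a \<le> (\<integral>\<^sup>+j. epow (g j) a \<partial>count_space UNIV)" by (rule nn_integral_ge_point) simp
  then have "epow (epow (g j) a) (1 / a) \<le> Lnorm (count_space UNIV) r g"
    unfolding 2(2) Lnorm_real[OF 2(1)] using 2(1) by (intro epow_mono) auto
  then show ?thesis using 2(1) by (simp add: epow_epow)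
qed

text \<open>Each term is at most \<open>G\<close>, hence \<open>(c j)^t \<le> (c j)^r G^(t - r)\<close>. This is the inclusion of \<open>\<ell>^r\<close> in \<open>\<ell>^t\<close>.\<close>

lemma Lnorm_count_sum_le:
  fixes c :: "nat => real"
  assumes r: "0 < r" "r \<le> ennreal t" and t: "t > 0" and c: "\<And>j. c j \<ge> 0" and G: "G \<ge> 0"
    and L: "Lnorm (count_space UNIV) r (\<lambda>j. ennreal (c j)) \<le> ennreal G" and J: "finite J"
  shows "(\<Sum>j\<in>J. c j powr t) \<le> G powr t"
proof -
  obtain a where a: "a > 0" "r = ennreal a" "a \<le> t"
    using r t by (cases rule: ennreal_exponent_cases[OF r(1)]) (auto simp: top_unique)
  have "(\<integral>\<^sup>+j. ennreal (c j powr a) \<partial>count_space UNIV) \<le> ennreal (G powr a)"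
    using L a(1) c G unfolding a(2) Lnorm_real[OF a(1)] by (simp add: epow_le_iff)
  then have i: "(\<Sum>j. ennreal (c j powr a)) \<le> ennreal (G powr a)" by (simp add: nn_integral_count_space_nat)
  have "ennreal (\<Sum>j\<in>J. c j powr a) = (\<Sum>j\<in>J. ennreal (c j powr a))" by (simp add: sum_ennreal)
  also have "\<dots> \<le> (\<Sum>j. ennreal (c j powr a))" using J by (intro sum_le_suminf) auto
  finally have s: "(\<Sum>j\<in>J. c j powr a) \<le> G powr a" using i by (simp add: order_trans[THEN ennreal_le_iff[THEN iffD1, rotated]])
  have cG: "c j \<le> G" for j
    using Lnorm_count_ge[OF r(1), of "\<lambda>j. ennreal (c j)" j] L G by (metis ennreal_le_iff order_trans)
  have "(\<Sum>j\<in>J. c j powr t) \<le> (\<Sum>j\<in>J. c j powr a * G powr (t - a))"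
  proof (rule sum_mono)
    fix j
    have "c j powr t = c j powr a * c j powr (t - a)" by (simp add: powr_add[symmetric])
    also have "\<dots> \<le> c j powr a * G powr (t - a)" using a c cG by (intro mult_left_mono powr_mono2) auto
    finally show "c j powr t \<le> c j powr a * G powr (t - a)" .
  qed
  also have "\<dots> = (\<Sum>j\<in>J. c j powr a) * G powr (t - a)" by (simp add: sum_distrib_right)
  also have "\<dots> \<le> G powr a * G powr (t - a)" using s by (intro mult_right_mono) auto
  also have "\<dots> = G powr t" by (simp add: powr_add[symmetric])
  finally show ?thesis .
qed

section \<open>Dilations\<close>

text \<open>For \<open>p = \<infinity>\<close> the exponent \<open>enn2real (1 / p)\<close> is 0, in agreement with the invariance of null sets.\<close>

lemma Lp_norm_matrix_le:
  fixes f :: "('d::{finite,linorder}) cfun"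
  assumes p: "0 < p" and M: "invertible M" and [measurable]: "f \<in> borel_measurable borel"
  shows "Lp_norm p (\<lambda>x. f (M *v x)) \<le> ennreal (\<bar>Determinants.det M\<bar> powr (- enn2real (1 / p))) * Lp_norm p f"
proof -
  have d: "\<bar>Determinants.det M\<bar> > 0" using M by (simp add: invertible_det_nz)
  show ?thesis
  proof (cases rule: ennreal_exponent_cases[OF p])
    case 1
    let ?s = "Lp_norm p f"
    let ?N = "{x. \<not> ennreal (norm (f x)) \<le> ?s}"
    have [measurable]: "?N \<in> sets borel" by measurable
    have "AE x in lborel. ennreal (norm (f x)) \<le> ?s" unfolding 1 Lp_norm_def Lnorm_top by (rule esssup_AE)
    then have "AE x in lborel. indicator ?N x = (0::ennreal)" by eventually_elim simp
    then have "(\<integral>\<^sup>+x. indicator ?N x \<partial>lborel) = (\<integral>\<^sup>+x. 0 \<partial>(lborel :: 'd rvec measure))" by (rule nn_integral_cong_AE)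
    then have "ennreal \<bar>Determinants.det M\<bar> * (\<integral>\<^sup>+x. indicator ?N (M *v x) \<partial>lborel) = 0"
      by (subst nn_integral_matrix[OF M]) auto
    then have "(\<integral>\<^sup>+x. indicator ?N (M *v x) \<partial>lborel) = (0::ennreal)" using d by simp
    then have "AE x in lborel. indicator ?N (M *v x) = (0::ennreal)" by (subst (asm) nn_integral_0_iff_AE) auto
    then have "AE x in lborel. ennreal (norm (f (M *v x))) \<le> ?s"
      by eventually_elim (auto simp: indicator_def split: if_splits)
    then have "Lp_norm p (\<lambda>x. f (M *v x)) \<le> ?s"
      unfolding 1 Lp_norm_def[of \<infinity> "\<lambda>x. f (M *v x)"] Lnorm_top by (intro esssup_I) auto
    then show ?thesis using d 1 by (simp add: powr_zero_eq_one)
  next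
    case (2 a)
    let ?I = "\<integral>\<^sup>+x. ennreal (norm (f x) powr a) \<partial>lborel"
    let ?D = "\<bar>Determinants.det M\<bar>"
    have "ennreal ?D * (\<integral>\<^sup>+x. ennreal (norm (f (M *v x)) powr a) \<partial>lborel) = ?I"
      by (rule nn_integral_matrix[OF M]) measurable
    then have "ennreal (1 / ?D) * (ennreal ?D * (\<integral>\<^sup>+x. ennreal (norm (f (M *v x)) powr a) \<partial>lborel)) = ennreal (1 / ?D) * ?I" by simp
    then have I: "(\<integral>\<^sup>+x. ennreal (norm (f (M *v x)) powr a) \<partial>lborel) = ennreal (1 / ?D) * ?I"
      using d by (simp add: mult.assoc[symmetric] ennreal_mult[symmetric])
    have e: "enn2real (1 / p) = 1 / a" using 2 divide_ennreal[of 1 a] by simp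
    show ?thesis unfolding e unfolding 2(2) Lp_norm_real[OF 2(1)] I
    proof -
      have "(1 / ?D) powr (1 / a) = ?D powr (- (1 / a))" using d by (simp add: powr_divide powr_minus_divide)
      then have "epow (ennreal (1 / ?D)) (1 / a) = ennreal (?D powr (- (1 / a)))" by simp
      then show "epow (ennreal (1 / ?D) * ?I) (1 / a) \<le> ennreal (?D powr (- (1 / a))) * epow ?I (1 / a)"
        using 2(1) by (simp only: epow_mult zero_less_divide_1_iff order_refl)
    qed
  qed
qed

section \<open>Structure of an expansive Jordan matrix\<close>

lemma jordan_matrix_off_diagonal:
  fixes n_as :: "(nat \<times> real) list"
  assumes "i < sum_list (map fst n_as)" "j < sum_list (map fst n_as)" "i \<noteq> j" "jordan_matrix n_as $$ (i, j) \<noteq> 0"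
  shows "j = Suc i \<and> jordan_matrix n_as $$ (i, j) = 1 \<and> jordan_matrix n_as $$ (i, i) = jordan_matrix n_as $$ (j, j)"
  using assms
proof (induction n_as arbitrary: i j)
  case (Cons na n_as)
  obtain n a where na: "na = (n, a)" by (cases na)
  let ?N = "sum_list (map fst n_as)"
  have lt: "i < n + ?N" "j < n + ?N" using Cons.prems na by auto
  have e: "jordan_matrix (na # n_as) $$ (k, l) =
      (if k < n then if l < n then jordan_block n a $$ (k, l) else 0
       else if l < n then 0 else jordan_matrix n_as $$ (k - n, l - n))"
    if "k < n + ?N" "l < n + ?N" for k l
    unfolding na jordan_matrix_Cons using that by simp
  show ?case
  proof (cases "i < n")
    case True
    then have "j < n" using Cons.prems(4) e[OF lt] by (auto split: if_splits)
    then show ?thesis using True Cons.prems(3,4) lt by (auto simp: e split: if_splits)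
  next
    case False
    then have j: "\<not> j < n" using Cons.prems(4) e[OF lt] by (auto split: if_splits)
    have "jordan_matrix n_as $$ (i - n, j - n) \<noteq> 0" using Cons.prems(4) e[OF lt] False j by simp
    then have "j - n = Suc (i - n) \<and> jordan_matrix n_as $$ (i - n, j - n) = 1 \<and>
      jordan_matrix n_as $$ (i - n, i - n) = jordan_matrix n_as $$ (j - n, j - n)"
      using lt False j Cons.prems(3) by (intro Cons.IH) auto
    then show ?thesis using lt False j by (auto simp: e)
  qed
qed simp

text \<open>The position of a coordinate in the enumeration \<open>coord\<close>, which turns vector indices into the indices of
  the Jordan matrix.\<close>

definition coord_index :: "'d::{finite,linorder} => nat" where
  "coord_index k = (THE i. i < CARD('d) \<and> coord i = k)"

lemma coord_bij: "bij_betw (coord :: nat => 'd::{finite,linorder}) {..<CARD('d)} UNIV"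
proof -
  let ?xs = "sorted_list_of_set (UNIV :: 'd set)"
  have "bij_betw (\<lambda>i. ?xs ! i) {..<length ?xs} (set ?xs)"
    by (rule bij_betw_nth) auto
  moreover have "(coord :: nat => 'd) = (\<lambda>i. ?xs ! i)" by (rule ext) (rule coord_def)
  moreover have "length ?xs = CARD('d)" "set ?xs = UNIV" by simp_all
  ultimately show ?thesis by (simp only:)
qed

lemma coord_index: "coord_index k < CARD('d)" "coord (coord_index k) = (k :: 'd::{finite,linorder})"
proof -
  have "k \<in> coord ` {..<CARD('d)}" using bij_betw_imp_surj_on[OF coord_bij[where 'd = 'd]] by simp
  then obtain i where i: "i < CARD('d)" "coord i = k" by auto
  have "\<exists>!i. i < CARD('d) \<and> coord i = k"
  proof (rule ex1I[of _ i])
    fix i' assume i': "i' < CARD('d) \<and> coord i' = k"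
    show "i' = i"
      by (rule inj_onD[OF bij_betw_imp_inj_on[OF coord_bij[where 'd = 'd]]]) (use i i' in auto)
  qed (use i in simp)
  from theI'[OF this] show "coord_index k < CARD('d)" "coord (coord_index k) = k" by (auto simp: coord_index_def)
qed

lemma coord_index_inject: "coord_index k = coord_index l \<longleftrightarrow> k = l"
  by (metis coord_index(2))

lemma to_mat_index: "to_mat A $$ (coord_index k, coord_index l) = A $ k $ l"
  using coord_index[of k] coord_index[of l] by (simp add: to_mat_def)

lemma to_mat_carrier: "to_mat (A :: 'd::{finite,linorder} sqmat) \<in> carrier_mat CARD('d) CARD('d)"
  by (simp add: to_mat_def)

locale jordan_expansive =
  fixes A :: "'d::{finite,linorder} sqmat"
  assumes A: "expansive_Jordan_normal_form A"
begin

abbreviation "ix \<equiv> (coord_index :: 'd => nat)"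

lemma off_diagonal:
  assumes "k \<noteq> l" "A $ k $ l \<noteq> 0"
  shows "ix l = Suc (ix k)" "A $ k $ l = 1" "A $ k $ k = A $ l $ l"
proof -
  obtain n_as where n: "to_mat A = jordan_matrix n_as"
    using A unfolding expansive_Jordan_normal_form_def by blast
  have dim: "sum_list (map fst n_as) = CARD('d)"
    using arg_cong[OF n, of dim_row] to_mat_carrier[of A] by simp
  have "ix l = Suc (ix k) \<and> jordan_matrix n_as $$ (ix k, ix l) = 1 \<and>
     jordan_matrix n_as $$ (ix k, ix k) = jordan_matrix n_as $$ (ix l, ix l)"
    using assms by (intro jordan_matrix_off_diagonal) (auto simp: dim coord_index coord_index_inject n[symmetric] to_mat_index)
  then show "ix l = Suc (ix k)" "A $ k $ l = 1" "A $ k $ k = A $ l $ l"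
    by (auto simp: n[symmetric] to_mat_index)
qed

lemma upper: "upper_triangular (to_mat A)"
proof -
  obtain n_as where n: "to_mat A = jordan_matrix n_as"
    using A unfolding expansive_Jordan_normal_form_def by blast
  show ?thesis unfolding n upper_triangular_def using jordan_matrix_upper_triangular[of _ n_as] by auto
qed

lemma char_poly_A: "char_poly (to_mat A) = (\<Prod>k\<leftarrow>sorted_list_of_set UNIV. [:- (A $ k $ k), 1:])"
proof -
  have "diag_mat (to_mat A) = map (\<lambda>k. A $ k $ k) (sorted_list_of_set UNIV)"
    by (rule nth_equalityI) (auto simp: diag_mat_def to_mat_def coord_def)
  then show ?thesis unfolding char_poly_upper_triangular[OF to_mat_carrier upper] by (simp add: o_def)
qed

lemma eigenvalues: "{\<mu>. eigenvalue (to_mat A) \<mu>} = range (\<lambda>k. A $ k $ k)"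
proof -
  have "poly (\<Prod>k\<leftarrow>xs. [:- (A $ k $ k), 1:]) \<mu> = 0 \<longleftrightarrow> \<mu> \<in> (\<lambda>k. A $ k $ k) ` set xs" for xs \<mu>
    by (induction xs) auto
  then show ?thesis by (auto simp: eigenvalue_root_char_poly[OF to_mat_carrier] char_poly_A)
qed

lemma diag_le_max: "A $ k $ k \<le> max_eigenvalue A"
  unfolding max_eigenvalue_def eigenvalues by (intro Max_ge) auto

lemma diag_gt_1: "A $ k $ k > 1"
proof -
  let ?M = "map_mat complex_of_real (to_mat A)"
  have M: "?M \<in> carrier_mat CARD('d) CARD('d)" using to_mat_carrier[of A] by simp
  have ut: "upper_triangular ?M" using upper to_mat_carrier[of A] unfolding upper_triangular_def by auto
  have "diag_mat ?M = map (\<lambda>k. complex_of_real (A $ k $ k)) (sorted_list_of_set UNIV)"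
    by (rule nth_equalityI) (auto simp: diag_mat_def to_mat_def coord_def)
  then have cp: "char_poly ?M = (\<Prod>k\<leftarrow>sorted_list_of_set UNIV. [:- complex_of_real (A $ k $ k), 1:])"
    unfolding char_poly_upper_triangular[OF M ut] by (simp add: o_def)
  have "poly (\<Prod>k\<leftarrow>xs. [:- complex_of_real (A $ k $ k), 1:]) \<mu> = 0 \<longleftrightarrow> \<mu> \<in> (\<lambda>k. complex_of_real (A $ k $ k)) ` set xs" for xs \<mu>
    by (induction xs) auto
  then have "eigenvalue ?M (complex_of_real (A $ k $ k))"
    unfolding eigenvalue_root_char_poly[OF M] cp by auto
  then have "Re (complex_of_real (A $ k $ k)) > 1"
    using A unfolding expansive_Jordan_normal_form_def expansive_normal_form_def by blast
  then show ?thesis by simp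
qed

lemma max_eigenvalue_gt_1: "max_eigenvalue A > 1"
  using diag_gt_1[of undefined] diag_le_max[of undefined] by linarith

lemma det_A: "Determinants.det A = 2"
  using A by (simp add: expansive_Jordan_normal_form_def expansive_normal_form_def)

lemma unique_successor:
  assumes "k \<noteq> l" "A $ k $ l \<noteq> 0" "k \<noteq> l'" "A $ k $ l' \<noteq> 0" shows "l = l'"
proof -
  have "ix l = ix l'" using off_diagonal(1)[OF assms(1,2)] off_diagonal(1)[OF assms(3,4)] by linarith
  then show ?thesis by (simp add: coord_index_inject)
qed

lemma row_sum:
  "(A *v v) $ k = A $ k $ k * v $ k + (\<Sum>l\<in>UNIV - {k}. A $ k $ l * v $ l)"
proof -
  have "(A *v v) $ k = (\<Sum>l\<in>UNIV. A $ k $ l * v $ l)" by (simp add: matrix_vector_mult_def)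
  also have "\<dots> = A $ k $ k * v $ k + (\<Sum>l\<in>UNIV - {k}. A $ k $ l * v $ l)"
    by (rule sum.remove[of UNIV k "\<lambda>l. A $ k $ l * v $ l"]) simp_all
  finally show ?thesis .
qed

lemma row_rest:
  assumes "k \<noteq> l" "A $ k $ l \<noteq> 0"
  shows "(\<Sum>l\<in>UNIV - {k}. A $ k $ l * v $ l) = v $ l"
proof -
  have "(\<Sum>l'\<in>UNIV - {k}. A $ k $ l' * v $ l') = (\<Sum>l'\<in>UNIV - {k}. if l' = l then v $ l else 0)"
  proof (rule sum.cong[OF refl])
    fix l' assume "l' \<in> UNIV - {k}"
    then have "k \<noteq> l'" by blast
    show "A $ k $ l' * v $ l' = (if l' = l then v $ l else 0)"
    proof (cases "l' = l")
      case True
      then show ?thesis using off_diagonal(2)[OF assms] by simp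
    next
      case False
      then have "A $ k $ l' = 0" using unique_successor[OF assms \<open>k \<noteq> l'\<close>] by metis
      then show ?thesis using False by simp
    qed
  qed
  then show ?thesis using assms by simp
qed

lemma row_rest_zero:
  assumes "\<And>l. k \<noteq> l ==> A $ k $ l = 0"
  shows "(\<Sum>l\<in>UNIV - {k}. A $ k $ l * v $ l) = 0"
  using assms by (intro sum.neutral) auto

text \<open>Equality of the two multiplicities says that every Jordan block of the largest eigenvalue has size 1,
  so a row with an entry 1 off the diagonal belongs to a smaller eigenvalue. It is shown by comparing dimensions:
  otherwise the eigenvectors would lie in a proper subspace of the span of the corresponding coordinates.\<close>

lemma AND_diag_lt_max:
  assumes "asymptotically_norm_diagonal A" "k \<noteq> l" "A $ k $ l \<noteq> 0"
  shows "A $ k $ k < max_eigenvalue A"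
proof (rule ccontr)
  let ?lm = "max_eigenvalue A"
  assume "\<not> A $ k $ k < ?lm"
  then have kl: "A $ k $ k = ?lm" "A $ l $ l = ?lm" using diag_le_max[of k] off_diagonal(3)[OF assms(2,3)] by auto
  define S where "S = {k. A $ k $ k = ?lm}"
  have nz: "(\<Prod>k\<leftarrow>xs. [:- (A $ k $ k), 1:]) \<noteq> 0" for xs by (auto simp: prod_list_zero_iff)
  have ord: "Polynomial.order ?lm (\<Prod>k\<leftarrow>xs. [:- (A $ k $ k), 1:]) = length (filter (\<lambda>k. A $ k $ k = ?lm) xs)" for xs
  proof (induction xs)
    case Nil
    show ?case by (simp add: order_0I)
  next
    case (Cons x xs)
    have o: "Polynomial.order ?lm [:- (A $ x $ x), 1:] = (if A $ x $ x = ?lm then 1 else 0)"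
      using order_power_n_n[of ?lm 1] order_0I[of "[:- (A $ x $ x), 1:]" ?lm] by auto
    have nz': "[:- (A $ x $ x), 1:] * (\<Prod>k\<leftarrow>xs. [:- (A $ k $ k), 1:]) \<noteq> 0"
      using nz[of "x # xs"] by (simp only: list.map prod_list.Cons not_False_eq_True)
    show ?case unfolding list.map prod_list.Cons order_mult[OF nz'] Cons.IH o by simp
  qed
  have "length (filter (\<lambda>k. A $ k $ k = ?lm) (sorted_list_of_set UNIV)) = card S"
    by (subst distinct_card[symmetric]) (auto simp: S_def)
  then have card: "dim {v. A *v v = ?lm *\<^sub>R v} = card S"
    using assms(1) ord[of "sorted_list_of_set UNIV"] by (simp add: asymptotically_norm_diagonal_def char_poly_A)
  have "{v. A *v v = ?lm *\<^sub>R v} \<subseteq> span ((\<lambda>i. axis i 1) ` (S - {l}))"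
  proof
    fix v assume "v \<in> {v. A *v v = ?lm *\<^sub>R v}"
    then have ev: "(A *v v) $ i = ?lm * v $ i" for i by simp
    have z: "v $ i = 0" if "i \<notin> S" for i
      using that
    proof (induction "CARD('d) - ix i" arbitrary: i rule: less_induct)
      case less
      have rest: "(\<Sum>j\<in>UNIV - {i}. A $ i $ j * v $ j) = 0"
      proof (cases "\<exists>j. i \<noteq> j \<and> A $ i $ j \<noteq> 0")
        case True
        then obtain j where j: "i \<noteq> j" "A $ i $ j \<noteq> 0" by blast
        have "v $ j = 0"
          using off_diagonal[OF j] coord_index(1)[of i] coord_index(1)[of j] less.prems
          by (intro less.hyps) (auto simp: S_def)
        then show ?thesis using row_rest[OF j] by simp
      qed (use row_rest_zero in blast)
      then show "v $ i = 0" using ev[of i] less.prems by (simp add: row_sum S_def)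
    qed
    have "v $ l = 0" using ev[of k] kl row_rest[OF assms(2,3), of v] by (simp add: row_sum)
    have "v = (\<Sum>i\<in>UNIV. (v $ i) *\<^sub>R axis i 1)"
      by (simp add: Finite_Cartesian_Product.vec_eq_iff axis_def if_distrib cong: if_cong)
    also have "\<dots> = (\<Sum>i\<in>S - {l}. (v $ i) *\<^sub>R axis i 1)"
      using z \<open>v $ l = 0\<close> by (intro sum.mono_neutral_right) auto
    also have "\<dots> \<in> span ((\<lambda>i. axis i 1) ` (S - {l}))"
      by (intro span_sum span_scale span_base imageI)
    finally show "v \<in> span ((\<lambda>i. axis i 1) ` (S - {l}))" .
  qed
  then have "dim {v. A *v v = ?lm *\<^sub>R v} \<le> card ((\<lambda>i. axis i (1::real)) ` (S - {l}))"
    by (intro dim_le_card) auto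
  also have "\<dots> \<le> card (S - {l})" by (intro card_image_le) simp
  also have "\<dots> < card S" using kl by (intro psubset_card_mono) (auto simp: S_def)
  finally show False using card by simp
qed

section \<open>Growth of the powers\<close>

text \<open>In the norm that weights the coordinate \<open>k\<close> by \<open>\<epsilon>^(- ix k)\<close> the off-diagonal entries of \<open>A\<close> shrink to \<open>\<epsilon>\<close>, because
  they couple a coordinate only to its successor. So in this norm \<open>A\<close> is almost diagonal.\<close>

lemma weighted_step:
  assumes \<epsilon>: "0 < \<epsilon>" and m: "m \<ge> 0"
    and \<mu>: "\<And>k. A $ k $ k \<le> \<mu>" "\<And>k l. k \<noteq> l ==> A $ k $ l \<noteq> 0 ==> A $ k $ k + \<epsilon> \<le> \<mu>"
    and v: "\<And>k. \<bar>v $ k\<bar> \<le> m * \<epsilon> ^ ix k"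
  shows "\<bar>(A *v v) $ k\<bar> \<le> (\<mu> * m) * \<epsilon> ^ ix k"
proof (cases "\<exists>l. k \<noteq> l \<and> A $ k $ l \<noteq> 0")
  case True
  then obtain l where l: "k \<noteq> l" "A $ k $ l \<noteq> 0" by blast
  have "\<bar>(A *v v) $ k\<bar> \<le> A $ k $ k * \<bar>v $ k\<bar> + \<bar>v $ l\<bar>"
    using diag_gt_1[of k] abs_triangle_ineq[of "A $ k $ k * v $ k" "v $ l"] by (simp add: row_sum row_rest[OF l] abs_mult)
  also have "\<dots> \<le> A $ k $ k * (m * \<epsilon> ^ ix k) + m * \<epsilon> ^ ix l"
    using diag_gt_1[of k] by (intro add_mono mult_left_mono v) auto
  also have "\<dots> = (A $ k $ k + \<epsilon>) * (m * \<epsilon> ^ ix k)" using off_diagonal(1)[OF l] by (simp add: algebra_simps)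
  also have "\<dots> \<le> \<mu> * (m * \<epsilon> ^ ix k)" using \<epsilon> m by (intro mult_right_mono \<mu>(2)[OF l]) auto
  finally show ?thesis by simp
next
  case False
  then have "(\<Sum>l\<in>UNIV - {k}. A $ k $ l * v $ l) = 0" by (intro row_rest_zero) auto
  then have "\<bar>(A *v v) $ k\<bar> = A $ k $ k * \<bar>v $ k\<bar>"
    using diag_gt_1[of k] by (simp add: row_sum abs_mult)
  also have "\<dots> \<le> \<mu> * (m * \<epsilon> ^ ix k)" using diag_gt_1[of k] \<mu>(1)[of k] by (intro mult_mono v) auto
  finally show ?thesis by simp
qed

lemma mat_funpow_mult: "(((**) M) ^^ j) (idm) *v x = (((*v) M) ^^ j) x"
  for M :: "'d sqmat"
  by (induction j) (simp_all add: matrix_vector_mul_assoc[symmetric])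

lemma mat_powi_nat: "mat_powi A (int j) *v x = (((*v) A) ^^ j) x"
  by (simp add: mat_powi_def mat_funpow_mult)

lemma mat_powi_neg: "mat_powi A (- int j) *v x = (((*v) (matrix_inv A)) ^^ j) x"
  by (cases "j = 0") (simp_all add: mat_powi_def mat_funpow_mult)

lemma entry_of_axis: "(M *v axis i 1) $ k = M $ k $ (i::'d)"
  by (simp add: matrix_vector_mult_def axis_def if_distrib cong: if_cong)

lemma axis_weighted:
  assumes "0 < \<epsilon>" "\<epsilon> \<le> 1" shows "\<bar>axis i (1::real) $ k\<bar> \<le> (1 / \<epsilon> ^ CARD('d)) * \<epsilon> ^ ix (k::'d)"
proof -
  have "\<epsilon> ^ CARD('d) \<le> \<epsilon> ^ ix k" using assms coord_index(1)[of k] by (intro power_decreasing) auto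
  then show ?thesis using assms by (auto simp: axis_def pos_le_divide_eq)
qed

lemma power_entry_bound:
  assumes \<epsilon>: "0 < \<epsilon>" "\<epsilon> \<le> 1"
    and \<mu>: "\<And>k. A $ k $ k \<le> \<mu>" "\<And>k l. k \<noteq> l ==> A $ k $ l \<noteq> 0 ==> A $ k $ k + \<epsilon> \<le> \<mu>"
  shows "\<bar>mat_powi A (int j) $ k $ i\<bar> \<le> (1 / \<epsilon> ^ CARD('d)) * \<mu> ^ j"
proof -
  let ?m = "1 / \<epsilon> ^ CARD('d)"
  have \<mu>0: "\<mu> \<ge> 0" using \<mu>(1)[of undefined] diag_gt_1[of undefined] by linarith
  have "\<bar>((((*v) A) ^^ j) (axis i 1)) $ k\<bar> \<le> (\<mu> ^ j * ?m) * \<epsilon> ^ ix k" for k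
  proof (induction j arbitrary: k)
    case 0
    show ?case using axis_weighted[OF \<epsilon>, of i k] by simp
  next
    case (Suc j)
    show ?case
      using weighted_step[OF \<epsilon>(1) _ \<mu> Suc.IH, where k = k] \<mu>0 \<epsilon> by (simp add: mult.assoc)
  qed
  from this[of k] have "\<bar>mat_powi A (int j) $ k $ i\<bar> \<le> (\<mu> ^ j * ?m) * \<epsilon> ^ ix k"
    using entry_of_axis[of "mat_powi A (int j)" i k] by (simp add: mat_powi_nat)
  also have "\<dots> \<le> (\<mu> ^ j * ?m) * 1" using \<mu>0 \<epsilon> by (intro mult_left_mono power_le_one) auto
  finally show ?thesis by (simp add: mult.commute)
qed

lemma power_growth:
  assumes "\<delta> > 0"
  shows "\<exists>C>0. \<forall>j k i. \<bar>mat_powi A (int j) $ k $ i\<bar> \<le> C * (max_eigenvalue A + \<delta>) ^ j"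
proof -
  let ?\<epsilon> = "min 1 \<delta>"
  have "\<bar>mat_powi A (int j) $ k $ i\<bar> \<le> (1 / ?\<epsilon> ^ CARD('d)) * (max_eigenvalue A + \<delta>) ^ j" for j k i
  proof (rule power_entry_bound)
    show "A $ k $ k \<le> max_eigenvalue A + \<delta>" for k using diag_le_max[of k] assms by simp
    show "A $ k $ k + ?\<epsilon> \<le> max_eigenvalue A + \<delta>" for k using diag_le_max[of k] by simp
  qed (use assms in auto)
  then show ?thesis using assms by (intro exI[of _ "1 / ?\<epsilon> ^ CARD('d)"]) auto
qed

text \<open>Rows with an off-diagonal entry have eigenvalues strictly below the maximum, so \<open>\<epsilon>\<close> can be chosen smaller
  than the gap and the rate is the largest eigenvalue itself.\<close>

lemma power_growth_AND:
  assumes "asymptotically_norm_diagonal A"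
  shows "\<exists>C>0. \<forall>j k i. \<bar>mat_powi A (int j) $ k $ i\<bar> \<le> C * max_eigenvalue A ^ j"
proof -
  let ?D = "insert 1 ((\<lambda>k. max_eigenvalue A - A $ k $ k) ` {k. A $ k $ k < max_eigenvalue A})"
  define \<epsilon> where "\<epsilon> = Min ?D"
  have "\<epsilon> \<in> ?D" unfolding \<epsilon>_def by (intro Min_in) auto
  then have e0: "\<epsilon> > 0" by auto
  have e1: "\<epsilon> \<le> 1" unfolding \<epsilon>_def by (intro Min_le) auto
  have "\<bar>mat_powi A (int j) $ k $ i\<bar> \<le> (1 / \<epsilon> ^ CARD('d)) * max_eigenvalue A ^ j" for j k i
  proof (rule power_entry_bound[OF e0 e1 diag_le_max])
    fix k l assume "k \<noteq> l" "A $ k $ l \<noteq> 0"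
    then have "A $ k $ k < max_eigenvalue A" by (rule AND_diag_lt_max[OF assms])
    then have "\<epsilon> \<le> max_eigenvalue A - A $ k $ k" unfolding \<epsilon>_def by (intro Min_le) auto
    then show "A $ k $ k + \<epsilon> \<le> max_eigenvalue A" by simp
  qed
  then show ?thesis using e0 by (intro exI[of _ "1 / \<epsilon> ^ CARD('d)"]) auto
qed

text \<open>The same weighted norm, read backwards: \<open>A\<close> expands it by at least the smallest eigenvalue minus \<open>\<epsilon>\<close>, which is
  larger than 1.\<close>

lemma inverse_decay:
  assumes inv: "A ** matrix_inv A = idm"
  shows "\<exists>C>0. \<exists>\<rho>. 0 < \<rho> \<and> \<rho> < 1 \<and> (\<forall>j k i. \<bar>mat_powi A (- int j) $ k $ i\<bar> \<le> C * \<rho> ^ j)"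
proof -
  define a0 where "a0 = Min (range (\<lambda>k. A $ k $ k))"
  have "a0 \<in> range (\<lambda>k. A $ k $ k)" unfolding a0_def by (intro Min_in) auto
  then have a0: "a0 > 1" using diag_gt_1 by auto
  have a0le: "a0 \<le> A $ k $ k" for k unfolding a0_def by (intro Min_le) auto
  define \<epsilon> where "\<epsilon> = min 1 ((a0 - 1) / 2)"
  have "\<epsilon> \<le> (a0 - 1) / 2" unfolding \<epsilon>_def by (rule min.cobounded2)
  then have "a0 - \<epsilon> > 1" using a0 by (simp add: field_simps)
  then have \<epsilon>: "0 < \<epsilon>" "\<epsilon> \<le> 1" "a0 - \<epsilon> > 1"
    using a0 by (auto simp: \<epsilon>_def)
  define \<rho> where "\<rho> = 1 / (a0 - \<epsilon>)"
  have \<rho>: "0 < \<rho>" "\<rho> < 1" using \<epsilon>(3) by (auto simp: \<rho>_def)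
  have step: "\<bar>v $ k\<bar> \<le> (\<rho> * m) * \<epsilon> ^ ix k" if m: "\<And>k. \<bar>(A *v v) $ k\<bar> \<le> m * \<epsilon> ^ ix k" for v m k
  proof -
    let ?r = "\<lambda>k. \<bar>v $ k\<bar> / \<epsilon> ^ ix k"
    define m' where "m' = Max (range ?r)"
    have "m' \<in> range ?r" unfolding m'_def by (intro Max_in) auto
    then obtain k0 where k0: "m' = ?r k0" by blast
    have le: "?r k \<le> m'" for k unfolding m'_def by (intro Max_ge) auto
    have le': "\<bar>v $ k\<bar> \<le> m' * \<epsilon> ^ ix k" for k using le[of k] \<epsilon>(1) by (simp add: pos_divide_le_eq)
    have m'0: "m' \<ge> 0" using k0 \<epsilon>(1) by simp
    have rest: "\<bar>\<Sum>l\<in>UNIV - {k0}. A $ k0 $ l * v $ l\<bar> \<le> m' * \<epsilon> * \<epsilon> ^ ix k0"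
    proof (cases "\<exists>l. k0 \<noteq> l \<and> A $ k0 $ l \<noteq> 0")
      case True
      then obtain l where l: "k0 \<noteq> l" "A $ k0 $ l \<noteq> 0" by blast
      show ?thesis using le'[of l] off_diagonal(1)[OF l] by (simp add: row_rest[OF l] mult.assoc)
    next
      case False
      then have "(\<Sum>l\<in>UNIV - {k0}. A $ k0 $ l * v $ l) = 0" by (intro row_rest_zero) auto
      then show ?thesis using m'0 \<epsilon>(1) by simp
    qed
    have "A $ k0 $ k0 * \<bar>v $ k0\<bar> = \<bar>(A *v v) $ k0 - (\<Sum>l\<in>UNIV - {k0}. A $ k0 $ l * v $ l)\<bar>"
      using diag_gt_1[of k0] by (simp add: row_sum abs_mult)
    also have "\<dots> \<le> m * \<epsilon> ^ ix k0 + m' * \<epsilon> * \<epsilon> ^ ix k0" using m[of k0] rest by linarith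
    finally have "A $ k0 $ k0 * (m' * \<epsilon> ^ ix k0) \<le> (m + m' * \<epsilon>) * \<epsilon> ^ ix k0"
      using k0 \<epsilon>(1) by (simp add: algebra_simps)
    then have "A $ k0 $ k0 * m' \<le> m + m' * \<epsilon>" using \<epsilon>(1) by (simp add: mult.assoc[symmetric])
    then have "a0 * m' \<le> m + m' * \<epsilon>" using mult_right_mono[OF a0le[of k0] m'0] by linarith
    then have "m' * (a0 - \<epsilon>) \<le> m" by (simp add: algebra_simps)
    then have "m' \<le> \<rho> * m" using \<epsilon>(3) by (simp add: \<rho>_def pos_le_divide_eq)
    then have "m' * \<epsilon> ^ ix k \<le> (\<rho> * m) * \<epsilon> ^ ix k" using \<epsilon>(1) by (intro mult_right_mono) auto
    then show ?thesis using le'[of k] by linarith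
  qed
  have pw: "\<bar>((((*v) (matrix_inv A)) ^^ j) (axis i 1)) $ k\<bar> \<le> (\<rho> ^ j * (1 / \<epsilon> ^ CARD('d))) * \<epsilon> ^ ix k" for i j k
  proof (induction j arbitrary: k)
    case 0
    show ?case using axis_weighted[OF \<epsilon>(1,2), of i k] by simp
  next
    case (Suc j)
    have "A *v (matrix_inv A *v w) = w" for w by (simp add: matrix_vector_mul_assoc inv)
    then show ?case
      using step[of "matrix_inv A *v ((((*v) (matrix_inv A)) ^^ j) (axis i 1))" "\<rho> ^ j * (1 / \<epsilon> ^ CARD('d))" k] Suc.IH
      by (simp add: mult.assoc)
  qed
  have b: "\<bar>mat_powi A (- int j) $ k $ i\<bar> \<le> (\<rho> ^ j * (1 / \<epsilon> ^ CARD('d))) * \<epsilon> ^ ix k" for i j k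
    using pw[of j i k] entry_of_axis[of "mat_powi A (- int j)" i k] by (simp add: mat_powi_neg)
  have "\<bar>mat_powi A (- int j) $ k $ i\<bar> \<le> (1 / \<epsilon> ^ CARD('d)) * \<rho> ^ j" for i j k
  proof -
    have "(\<rho> ^ j * (1 / \<epsilon> ^ CARD('d))) * \<epsilon> ^ ix k \<le> (\<rho> ^ j * (1 / \<epsilon> ^ CARD('d))) * 1"
      using \<rho> \<epsilon> by (intro mult_left_mono power_le_one) auto
    then show ?thesis using b[of j k i] by (simp add: mult.commute)
  qed
  then show ?thesis using \<rho> \<epsilon> by (intro exI[of _ "1 / \<epsilon> ^ CARD('d)"] conjI exI[of _ \<rho>]) auto
qed

end

section \<open>Powers of a matrix\<close>

lemma mat_powi_0 [simp]: "mat_powi M 0 *v x = x"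
  by (simp add: mat_powi_def)

lemma mat_powi_of_nat: "mat_powi M (int j) = (((**) M) ^^ j) idm"
  by (simp add: mat_powi_def)

lemma mat_powi_minus_nat: "mat_powi M (- int j) = (((**) (matrix_inv M)) ^^ j) idm"
  by (cases "j = 0") (simp_all add: mat_powi_def)

lemma funpow_matrix_add:
  fixes M :: "('d::finite) sqmat"
  shows "(((**) M) ^^ (j + k)) idm = (((**) M) ^^ j) idm ** (((**) M) ^^ k) idm"
  by (induction j) (simp_all add: matrix_mul_assoc)

lemma funpow_matrix_commute:
  fixes M :: "('d::finite) sqmat"
  shows "(((**) M) ^^ j) idm ** M = M ** (((**) M) ^^ j) idm"
  using funpow_matrix_add[of j 1 M] funpow_matrix_add[of 1 j M] by (simp add: add.commute)

lemma funpow_matrix_inverse: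
  fixes M N :: "('d::finite) sqmat"
  assumes "M ** N = idm" shows "(((**) M) ^^ j) idm ** (((**) N) ^^ j) idm = idm"
proof (induction j)
  case (Suc j)
  let ?M = "(((**) M) ^^ j) idm" and ?N = "(((**) N) ^^ j) idm"
  have "(((**) M) ^^ Suc j) idm ** (((**) N) ^^ Suc j) idm = (M ** ?M) ** (?N ** N)"
    by (simp add: funpow_matrix_commute)
  also have "\<dots> = M ** (?M ** ?N) ** N" by (simp add: matrix_mul_assoc)
  also have "\<dots> = idm" by (simp add: Suc.IH assms)
  finally show ?case .
qed simp

lemma transpose_funpow_matrix:
  fixes M :: "('d::finite) sqmat"
  shows "Finite_Cartesian_Product.transpose ((((**) M) ^^ j) idm) = (((**) (Finite_Cartesian_Product.transpose M)) ^^ j) idm"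
  by (induction j) (simp_all add: matrix_transpose_mul funpow_matrix_commute transpose_mat)

lemma det_funpow_matrix:
  fixes M :: "('d::finite) sqmat"
  shows "Determinants.det ((((**) M) ^^ j) idm) = Determinants.det M ^ j"
  by (induction j) (simp_all add: Determinants.det_mul Determinants.det_I)

lemma matrix_inv_transpose:
  fixes M :: "('d::finite) sqmat"
  assumes "invertible M"
  shows "matrix_inv (Finite_Cartesian_Product.transpose M) = Finite_Cartesian_Product.transpose (matrix_inv M)"
proof -
  let ?T = "Finite_Cartesian_Product.transpose M" and ?I = "Finite_Cartesian_Product.transpose (matrix_inv M)"
  have 1: "?T ** ?I = idm"
    using matrix_inv_mult(2)[OF assms] by (simp add: matrix_transpose_mul[symmetric] transpose_mat)
  have "matrix_inv ?T = matrix_inv ?T ** (?T ** ?I)" by (simp add: 1)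
  also have "\<dots> = (matrix_inv ?T ** ?T) ** ?I" by (simp add: matrix_mul_assoc)
  also have "\<dots> = ?I" by (simp add: matrix_inv_mult(2)[OF transpose_invertible[OF assms]])
  finally show ?thesis .
qed

section \<open>The Littlewood-Paley system\<close>

locale wavelet_system = jordan_expansive A for A :: "('d::{finite,linorder}) sqmat" +
  fixes \<psi> \<psi>0 :: "'d cfun"
  assumes inv: "invertible A" and wav: "is_wavelet A \<psi>" and low: "is_low_pass_complement A \<psi> \<psi>0"
begin

text \<open>\<open>Ap\<close> and \<open>An\<close> are the positive and negative powers acting in space; \<open>Bn\<close> is the transpose of \<open>An\<close> and
  describes their effect on frequencies.\<close>

abbreviation Ap :: "nat => 'd sqmat" where "Ap j \<equiv> mat_powi A (int j)"
abbreviation An :: "nat => 'd sqmat" where "An j \<equiv> mat_powi A (- int j)"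
abbreviation Bn :: "nat => 'd sqmat" where "Bn j \<equiv> mat_powi (Finite_Cartesian_Product.transpose A) (- int j)"
abbreviation \<phi> :: "nat => 'd cfun" where "\<phi> \<equiv> inhom_wavelet A \<psi> \<psi>0"

lemma An_Ap: "An j ** Ap j = idm" "Ap j ** An j = idm"
  unfolding mat_powi_of_nat mat_powi_minus_nat
  using funpow_matrix_inverse[OF matrix_inv_mult(1)[OF inv]] funpow_matrix_inverse[OF matrix_inv_mult(2)[OF inv]] by auto

lemma An_Ap_cancel: "An j *v (Ap j *v x) = x" "Ap j *v (An j *v x) = x"
  by (simp_all add: matrix_vector_mul_assoc An_Ap)

lemma invertible_powers: "invertible (Ap j)" "invertible (An j)"
  using An_Ap[of j] unfolding invertible_def by blast+

lemma det_Ap: "Determinants.det (Ap j) = 2 ^ j"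
  by (simp add: mat_powi_of_nat det_funpow_matrix det_A)

lemma det_An: "Determinants.det (An j) = 1 / 2 ^ j"
proof -
  have "Determinants.det (An j) * Determinants.det (Ap j) = 1"
    unfolding Determinants.det_mul[symmetric] An_Ap by (rule Determinants.det_I)
  then show ?thesis by (simp add: det_Ap field_simps)
qed

lemma Bn_transpose: "Bn j = Finite_Cartesian_Product.transpose (An j)"
  by (simp only: mat_powi_minus_nat matrix_inv_transpose[OF inv] transpose_funpow_matrix)

lemma Bn_entry: "Bn j $ k $ i = An j $ i $ k"
  by (subst Bn_transpose) (simp only: Finite_Cartesian_Product.transpose_def vec_lambda_beta)

lemma Bn_inner: "(Bn j *v \<xi>) \<bullet> (Ap j *v x) = \<xi> \<bullet> x"
  unfolding Bn_transpose by (simp add: dot_lmul_matrix An_Ap_cancel)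

lemma Bn_add: "Bn (j + k) *v \<xi> = Bn j *v (Bn k *v \<xi>)"
  by (simp only: mat_powi_minus_nat matrix_vector_mul_assoc funpow_matrix_add)

lemma Bn_decay:
  obtains C \<rho> where "C > 0" "0 < \<rho>" "\<rho> < 1" "\<And>j \<xi>. norm (Bn j *v \<xi>) \<le> C * \<rho> ^ j * norm \<xi>"
proof -
  from inverse_decay[OF matrix_inv_mult(1)[OF inv]] obtain C \<rho> where C: "C > 0" "0 < \<rho>" "\<rho> < 1"
    "\<And>j k i. \<bar>An j $ k $ i\<bar> \<le> C * \<rho> ^ j" by auto
  let ?d = "real CARD('d)"
  have "norm (Bn j *v \<xi>) \<le> (?d * ?d * C) * \<rho> ^ j * norm \<xi>" for j \<xi>
  proof -
    have "\<bar>(Bn j *v \<xi>) $ k\<bar> \<le> ?d * (C * \<rho> ^ j * norm \<xi>)" for k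
    proof -
      have "\<bar>(Bn j *v \<xi>) $ k\<bar> \<le> (\<Sum>i\<in>UNIV. \<bar>Bn j $ k $ i * \<xi> $ i\<bar>)"
        by (simp only: matrix_vector_mult_def vec_lambda_beta) (rule sum_abs)
      also have "\<dots> \<le> (\<Sum>i\<in>(UNIV :: 'd set). C * \<rho> ^ j * norm \<xi>)"
      proof (rule sum_mono)
        fix i
        have "\<bar>An j $ i $ k\<bar> * \<bar>\<xi> $ i\<bar> \<le> (C * \<rho> ^ j) * norm \<xi>"
          using C by (intro mult_mono C(4) component_le_norm_cart) auto
        then show "\<bar>Bn j $ k $ i * \<xi> $ i\<bar> \<le> C * \<rho> ^ j * norm \<xi>"
          using Bn_entry[of j k i] by (simp only: abs_mult)
      qed
      finally show ?thesis by simp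
    qed
    then have "(\<Sum>k\<in>UNIV. \<bar>(Bn j *v \<xi>) $ k\<bar>) \<le> (\<Sum>k\<in>(UNIV :: 'd set). ?d * (C * \<rho> ^ j * norm \<xi>))" by (intro sum_mono)
    then show ?thesis using norm_le_l1_cart[of "Bn j *v \<xi>"] by (simp add: mult_ac)
  qed
  then show ?thesis using C by (intro that[of "?d * ?d * C" \<rho>]) auto
qed

text \<open>The dilation that preserves integrals, since \<open>det A = 2\<close>.\<close>

definition dil :: "'d cfun => nat => 'd cfun" where
  "dil f j = (\<lambda>x. complex_of_real (2 ^ j) * f (Ap j *v x))"

lemma wavelet_dil: "\<phi> j = (if j = 0 then \<psi>0 else dil \<psi> j)"
  by (simp add: inhom_wavelet_def dil_def det_A)

lemma schwartz_\<psi>: "\<psi> \<in> schwartz" "\<psi>0 \<in> schwartz"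
  using wav low by (auto simp: is_wavelet_def is_low_pass_complement_def)

lemma schwartz_dil: assumes "f \<in> schwartz" shows "dil f j \<in> schwartz"
proof -
  have "(\<lambda>x. f (Ap j *v x + 0)) \<in> schwartz" by (rule schwartz_affine[OF assms invertible_powers(1)])
  then show ?thesis unfolding dil_def by (intro schwartz_scale) simp
qed

lemma schwartz_\<phi>: "\<phi> j \<in> schwartz"
  by (simp add: wavelet_dil schwartz_dil schwartz_\<psi>)

lemma fourier_dil: assumes "f \<in> schwartz" shows "fourier (dil f j) \<xi> = fourier f (Bn j *v \<xi>)"
  using fourier_dilate[OF invertible_powers(1) schwartz_measurable[OF assms] Bn_inner[of j \<xi>]]
  by (simp add: dil_def det_Ap)

lemma fourier_\<phi>: "fourier (\<phi> j) \<xi> = fourier (if j = 0 then \<psi>0 else \<psi>) (Bn j *v \<xi>)"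
  by (simp add: wavelet_dil fourier_dil schwartz_\<psi>)

lemma fourier_supports:
  obtains a b where "a > 0" "\<And>\<xi>. fourier \<psi> \<xi> \<noteq> 0 ==> a \<le> norm \<xi>" "\<And>\<xi>. fourier \<psi> \<xi> \<noteq> 0 ==> norm \<xi> \<le> b"
    "\<And>\<xi>. fourier \<psi>0 \<xi> \<noteq> 0 ==> norm \<xi> \<le> b"
proof -
  have c: "compact (supp (fourier \<psi>))" "supp (fourier \<psi>) \<subseteq> UNIV - {0}" "compact (supp (fourier \<psi>0))"
    using wav low by (auto simp: is_wavelet_def is_low_pass_complement_def)
  have sub: "f \<xi> \<noteq> 0 ==> \<xi> \<in> supp f" for f :: "'d cfun" and \<xi>
    unfolding supp_def using closure_subset by fastforce
  obtain b1 where b1: "\<And>\<xi>. \<xi> \<in> supp (fourier \<psi>) ==> norm \<xi> \<le> b1"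
    using compact_imp_bounded[OF c(1)] by (auto simp: bounded_iff)
  obtain b2 where b2: "\<And>\<xi>. \<xi> \<in> supp (fourier \<psi>0) ==> norm \<xi> \<le> b2"
    using compact_imp_bounded[OF c(3)] by (auto simp: bounded_iff)
  have "open (- supp (fourier \<psi>))" "0 \<in> - supp (fourier \<psi>)" using c(2) by (auto simp: supp_def)
  then obtain a where a: "a > 0" "ball 0 a \<subseteq> - supp (fourier \<psi>)" using openE by blast
  have "a \<le> norm \<xi>" if "fourier \<psi> \<xi> \<noteq> 0" for \<xi>
  proof (rule ccontr)
    assume "\<not> a \<le> norm \<xi>"
    then have "\<xi> \<in> ball 0 a" by simp
    then show False using a(2) sub[of "fourier \<psi>", OF that] by blast
  qed
  moreover have "norm \<xi> \<le> max b1 b2" if "fourier \<psi> \<xi> \<noteq> 0" for \<xi> using b1[OF sub[of "fourier \<psi>", OF that]] by simp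
  moreover have "norm \<xi> \<le> max b1 b2" if "fourier \<psi>0 \<xi> \<noteq> 0" for \<xi> using b2[OF sub[of "fourier \<psi>0", OF that]] by simp
  ultimately show ?thesis using a(1) that by blast
qed

text \<open>Frequencies in the support of the \<open>i\<close>-th piece are contracted by \<open>m\<close> further steps by a factor of order \<open>\<rho>^m\<close>, and
  for large \<open>m\<close> they leave the support of \<open>fourier \<psi>\<close>, which stays away from 0.\<close>

lemma overlap:
  obtains L where "\<And>i j \<xi>. i + L < j \<or> j + L < i ==> fourier (\<phi> i) \<xi> = 0 \<or> fourier (\<phi> j) \<xi> = 0"
proof -
  obtain a b where ab: "a > 0" "\<And>\<xi>. fourier \<psi> \<xi> \<noteq> 0 ==> a \<le> norm \<xi>" "\<And>\<xi>. fourier \<psi> \<xi> \<noteq> 0 ==> norm \<xi> \<le> b"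
    "\<And>\<xi>. fourier \<psi>0 \<xi> \<noteq> 0 ==> norm \<xi> \<le> b" using fourier_supports by blast
  obtain C \<rho> where C: "C > 0" "0 < \<rho>" "\<rho> < 1" "\<And>j \<xi>. norm (Bn j *v \<xi>) \<le> C * \<rho> ^ j * norm \<xi>" using Bn_decay by blast
  have "(\<lambda>m. C * \<rho> ^ m * \<bar>b\<bar>) \<longlonglongrightarrow> C * 0 * \<bar>b\<bar>" using C by (intro tendsto_mult tendsto_const LIMSEQ_realpow_zero) auto
  then have "\<forall>\<^sub>F m in sequentially. C * \<rho> ^ m * \<bar>b\<bar> < a" using ab(1) by (intro order_tendstoD(2)) auto
  then obtain L where L: "\<And>m. m \<ge> L ==> C * \<rho> ^ m * \<bar>b\<bar> < a" by (auto simp: eventually_sequentially)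
  have main: "fourier (\<phi> j) \<xi> = 0" if "i + L < j" "fourier (\<phi> i) \<xi> \<noteq> 0" for i j \<xi>
  proof (rule ccontr)
    assume j: "fourier (\<phi> j) \<xi> \<noteq> 0"
    have "norm (Bn i *v \<xi>) \<le> b" using that(2) ab(3,4) by (auto simp: fourier_\<phi> split: if_splits)
    then have "norm (Bn i *v \<xi>) \<le> \<bar>b\<bar>" by linarith
    moreover have "a \<le> norm (Bn j *v \<xi>)" using j that(1) ab(2) by (auto simp: fourier_\<phi> split: if_splits)
    moreover have "Bn j *v \<xi> = Bn (j - i) *v (Bn i *v \<xi>)"
    proof -
      have "j - i + i = j" using that(1) by simp
      with Bn_add[of "j - i" i \<xi>] show ?thesis by (simp only:)
    qed
    moreover have "C * \<rho> ^ (j - i) * norm (Bn i *v \<xi>) \<le> C * \<rho> ^ (j - i) * \<bar>b\<bar>"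
      using C(1,2) \<open>norm (Bn i *v \<xi>) \<le> \<bar>b\<bar>\<close> by (intro mult_left_mono) simp_all
    ultimately have "a \<le> C * \<rho> ^ (j - i) * \<bar>b\<bar>"
      using C(4)[of "j - i" "Bn i *v \<xi>"] by (simp only:)
    moreover have "L \<le> j - i" using that(1) by linarith
    ultimately show False using L[of "j - i"] by linarith
  qed
  show ?thesis by (rule that[of L]) (use main in blast)
qed

lemma partition_sum:
  "((\<lambda>i. fourier (\<phi> i) \<xi>) has_sum (1 - fourier \<psi>0 \<xi>)) {1..}"
proof -
  have h: "((\<lambda>i :: nat. fourier \<psi> (Bn i *v \<xi>)) has_sum (1 - fourier \<psi>0 \<xi>)) {1..}"
    using low unfolding is_low_pass_complement_def by blast
  have "fourier (\<phi> i) \<xi> = fourier \<psi> (Bn i *v \<xi>)" if "i \<in> {1..}" for i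
    using that by (simp add: fourier_\<phi>)
  then show ?thesis by (rule iffD2[OF has_sum_cong h])
qed

text \<open>Near 0 no dilated wavelet is active, so the partition of unity leaves the value 1 to \<open>\<psi>0\<close>.\<close>

lemma low_pass_one:
  obtains e where "e > 0" "\<And>\<xi>. norm \<xi> < e ==> fourier \<psi>0 \<xi> = 1"
proof -
  obtain a b where ab: "a > 0" "\<And>\<xi>. fourier \<psi> \<xi> \<noteq> 0 ==> a \<le> norm \<xi>" "\<And>\<xi>. fourier \<psi> \<xi> \<noteq> 0 ==> norm \<xi> \<le> b"
    "\<And>\<xi>. fourier \<psi>0 \<xi> \<noteq> 0 ==> norm \<xi> \<le> b" using fourier_supports by blast
  note a = ab(1,2)
  obtain C \<rho> where C: "C > 0" "0 < \<rho>" "\<rho> < 1" "\<And>j \<xi>. norm (Bn j *v \<xi>) \<le> C * \<rho> ^ j * norm \<xi>" using Bn_decay by blast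
  show ?thesis
  proof (rule that[of "a / C"])
    show "a / C > 0" using a C by simp
    fix \<xi> :: "'d rvec" assume \<xi>: "norm \<xi> < a / C"
    have "fourier (\<phi> i) \<xi> = 0" if "i \<in> {1..}" for i
    proof (rule ccontr)
      assume "fourier (\<phi> i) \<xi> \<noteq> 0"
      then have "a \<le> norm (Bn i *v \<xi>)" using a(2) that by (simp add: fourier_\<phi>)
      also have "\<dots> \<le> C * \<rho> ^ i * norm \<xi>" by (rule C(4))
      also have "\<dots> \<le> C * 1 * norm \<xi>" using C by (intro mult_right_mono mult_left_mono power_le_one) auto
      also have "\<dots> < a" using \<xi> C(1) by (simp add: pos_less_divide_eq mult.commute)
      finally show False by simp
    qed
    then have "((\<lambda>i. fourier (\<phi> i) \<xi>) has_sum 0) {1..}" by (rule has_sum_0)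
    then have "1 - fourier \<psi>0 \<xi> = 0" by (rule has_sum_unique[OF partition_sum])
    then show "fourier \<psi>0 \<xi> = 1" by simp
  qed
qed

text \<open>A sufficiently high dilate of \<open>\<psi>0\<close> has Fourier transform 1 on the supports of \<open>fourier \<psi>\<close> and \<open>fourier \<psi>0\<close>, and this
  relation is invariant under dilation. All pieces are thus reproduced by dilates of one kernel.\<close>

lemma reproducing_kernel:
  obtains \<kappa> where "\<kappa> \<in> schwartz" "\<And>j. cv (\<phi> j) (dil \<kappa> j) = \<phi> j"
proof -
  obtain a b where ab: "a > 0" "\<And>\<xi>. fourier \<psi> \<xi> \<noteq> 0 ==> a \<le> norm \<xi>" "\<And>\<xi>. fourier \<psi> \<xi> \<noteq> 0 ==> norm \<xi> \<le> b"
    "\<And>\<xi>. fourier \<psi>0 \<xi> \<noteq> 0 ==> norm \<xi> \<le> b" using fourier_supports by blast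
  note b = ab(3,4)
  obtain C \<rho> where C: "C > 0" "0 < \<rho>" "\<rho> < 1" "\<And>j \<xi>. norm (Bn j *v \<xi>) \<le> C * \<rho> ^ j * norm \<xi>" using Bn_decay by blast
  obtain e where e: "e > 0" "\<And>\<xi>. norm \<xi> < e ==> fourier \<psi>0 \<xi> = 1" using low_pass_one by blast
  have "(\<lambda>m. C * \<rho> ^ m * \<bar>b\<bar>) \<longlonglongrightarrow> C * 0 * \<bar>b\<bar>" using C by (intro tendsto_mult tendsto_const LIMSEQ_realpow_zero) auto
  then have "\<forall>\<^sub>F m in sequentially. C * \<rho> ^ m * \<bar>b\<bar> < e" using e(1) by (intro order_tendstoD(2)) auto
  then obtain m where m: "C * \<rho> ^ m * \<bar>b\<bar> < e" by (auto simp: eventually_sequentially)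
  let ?\<kappa> = "dil \<psi>0 m"
  have k: "?\<kappa> \<in> schwartz" by (intro schwartz_dil schwartz_\<psi>)
  have "cv (\<phi> j) (dil ?\<kappa> j) = \<phi> j" for j
  proof (rule cv_eqI[OF schwartz_\<phi> schwartz_dil[OF k] schwartz_\<phi>])
    fix \<xi>
    show "fourier (\<phi> j) \<xi> * fourier (dil ?\<kappa> j) \<xi> = fourier (\<phi> j) \<xi>"
    proof (cases "fourier (\<phi> j) \<xi> = 0")
      case False
      then have "norm (Bn j *v \<xi>) \<le> b" using b by (auto simp: fourier_\<phi> split: if_splits)
      then have "norm (Bn j *v \<xi>) \<le> \<bar>b\<bar>" by linarith
      then have "C * \<rho> ^ m * norm (Bn j *v \<xi>) \<le> C * \<rho> ^ m * \<bar>b\<bar>"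
        using C(1,2) by (intro mult_left_mono) simp_all
      then have "norm (Bn m *v (Bn j *v \<xi>)) < e" using m C(4)[of m "Bn j *v \<xi>"] by linarith
      then show ?thesis by (simp add: fourier_dil[OF k] fourier_dil[OF schwartz_\<psi>(2)] e(2))
    qed simp
  qed
  then show ?thesis using k that by blast
qed

definition band :: "nat => nat => nat set" where "band L j = {i. i \<le> j + L \<and> j \<le> i + L}"

text \<open>A sum of neighbouring wavelets also reproduces the \<open>j\<close>-th piece. Unlike the kernel of
  \<open>reproducing_kernel\<close> it is localised in frequency on both sides, which gives the almost orthogonality.\<close>

definition \<theta> :: "nat => nat => 'd cfun" where "\<theta> L j = (\<lambda>x. \<Sum>i\<in>band L j. \<phi> i x)"

lemma finite_band: "finite (band L j)"
  by (rule finite_subset[of _ "{..j + L}"]) (auto simp: band_def)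

lemma card_band: "card (band L j) \<le> 2 * L + 1"
proof -
  have "card (band L j) \<le> card {j - L..j + L}" by (intro card_mono) (auto simp: band_def)
  then show ?thesis by simp
qed

lemma schwartz_\<theta>: "\<theta> L j \<in> schwartz"
proof -
  have "(\<lambda>x. \<Sum>i\<in>band L j. 1 * \<phi> i x) \<in> schwartz" by (rule schwartz_sum[OF finite_band schwartz_\<phi>])
  then show ?thesis by (simp add: \<theta>_def)
qed

lemma fourier_\<theta>: "fourier (\<theta> L j) \<xi> = (\<Sum>i\<in>band L j. fourier (\<phi> i) \<xi>)"
proof -
  have "fourier (\<lambda>x. \<Sum>i\<in>band L j. 1 * \<phi> i x) \<xi> = (\<Sum>i\<in>band L j. 1 * fourier (\<phi> i) \<xi>)"
    by (rule fourier_sum) (rule schwartz_integrable[OF schwartz_\<phi>])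
  then show ?thesis by (simp add: \<theta>_def)
qed

lemma integral_\<theta>:
  obtains C where "C > 0" "\<And>j. (\<integral>\<^sup>+x. ennreal (norm (\<theta> L j x)) \<partial>lborel) \<le> ennreal C"
proof -
  let ?I = "\<lambda>f :: 'd cfun. LINT x|lborel. norm (f x)"
  define C1 where "C1 = ?I \<psi> + ?I \<psi>0 + 1"
  have I0: "?I f \<ge> 0" for f :: "'d cfun" by (intro Bochner_Integration.integral_nonneg) simp
  have C1: "?I \<psi> \<le> C1" "?I \<psi>0 \<le> C1" "C1 > 0" using I0[of \<psi>] I0[of \<psi>0] unfolding C1_def by linarith+
  have I: "(\<integral>\<^sup>+x. ennreal (norm (f x)) \<partial>lborel) = ennreal (?I f)" if "f \<in> schwartz" for f :: "'d cfun"
    by (rule nn_integral_eq_integral[OF integrable_norm[OF schwartz_integrable[OF that]]]) simp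
  have D: "(\<integral>\<^sup>+x. ennreal (norm (dil f j x)) \<partial>lborel) = (\<integral>\<^sup>+x. ennreal (norm (f x)) \<partial>lborel)" if f: "f \<in> schwartz" for f j
  proof -
    note [measurable] = schwartz_measurable[OF f]
    have "(\<integral>\<^sup>+x. ennreal (norm (dil f j x)) \<partial>lborel) = (\<integral>\<^sup>+x. ennreal (2 ^ j) * ennreal (norm (f (Ap j *v x))) \<partial>lborel)"
      by (intro nn_integral_cong) (simp add: dil_def norm_mult norm_power ennreal_mult)
    also have "\<dots> = ennreal (2 ^ j) * (\<integral>\<^sup>+x. ennreal (norm (f (Ap j *v x))) \<partial>lborel)"
      by (rule nn_integral_cmult) measurable
    also have "\<dots> = (\<integral>\<^sup>+x. ennreal (norm (f x)) \<partial>lborel)"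
      using nn_integral_matrix[OF invertible_powers(1), of "\<lambda>x. ennreal (norm (f x))" j] by (simp add: det_Ap)
    finally show ?thesis .
  qed
  have \<phi>1: "(\<integral>\<^sup>+x. ennreal (norm (\<phi> i x)) \<partial>lborel) \<le> ennreal C1" for i
    using C1 by (cases "i = 0") (auto simp: wavelet_dil D I schwartz_\<psi> ennreal_leI)
  have "(\<integral>\<^sup>+x. ennreal (norm (\<theta> L j x)) \<partial>lborel) \<le> ennreal (real (2 * L + 1) * C1)" for j
  proof -
    have "(\<integral>\<^sup>+x. ennreal (norm (\<theta> L j x)) \<partial>lborel) \<le> (\<integral>\<^sup>+x. (\<Sum>i\<in>band L j. ennreal (norm (\<phi> i x))) \<partial>lborel)"
    proof (rule nn_integral_mono)
      show "ennreal (norm (\<theta> L j x)) \<le> (\<Sum>i\<in>band L j. ennreal (norm (\<phi> i x)))" for x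
        unfolding \<theta>_def by (simp add: sum_ennreal ennreal_leI norm_sum)
    qed
    also have "\<dots> = (\<Sum>i\<in>band L j. \<integral>\<^sup>+x. ennreal (norm (\<phi> i x)) \<partial>lborel)"
      using schwartz_measurable[OF schwartz_\<phi>] by (intro nn_integral_sum) simp
    also have "\<dots> \<le> (\<Sum>i\<in>band L j. ennreal C1)" by (intro sum_mono \<phi>1)
    also have "\<dots> = ennreal (real (card (band L j)) * C1)" using C1(3) by (simp add: ennreal_of_nat_eq_real_of_nat ennreal_mult)
    also have "\<dots> \<le> ennreal (real (2 * L + 1) * C1)"
      using card_band[of L j] C1(3) by (intro ennreal_leI mult_right_mono) (auto simp del: of_nat_add of_nat_mult)
    finally show ?thesis .
  qed
  then show ?thesis using C1(3) by (intro that[of "real (2 * L + 1) * C1"]) auto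
qed

context
  fixes L assumes L: "\<And>i j \<xi>. i + L < j \<or> j + L < i ==> fourier (\<phi> i) \<xi> = 0 \<or> fourier (\<phi> j) \<xi> = 0"
begin

text \<open>Where \<open>fourier (\<phi> j)\<close> does not vanish, the partition of unity has no terms outside the band around \<open>j\<close>.\<close>

lemma \<theta>_reproduces: "cv (\<phi> j) (\<theta> L j) = \<phi> j"
proof (rule cv_eqI[OF schwartz_\<phi> schwartz_\<theta> schwartz_\<phi>])
  fix \<xi>
  show "fourier (\<phi> j) \<xi> * fourier (\<theta> L j) \<xi> = fourier (\<phi> j) \<xi>"
  proof (cases "fourier (\<phi> j) \<xi> = 0")
    case False
    let ?f = "\<lambda>i. fourier (\<phi> i) \<xi>"
    have zero: "?f i = 0" if "i \<notin> band L j" for i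
      using L[of i j \<xi>] False that by (auto simp: band_def)
    have "(?f has_sum (1 - fourier \<psi>0 \<xi>)) (band L j - {0})"
    proof (rule has_sum_cong_neutral[THEN iffD1, OF _ _ _ partition_sum])
      show "?f i = 0" if "i \<in> {1..} - (band L j - {0})" for i using zero that by auto
    qed auto
    moreover have "(?f has_sum (\<Sum>i\<in>band L j - {0}. ?f i)) (band L j - {0})"
      using finite_band by (intro has_sum_finite) auto
    ultimately have s: "(\<Sum>i\<in>band L j - {0}. ?f i) = 1 - fourier \<psi>0 \<xi>" by (metis has_sum_unique)
    have f0: "?f 0 = fourier \<psi>0 \<xi>" by (simp add: wavelet_dil)
    have "(\<Sum>i\<in>band L j. ?f i) = 1"
    proof (cases "0 \<in> band L j")
      case True
      then show ?thesis using sum.remove[OF finite_band True, of ?f] s f0 by simp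
    next
      case False
      then show ?thesis using zero[OF False] s f0 by simp
    qed
    then show ?thesis by (simp add: fourier_\<theta>)
  qed simp
qed

lemma \<theta>_disjoint:
  assumes "j + 3 * L < k \<or> k + 3 * L < j"
  shows "fourier (\<theta> L j) \<xi> * cnj (fourier (\<theta> L k) \<xi>) = 0"
proof (rule ccontr)
  assume "\<not> ?thesis"
  then have "fourier (\<theta> L j) \<xi> \<noteq> 0" "fourier (\<theta> L k) \<xi> \<noteq> 0" by auto
  then have "(\<Sum>i\<in>band L j. fourier (\<phi> i) \<xi>) \<noteq> 0" "(\<Sum>i\<in>band L k. fourier (\<phi> i) \<xi>) \<noteq> 0" unfolding fourier_\<theta> by blast+
  then obtain i i' where i: "i \<in> band L j" "fourier (\<phi> i) \<xi> \<noteq> 0" "i' \<in> band L k" "fourier (\<phi> i') \<xi> \<noteq> 0"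
    by (meson sum.not_neutral_contains_not_neutral)
  then have "\<not> (i + L < i' \<or> i' + L < i)" using L by blast
  then show False using i(1,3) assms by (auto simp: band_def)
qed

end

section \<open>Derivatives of the dyadic pieces\<close>

text \<open>A convolution with a dilated kernel becomes, in the coordinates \<open>x = A^j y\<close>, a convolution with a kernel of
  unit scale; the factor \<open>2^j\<close> of the kernel is the Jacobian.\<close>

lemma kernel_rescale:
  assumes G: "poly_growth G" and k: "k \<in> schwartz"
    and kb: "\<And>z. norm (k z) \<le> 2 ^ j * (D / weight (Ap j *v z) ^ N)"
  shows "ennreal (norm (cv G k (An j *v x))) \<le> (\<integral>\<^sup>+y. ennreal (norm (G (An j *v y)) * (D / weight (x - y) ^ N)) \<partial>lborel)"
proof -
  have D: "D \<ge> 0"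
  proof (rule ccontr)
    assume "\<not> D \<ge> 0"
    then have "2 ^ j * (D / weight (Ap j *v 0) ^ N) < 0"
      using weight_pos[of "Ap j *v 0"] by (intro mult_pos_neg divide_neg_pos zero_less_power) simp_all
    moreover have "0 \<le> 2 ^ j * (D / weight (Ap j *v 0) ^ N)" by (rule order_trans[OF norm_ge_zero kb])
    ultimately show False by linarith
  qed
  note [measurable] = poly_growth_measurable[OF G]
  let ?h = "\<lambda>y. ennreal (norm (G (An j *v y)) * (D / weight (x - y) ^ N))"
  have "ennreal (norm (cv G k (An j *v x))) \<le> (\<integral>\<^sup>+y. ennreal (norm (G y * k (An j *v x - y))) \<partial>lborel)"
    unfolding cv_def by (rule integral_norm_bound_ennreal[OF cv_integrable[OF G k]])
  also have "\<dots> \<le> (\<integral>\<^sup>+y. ennreal (2 ^ j) * ?h (Ap j *v y) \<partial>lborel)"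
  proof (rule nn_integral_mono)
    fix y
    have e: "Ap j *v (An j *v x - y) = x - Ap j *v y"
      by (simp add: matrix_vector_mult_diff_distrib An_Ap_cancel)
    have "norm (G y * k (An j *v x - y)) \<le> norm (G y) * (2 ^ j * (D / weight (x - Ap j *v y) ^ N))"
      unfolding norm_mult using kb[of "An j *v x - y"] unfolding e by (rule mult_left_mono) simp
    then show "ennreal (norm (G y * k (An j *v x - y))) \<le> ennreal (2 ^ j) * ?h (Ap j *v y)"
      using D weight_pos[of "x - Ap j *v y"]
      by (simp add: ennreal_mult[symmetric] An_Ap_cancel ennreal_leI mult_ac)
  qed
  also have "\<dots> = ennreal (2 ^ j) * (\<integral>\<^sup>+y. ?h (Ap j *v y) \<partial>lborel)"
    by (rule nn_integral_cmult) measurable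
  also have "\<dots> = (\<integral>\<^sup>+y. ?h y \<partial>lborel)"
  proof -
    have "?h \<in> borel_measurable borel" by measurable
    from nn_integral_matrix[OF invertible_powers(1) this] show ?thesis by (simp add: det_Ap)
  qed
  finally show ?thesis .
qed

lemma poly_growth_An: assumes "poly_growth G" shows "poly_growth (\<lambda>x. G (An j *v x))"
proof -
  note [measurable] = poly_growth_measurable[OF assms]
  obtain C N where C: "C > 0" "\<And>x. norm (G x) \<le> C * weight x ^ N" using poly_growthE[OF assms] by blast
  obtain C0 where C0: "C0 > 0" "\<And>x. weight (An j *v x) \<le> C0 * weight x ^ CARD('d)"
    using weight_linear[OF matrix_vector_mul_linear, of "An j"] by blast
  have "norm (G (An j *v x)) \<le> (C * C0 ^ N) * weight x ^ (CARD('d) * N)" for x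
  proof -
    have "weight (An j *v x) ^ N \<le> (C0 * weight x ^ CARD('d)) ^ N"
      using C0(2) weight_pos by (intro power_mono) (auto intro: less_imp_le)
    then have "C * weight (An j *v x) ^ N \<le> C * (C0 * weight x ^ CARD('d)) ^ N" using C(1) by (intro mult_left_mono) auto
    then show ?thesis using C(2)[of "An j *v x"] by (simp add: power_mult_distrib power_mult mult.assoc)
  qed
  moreover have "(\<lambda>x. G (An j *v x)) \<in> borel_measurable borel" by measurable
  ultimately show ?thesis unfolding poly_growth_def by blast
qed

text \<open>The Bernstein-Nikolskii inequality is applied to the rescaled piece, where all constants are independent of \<open>j\<close>.
  The derivatives of the dilated kernel contribute \<open>m^k\<close>, and the two changes of variables contribute the powers
  of 2.\<close>

lemma derivative_bound:
  assumes p: "0 < p" "p \<le> q"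
  obtains C where "C > 0"
    "\<And>u j m. u \<in> tempered ==> m > 0 ==> (\<And>k i. \<bar>Ap j $ k $ i\<bar> \<le> m) ==>
      Lp_norm q (pderivs is (convol u (\<phi> j))) \<le>
      ennreal (C * m ^ length is * 2 powr (real j * (enn2real (1 / p) - enn2real (1 / q)))) * Lp_norm p (convol u (\<phi> j))"
proof -
  obtain \<kappa> where \<kappa>: "\<kappa> \<in> schwartz" "\<And>j. cv (\<phi> j) (dil \<kappa> j) = \<phi> j" using reproducing_kernel by blast
  have "\<forall>N. \<exists>C>0. \<forall>x. norm (\<kappa> x) \<le> C / weight x ^ N" using schwartz_decay_fun[OF \<kappa>(1)] by metis
  then obtain c where c: "\<And>N. c N > 0" "\<And>N x. norm (\<kappa> x) \<le> c N / weight x ^ N" by metis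
  have "\<forall>N. \<exists>C>0. \<forall>ls x. length ls = length is \<longrightarrow> norm (pderivs ls \<kappa> x) \<le> C / weight x ^ N"
    using schwartz_decay[OF \<kappa>(1)] by blast
  then obtain c' where c': "\<And>N. c' N > 0" "\<And>N ls x. length ls = length is ==> norm (pderivs ls \<kappa> x) \<le> c' N / weight x ^ N"
    by metis
  show ?thesis
  proof (rule bernstein_nikolskii[where 'd = 'd, OF p c(1)])
    fix N Cb assume Cb: "Cb > 0" and BN:
    "\<And>(G :: 'd cfun) F D. poly_growth G ==>
     (\<And>N x. ennreal (norm (G x)) \<le> (\<integral>\<^sup>+y. ennreal (norm (G y) * (c N / weight (x - y) ^ N)) \<partial>lborel)) ==>
     F \<in> borel_measurable borel ==> D > 0 ==>
     (\<And>x. ennreal (norm (F x)) \<le> (\<integral>\<^sup>+y. ennreal (norm (G y) * (D / weight (x - y) ^ N)) \<partial>lborel)) ==>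
     Lp_norm q F \<le> ennreal (Cb * D) * Lp_norm p G"
  let ?d = "real CARD('d)" and ?e = "length is"
  define C where "C = Cb * ?d ^ ?e * c' N"
  have q: "0 < q" using p by (rule less_le_trans)
  show ?thesis
  proof (rule that[of C])
    show "C > 0" using Cb c'(1) by (simp add: C_def)
    fix u :: "'d functional" and j :: nat and m :: real assume u: "u \<in> tempered" and m: "m > 0" and M: "\<And>k i. \<bar>Ap j $ k $ i\<bar> \<le> m"
    let ?G = "convol u (\<phi> j)" and ?\<kappa> = "dil \<kappa> j"
    let ?F = "pderivs is ?G"
    have k: "?\<kappa> \<in> schwartz" by (rule schwartz_dil[OF \<kappa>(1)])
    have G: "poly_growth ?G" by (rule convol_poly_growth[OF u schwartz_\<phi>])
    have rep: "cv ?G ?\<kappa> = ?G" by (rule convol_reproduce[OF u schwartz_\<phi> k \<kappa>(2)])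
    have F: "?F = cv ?G (pderivs is ?\<kappa>)" using pderivs_cv[OF G k, of "is"] rep by simp
    have k': "pderivs is ?\<kappa> \<in> schwartz" by (rule schwartz_pderivs[OF k])
    let ?D = "(?d * m) ^ ?e * c' N"
    have D: "?D > 0" using m c'(1) by simp
    have b1: "norm (?\<kappa> z) \<le> 2 ^ j * (c N' / weight (Ap j *v z) ^ N')" for z N'
      using c(2)[of "Ap j *v z" N'] by (simp add: dil_def norm_mult norm_power del: times_divide_eq_right)
    have b2: "norm (pderivs is ?\<kappa> z) \<le> 2 ^ j * (?D / weight (Ap j *v z) ^ N)" for z
    proof -
      let ?f = "\<lambda>x. complex_of_real (2 ^ j) * \<kappa> x"
      have f: "smooth ?f" by (intro schwartz_smooth schwartz_scale \<kappa>(1))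
      have pf: "pderivs ls ?f = (\<lambda>x. complex_of_real (2 ^ j) * pderivs ls \<kappa> x)" for ls
        using pderivs_sum[of "{()}" ls "\<lambda>_. \<kappa>" "\<lambda>_. complex_of_real (2 ^ j)"] schwartz_smooth[OF \<kappa>(1)]
        by (simp add: smooth_def)
      have "norm (pderivs is (\<lambda>x. ?f (Ap j *v x + 0)) z) \<le> (?d * m) ^ ?e * (2 ^ j * (c' N / weight (Ap j *v z) ^ N))"
      proof (rule norm_pderivs_affine_le[OF f M])
        fix ls :: "'d list" assume "length ls = ?e"
        then show "norm (pderivs ls ?f (Ap j *v z + 0)) \<le> 2 ^ j * (c' N / weight (Ap j *v z) ^ N)"
          using c'(2)[of ls "Ap j *v z" N] unfolding pf add_0_right norm_mult norm_of_real
          by (simp del: times_divide_eq_right)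
      qed
      then show ?thesis by (simp add: dil_def mult_ac)
    qed
    let ?H = "\<lambda>x. ?G (An j *v x)" and ?E = "\<lambda>x. ?F (An j *v x)"
    have Fm [measurable]: "?F \<in> borel_measurable borel"
      unfolding F by (rule poly_growth_measurable[OF poly_growth_cv[OF G k']])
    have Em: "?E \<in> borel_measurable borel" by measurable
    have 1: "Lp_norm q ?E \<le> ennreal (Cb * ?D) * Lp_norm p ?H"
    proof (rule BN[OF poly_growth_An[OF G] _ Em D])
      show "ennreal (norm (?H x)) \<le> (\<integral>\<^sup>+y. ennreal (norm (?H y) * (c N' / weight (x - y) ^ N')) \<partial>lborel)" for N' x
        using kernel_rescale[OF G k b1, of x] unfolding rep .
      show "ennreal (norm (?E x)) \<le> (\<integral>\<^sup>+y. ennreal (norm (?H y) * (?D / weight (x - y) ^ N)) \<partial>lborel)" for x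
        using kernel_rescale[OF G k' b2, of x] unfolding F .
    qed
    have 2: "Lp_norm q ?F \<le> ennreal ((2 ^ j) powr (- enn2real (1 / q))) * Lp_norm q ?E"
      using Lp_norm_matrix_le[OF q invertible_powers(1) Em, of j] by (simp add: An_Ap_cancel det_Ap)
    have 3: "Lp_norm p ?H \<le> ennreal ((1 / 2 ^ j) powr (- enn2real (1 / p))) * Lp_norm p ?G"
      using Lp_norm_matrix_le[OF p(1) invertible_powers(2) poly_growth_measurable[OF G], of j] by (simp add: det_An)
    have pw: "(2 ^ j) powr (- enn2real (1 / q)) * (1 / 2 ^ j) powr (- enn2real (1 / p))
        = 2 powr (real j * (enn2real (1 / p) - enn2real (1 / q)))"
    proof -
      have "(1 / 2 ^ j) powr (- enn2real (1 / p)) = (2 ^ j) powr (enn2real (1 / p))" by (simp add: powr_divide powr_minus_divide)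
      moreover have "(2 ^ j) powr s = 2 powr (real j * s)" for s :: real by (simp add: powr_realpow[symmetric] powr_powr)
      ultimately show ?thesis by (simp add: powr_add[symmetric] algebra_simps)
    qed
    have assoc: "ennreal x * (ennreal y * (ennreal z * w)) = ennreal (x * (y * z)) * w"
      if "x \<ge> 0" "y \<ge> 0" "z \<ge> 0" for x y z w using that by (simp add: ennreal_mult mult.assoc)
    have "Lp_norm q ?F \<le> ennreal ((2 ^ j) powr (- enn2real (1 / q))) *
        (ennreal (Cb * ?D) * (ennreal ((1 / 2 ^ j) powr (- enn2real (1 / p))) * Lp_norm p ?G))"
      by (rule order_trans[OF 2 mult_left_mono[OF order_trans[OF 1 mult_left_mono[OF 3]]]]) simp_all
    also have "\<dots> = ennreal ((2 ^ j) powr (- enn2real (1 / q)) * ((Cb * ?D) * (1 / 2 ^ j) powr (- enn2real (1 / p)))) * Lp_norm p ?G"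
      by (rule assoc) (use Cb D in simp_all)
    also have "(2 ^ j) powr (- enn2real (1 / q)) * ((Cb * ?D) * (1 / 2 ^ j) powr (- enn2real (1 / p)))
        = (Cb * ?D) * ((2 ^ j) powr (- enn2real (1 / q)) * (1 / 2 ^ j) powr (- enn2real (1 / p)))" by (simp only: mult_ac)
    also have "\<dots> = C * m ^ ?e * 2 powr (real j * (enn2real (1 / p) - enn2real (1 / q)))"
      unfolding pw by (simp add: C_def power_mult_distrib mult_ac)
    finally show "Lp_norm q ?F \<le> ennreal (C * m ^ ?e * 2 powr (real j * (enn2real (1 / p) - enn2real (1 / q)))) * Lp_norm p ?G" .
  qed
  qed
qed

section \<open>The embedding\<close>

text \<open>The three alternatives of the theorem in one form: a majorant \<open>m j\<close> of the entries of \<open>A^j\<close> whose \<open>n\<close>-th power,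
  compared with \<open>2^(j nstar)\<close>, is a geometric sequence of ratio \<open>\<rho> \<le> 1\<close>. The ratio 1 occurs only in the limiting
  cases, in which the summability condition \<open>good\<close> is available.\<close>

lemma growth_weights:
  assumes n: "real n < ln 2 / ln (max_eigenvalue A) * nstar \<or> (n = 0 \<and> nstar = 0 \<and> good) \<or>
    (asymptotically_norm_diagonal A \<and> real n = ln 2 / ln (max_eigenvalue A) * nstar \<and> good)"
  obtains m \<rho> C where "C > 0" "0 < \<rho>" "\<rho> < 1 \<or> \<rho> = 1 \<and> good" "\<And>j. m j \<ge> 1" "\<And>j k i. \<bar>Ap j $ k $ i\<bar> \<le> m j"
    "\<And>j. m j ^ n * 2 powr (- (real j * nstar)) = C * \<rho> ^ j"
proof -
  note conclude = that
  let ?l = "max_eigenvalue A"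
  have l: "?l > 1" by (rule max_eigenvalue_gt_1)
  have lnl: "ln ?l > 0" using l by simp
  have pow: "?l ^ n = exp (real n * ln ?l)" using l by (simp add: exp_of_nat_mult)
  have two: "(2::real) powr nstar = exp (nstar * ln 2)" by (simp add: powr_def)
  have finish: thesis if C1: "C1 > 0" "\<And>j k i. \<bar>Ap j $ k $ i\<bar> \<le> C1 * \<Lambda> ^ j" and \<Lambda>: "\<Lambda> \<ge> 1"
      and r: "\<Lambda> ^ n < 2 powr nstar \<or> \<Lambda> ^ n = 2 powr nstar \<and> good" for C1 \<Lambda>
  proof -
    \<comment> \<open>The maximum with 1 makes \<open>m j \<ge> 1\<close>, so that derivatives of order below \<open>n\<close> are covered by the \<open>n\<close>-th power.\<close>
    let ?m = "\<lambda>j. max 1 C1 * \<Lambda> ^ j" and ?r = "\<Lambda> ^ n * 2 powr (- nstar)"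
    have pos: "\<Lambda> ^ n > 0" using \<Lambda> by simp
    have r': "?r = \<Lambda> ^ n / 2 powr nstar" by (simp add: powr_minus divide_inverse)
    show thesis
    proof (rule conclude[of "(max 1 C1) ^ n" ?r ?m])
      show "(max 1 C1) ^ n > 0" by simp
      show "0 < ?r" using pos by simp
      show "?r < 1 \<or> ?r = 1 \<and> good" using r unfolding r' by auto
      show "?m j \<ge> 1" for j
        using mult_mono[of 1 "max 1 C1" 1 "\<Lambda> ^ j"] one_le_power[OF \<Lambda>, of j] by simp
      show "\<bar>Ap j $ k $ i\<bar> \<le> ?m j" for j k i
      proof -
        have "C1 * \<Lambda> ^ j \<le> max 1 C1 * \<Lambda> ^ j" using \<Lambda> by (intro mult_right_mono) auto
        then show ?thesis using C1(2)[of j k i] by linarith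
      qed
      show "?m j ^ n * 2 powr (- (real j * nstar)) = (max 1 C1) ^ n * ?r ^ j" for j
      proof -
        have "2 powr (- (real j * nstar)) = (2 powr (- nstar)) ^ j"
          by (simp add: powr_realpow[symmetric] powr_powr mult.commute)
        moreover have "(\<Lambda> ^ j) ^ n = (\<Lambda> ^ n) ^ j" by (simp only: power_mult[symmetric] mult.commute)
        ultimately show ?thesis by (simp only: power_mult_distrib mult.assoc)
      qed
    qed
  qed
  consider "real n < ln 2 / ln ?l * nstar" | "n = 0" "nstar = 0" good
    | "asymptotically_norm_diagonal A" "real n = ln 2 / ln ?l * nstar" good
    using n by blast
  then show thesis
  proof cases
    case 1
    then have "real n * ln ?l < nstar * ln 2" using lnl by (simp add: pos_less_divide_eq mult.commute)
    then have "(?l + 0) ^ n < 2 powr nstar" by (simp add: pow two)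
    moreover have "((\<lambda>\<delta>. (?l + \<delta>) ^ n) \<longlongrightarrow> (?l + 0) ^ n) (at_right 0)"
      by (intro tendsto_power tendsto_add tendsto_const tendsto_ident_at)
    ultimately have "\<forall>\<^sub>F \<delta> in at_right 0. (?l + \<delta>) ^ n < 2 powr nstar" by (rule order_tendstoD(2)[rotated])
    then have "\<forall>\<^sub>F \<delta> in at_right 0. \<delta> > 0 \<and> (?l + \<delta>) ^ n < 2 powr nstar"
      using eventually_at_right_less[of "0::real"] by eventually_elim simp
    then have "\<exists>\<delta>. \<delta> > 0 \<and> (?l + \<delta>) ^ n < 2 powr nstar"
      by (rule eventually_happens'[rotated]) simp
    then obtain \<delta> where d: "\<delta> > 0" "(?l + \<delta>) ^ n < 2 powr nstar" by blast
    obtain C1 where "C1 > 0" "\<forall>j k i. \<bar>Ap j $ k $ i\<bar> \<le> C1 * (?l + \<delta>) ^ j" using power_growth[OF d(1)] by blast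
    then show thesis using d l by (intro finish[of C1 "?l + \<delta>"]) auto
  next
    case 2
    obtain C1 where "C1 > 0" "\<forall>j k i. \<bar>Ap j $ k $ i\<bar> \<le> C1 * (?l + 1) ^ j" using power_growth[of 1] by auto
    then show thesis using 2 l by (intro finish[of C1 "?l + 1"]) auto
  next
    case 3
    obtain C1 where "C1 > 0" "\<forall>j k i. \<bar>Ap j $ k $ i\<bar> \<le> C1 * ?l ^ j" using power_growth_AND[OF 3(1)] by blast
    moreover have "?l ^ n = 2 powr nstar"
    proof -
      have "real n * ln ?l = nstar * ln 2" using 3(2) lnl by simp
      then show ?thesis by (simp add: pow two)
    qed
    ultimately show thesis using 3 l by (intro finish[of C1 ?l]) auto
  qed
qed

text \<open>If \<open>\<rho> < 1\<close>, the numbers \<open>c j\<close> are dominated by a geometric sequence and the exponent \<open>r\<close> is irrelevant. If \<open>\<rho> = 1\<close>,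
  they are a multiple of the Besov sequence, which is in \<open>\<ell>^t\<close> because \<open>r \<le> t\<close>.\<close>

lemma besov_embeds_sobolev:
  assumes p: "0 < p" "p \<le> q" and r: "0 < r"
    and nstar: "nstar = \<alpha> + enn2real (1 / q) - enn2real (1 / p)"
    and n: "real n < ln 2 / ln (max_eigenvalue A) * nstar \<or> (n = 0 \<and> nstar = 0 \<and> r \<le> nabla_exponent q) \<or>
      (asymptotically_norm_diagonal A \<and> real n = ln 2 / ln (max_eigenvalue A) * nstar \<and> r \<le> nabla_exponent q)"
  shows "besov_embeds_sobolev A \<psi> \<psi>0 \<alpha> p r n q"
  unfolding besov_embeds_sobolev_def
proof (intro allI impI)
  fix \<beta> :: "'d => nat" assume \<beta>: "(\<Sum>i\<in>UNIV. \<beta> i) \<le> n"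
  define ds where "ds = deriv_list \<beta>"
  have len: "length ds \<le> n" using \<beta> by (simp add: ds_def length_deriv_list)
  have q: "0 < q" using p by (rule less_le_trans)
  obtain L where L: "\<And>i j \<xi>. i + L < j \<or> j + L < i ==> fourier (\<phi> i) \<xi> = 0 \<or> fourier (\<phi> j) \<xi> = 0"
    using overlap by blast
  obtain C0 where C0: "C0 > 0" "\<And>j. (\<integral>\<^sup>+x. ennreal (norm (\<theta> L j x)) \<partial>lborel) \<le> ennreal C0" using integral_\<theta> by blast
  have disj: "fourier (\<theta> L j) \<xi> * cnj (fourier (\<theta> L k) \<xi>) = 0" if "j + 3 * L < k \<or> k + 3 * L < j" for j k \<xi>
    by (rule \<theta>_disjoint[OF L that])
  show "\<exists>C :: real. \<forall>f \<in> besov_space A \<psi> \<psi>0 \<alpha> p r. \<exists>g.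
          Lp_has_sum q (\<lambda>j. multi_deriv \<beta> (convol f (\<phi> j))) g \<and> Lp_norm q g \<le> ennreal C * besov_norm A \<psi> \<psi>0 \<alpha> p r f"
  proof (rule derivative_bound[OF p, of ds], rule synthesis_bound_all[OF q schwartz_\<theta> disj C0(2,1)], assumption,
      rule growth_weights[OF n])
    fix Cd t K C2 \<rho> :: real and m :: "nat => real"
    assume Cd: "Cd > 0" and DB: "\<And>u j m. u \<in> tempered ==> m > 0 ==> (\<And>k i. \<bar>Ap j $ k $ i\<bar> \<le> m) ==>
      Lp_norm q (pderivs ds (convol u (\<phi> j))) \<le>
      ennreal (Cd * m ^ length ds * 2 powr (real j * (enn2real (1 / p) - enn2real (1 / q)))) * Lp_norm p (convol u (\<phi> j))"
      and t: "t > 0" and K: "K > 0" and nab: "nabla_exponent q = ennreal t"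
      and SB: "\<And>J F c. finite J ==> (\<And>j. j \<in> J ==> poly_growth (F j)) ==> (\<And>j. j \<in> J ==> cv (F j) (\<theta> L j) = F j) ==>
      (\<And>j. c j \<ge> 0) ==> (\<And>j. j \<in> J ==> Lp_norm q (F j) \<le> ennreal (c j)) ==>
      Lp_norm q (\<lambda>x. \<Sum>j\<in>J. F j x) \<le> ennreal (K * (\<Sum>j\<in>J. c j powr t) powr (1 / t))"
      and C2: "C2 > 0" and \<rho>: "0 < \<rho>" "\<rho> < 1 \<or> \<rho> = 1 \<and> r \<le> nabla_exponent q"
      and m: "\<And>j. m j \<ge> 1" "\<And>j k i. \<bar>Ap j $ k $ i\<bar> \<le> m j"
      and mn: "\<And>j. m j ^ n * 2 powr (- (real j * nstar)) = C2 * \<rho> ^ j"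
    define S where "S = (if \<rho> < 1 then 1 / (1 - \<rho> powr t) else 1)"
    have \<rho>t: "\<rho> powr t < 1" if "\<rho> < 1" using powr_less_mono2[OF t _ that] \<rho>(1) by simp
    have S: "S > 0" using \<rho>t by (simp add: S_def)
    let ?const = "K * (Cd * C2) * S powr (1 / t)"
    show ?thesis
    proof (rule exI[of _ ?const], rule ballI)
      fix f assume "f \<in> besov_space A \<psi> \<psi>0 \<alpha> p r"
      then have f: "f \<in> tempered" "besov_norm A \<psi> \<psi>0 \<alpha> p r f < \<infinity>" by (auto simp: besov_space_def)
      let ?N = "besov_norm A \<psi> \<psi>0 \<alpha> p r f"
      define \<Gamma> where "\<Gamma> = enn2real ?N"
      have \<Gamma>: "?N = ennreal \<Gamma>" "\<Gamma> \<ge> 0" using f(2) by (auto simp: \<Gamma>_def ennreal_enn2real)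
      let ?G = "\<lambda>j. convol f (\<phi> j)"
      let ?F = "\<lambda>j. pderivs ds (?G j)"
      define l where "l = (\<lambda>j. enn2real (Lp_norm p (?G j)))"
      define g where "g = (\<lambda>j. 2 powr (real j * \<alpha>) * l j)"
      have N: "?N = Lnorm (count_space UNIV) r (\<lambda>j. ennreal (2 powr (real j * \<alpha>)) * Lp_norm p (?G j))"
        by (simp add: besov_norm_def det_A)
      have le: "ennreal (2 powr (real j * \<alpha>)) * Lp_norm p (?G j) \<le> ennreal \<Gamma>" for j
        unfolding \<Gamma>(1)[symmetric] N by (rule Lnorm_count_ge[OF r])
      have "Lp_norm p (?G j) \<noteq> \<infinity>" for j
      proof
        assume "Lp_norm p (?G j) = \<infinity>"
        then show False using le[of j] by (simp add: ennreal_mult_top top_unique)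
      qed
      then have l: "Lp_norm p (?G j) = ennreal (l j)" for j by (simp add: l_def ennreal_enn2real less_top)
      have l0: "l j \<ge> 0" for j by (simp add: l_def)
      have g0: "g j \<ge> 0" for j using l0 by (simp add: g_def)
      have g: "ennreal (2 powr (real j * \<alpha>)) * Lp_norm p (?G j) = ennreal (g j)" for j
        unfolding l g_def by (simp add: ennreal_mult l0)
      have g\<Gamma>: "g j \<le> \<Gamma>" for j using le[of j] \<Gamma>(2) unfolding g by simp
      have N': "Lnorm (count_space UNIV) r (\<lambda>j. ennreal (g j)) \<le> ennreal \<Gamma>" using N \<Gamma>(1) unfolding g by simp
      define c where "c = (\<lambda>j. Cd * C2 * \<rho> ^ j * g j)"
      have c0: "c j \<ge> 0" for j using Cd C2 \<rho>(1) g0 by (simp add: c_def)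
      have Fc: "Lp_norm q (?F j) \<le> ennreal (c j)" for j
      proof -
        have m0: "m j > 0" using m(1)[of j] by linarith
        let ?e = "2 powr (real j * (enn2real (1 / p) - enn2real (1 / q)))"
        have "Lp_norm q (?F j) \<le> ennreal (Cd * m j ^ length ds * ?e) * ennreal (l j)"
          using DB[OF f(1) m0 m(2)] unfolding l .
        also have "\<dots> = ennreal (Cd * m j ^ length ds * ?e * l j)" using Cd m0 l0 by (simp add: ennreal_mult)
        also have "\<dots> \<le> ennreal (c j)"
        proof (rule ennreal_leI)
          have e: "?e = 2 powr (- (real j * nstar)) * 2 powr (real j * \<alpha>)"
            unfolding nstar by (simp add: powr_add[symmetric] algebra_simps)
          have "Cd * m j ^ length ds * ?e * l j \<le> Cd * m j ^ n * ?e * l j"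
            using Cd l0 m(1)[of j] len by (intro mult_right_mono mult_left_mono power_increasing) simp_all
          also have "\<dots> = Cd * (m j ^ n * 2 powr (- (real j * nstar))) * (2 powr (real j * \<alpha>) * l j)"
            unfolding e by (simp only: mult_ac)
          also have "\<dots> = c j" unfolding mn c_def g_def by (simp only: mult_ac)
          finally show "Cd * m j ^ length ds * ?e * l j \<le> c j" .
        qed
        finally show ?thesis .
      qed
      let ?u = "\<lambda>j. c j powr t"
      let ?B = "(Cd * C2 * \<Gamma>) powr t * S"
      have u_sum: "(\<Sum>j<k. ?u j) \<le> ?B" for k
      proof (cases "\<rho> < 1")
        case True
        have "(\<Sum>j<k. ?u j) \<le> (\<Sum>j<k. (Cd * C2 * \<Gamma>) powr t * (\<rho> powr t) ^ j)"
        proof (rule sum_mono)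
          fix j
          have "c j \<le> Cd * C2 * \<rho> ^ j * \<Gamma>" unfolding c_def using Cd C2 \<rho>(1) by (intro mult_left_mono g\<Gamma>) simp_all
          then have "c j \<le> (Cd * C2 * \<Gamma>) * \<rho> ^ j" by (simp only: mult_ac)
          then have "?u j \<le> ((Cd * C2 * \<Gamma>) * \<rho> ^ j) powr t" using c0 t by (intro powr_mono2) simp_all
          also have "\<dots> = (Cd * C2 * \<Gamma>) powr t * (\<rho> ^ j) powr t" by (rule powr_mult)
          also have "(\<rho> ^ j) powr t = (\<rho> powr t) ^ j"
            using \<rho>(1) by (simp add: powr_realpow[symmetric] powr_powr mult.commute)
          finally show "?u j \<le> (Cd * C2 * \<Gamma>) powr t * (\<rho> powr t) ^ j" .
        qed
        also have "\<dots> = (Cd * C2 * \<Gamma>) powr t * (\<Sum>j<k. (\<rho> powr t) ^ j)" by (simp add: sum_distrib_left)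
        also have "(\<Sum>j<k. (\<rho> powr t) ^ j) \<le> (\<Sum>j. (\<rho> powr t) ^ j)"
          using \<rho>t[OF True] by (intro sum_le_suminf summable_geometric) simp_all
        then have "(Cd * C2 * \<Gamma>) powr t * (\<Sum>j<k. (\<rho> powr t) ^ j) \<le> (Cd * C2 * \<Gamma>) powr t * (\<Sum>j. (\<rho> powr t) ^ j)"
          by (rule mult_left_mono) simp
        also have "(\<Sum>j. (\<rho> powr t) ^ j) = S" using \<rho>t[OF True] True by (simp add: S_def suminf_geometric)
        finally show ?thesis .
      next
        case False
        then have rt: "\<rho> = 1" "r \<le> ennreal t" using \<rho>(2) nab by auto
        have "?u j = (Cd * C2) powr t * g j powr t" for j unfolding c_def rt(1) by (simp add: powr_mult)
        then have "(\<Sum>j<k. ?u j) = (Cd * C2) powr t * (\<Sum>j<k. g j powr t)" by (simp add: sum_distrib_left)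
        also have "\<dots> \<le> (Cd * C2) powr t * \<Gamma> powr t"
          by (intro mult_left_mono Lnorm_count_sum_le[OF r rt(2) t g0 \<Gamma>(2) N']) simp_all
        finally show ?thesis using False by (simp add: S_def powr_mult)
      qed
      have u0: "?u j \<ge> 0" for j by simp
      have u: "summable ?u" by (rule summableI_nonneg_bounded[OF u0 u_sum])
      have uB: "(\<Sum>j. ?u j) \<le> ?B" by (rule suminf_le_const[OF u u_sum])
      obtain \<kappa> where \<kappa>: "\<kappa> \<in> schwartz" "\<And>j. cv (\<phi> j) (dil \<kappa> j) = \<phi> j" using reproducing_kernel by blast
      have G: "poly_growth (?G j)" for j by (rule convol_poly_growth[OF f(1) schwartz_\<phi>])
      have Fcv: "?F j = cv (?G j) (pderivs ds (dil \<kappa> j))" for j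
        using pderivs_cv[OF G[of j] schwartz_dil[OF \<kappa>(1), of j], of ds]
          convol_reproduce[OF f(1) schwartz_\<phi> schwartz_dil[OF \<kappa>(1)] \<kappa>(2), of j] by simp
      have k: "pderivs ds (dil \<kappa> j) \<in> schwartz" for j by (intro schwartz_pderivs schwartz_dil \<kappa>(1))
      have Fp: "poly_growth (?F j)" for j unfolding Fcv by (rule poly_growth_cv[OF G k])
      have Fr: "cv (?F j) (\<theta> L j) = ?F j" for j
        unfolding Fcv cv_cv_commute[OF G k schwartz_\<theta>]
        by (simp only: convol_reproduce[OF f(1) schwartz_\<phi> schwartz_\<theta> \<theta>_reproduces[OF L]])
      have "\<exists>h. Lp_has_sum q ?F h \<and> Lp_norm q h \<le> ennreal (K * (\<Sum>j. ?u j) powr (1 / t))"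
      proof (rule Lp_unconditional_sum[OF q poly_growth_measurable[OF Fp] u0 u])
        show "Lp_norm q (\<lambda>x. \<Sum>j\<in>J. ?F j x) \<le> ennreal (K * (\<Sum>j\<in>J. ?u j) powr (1 / t))" if "finite J" for J
          by (rule SB[OF that Fp Fr c0 Fc])
      qed (use K t in simp_all)
      then obtain h where h: "Lp_has_sum q ?F h" "Lp_norm q h \<le> ennreal (K * (\<Sum>j. ?u j) powr (1 / t))" by blast
      have "K * (\<Sum>j. ?u j) powr (1 / t) \<le> K * ?B powr (1 / t)"
        using K t uB suminf_nonneg[OF u u0] by (intro mult_left_mono powr_mono2) simp_all
      also have "?B powr (1 / t) = Cd * C2 * \<Gamma> * S powr (1 / t)"
        using Cd C2 \<Gamma>(2) t by (simp add: powr_mult powr_powr)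
      finally have "Lp_norm q h \<le> ennreal (?const * \<Gamma>)"
        using h(2) by (elim order_trans) (simp add: ennreal_leI mult_ac)
      also have "\<dots> = ennreal ?const * ?N" using K Cd C2 S \<Gamma> by (simp add: ennreal_mult)
      finally show "\<exists>g. Lp_has_sum q (\<lambda>j. multi_deriv \<beta> (?G j)) g \<and> Lp_norm q g \<le> ennreal ?const * ?N"
        using h(1) by (auto simp: multi_deriv_eq_pderivs ds_def)
    qed
  qed
qed

end

theorem theorem4p4:
  fixes A :: "('d :: {finite, linorder}) sqmat"
    and \<psi> \<psi>0 :: "'d cfun"
    and n :: nat
    and p q r :: ennreal
    and \<alpha> nstar lambda_max :: real
  assumes "0 < p" and "0 < q" and "0 < r"
    and "invertible A"
    and "expansive_Jordan_normal_form A"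
    and "lambda_max = max_eigenvalue A"
    and "is_wavelet A \<psi>"
    and "is_low_pass_complement A \<psi> \<psi>0"
    and "nstar = \<alpha> + enn2real (1 / q) - enn2real (1 / p)"
    and "p \<le> q"
    and "real n < ln \<bar>Determinants.det A\<bar> / ln lambda_max * nstar
       \<or> (n = 0 \<and> nstar = 0 \<and> r \<le> nabla_exponent q)
       \<or> (asymptotically_norm_diagonal A
          \<and> real n = ln \<bar>Determinants.det A\<bar> / ln lambda_max * nstar
          \<and> r \<le> nabla_exponent q)"
  shows "besov_embeds_sobolev A \<psi> \<psi>0 \<alpha> p r n q"
proof -
  interpret wavelet_system A \<psi> \<psi>0
    by unfold_locales (use assms in auto)
  have "\<bar>Determinants.det A\<bar> = 2" by (simp add: det_A)
  then show ?thesis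
    using assms(11) unfolding assms(6) by (intro besov_embeds_sobolev[OF assms(1,10,3,9)]) simp
qed

end
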